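(* Let $\mathcal D$ be a bounded subset of $\mathbb R^d$ that contains a $d$-dimensional open ball, and let $Y(s)=X(s)\beta+W(s)$ for $s\in\mathcal D$. Let $(X,W)$ be a non-degenerate stationary bivariate Gaussian random field such that $X$ and $W$ marginally have generalized Cauchy covariance functions with parameters $(\delta_X,\kappa_X)$ and $(\delta_W,\kappa_W)$ respectively, with $\delta_X\kappa_X>d$ and $\delta_W\kappa_W>d$. Suppose also that the cross-covariance satisfies the smoothness condition of the context with some exponent $\alpha_{12}>\delta_X$. Then: (a) If $d=1$ and $\delta_X<\delta_W+1$, then $\beta$ is consistently estimable. A consistent estimator of $\beta$ is the OLS estimator between the first order differences of $Y$ and those of $X$ on a one-dimensional regular lattice. (b) If $d=1$ and $\delta_X>\delta_W+1$, then $\beta$ is not consistently estimable. (c) If $d\ge2$, $\beta$ is always consistently estimable. A consistent estimator of $\beta$ is the OLS estimator between the first order discrete Laplacians of $Y$ and those of $X$ on a $d$-dimensional regular lattice.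
   Context: Generalized Cauchy covariance: $C(s-s')=\sigma^2(1+\phi\|s-s'\|^\delta)^{-\kappa}$ with $\sigma^2,\phi,\kappa>0$, $\delta\in(0,2)$. Smoothness condition with exponent $\alpha$. Case $d=1$: for some $L>0$, the function $K$ can be written $K(t)=A(t)+B(t)$, where $A$ is even and analytic and $B$ is even and continuous on $[-L,L]$; the $k$-th derivative $B^{(k)}$ on $(0,L]$ ($k\ge0$, $B^{(0)}=B$) satisfies, as $t\downarrow0$, $B^{(k)}(t)=(\alpha)_k\,c\,t^{\alpha-k}+o(t^{\alpha-k})$, where $c$ is a constant (allowed to be zero for a cross-covariance), $\alpha>0$ is not an even integer and $(\alpha)_k=\Gamma(\alpha+1)/\Gamma(\alpha+1-k)$. Case $d>1$: the cross-covariance is symmetric ($C_{12}=C_{21}$) and $C_{12}(u)=K_{12}(\|u\|)+r_{12}(u)$ with $K_{12}$ (extended evenly) satisfying the $d=1$ condition with exponent $\alpha$, $r_{12}(u)=o(\|u\|^{\alpha})$, and all $p$-th order mixed partial derivatives of $r_{12}$ at $u\neq0$ being $o(\|u\|^{\alpha-p})$. Estimators: lattices are regular with spacing $h\to0$ filling a fixed interval or cube contained in $\mathcal D$. The OLS estimator between transformed data $TY$, $TX$ is $\sum(TX)(TY)/\sum(TX)^2$ over all lattice points where the transform is defined; $T$ is the first difference $Z(s+h)-Z(s)$, or the discrete Laplacian $h^{-2}\sum_{g=1}^d\{Z(s+he_g)+Z(s-he_g)-2Z(s)\}$. $W$ is unobserved. With $(\delta_X,\delta_W)$ fixed, the model consists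 of all $\beta\in\mathbb R$ and all laws of $(X,W)$ satisfying the hypotheses (independence of $X$ and $W$ included). $\beta$ is consistently estimable if there is a sequence of measurable functions of $\{(X(s),Y(s)):s\in\mathcal D\}$ converging in probability to $\beta$ under every member of the model, and not consistently estimable otherwise. *)

theory Defs
  imports "HOL-Probability.Probability"
begin

section \<open>Stationary bivariate Gaussian random fields\<close>

definition covariance :: "'w measure \<Rightarrow> ('w \<Rightarrow> real) \<Rightarrow> ('w \<Rightarrow> real) \<Rightarrow> real" where
  "covariance M U V =
     (\<integral>\<omega>. (U \<omega> - (\<integral>\<omega>'. U \<omega>' \<partial>M)) * (V \<omega> - (\<integral>\<omega>'. V \<omega>' \<partial>M)) \<partial>M)"

text \<open>Univariate Gaussian variables; the second disjunct is the case of zero variance.\<close>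

definition gaussian_variable :: "'w measure \<Rightarrow> ('w \<Rightarrow> real) \<Rightarrow> bool" where
  "gaussian_variable M Z \<longleftrightarrow> Z \<in> borel_measurable M \<and>
     ((\<exists>\<mu> \<tau>. 0 < \<tau> \<and> distributed M lborel Z (normal_density \<mu> \<tau>)) \<or>
      (\<exists>\<mu>. AE \<omega> in M. Z \<omega> = \<mu>))"

definition bivariate_gaussian_field ::
  "'w measure \<Rightarrow> ('a \<Rightarrow> 'w \<Rightarrow> real) \<Rightarrow> ('a \<Rightarrow> 'w \<Rightarrow> real) \<Rightarrow> bool" where
  "bivariate_gaussian_field M X W \<longleftrightarrow>
     (\<forall>S a b. finite S \<longrightarrow>
        gaussian_variable M (\<lambda>\<omega>. \<Sum>s\<in>S. a s * X s \<omega> + b s * W s \<omega>))"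

text \<open>Non-degeneracy: every finite-dimensional distribution of the pair has a nonsingular
  covariance matrix, i.e. the associated quadratic form is positive definite.\<close>

definition nondegenerate_field ::
  "'w measure \<Rightarrow> ('a \<Rightarrow> 'w \<Rightarrow> real) \<Rightarrow> ('a \<Rightarrow> 'w \<Rightarrow> real) \<Rightarrow> bool" where
  "nondegenerate_field M X W \<longleftrightarrow>
     (\<forall>S a b. finite S \<and> (\<exists>s\<in>S. a s \<noteq> 0 \<or> b s \<noteq> 0) \<longrightarrow>
        0 < (\<Sum>s\<in>S. \<Sum>s'\<in>S.
               a s * a s' * covariance M (X s) (X s') + a s * b s' * covariance M (X s) (W s')
             + b s * a s' * covariance M (W s) (X s') + b s * b s' * covariance M (W s) (W s')))"

text \<open>Constant, not necessarily zero, means and translation invariant auto- and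
  cross-covariances. For Gaussian fields this is the same as strict stationarity.\<close>

definition stationary_field ::
  "'w measure \<Rightarrow> ('a::real_vector \<Rightarrow> 'w \<Rightarrow> real) \<Rightarrow> ('a \<Rightarrow> 'w \<Rightarrow> real) \<Rightarrow> bool" where
  "stationary_field M X W \<longleftrightarrow>
     (\<forall>s v. (\<integral>\<omega>. X (s + v) \<omega> \<partial>M) = (\<integral>\<omega>. X s \<omega> \<partial>M) \<and>
            (\<integral>\<omega>. W (s + v) \<omega> \<partial>M) = (\<integral>\<omega>. W s \<omega> \<partial>M)) \<and>
     (\<forall>s s' v. covariance M (X (s + v)) (X (s' + v)) = covariance M (X s) (X s') \<and>
               covariance M (X (s + v)) (W (s' + v)) = covariance M (X s) (W s') \<and>
               covariance M (W (s + v)) (W (s' + v)) = covariance M (W s) (W s'))"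

definition generalized_cauchy ::
  "real \<Rightarrow> real \<Rightarrow> real \<Rightarrow> real \<Rightarrow> 'a::real_normed_vector \<Rightarrow> real" where
  "generalized_cauchy \<sigma>2 \<phi> \<delta> \<kappa> u = \<sigma>2 * (1 + \<phi> * norm u powr \<delta>) powr (- \<kappa>)"

definition has_generalized_cauchy_covariance ::
  "'w measure \<Rightarrow> ('a::real_normed_vector \<Rightarrow> 'w \<Rightarrow> real) \<Rightarrow> real \<Rightarrow> real \<Rightarrow> bool" where
  "has_generalized_cauchy_covariance M Z \<delta> \<kappa> \<longleftrightarrow>
     0 < \<delta> \<and> \<delta> < 2 \<and> 0 < \<kappa> \<and>
     (\<exists>\<sigma>2 \<phi>. 0 < \<sigma>2 \<and> 0 < \<phi> \<and>
        (\<forall>s s'. covariance M (Z s) (Z s') = generalized_cauchy \<sigma>2 \<phi> \<delta> \<kappa> (s - s')))"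


section \<open>The smoothness condition on the cross-covariance\<close>

definition real_analytic_on :: "(real \<Rightarrow> real) \<Rightarrow> real set \<Rightarrow> bool" where
  "real_analytic_on f S \<longleftrightarrow>
     (\<forall>t\<in>S. \<exists>a r. 0 < r \<and> (\<forall>y. \<bar>y - t\<bar> < r \<longrightarrow> (\<lambda>n. a n * (y - t) ^ n) sums f y))"

text \<open>\<open>\<Gamma>(\<alpha> + 1) / \<Gamma>(\<alpha> + 1 - k)\<close>, which is \<open>0\<close> when \<open>\<alpha> + 1 - k\<close> is a pole of \<open>\<Gamma>\<close>.\<close>

definition falling :: "real \<Rightarrow> nat \<Rightarrow> real" where
  "falling \<alpha> k = Gamma (\<alpha> + 1) * rGamma (\<alpha> + 1 - real k)"

text \<open>Below, \<open>D k\<close> is the \<open>k\<close>-th derivative of \<open>B\<close> on \<open>(0,L]\<close>, one-sided at \<open>L\<close>.\<close>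

definition smooth_1d :: "real \<Rightarrow> (real \<Rightarrow> real) \<Rightarrow> bool" where
  "smooth_1d \<alpha> K \<longleftrightarrow>
     0 < \<alpha> \<and> (\<nexists>m::int. \<alpha> = 2 * of_int m) \<and>
     (\<exists>L A B. 0 < L \<and>
        (\<forall>t\<in>{-L..L}. K t = A t + B t) \<and>
        (\<forall>t\<in>{-L..L}. A (- t) = A t) \<and> real_analytic_on A {-L..L} \<and>
        (\<forall>t\<in>{-L..L}. B (- t) = B t) \<and> continuous_on {-L..L} B \<and>
        (\<exists>c D. (\<forall>t\<in>{0<..L}. D 0 t = B t) \<and>
           (\<forall>k. \<forall>t\<in>{0<..L}.
              (D k has_real_derivative D (Suc k) t) (at t within {0<..L})) \<and>
           (\<forall>k. (\<lambda>t. D k t - falling \<alpha> k * c * t powr (\<alpha> - real k))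
                  \<in> o[at_right 0](\<lambda>t. t powr (\<alpha> - real k)))))"

text \<open>For a list \<open>bs\<close> of coordinate vectors, \<open>D bs\<close> is the corresponding mixed partial derivative
  of \<open>r\<close> of order \<open>length bs\<close>, on a punctured ball around the origin. The empty list gives
  \<open>r(u) = o(\<parallel>u\<parallel>\<^sup>\<alpha>)\<close>.\<close>

definition small_remainder :: "real \<Rightarrow> ('a::euclidean_space \<Rightarrow> real) \<Rightarrow> bool" where
  "small_remainder \<alpha> r \<longleftrightarrow>
     (\<exists>R D. 0 < R \<and>
        (\<forall>u. 0 < norm u \<and> norm u < R \<longrightarrow> D [] u = r u) \<and>
        (\<forall>bs\<in>lists Basis. \<forall>b\<in>Basis. \<forall>u. 0 < norm u \<and> norm u < R \<longrightarrow>
           ((\<lambda>t. D bs (u + t *\<^sub>R b)) has_real_derivative D (b # bs) u) (at 0)) \<and>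
        (\<forall>bs\<in>lists Basis. D bs \<in> o[at 0](\<lambda>u. norm u powr (\<alpha> - real (length bs)))))"

text \<open>\<open>C12 u\<close> is the covariance of \<open>X (s + u)\<close> and \<open>W s\<close>, and \<open>C21 u\<close> that of \<open>W (s + u)\<close> and
  \<open>X s\<close>. In dimension one \<open>Basis\<close> has exactly one element.\<close>

definition smooth_cross_covariance ::
  "real \<Rightarrow> ('a::euclidean_space \<Rightarrow> real) \<Rightarrow> ('a \<Rightarrow> real) \<Rightarrow> bool" where
  "smooth_cross_covariance \<alpha> C12 C21 \<longleftrightarrow>
     (DIM('a) = 1 \<longrightarrow> (\<forall>b\<in>Basis. smooth_1d \<alpha> (\<lambda>t. C12 (t *\<^sub>R b)))) \<and>
     (DIM('a) > 1 \<longrightarrow> C12 = C21 \<and>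
        (\<exists>K r. (\<forall>u. C12 u = K (norm u) + r u) \<and>
               smooth_1d \<alpha> (\<lambda>t. K \<bar>t\<bar>) \<and> small_remainder \<alpha> r))"


section \<open>The model and consistent estimation\<close>

definition admissible_field ::
  "real \<Rightarrow> real \<Rightarrow> 'w measure \<Rightarrow> ('a::euclidean_space \<Rightarrow> 'w \<Rightarrow> real) \<Rightarrow>
   ('a \<Rightarrow> 'w \<Rightarrow> real) \<Rightarrow> bool" where
  "admissible_field \<delta>X \<delta>W M X W \<longleftrightarrow>
     bivariate_gaussian_field M X W \<and> nondegenerate_field M X W \<and> stationary_field M X W \<and>
     (\<exists>\<kappa>X. has_generalized_cauchy_covariance M X \<delta>X \<kappa>X \<and> \<delta>X * \<kappa>X > real DIM('a)) \<and>
     (\<exists>\<kappa>W. has_generalized_cauchy_covariance M W \<delta>W \<kappa>W \<and> \<delta>W * \<kappa>W > real DIM('a)) \<and>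
     (\<exists>\<alpha>12 > \<delta>X. smooth_cross_covariance \<alpha>12
        (\<lambda>u. covariance M (X u) (W 0)) (\<lambda>u. covariance M (W u) (X 0)))"

text \<open>Laws of \<open>(X, W)\<close> are probability measures on the space of all functions from the index
  space to pairs, with the product \<open>\<sigma>\<close>-algebra; the field is the coordinate process.\<close>

definition model_laws ::
  "real \<Rightarrow> real \<Rightarrow> ('a::euclidean_space \<Rightarrow> real \<times> real) measure set" where
  "model_laws \<delta>X \<delta>W =
     {P. prob_space P \<and> sets P = sets (PiM UNIV (\<lambda>_. borel)) \<and>
         admissible_field \<delta>X \<delta>W P (\<lambda>s \<omega>. fst (\<omega> s)) (\<lambda>s \<omega>. snd (\<omega> s))}"

text \<open>The observations \<open>(X s, Y s)\<close>, \<open>s \<in> D\<close>, where \<open>\<omega> s = (X s, W s)\<close>.\<close>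

definition observed_data ::
  "'a set \<Rightarrow> real \<Rightarrow> ('a \<Rightarrow> real \<times> real) \<Rightarrow> 'a \<Rightarrow> real \<times> real" where
  "observed_data D \<beta> \<omega> = (\<lambda>s\<in>D. (fst (\<omega> s), fst (\<omega> s) * \<beta> + snd (\<omega> s)))"

definition consistent_estimator ::
  "'a set \<Rightarrow> ('a \<Rightarrow> real \<times> real) measure set \<Rightarrow>
   (nat \<Rightarrow> ('a \<Rightarrow> real \<times> real) \<Rightarrow> real) \<Rightarrow> bool" where
  "consistent_estimator D \<P> E \<longleftrightarrow>
     (\<forall>n. E n \<in> borel_measurable (PiM D (\<lambda>_. borel))) \<and>
     (\<forall>\<beta>. \<forall>P\<in>\<P>. \<forall>\<epsilon>>0.
        (\<lambda>n. measure P {\<omega> \<in> space P. \<bar>E n (observed_data D \<beta> \<omega>) - \<beta>\<bar> > \<epsilon>}) \<longlonglongrightarrow> 0)"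

definition consistently_estimable ::
  "'a set \<Rightarrow> ('a \<Rightarrow> real \<times> real) measure set \<Rightarrow> bool" where
  "consistently_estimable D \<P> \<longleftrightarrow> (\<exists>E. consistent_estimator D \<P> E)"


section \<open>The least squares estimators\<close>

definition regular_lattice :: "'a::euclidean_space \<Rightarrow> real \<Rightarrow> 'a set" where
  "regular_lattice p h = range (\<lambda>k :: 'a \<Rightarrow> int. p + h *\<^sub>R (\<Sum>b\<in>Basis. of_int (k b) *\<^sub>R b))"

definition cube :: "'a::euclidean_space \<Rightarrow> real \<Rightarrow> 'a set" where
  "cube p l = cbox p (p + l *\<^sub>R One)"

definition ols :: "'a set \<Rightarrow> ('a \<Rightarrow> real) \<Rightarrow> ('a \<Rightarrow> real) \<Rightarrow> real" where
  "ols S U V = (\<Sum>s\<in>S. U s * V s) / (\<Sum>s\<in>S. (U s)\<^sup>2)"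

definition first_difference :: "real \<Rightarrow> 'a::euclidean_space \<Rightarrow> ('a \<Rightarrow> real) \<Rightarrow> 'a \<Rightarrow> real" where
  "first_difference h e Z s = Z (s + h *\<^sub>R e) - Z s"

definition discrete_laplacian :: "real \<Rightarrow> ('a::euclidean_space \<Rightarrow> real) \<Rightarrow> 'a \<Rightarrow> real" where
  "discrete_laplacian h Z s =
     (\<Sum>e\<in>Basis. Z (s + h *\<^sub>R e) + Z (s - h *\<^sub>R e) - 2 * Z s) / h\<^sup>2"

text \<open>Both estimators are functions of the data \<open>z s = (X s, Y s)\<close>. Sums range over the points of
  the lattice \<open>\<Lambda>\<close> at which the transform only uses points of \<open>\<Lambda>\<close>.\<close>

definition ols_first_difference ::
  "'a::euclidean_space set \<Rightarrow> real \<Rightarrow> 'a \<Rightarrow> ('a \<Rightarrow> real \<times> real) \<Rightarrow> real" where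
  "ols_first_difference \<Lambda> h e z =
     ols {s\<in>\<Lambda>. s + h *\<^sub>R e \<in> \<Lambda>}
       (first_difference h e (\<lambda>s. fst (z s))) (first_difference h e (\<lambda>s. snd (z s)))"

definition ols_laplacian ::
  "'a::euclidean_space set \<Rightarrow> real \<Rightarrow> ('a \<Rightarrow> real \<times> real) \<Rightarrow> real" where
  "ols_laplacian \<Lambda> h z =
     ols {s\<in>\<Lambda>. \<forall>e\<in>Basis. s + h *\<^sub>R e \<in> \<Lambda> \<and> s - h *\<^sub>R e \<in> \<Lambda>}
       (discrete_laplacian h (\<lambda>s. fst (z s))) (discrete_laplacian h (\<lambda>s. snd (z s)))"

end

theory Submission
  imports Defs
begin

text \<open>The least squares error is a ratio whose numerator has mean of order \<open>h\<^bsup>min \<alpha> 2\<^esup>\<close> per lattice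
  point, with \<open>\<alpha> > \<delta>X\<close>, and whose denominator has mean of order \<open>h\<^bsup>\<delta>X\<^esup>\<close>. Gaussian fourth moments
  express the variances of both through the covariances of differenced fields, which decay like
  \<open>h\<^sup>\<delta> (1 + \<bar>u\<bar>/h)\<^bsup>\<delta> - 2\<^esup>\<close> near the origin. Chebyshev's inequality then gives consistency whenever
  \<open>\<delta>X < \<delta>W + d\<close>.

  For the converse in dimension one, \<open>X\<close> and \<open>W\<close> are taken independent, with \<open>\<kappa>X = 1\<close> and
  \<open>\<kappa>W = 2 / \<delta>W\<close>. The estimators only use countably many points; Gram-Schmidt whitens \<open>W\<close> there, so
  that adding \<open>\<beta> X\<close> to \<open>W\<close> at finitely many of them is a translation of i.i.d. normal coordinates
  by a vector \<open>y\<close> with \<open>E \<bar>y\<bar>\<^sup>2 = \<beta>\<^sup>2 tr (\<Sigma>W\<^sup>-\<^sup>1 \<Sigma>X)\<close>. Since \<open>\<delta>W < 1\<close>, the kernel of \<open>W\<close> is convex and a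
  Polya type bound gives
  \<open>\<Sigma>W\<^sup>-\<^sup>1[cos (\<omega> t)] \<le> C max 1 \<bar>\<omega>\<bar>\<^bsup>1 + \<delta>W\<^esup>\<close>; since the kernel of \<open>X\<close> is a limit of mixtures of
  Gaussians and \<open>1 + \<delta>W < \<delta>X\<close>, the trace is bounded independently of the points. For small \<open>\<beta>\<close>
  the laws of the data under \<open>0\<close> and \<open>\<beta>\<close> therefore cannot be separated.\<close>

text \<open>The threshold is spectral. Heuristically the spectral densities of X and W decay with
  exponents \<open>d + \<delta>X\<close> and \<open>d + \<delta>W\<close>, and \<beta> is hidden
  when their ratio is integrable at infinity, which for d = 1 means
  \<open>\<delta>X > \<delta>W + 1\<close>. The proof never forms a spectral density. In the
  negative part the Polya type bound with exponent \<open>1 + \<delta>W\<close> stands for the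
  inverse of the density of W, and Gaussian mixtures, that is, cosines with random normal
  frequencies, stand for the density of X. In the positive part the covariance bounds are local,
  near lag 0, whereas the lattice fills a cube of fixed size. Cutting the cube into a bounded number
  of small blocks costs a constant factor and removes all lags that are not small. In the negative
  part the order of choices matters: \<beta> is fixed before the finite set of points that
  approximates the estimator, so the trace has to be bounded uniformly over all finite subsets of a
  countable set, which itself is fixed before \<beta>.\<close>

section \<open>Moments of Gaussian variables and Wick's formula\<close>

lemma gaussian_variable_power_integrable:
  assumes "prob_space M" "gaussian_variable M Z"
  shows "integrable M (\<lambda>\<omega>. Z \<omega> ^ k)"
proof -
  interpret prob_space M by fact
  have [measurable]: "Z \<in> borel_measurable M"
    using assms(2) by (simp add: gaussian_variable_def)
  consider (n) \<mu> \<tau> where "0 < \<tau>" "distributed M lborel Z (normal_density \<mu> \<tau>)"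
    | (c) \<mu> where "AE \<omega> in M. Z \<omega> = \<mu>"
    using assms(2) unfolding gaussian_variable_def by blast
  then show ?thesis
  proof cases
    case n
    have *: "integrable M (\<lambda>\<omega>. (Z \<omega> - \<mu>) ^ j)" for j
      using distributed_integrable[OF n(2), of "\<lambda>x. (x - \<mu>) ^ j"] integrable_normal_moment[OF n(1), of \<mu> j]
      by simp
    have "(\<lambda>\<omega>. Z \<omega> ^ k) = (\<lambda>\<omega>. \<Sum>j\<le>k. real (k choose j) * (Z \<omega> - \<mu>) ^ j * \<mu> ^ (k - j))"
    proof
      fix \<omega>
      show "Z \<omega> ^ k = (\<Sum>j\<le>k. real (k choose j) * (Z \<omega> - \<mu>) ^ j * \<mu> ^ (k - j))"
        using binomial_ring[of "Z \<omega> - \<mu>" \<mu> k] by simp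
    qed
    then show ?thesis using * by simp
  next
    case c
    have "AE \<omega> in M. Z \<omega> ^ k = \<mu> ^ k" using c by eventually_elim simp
    then have "integrable M (\<lambda>\<omega>. Z \<omega> ^ k) \<longleftrightarrow> integrable M (\<lambda>\<omega>. \<mu> ^ k)"
      by (intro integrable_cong_AE) auto
    then show ?thesis by simp
  qed
qed

lemma gaussian_variable_fourth_moment:
  assumes "prob_space M" "gaussian_variable M Z" "(\<integral>\<omega>. Z \<omega> \<partial>M) = 0"
  shows "(\<integral>\<omega>. Z \<omega> ^ 4 \<partial>M) = 3 * (\<integral>\<omega>. Z \<omega> ^ 2 \<partial>M)\<^sup>2"
proof -
  interpret prob_space M by fact
  have [measurable]: "Z \<in> borel_measurable M"
    using assms(2) by (simp add: gaussian_variable_def)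
  consider (n) \<mu> \<tau> where "0 < \<tau>" "distributed M lborel Z (normal_density \<mu> \<tau>)"
    | (c) \<mu> where "AE \<omega> in M. Z \<omega> = \<mu>"
    using assms(2) unfolding gaussian_variable_def by blast
  then show ?thesis
  proof cases
    case n
    have mu: "\<mu> = 0"
      using distributed_integral[OF n(2), of "\<lambda>x. x"] integral_normal_moment_nz_1[OF n(1), of \<mu>] assms(3)
      by simp
    have "(\<integral>\<omega>. Z \<omega> ^ (2*k) \<partial>M) = fact (2 * k) / ((2 / \<tau>\<^sup>2)^k * fact k)" for k
      using distributed_integral[OF n(2), of "\<lambda>x. x ^ (2*k)"] integral_normal_moment_even[OF n(1), of \<mu> k]
      by (simp add: mu)
    from this[of 1] this[of 2] show ?thesis
      by (simp add: fact_numeral power2_eq_square)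
  next
    case c
    have "(\<integral>\<omega>. Z \<omega> \<partial>M) = (\<integral>\<omega>. \<mu> \<partial>M)"
      using c by (intro integral_cong_AE) auto
    then have mu: "\<mu> = 0" using assms(3) by (simp add: prob_space)
    have "(\<integral>\<omega>. Z \<omega> ^ k \<partial>M) = (\<integral>\<omega>. 0 \<partial>M)" if "k > 0" for k
      using c that by (intro integral_cong_AE) (auto simp: mu)
    then show ?thesis by simp
  qed
qed

lemma gaussian_variable_product_integrable:
  assumes "prob_space M" "gaussian_variable M (\<lambda>\<omega>. U \<omega> + V \<omega>)" "gaussian_variable M (\<lambda>\<omega>. U \<omega> - V \<omega>)"
  shows "integrable M (\<lambda>\<omega>. U \<omega> * V \<omega>)"
proof -
  have "(\<lambda>\<omega>. U \<omega> * V \<omega>) = (\<lambda>\<omega>. ((U \<omega> + V \<omega>)^2 - (U \<omega> - V \<omega>)^2) / 4)"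
    by (auto simp: power2_eq_square algebra_simps)
  then show ?thesis
    using gaussian_variable_power_integrable[OF assms(1,2), of 2]
      gaussian_variable_power_integrable[OF assms(1,3), of 2] by simp
qed

text \<open>Polarization: 192 times the product is a signed sum of eight fourth powers of linear
  forms with coefficients 1 and -1. Each form is a centred Gaussian, so its fourth moment is three
  times the square of its variance and only covariances remain. The variables may coincide; the
  lemma is later applied with \<open>U\<close> repeated.\<close>

lemma wick_fourth_moment:
  fixes U V X Y :: "'w \<Rightarrow> real"
  assumes M: "prob_space M"
    and G: "\<And>a b c d. gaussian_variable M (\<lambda>\<omega>. a * U \<omega> + b * V \<omega> + c * X \<omega> + d * Y \<omega>)"
    and z: "(\<integral>\<omega>. U \<omega> \<partial>M) = 0" "(\<integral>\<omega>. V \<omega> \<partial>M) = 0" "(\<integral>\<omega>. X \<omega> \<partial>M) = 0" "(\<integral>\<omega>. Y \<omega> \<partial>M) = 0"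
  shows "integrable M (\<lambda>\<omega>. U \<omega> * V \<omega> * X \<omega> * Y \<omega>)" (is ?I)
    and "(\<integral>\<omega>. U \<omega> * V \<omega> * X \<omega> * Y \<omega> \<partial>M)
       = (\<integral>\<omega>. U \<omega> * V \<omega> \<partial>M) * (\<integral>\<omega>. X \<omega> * Y \<omega> \<partial>M) + (\<integral>\<omega>. U \<omega> * X \<omega> \<partial>M) * (\<integral>\<omega>. V \<omega> * Y \<omega> \<partial>M)
         + (\<integral>\<omega>. U \<omega> * Y \<omega> \<partial>M) * (\<integral>\<omega>. V \<omega> * X \<omega> \<partial>M)" (is ?E)
proof -
  interpret prob_space M by fact
  define L where "L a b c d \<omega> = a * U \<omega> + b * V \<omega> + c * X \<omega> + d * Y \<omega>" for a b c d \<omega>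
  have GL: "gaussian_variable M (L a b c d)" for a b c d
    using G unfolding L_def .
  have lin: "integrable M U" "integrable M V" "integrable M X" "integrable M Y"
    using gaussian_variable_power_integrable[OF M GL, of 1 0 0 0 1]
      gaussian_variable_power_integrable[OF M GL, of 0 1 0 0 1]
      gaussian_variable_power_integrable[OF M GL, of 0 0 1 0 1]
      gaussian_variable_power_integrable[OF M GL, of 0 0 0 1 1] by (simp_all add: L_def)
  have prods: "integrable M (\<lambda>\<omega>. L a b c d \<omega> * L a' b' c' d' \<omega>)" for a b c d a' b' c' d'
  proof (rule gaussian_variable_product_integrable[OF M])
    show "gaussian_variable M (\<lambda>\<omega>. L a b c d \<omega> + L a' b' c' d' \<omega>)"
      using GL[of "a + a'" "b + b'" "c + c'" "d + d'"] by (simp add: L_def[abs_def] algebra_simps)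
    show "gaussian_variable M (\<lambda>\<omega>. L a b c d \<omega> - L a' b' c' d' \<omega>)"
      using GL[of "a - a'" "b - b'" "c - c'" "d - d'"] by (simp add: L_def[abs_def] algebra_simps)
  qed
  have p2: "integrable M (\<lambda>\<omega>. U \<omega> * U \<omega>)" "integrable M (\<lambda>\<omega>. V \<omega> * V \<omega>)" "integrable M (\<lambda>\<omega>. X \<omega> * X \<omega>)"
     "integrable M (\<lambda>\<omega>. Y \<omega> * Y \<omega>)" "integrable M (\<lambda>\<omega>. U \<omega> * V \<omega>)" "integrable M (\<lambda>\<omega>. U \<omega> * X \<omega>)"
     "integrable M (\<lambda>\<omega>. U \<omega> * Y \<omega>)" "integrable M (\<lambda>\<omega>. V \<omega> * X \<omega>)" "integrable M (\<lambda>\<omega>. V \<omega> * Y \<omega>)"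
     "integrable M (\<lambda>\<omega>. X \<omega> * Y \<omega>)"
    using prods[of 1 0 0 0 1 0 0 0] prods[of 0 1 0 0 0 1 0 0] prods[of 0 0 1 0 0 0 1 0]
      prods[of 0 0 0 1 0 0 0 1] prods[of 1 0 0 0 0 1 0 0] prods[of 1 0 0 0 0 0 1 0]
      prods[of 1 0 0 0 0 0 0 1] prods[of 0 1 0 0 0 0 1 0] prods[of 0 1 0 0 0 0 0 1]
      prods[of 0 0 1 0 0 0 0 1]
    by (simp_all add: L_def)
  define q where "q a b c d =
     a*a * (\<integral>\<omega>. U \<omega> * U \<omega> \<partial>M) + b*b * (\<integral>\<omega>. V \<omega> * V \<omega> \<partial>M) + c*c * (\<integral>\<omega>. X \<omega> * X \<omega> \<partial>M) + d*d * (\<integral>\<omega>. Y \<omega> * Y \<omega> \<partial>M)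
     + 2*a*b * (\<integral>\<omega>. U \<omega> * V \<omega> \<partial>M) + 2*a*c * (\<integral>\<omega>. U \<omega> * X \<omega> \<partial>M) + 2*a*d * (\<integral>\<omega>. U \<omega> * Y \<omega> \<partial>M)
     + 2*b*c * (\<integral>\<omega>. V \<omega> * X \<omega> \<partial>M) + 2*b*d * (\<integral>\<omega>. V \<omega> * Y \<omega> \<partial>M) + 2*c*d * (\<integral>\<omega>. X \<omega> * Y \<omega> \<partial>M)"
    for a b c d :: real
  have sq: "(\<integral>\<omega>. L a b c d \<omega> ^ 2 \<partial>M) = q a b c d" for a b c d
  proof -
    have "(\<lambda>\<omega>. L a b c d \<omega> ^ 2) = (\<lambda>\<omega>.
      a*a * (U \<omega> * U \<omega>) + b*b * (V \<omega> * V \<omega>) + c*c * (X \<omega> * X \<omega>) + d*d * (Y \<omega> * Y \<omega>)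
     + 2*a*b * (U \<omega> * V \<omega>) + 2*a*c * (U \<omega> * X \<omega>) + 2*a*d * (U \<omega> * Y \<omega>)
     + 2*b*c * (V \<omega> * X \<omega>) + 2*b*d * (V \<omega> * Y \<omega>) + 2*c*d * (X \<omega> * Y \<omega>))"
      by (auto simp: L_def power2_eq_square algebra_simps)
    then show ?thesis unfolding q_def using p2 by simp
  qed
  have z4: "(\<integral>\<omega>. L a b c d \<omega> \<partial>M) = 0" for a b c d
    unfolding L_def using lin z by simp
  have i4: "integrable M (\<lambda>\<omega>. L a b c d \<omega> ^ 4)" for a b c d
    by (rule gaussian_variable_power_integrable[OF M GL])
  have e4: "(\<integral>\<omega>. L a b c d \<omega> ^ 4 \<partial>M) = 3 * (q a b c d)\<^sup>2" for a b c d
    using gaussian_variable_fourth_moment[OF M GL z4] sq by simp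
  have pol: "(\<lambda>\<omega>. U \<omega> * V \<omega> * X \<omega> * Y \<omega>) = (\<lambda>\<omega>. (L 1 1 1 1 \<omega> ^ 4 - L 1 1 1 (-1) \<omega> ^ 4
      - L 1 1 (-1) 1 \<omega> ^ 4 + L 1 1 (-1) (-1) \<omega> ^ 4 - L 1 (-1) 1 1 \<omega> ^ 4 + L 1 (-1) 1 (-1) \<omega> ^ 4
      + L 1 (-1) (-1) 1 \<omega> ^ 4 - L 1 (-1) (-1) (-1) \<omega> ^ 4) / 192)"
  proof
    fix \<omega>
    have "192 * (u * v * x * y) = (u+v+x+y)^4 - (u+v+x-y)^4 - (u+v-x+y)^4 + (u+v-x-y)^4
       - (u-v+x+y)^4 + (u-v+x-y)^4 + (u-v-x+y)^4 - (u-v-x-y)^4" for u v x y :: real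
      by algebra
    from this[of "U \<omega>" "V \<omega>" "X \<omega>" "Y \<omega>"] show "U \<omega> * V \<omega> * X \<omega> * Y \<omega> = (L 1 1 1 1 \<omega> ^ 4 - L 1 1 1 (-1) \<omega> ^ 4
      - L 1 1 (-1) 1 \<omega> ^ 4 + L 1 1 (-1) (-1) \<omega> ^ 4 - L 1 (-1) 1 1 \<omega> ^ 4 + L 1 (-1) 1 (-1) \<omega> ^ 4
      + L 1 (-1) (-1) 1 \<omega> ^ 4 - L 1 (-1) (-1) (-1) \<omega> ^ 4) / 192"
      by (simp add: L_def)
  qed
  show ?I unfolding pol using i4 by simp
  \<comment> \<open>The eight squares are those of \<open>q\<close> at the eight sign patterns:
    \<open>s\<close> collects the four second moments, and \<open>a\<close> to \<open>f\<close> are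
    the mixed moments in the order UV, UX, UY, VX, VY, XY.\<close>
  have *: "3 * (((s+2*(a+b+c+d+e+f))\<^sup>2 - (s+2*(a+b-c+d-e-f))\<^sup>2 - (s+2*(a-b+c-d+e-f))\<^sup>2 + (s+2*(a-b-c-d-e+f))\<^sup>2
      - (s+2*(-a+b+c-d-e+f))\<^sup>2 + (s+2*(-a+b-c-d+e-f))\<^sup>2 + (s+2*(-a-b+c+d-e-f))\<^sup>2 - (s+2*(-a-b-c+d+e+f))\<^sup>2))
      = 192 * (a * f + b * e + c * d)" for a b c d e f s :: real
    by algebra
  show ?E
    unfolding pol using i4
    apply (simp add: e4)
    using *[of "(\<integral>\<omega>. U \<omega> * U \<omega> \<partial>M) + (\<integral>\<omega>. V \<omega> * V \<omega> \<partial>M) + (\<integral>\<omega>. X \<omega> * X \<omega> \<partial>M) + (\<integral>\<omega>. Y \<omega> * Y \<omega> \<partial>M)"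
       "\<integral>\<omega>. U \<omega> * V \<omega> \<partial>M" "\<integral>\<omega>. U \<omega> * X \<omega> \<partial>M" "\<integral>\<omega>. U \<omega> * Y \<omega> \<partial>M" "\<integral>\<omega>. V \<omega> * X \<omega> \<partial>M"
       "\<integral>\<omega>. V \<omega> * Y \<omega> \<partial>M" "\<integral>\<omega>. X \<omega> * Y \<omega> \<partial>M"]
    by (simp add: q_def algebra_simps)
qed

text \<open>The points \<open>p i\<close> may coincide, while
  \<open>bivariate_gaussian_field\<close> sums over a set of points, so the coefficients are first
  collected over the fibres of \<open>p\<close>.\<close>

lemma field_family_gaussian:
  assumes B: "bivariate_gaussian_field M X W" and I: "finite I"
  shows "gaussian_variable M (\<lambda>\<omega>. \<Sum>i\<in>I. a i * X (p i) \<omega> + b i * W (p i) \<omega>)"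
proof -
  have "(\<lambda>\<omega>. \<Sum>i\<in>I. a i * X (p i) \<omega> + b i * W (p i) \<omega>) =
    (\<lambda>\<omega>. \<Sum>s\<in>p ` I. (\<Sum>i | i \<in> I \<and> p i = s. a i) * X s \<omega> + (\<Sum>i | i \<in> I \<and> p i = s. b i) * W s \<omega>)"
  proof
    fix \<omega>
    have "(\<Sum>i\<in>I. a i * X (p i) \<omega> + b i * W (p i) \<omega>)
       = (\<Sum>s\<in>p ` I. \<Sum>i | i \<in> I \<and> p i = s. a i * X (p i) \<omega> + b i * W (p i) \<omega>)"
      by (rule sum.image_gen[OF I])
    also have "\<dots> = (\<Sum>s\<in>p ` I. (\<Sum>i | i \<in> I \<and> p i = s. a i) * X s \<omega> + (\<Sum>i | i \<in> I \<and> p i = s. b i) * W s \<omega>)"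
      by (intro sum.cong refl) (simp add: sum.distrib sum_distrib_right)
    finally show "(\<Sum>i\<in>I. a i * X (p i) \<omega> + b i * W (p i) \<omega>) = \<dots>" .
  qed
  with B I show ?thesis unfolding bivariate_gaussian_field_def by simp
qed

section \<open>Stencils of a stationary Gaussian pair\<close>

text \<open>One notion covers both estimators: first differences are stencils, and so are discrete
  Laplacians up to the factor \<open>h\<^sup>2\<close>, which cancels in the least squares
  quotient.\<close>

definition stencil :: "'a::real_vector set \<Rightarrow> ('a \<Rightarrow> real) \<Rightarrow> real \<Rightarrow> ('a \<Rightarrow> real) \<Rightarrow> 'a \<Rightarrow> real" where
  "stencil V w h Z s = (\<Sum>v\<in>V. w v * Z (s + h *\<^sub>R v))"

text \<open>The covariance at lag \<open>u\<close> of two stencils with the same weights, when \<open>C\<close> is the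
  covariance of the fields.\<close>

definition stencil_cov :: "'a::real_vector set \<Rightarrow> ('a \<Rightarrow> real) \<Rightarrow> real \<Rightarrow> ('a \<Rightarrow> real) \<Rightarrow> 'a \<Rightarrow> real" where
  "stencil_cov V w h C u = (\<Sum>v\<in>V. \<Sum>v'\<in>V. w v * w v' * C (u + h *\<^sub>R v - h *\<^sub>R v'))"

locale gaussian_pair = prob_space M for M :: "'w measure" +
  fixes X W :: "'a::euclidean_space \<Rightarrow> 'w \<Rightarrow> real"
  assumes gaussian_field: "bivariate_gaussian_field M X W"
    and stationary: "stationary_field M X W"
begin

lemma gaussian_combination:
  assumes "finite I"
  shows "gaussian_variable M (\<lambda>\<omega>. \<Sum>i\<in>I. a i * X (p i) \<omega> + b i * W (p i) \<omega>)"
  by (rule field_family_gaussian[OF gaussian_field assms])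

lemma gaussian_four:
  "gaussian_variable M (\<lambda>\<omega>. a * X s \<omega> + b * W s \<omega> + c * X t \<omega> + d * W t \<omega>)"
proof -
  have "(\<lambda>\<omega>. a * X s \<omega> + b * W s \<omega> + c * X t \<omega> + d * W t \<omega>)
    = (\<lambda>\<omega>. \<Sum>i\<in>(UNIV::bool set). (if i then a else c) * X (if i then s else t) \<omega>
        + (if i then b else d) * W (if i then s else t) \<omega>)"
    by (auto simp: UNIV_bool)
  then show ?thesis using gaussian_combination[of "UNIV::bool set"] by simp
qed

lemma product_integrable [simp]:
  "integrable M (\<lambda>\<omega>. X s \<omega> * X t \<omega>)" "integrable M (\<lambda>\<omega>. X s \<omega> * W t \<omega>)"
  "integrable M (\<lambda>\<omega>. W s \<omega> * X t \<omega>)" "integrable M (\<lambda>\<omega>. W s \<omega> * W t \<omega>)"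
  by (rule gaussian_variable_product_integrable[OF prob_space_axioms];
      use gaussian_four[of 1 s 0 1 t 0] gaussian_four[of 1 s 0 "-1" t 0]
      gaussian_four[of 1 s 0 0 t 1] gaussian_four[of 1 s 0 0 t "-1"]
      gaussian_four[of 0 s 1 1 t 0] gaussian_four[of 0 s 1 "-1" t 0]
      gaussian_four[of 0 s 1 0 t 1] gaussian_four[of 0 s 1 0 t "-1"] in simp)+

lemma field_integrable [simp]: "integrable M (X s)" "integrable M (W s)"
  using gaussian_variable_power_integrable[OF prob_space_axioms gaussian_four[of 1 s 0 0 s 0], of 1]
    gaussian_variable_power_integrable[OF prob_space_axioms gaussian_four[of 0 s 1 0 s 0], of 1]
  by simp_all

lemma mean_const: "(\<integral>\<omega>. X s \<omega> \<partial>M) = (\<integral>\<omega>. X 0 \<omega> \<partial>M)" "(\<integral>\<omega>. W s \<omega> \<partial>M) = (\<integral>\<omega>. W 0 \<omega> \<partial>M)"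
  using stationary unfolding stationary_field_def by (metis add_0)+

lemma covariance_alt:
  assumes "integrable M U" "integrable M V" "integrable M (\<lambda>\<omega>. U \<omega> * V \<omega>)"
  shows "covariance M U V = (\<integral>\<omega>. U \<omega> * V \<omega> \<partial>M) - (\<integral>\<omega>. U \<omega> \<partial>M) * (\<integral>\<omega>. V \<omega> \<partial>M)"
  unfolding covariance_def using assms
  by (simp add: left_diff_distrib right_diff_distrib prob_space)

lemma covariance_stationary:
  "covariance M (X s) (X t) = covariance M (X (s - t)) (X 0)"
  "covariance M (X s) (W t) = covariance M (X (s - t)) (W 0)"
  "covariance M (W s) (W t) = covariance M (W (s - t)) (W 0)"
  "covariance M (W s) (X t) = covariance M (W (s - t)) (X 0)"
proof -
  have st: "\<And>s s' v. covariance M (X (s + v)) (X (s' + v)) = covariance M (X s) (X s') \<and>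
               covariance M (X (s + v)) (W (s' + v)) = covariance M (X s) (W s') \<and>
               covariance M (W (s + v)) (W (s' + v)) = covariance M (W s) (W s')"
    using stationary unfolding stationary_field_def by blast
  have com: "covariance M U V = covariance M V U" for U V
    unfolding covariance_def by (simp add: mult.commute)
  show "covariance M (X s) (X t) = covariance M (X (s - t)) (X 0)"
    "covariance M (X s) (W t) = covariance M (X (s - t)) (W 0)"
    "covariance M (W s) (W t) = covariance M (W (s - t)) (W 0)"
    using st[of "s - t" t 0] by auto
  show "covariance M (W s) (X t) = covariance M (W (s - t)) (X 0)"
    using st[of 0 t "s - t"] com by auto
qed

end

text \<open>The means are constant but arbitrary. They enter as
  \<open>sum a I * sum b J * (\<mu> * \<nu>)\<close>, which vanishes because difference weights sum
  to zero; hence raw product moments of stencils are combinations of covariances.\<close>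

lemma (in prob_space) expectation_bilinear:
  fixes U :: "'i \<Rightarrow> 'a \<Rightarrow> real" and V :: "'j \<Rightarrow> 'a \<Rightarrow> real"
  assumes "finite I" "finite J" "\<And>i. i \<in> I \<Longrightarrow> integrable M (U i)" "\<And>j. j \<in> J \<Longrightarrow> integrable M (V j)"
    and ij: "\<And>i j. i \<in> I \<Longrightarrow> j \<in> J \<Longrightarrow> integrable M (\<lambda>\<omega>. U i \<omega> * V j \<omega>)"
    and "\<And>i. i \<in> I \<Longrightarrow> (\<integral>\<omega>. U i \<omega> \<partial>M) = \<mu>" "\<And>j. j \<in> J \<Longrightarrow> (\<integral>\<omega>. V j \<omega> \<partial>M) = \<nu>"
    and a: "sum a I = 0" and b: "sum b J = 0"
  shows "integrable M (\<lambda>\<omega>. (\<Sum>i\<in>I. a i * U i \<omega>) * (\<Sum>j\<in>J. b j * V j \<omega>))"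
    and "(\<integral>\<omega>. (\<Sum>i\<in>I. a i * U i \<omega>) * (\<Sum>j\<in>J. b j * V j \<omega>) \<partial>M)
       = (\<Sum>i\<in>I. \<Sum>j\<in>J. a i * b j * covariance M (U i) (V j))"
proof -
  have *: "(\<lambda>\<omega>. (\<Sum>i\<in>I. a i * U i \<omega>) * (\<Sum>j\<in>J. b j * V j \<omega>))
    = (\<lambda>\<omega>. \<Sum>i\<in>I. \<Sum>j\<in>J. a i * b j * (U i \<omega> * V j \<omega>))"
    by (simp add: sum_product algebra_simps)
  show "integrable M (\<lambda>\<omega>. (\<Sum>i\<in>I. a i * U i \<omega>) * (\<Sum>j\<in>J. b j * V j \<omega>))"
    unfolding * by (intro Bochner_Integration.integrable_sum) (auto simp: ij)
  have "(\<integral>\<omega>. (\<Sum>i\<in>I. a i * U i \<omega>) * (\<Sum>j\<in>J. b j * V j \<omega>) \<partial>M)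
     = (\<Sum>i\<in>I. \<Sum>j\<in>J. a i * b j * (\<integral>\<omega>. U i \<omega> * V j \<omega> \<partial>M))"
    unfolding *
    by (simp add: ij Bochner_Integration.integral_sum Bochner_Integration.integrable_sum cong: sum.cong)
  also have "\<dots> = (\<Sum>i\<in>I. \<Sum>j\<in>J. a i * b j * covariance M (U i) (V j)) + (\<Sum>i\<in>I. \<Sum>j\<in>J. a i * b j * (\<mu> * \<nu>))"
    unfolding sum.distrib[symmetric]
  proof (intro sum.cong refl)
    fix i j assume "i \<in> I" "j \<in> J"
    then have e: "(\<integral>\<omega>. U i \<omega> * V j \<omega> \<partial>M) = covariance M (U i) (V j) + \<mu> * \<nu>"
      unfolding covariance_def using assms
      by (simp add: left_diff_distrib right_diff_distrib prob_space)
    show "a i * b j * (\<integral>\<omega>. U i \<omega> * V j \<omega> \<partial>M) = a i * b j * covariance M (U i) (V j) + a i * b j * (\<mu> * \<nu>)"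
      unfolding e by (simp add: distrib_left)
  qed
  also have "(\<Sum>i\<in>I. \<Sum>j\<in>J. a i * b j * (\<mu> * \<nu>)) = sum a I * sum b J * (\<mu> * \<nu>)"
    by (subst sum_product) (simp only: sum_distrib_right)
  finally show "(\<integral>\<omega>. (\<Sum>i\<in>I. a i * U i \<omega>) * (\<Sum>j\<in>J. b j * V j \<omega>) \<partial>M)
       = (\<Sum>i\<in>I. \<Sum>j\<in>J. a i * b j * covariance M (U i) (V j))" using a b by simp
qed

context gaussian_pair
begin

context
  fixes V :: "'a set" and w :: "'a \<Rightarrow> real" and h :: real
  assumes V: "finite V" and w0: "sum w V = 0"
begin

abbreviation "TX s \<equiv> (\<lambda>\<omega>. stencil V w h (\<lambda>t. X t \<omega>) s)"
abbreviation "TW s \<equiv> (\<lambda>\<omega>. stencil V w h (\<lambda>t. W t \<omega>) s)"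

lemma stencil_moments:
  "(\<integral>\<omega>. TX s \<omega> * TX t \<omega> \<partial>M) = stencil_cov V w h (\<lambda>u. covariance M (X u) (X 0)) (s - t)"
  "(\<integral>\<omega>. TX s \<omega> * TW t \<omega> \<partial>M) = stencil_cov V w h (\<lambda>u. covariance M (X u) (W 0)) (s - t)"
  "(\<integral>\<omega>. TW s \<omega> * TX t \<omega> \<partial>M) = stencil_cov V w h (\<lambda>u. covariance M (W u) (X 0)) (s - t)"
  "(\<integral>\<omega>. TW s \<omega> * TW t \<omega> \<partial>M) = stencil_cov V w h (\<lambda>u. covariance M (W u) (W 0)) (s - t)"
proof -
  have *: "s + h *\<^sub>R v - (t + h *\<^sub>R v') = s - t + h *\<^sub>R v - h *\<^sub>R v'" for v v' by simp
  note E = expectation_bilinear(2)[OF V V _ _ _ _ _ w0 w0]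
  show "(\<integral>\<omega>. TX s \<omega> * TX t \<omega> \<partial>M) = stencil_cov V w h (\<lambda>u. covariance M (X u) (X 0)) (s - t)"
    unfolding stencil_def
    by (subst E[OF _ _ _ mean_const(1) mean_const(1)])
       (auto simp: stencil_cov_def covariance_stationary(1)[of "_ + _"] * simp del: add_diff_cancel_right' intro!: sum.cong)
  show "(\<integral>\<omega>. TX s \<omega> * TW t \<omega> \<partial>M) = stencil_cov V w h (\<lambda>u. covariance M (X u) (W 0)) (s - t)"
    unfolding stencil_def
    by (subst E[OF _ _ _ mean_const(1) mean_const(2)])
       (auto simp: stencil_cov_def covariance_stationary(2)[of "_ + _"] * intro!: sum.cong)
  show "(\<integral>\<omega>. TW s \<omega> * TX t \<omega> \<partial>M) = stencil_cov V w h (\<lambda>u. covariance M (W u) (X 0)) (s - t)"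
    unfolding stencil_def
    by (subst E[OF _ _ _ mean_const(2) mean_const(1)])
       (auto simp: stencil_cov_def covariance_stationary(4)[of "_ + _"] * intro!: sum.cong)
  show "(\<integral>\<omega>. TW s \<omega> * TW t \<omega> \<partial>M) = stencil_cov V w h (\<lambda>u. covariance M (W u) (W 0)) (s - t)"
    unfolding stencil_def
    by (subst E[OF _ _ _ mean_const(2) mean_const(2)])
       (auto simp: stencil_cov_def covariance_stationary(3)[of "_ + _"] * intro!: sum.cong)
qed

lemma stencil_gaussian_four:
  "gaussian_variable M (\<lambda>\<omega>. a * TX s \<omega> + b * TW s \<omega> + c * TX t \<omega> + d * TW t \<omega>)"
proof -
  \<comment> \<open>The two base points \<open>s\<close> and \<open>t\<close> are encoded by the
    second component of the index, so that overlapping stencils cause no trouble.\<close>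
  have pr: "sum f (V \<times> (UNIV::bool set)) = (\<Sum>v\<in>V. f (v, True) + f (v, False))" for f :: "'a \<times> bool \<Rightarrow> real"
    using sum.cartesian_product[of "\<lambda>v b. f (v, b)" "UNIV::bool set" V] by (simp add: UNIV_bool add.commute)
  have "(\<lambda>\<omega>. a * TX s \<omega> + b * TW s \<omega> + c * TX t \<omega> + d * TW t \<omega>)
    = (\<lambda>\<omega>. \<Sum>i\<in>V \<times> (UNIV::bool set).
        ((if snd i then a else c) * w (fst i)) * X ((if snd i then s else t) + h *\<^sub>R fst i) \<omega>
        + ((if snd i then b else d) * w (fst i)) * W ((if snd i then s else t) + h *\<^sub>R fst i) \<omega>)"
    by (auto simp: pr stencil_def sum_distrib_left sum.distrib algebra_simps)
  then show ?thesis
    using gaussian_combination[of "V \<times> (UNIV::bool set)"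
        "\<lambda>i. (if snd i then a else c) * w (fst i)" "\<lambda>i. (if snd i then s else t) + h *\<^sub>R fst i"
        "\<lambda>i. (if snd i then b else d) * w (fst i)"] V by simp
qed

lemma stencil_mean: "(\<integral>\<omega>. TX s \<omega> \<partial>M) = 0" "(\<integral>\<omega>. TW s \<omega> \<partial>M) = 0"
proof -
  have "(\<integral>\<omega>. TX s \<omega> \<partial>M) = (\<Sum>v\<in>V. w v * (\<integral>\<omega>. X (s + h *\<^sub>R v) \<omega> \<partial>M))"
    unfolding stencil_def by (subst Bochner_Integration.integral_sum) auto
  also have "\<dots> = (\<Sum>v\<in>V. w v * (\<integral>\<omega>. X 0 \<omega> \<partial>M))"
    by (subst mean_const(1)) simp
  finally show "(\<integral>\<omega>. TX s \<omega> \<partial>M) = 0" using w0 by (simp add: sum_distrib_right[symmetric])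
  have "(\<integral>\<omega>. TW s \<omega> \<partial>M) = (\<Sum>v\<in>V. w v * (\<integral>\<omega>. W (s + h *\<^sub>R v) \<omega> \<partial>M))"
    unfolding stencil_def by (subst Bochner_Integration.integral_sum) auto
  also have "\<dots> = (\<Sum>v\<in>V. w v * (\<integral>\<omega>. W 0 \<omega> \<partial>M))"
    by (subst mean_const(2)) simp
  finally show "(\<integral>\<omega>. TW s \<omega> \<partial>M) = 0" using w0 by (simp add: sum_distrib_right[symmetric])
qed

end
end

section \<open>Second differences of covariances\<close>

definition second_difference :: "real \<Rightarrow> 'a::real_vector \<Rightarrow> ('a \<Rightarrow> real) \<Rightarrow> 'a \<Rightarrow> real" where
  "second_difference h e g u = g (u + h *\<^sub>R e) + g (u - h *\<^sub>R e) - 2 * g u"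

text \<open>The two facts that control a second difference of a function resembling
  \<open>norm u powr \<delta>\<close>: increments from the origin, for lags of the order of the
  spacing, and pure second derivatives, for larger lags. The origin is excluded, since the bound on
  the derivatives is singular there when \<open>\<delta> < 2\<close>.\<close>

definition power_smooth :: "real \<Rightarrow> ('a::euclidean_space \<Rightarrow> real) \<Rightarrow> bool" where
  "power_smooth \<delta> g \<longleftrightarrow> (\<exists>C \<rho> g1 g2. 0 < \<rho> \<and> 0 \<le> C \<and>
     (\<forall>u. 0 < norm u \<and> norm u < \<rho> \<longrightarrow>
        \<bar>g u - g 0\<bar> \<le> C * norm u powr \<delta> \<and>
        (\<forall>e\<in>Basis. ((\<lambda>t. g (u + t *\<^sub>R e)) has_real_derivative g1 e u) (at 0) \<and>
                   ((\<lambda>t. g1 e (u + t *\<^sub>R e)) has_real_derivative g2 e u) (at 0) \<and>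
                   \<bar>g2 e u\<bar> \<le> C * norm u powr (\<delta> - 2))))"

lemma power_smooth_mono:
  assumes "power_smooth \<alpha> g" "\<delta> \<le> \<alpha>"
  shows "power_smooth \<delta> g"
proof -
  obtain C \<rho> g1 g2 where *: "0 < \<rho>" "0 \<le> C"
     "\<And>u. 0 < norm u \<Longrightarrow> norm u < \<rho> \<Longrightarrow>
        \<bar>g u - g 0\<bar> \<le> C * norm u powr \<alpha> \<and>
        (\<forall>e\<in>Basis. ((\<lambda>t. g (u + t *\<^sub>R e)) has_real_derivative g1 e u) (at 0) \<and>
                   ((\<lambda>t. g1 e (u + t *\<^sub>R e)) has_real_derivative g2 e u) (at 0) \<and>
                   \<bar>g2 e u\<bar> \<le> C * norm u powr (\<alpha> - 2))"
    using assms(1) unfolding power_smooth_def by blast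
  have pw: "C * norm u powr (\<alpha> - a) \<le> C * norm u powr (\<delta> - a)" if "0 < norm u" "norm u < min \<rho> 1" for u :: 'a and a
    using that assms(2) \<open>0 \<le> C\<close> by (intro mult_left_mono powr_mono') auto
  show ?thesis
    unfolding power_smooth_def
  proof (intro exI conjI allI impI)
    show "0 < min \<rho> 1" using * by simp
    show "0 \<le> C" by fact
    fix u :: 'a assume u: "0 < norm u \<and> norm u < min \<rho> 1"
    show "\<bar>g u - g 0\<bar> \<le> C * norm u powr \<delta>"
      using *(3)[of u] pw[of u 0] u by auto
    show "\<forall>e\<in>Basis. ((\<lambda>t. g (u + t *\<^sub>R e)) has_real_derivative g1 e u) (at 0) \<and>
                   ((\<lambda>t. g1 e (u + t *\<^sub>R e)) has_real_derivative g2 e u) (at 0) \<and>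
                   \<bar>g2 e u\<bar> \<le> C * norm u powr (\<delta> - 2)"
      using *(3)[of u] pw[of u 2] u by fastforce
  qed
qed

lemma power_smooth_add:
  assumes "power_smooth \<delta> f" "power_smooth \<delta> g"
  shows "power_smooth \<delta> (\<lambda>u. f u + g u)"
proof -
  obtain C \<rho> f1 f2 where 1: "0 < \<rho>" "0 \<le> C"
     "\<And>u. 0 < norm u \<Longrightarrow> norm u < \<rho> \<Longrightarrow>
        \<bar>f u - f 0\<bar> \<le> C * norm u powr \<delta> \<and>
        (\<forall>e\<in>Basis. ((\<lambda>t. f (u + t *\<^sub>R e)) has_real_derivative f1 e u) (at 0) \<and>
                   ((\<lambda>t. f1 e (u + t *\<^sub>R e)) has_real_derivative f2 e u) (at 0) \<and>
                   \<bar>f2 e u\<bar> \<le> C * norm u powr (\<delta> - 2))"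
    using assms(1) unfolding power_smooth_def by blast
  obtain C' \<rho>' g1 g2 where 2: "0 < \<rho>'" "0 \<le> C'"
     "\<And>u. 0 < norm u \<Longrightarrow> norm u < \<rho>' \<Longrightarrow>
        \<bar>g u - g 0\<bar> \<le> C' * norm u powr \<delta> \<and>
        (\<forall>e\<in>Basis. ((\<lambda>t. g (u + t *\<^sub>R e)) has_real_derivative g1 e u) (at 0) \<and>
                   ((\<lambda>t. g1 e (u + t *\<^sub>R e)) has_real_derivative g2 e u) (at 0) \<and>
                   \<bar>g2 e u\<bar> \<le> C' * norm u powr (\<delta> - 2))"
    using assms(2) unfolding power_smooth_def by blast
  show ?thesis
    unfolding power_smooth_def
  proof (rule exI[of _ "C + C'"], rule exI[of _ "min \<rho> \<rho>'"], rule exI[of _ "\<lambda>e u. f1 e u + g1 e u"],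
       rule exI[of _ "\<lambda>e u. f2 e u + g2 e u"], intro conjI allI impI ballI)
    fix u :: 'a assume u: "0 < norm u \<and> norm u < min \<rho> \<rho>'"
    have a: "\<bar>f u - f 0\<bar> \<le> C * norm u powr \<delta>" "\<bar>g u - g 0\<bar> \<le> C' * norm u powr \<delta>"
      using 1(3)[of u] 2(3)[of u] u by auto
    show "\<bar>f u + g u - (f 0 + g 0)\<bar> \<le> (C + C') * norm u powr \<delta>"
      using a unfolding distrib_right by linarith
    fix e :: 'a assume e: "e \<in> Basis"
    show "((\<lambda>t. f (u + t *\<^sub>R e) + g (u + t *\<^sub>R e)) has_real_derivative f1 e u + g1 e u) (at 0)"
      "((\<lambda>t. f1 e (u + t *\<^sub>R e) + g1 e (u + t *\<^sub>R e)) has_real_derivative f2 e u + g2 e u) (at 0)"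
      using 1(3)[of u] 2(3)[of u] u e by (auto intro!: DERIV_add)
    have "\<bar>f2 e u\<bar> \<le> C * norm u powr (\<delta> - 2)" "\<bar>g2 e u\<bar> \<le> C' * norm u powr (\<delta> - 2)"
      using 1(3)[of u] 2(3)[of u] u e by auto
    then show "\<bar>f2 e u + g2 e u\<bar> \<le> (C + C') * norm u powr (\<delta> - 2)"
      unfolding distrib_right by linarith
  qed (use 1 2 in auto)
qed

lemma power_smooth_cong:
  assumes "power_smooth \<delta> f" "0 < \<rho>" "\<And>u. norm u < \<rho> \<Longrightarrow> g u = f u"
  shows "power_smooth \<delta> g"
proof -
  obtain C \<rho>' f1 f2 where 1: "0 < \<rho>'" "0 \<le> C"
     "\<And>u. 0 < norm u \<Longrightarrow> norm u < \<rho>' \<Longrightarrow>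
        \<bar>f u - f 0\<bar> \<le> C * norm u powr \<delta> \<and>
        (\<forall>e\<in>Basis. ((\<lambda>t. f (u + t *\<^sub>R e)) has_real_derivative f1 e u) (at 0) \<and>
                   ((\<lambda>t. f1 e (u + t *\<^sub>R e)) has_real_derivative f2 e u) (at 0) \<and>
                   \<bar>f2 e u\<bar> \<le> C * norm u powr (\<delta> - 2))"
    using assms(1) unfolding power_smooth_def by blast
  show ?thesis
    unfolding power_smooth_def
  proof (rule exI[of _ C], rule exI[of _ "min \<rho> \<rho>'"], rule exI[of _ f1], rule exI[of _ f2], intro conjI allI impI ballI)
    fix u :: 'a assume u: "0 < norm u \<and> norm u < min \<rho> \<rho>'"
    show "\<bar>g u - g 0\<bar> \<le> C * norm u powr \<delta>"
      using 1(3)[of u] u assms(2) by (simp add: assms(3))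
    fix e :: 'a assume e: "e \<in> Basis"
    show "\<bar>f2 e u\<bar> \<le> C * norm u powr (\<delta> - 2)" "((\<lambda>t. f1 e (u + t *\<^sub>R e)) has_real_derivative f2 e u) (at 0)"
      using 1(3)[of u] u e by auto
    have "open {t. norm (u + t *\<^sub>R e) < \<rho>}"
      by (intro open_Collect_less continuous_intros)
    from eventually_nhds_in_open[OF this, of 0]
    have "\<forall>\<^sub>F t in nhds 0. norm (u + t *\<^sub>R e) < \<rho>"
      using u by simp
    then have "\<forall>\<^sub>F t in nhds 0. f (u + t *\<^sub>R e) = g (u + t *\<^sub>R e)"
      by eventually_elim (simp add: assms(3))
    moreover have "((\<lambda>t. f (u + t *\<^sub>R e)) has_real_derivative f1 e u) (at 0)"
      using 1(3)[of u] u e by auto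
    ultimately show "((\<lambda>t. g (u + t *\<^sub>R e)) has_real_derivative f1 e u) (at 0)"
      by (subst (asm) DERIV_cong_ev[OF refl _ refl, where g="\<lambda>t. g (u + t *\<^sub>R e)"]) auto
  qed (use 1 assms in auto)
qed

text \<open>The mean value theorem is used once for \<open>\<phi> t + \<phi> (- t)\<close> and once
  for \<open>\<phi>1\<close> on a symmetric interval; the length of the latter yields the factor
  2.\<close>

lemma second_difference_mean_value:
  fixes \<phi> \<phi>1 \<phi>2 :: "real \<Rightarrow> real"
  assumes "0 < h"
    and 1: "\<And>t. \<bar>t\<bar> \<le> h \<Longrightarrow> (\<phi> has_real_derivative \<phi>1 t) (at t)"
    and 2: "\<And>t. \<bar>t\<bar> \<le> h \<Longrightarrow> (\<phi>1 has_real_derivative \<phi>2 t) (at t)"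
    and b: "\<And>t. \<bar>t\<bar> \<le> h \<Longrightarrow> \<bar>\<phi>2 t\<bar> \<le> K"
  shows "\<bar>\<phi> h + \<phi> (- h) - 2 * \<phi> 0\<bar> \<le> 2 * h\<^sup>2 * K"
proof -
  have d: "((\<lambda>t. \<phi> t + \<phi> (- t)) has_real_derivative \<phi>1 t - \<phi>1 (- t)) (at t)" if "0 \<le> t" "t \<le> h" for t
    using that by (auto intro!: derivative_eq_intros 1 DERIV_chain2[OF 1])
  obtain x where x: "0 < x" "x < h" "\<phi> h + \<phi> (- h) - (\<phi> 0 + \<phi> (- 0)) = (h - 0) * (\<phi>1 x - \<phi>1 (- x))"
    using MVT2[OF assms(1), of "\<lambda>t. \<phi> t + \<phi> (- t)" "\<lambda>t. \<phi>1 t - \<phi>1 (- t)"] d by auto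
  obtain z where z: "- x < z" "z < x" "\<phi>1 x - \<phi>1 (- x) = (x - (- x)) * \<phi>2 z"
    using MVT2[of "- x" x \<phi>1 \<phi>2] 2 x by auto
  have "\<bar>\<phi> h + \<phi> (- h) - 2 * \<phi> 0\<bar> = \<bar>h * (2 * x * \<phi>2 z)\<bar>"
    using x(3) z(3) by simp
  also have "\<dots> = h * (2 * x) * \<bar>\<phi>2 z\<bar>" using assms(1) x by (simp add: abs_mult)
  also have "\<dots> \<le> h * (2 * h) * K"
    using x z b[of z] assms(1) by (intro mult_mono) auto
  finally show ?thesis by (simp add: power2_eq_square mult_ac)
qed

text \<open>Two regimes. If \<open>norm u < 2 * h\<close>, all three points lie within
  \<open>3 * h\<close> of the origin and the increments suffice, as \<open>1 + norm u / h\<close> is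
  bounded. Otherwise the segment stays at a distance from the origin comparable to
  \<open>norm u + h\<close>, and the second derivative there gives the order
  \<open>h\<^sup>2 * (norm u + h) powr (\<delta> - 2)\<close>.\<close>

lemma power_smooth_second_difference:
  fixes g :: "'a::euclidean_space \<Rightarrow> real"
  assumes g: "power_smooth \<delta> g" and \<delta>: "0 < \<delta>" "\<delta> \<le> 2"
  shows "\<exists>C>0. \<exists>\<rho>>0. \<forall>h u. \<forall>e\<in>Basis. 0 < h \<and> norm u + h < \<rho> \<longrightarrow>
     \<bar>second_difference h e g u\<bar> \<le> C * h powr \<delta> * (1 + norm u / h) powr (\<delta> - 2)"
proof -
  obtain C \<rho> g1 g2 where 1: "0 < \<rho>" "0 \<le> C"
     "\<And>u. 0 < norm u \<Longrightarrow> norm u < \<rho> \<Longrightarrow>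
        \<bar>g u - g 0\<bar> \<le> C * norm u powr \<delta> \<and>
        (\<forall>e\<in>Basis. ((\<lambda>t. g (u + t *\<^sub>R e)) has_real_derivative g1 e u) (at 0) \<and>
                   ((\<lambda>t. g1 e (u + t *\<^sub>R e)) has_real_derivative g2 e u) (at 0) \<and>
                   \<bar>g2 e u\<bar> \<le> C * norm u powr (\<delta> - 2))"
    using g unfolding power_smooth_def by blast
  \<comment> \<open>\<open>36 * C\<close> is \<open>4 * 3\<^sup>2 * C\<close> from the near regime;
    the far one needs \<open>18 * C\<close>. The summand 1 keeps the constant positive when
    \<open>C = 0\<close>.\<close>
  have bd: "\<bar>second_difference h e g u\<bar> \<le> (36 * C + 1) * h powr \<delta> * (1 + norm u / h) powr (\<delta> - 2)"
    if e: "e \<in> Basis" and h: "0 < h" and u: "norm u + h < \<rho>" for h u e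
  proof (cases "norm u < 2 * h")
    case True
    have pt: "\<bar>g x - g 0\<bar> \<le> C * (3 * h) powr \<delta>" if "norm x \<le> norm u + h" for x
    proof (cases "x = 0")
      case False
      then have "\<bar>g x - g 0\<bar> \<le> C * norm x powr \<delta>" using 1(3)[of x] that u by auto
      also have "\<dots> \<le> C * (3 * h) powr \<delta>"
        using 1(2) that True \<delta> by (intro mult_left_mono powr_mono2) auto
      finally show ?thesis .
    qed (use 1 in simp)
    have "norm (u + h *\<^sub>R e) \<le> norm u + h" "norm (u - h *\<^sub>R e) \<le> norm u + h"
      using norm_triangle_ineq[of u "h *\<^sub>R e"] norm_triangle_ineq4[of u "h *\<^sub>R e"] h e by auto
    from pt[OF this(1)] pt[OF this(2)] pt[of u] h
    have "\<bar>second_difference h e g u\<bar> \<le> 4 * (C * (3 * h) powr \<delta>)"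
      unfolding second_difference_def by auto
    also have "\<dots> = 36 * C * h powr \<delta> * 3 powr (\<delta> - 2)"
      using h by (simp add: powr_mult powr_diff)
    also have "\<dots> \<le> (36 * C + 1) * h powr \<delta> * (1 + norm u / h) powr (\<delta> - 2)"
    proof (intro mult_mono)
      show "3 powr (\<delta> - 2) \<le> (1 + norm u / h) powr (\<delta> - 2)"
        using True h \<delta> by (intro powr_mono2') (auto simp: field_simps add_pos_nonneg)
    qed (use 1 in auto)
    finally show ?thesis .
  next
    case False
    have far: "norm u - h \<le> norm (u + t *\<^sub>R e)" "norm (u + t *\<^sub>R e) \<le> norm u + h" if "\<bar>t\<bar> \<le> h" for t
      using norm_triangle_ineq[of u "t *\<^sub>R e"] norm_diff_ineq[of u "t *\<^sub>R e"] that e by auto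
    \<comment> \<open>From \<open>2 * h \<le> norm u\<close> follows
      \<open>(norm u + h) / 3 \<le> norm u - h\<close>, a lower bound for the distance to the origin
      along the segment.\<close>
    let ?K = "C * ((norm u + h) / 3) powr (\<delta> - 2)"
    have "\<bar>g (u + h *\<^sub>R e) + g (u + (- h) *\<^sub>R e) - 2 * g (u + 0 *\<^sub>R e)\<bar> \<le> 2 * h\<^sup>2 * ?K"
    proof (rule second_difference_mean_value[OF h])
      fix t :: real assume t: "\<bar>t\<bar> \<le> h"
      let ?u = "u + t *\<^sub>R e"
      have n: "0 < norm ?u" "norm ?u < \<rho>" using far[OF t] False h u by linarith+
      have sh: "(\<lambda>s. G (u + s *\<^sub>R e)) = (\<lambda>s. G (?u + (s - t) *\<^sub>R e))" for G :: "'a \<Rightarrow> real"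
        by (simp add: algebra_simps)
      have tr: "((\<lambda>s. G (u + s *\<^sub>R e)) has_real_derivative d) (at t)"
        if "((\<lambda>s. G (?u + s *\<^sub>R e)) has_real_derivative d) (at 0)" for G d
      proof -
        have "((\<lambda>s. s - t) has_real_derivative 1) (at t)" by (auto intro!: derivative_eq_intros)
        then have "((\<lambda>s. G (?u + (s - t) *\<^sub>R e)) has_real_derivative d * 1) (at t)"
          by (intro DERIV_chain2[of "\<lambda>s. G (?u + s *\<^sub>R e)"]) (use that in simp_all)
        then show ?thesis unfolding sh by simp
      qed
      show "((\<lambda>s. g (u + s *\<^sub>R e)) has_real_derivative g1 e ?u) (at t)"
        "((\<lambda>s. g1 e (u + s *\<^sub>R e)) has_real_derivative g2 e ?u) (at t)"
        using 1(3)[OF n] e by (auto intro!: tr)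
      have "\<bar>g2 e ?u\<bar> \<le> C * norm ?u powr (\<delta> - 2)" using 1(3)[OF n] e by auto
      also have "\<dots> \<le> ?K"
        using far[OF t] False h \<delta> 1(2) by (intro mult_left_mono powr_mono2') auto
      finally show "\<bar>g2 e ?u\<bar> \<le> ?K" .
    qed
    then have "\<bar>second_difference h e g u\<bar> \<le> 2 * h\<^sup>2 * ?K"
      by (simp add: second_difference_def)
    also have "2 * h\<^sup>2 * ?K
       = (2 * C * (1/3) powr (\<delta> - 2)) * h powr \<delta> * (1 + norm u / h) powr (\<delta> - 2)"
    proof -
      have r: "(norm u + h) / 3 = h * ((1 + norm u / h) * (1/3))" using h by (simp add: field_simps)
      have nn: "0 \<le> 1 + norm u / h" using h by simp
      have h2: "h\<^sup>2 * h powr (\<delta> - 2) = h powr \<delta>"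
        using h powr_add[of h 2 "\<delta> - 2"] by simp
      have pm: "(h * ((1 + norm u / h) * (1/3))) powr (\<delta> - 2)
          = h powr (\<delta> - 2) * ((1 + norm u / h) powr (\<delta> - 2) * (1/3) powr (\<delta> - 2))"
        by (simp only: powr_mult)
      show ?thesis unfolding r pm h2[symmetric] by (simp only: mult_ac)
    qed
    also have "\<dots> \<le> (36 * C + 1) * h powr \<delta> * (1 + norm u / h) powr (\<delta> - 2)"
    proof (intro mult_right_mono)
      have "(1/3::real) powr (\<delta> - 2) = 3 powr (2 - \<delta>)"
        using powr_minus[of 3 "2 - \<delta>"] by (simp add: powr_divide inverse_eq_divide)
      also have "\<dots> \<le> 3 powr 2" using \<delta> by (intro powr_mono) auto
      finally have *: "(1/3::real) powr (\<delta> - 2) \<le> 9" by simp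
      have "2 * C * (1/3) powr (\<delta> - 2) \<le> 2 * C * 9" using * 1(2) by (intro mult_left_mono) auto
      then show "2 * C * (1/3) powr (\<delta> - 2) \<le> 36 * C + 1" using 1(2) by linarith
    qed auto
    finally show ?thesis .
  qed
  show ?thesis
    by (intro exI[of _ "36 * C + 1"] exI[of _ \<rho>] conjI) (use 1 bd in auto)
qed

section \<open>Covariances that behave like a power of the distance near lag 0\<close>

text \<open>Along a coordinate direction the second derivative of \<open>F (norm u)\<close> is
  \<open>F2\<close> times the squared cosine of the angle plus \<open>F1 / norm u\<close> times the
  squared sine. The second term costs one power of \<open>norm u\<close>, which is why
  \<open>F1\<close> has its own bound. The constants add up to \<open>C + 2 * C\<close>.\<close>

lemma power_smooth_radial:
  fixes F F1 F2 :: "real \<Rightarrow> real"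
  assumes "0 < L" "0 \<le> C"
    and F: "\<And>t. 0 < t \<Longrightarrow> t < L \<Longrightarrow> (F has_real_derivative F1 t) (at t)"
    and F1: "\<And>t. 0 < t \<Longrightarrow> t < L \<Longrightarrow> (F1 has_real_derivative F2 t) (at t)"
    and b: "\<And>t. 0 < t \<Longrightarrow> t < L \<Longrightarrow> \<bar>F t - F 0\<bar> \<le> C * t powr \<delta>"
           "\<And>t. 0 < t \<Longrightarrow> t < L \<Longrightarrow> \<bar>F1 t\<bar> \<le> C * t powr (\<delta> - 1)"
           "\<And>t. 0 < t \<Longrightarrow> t < L \<Longrightarrow> \<bar>F2 t\<bar> \<le> C * t powr (\<delta> - 2)"
  shows "power_smooth \<delta> (\<lambda>u::'a::euclidean_space. F (norm u))"
  unfolding power_smooth_def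
proof (rule exI[of _ "3 * C"], rule exI[of _ L], rule exI[of _ "\<lambda>e u. F1 (norm u) * ((u \<bullet> e) / norm u)"],
       rule exI[of _ "\<lambda>e u. F2 (norm u) * ((u \<bullet> e) / norm u)\<^sup>2 + F1 (norm u) * (1 / norm u - (u \<bullet> e)\<^sup>2 / norm u ^ 3)"],
       intro conjI allI impI ballI)
  fix u :: 'a assume u: "0 < norm u \<and> norm u < L"
  let ?n = "norm u"
  have "\<bar>F ?n - F (norm (0::'a))\<bar> \<le> C * ?n powr \<delta>" using b(1)[of ?n] u by simp
  moreover have "C * ?n powr \<delta> \<le> 3 * C * ?n powr \<delta>" using assms(2) by simp
  ultimately show "\<bar>F ?n - F (norm (0::'a))\<bar> \<le> 3 * C * ?n powr \<delta>" by linarith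
  fix e :: 'a assume e: "e \<in> Basis"
  have n: "((\<lambda>t. norm (u + t *\<^sub>R e)) has_real_derivative (u \<bullet> e) / ?n) (at 0)"
  proof -
    have eq: "(\<lambda>t. norm (u + t *\<^sub>R e)) = (\<lambda>t. sqrt (u \<bullet> u + 2 * t * (u \<bullet> e) + t\<^sup>2))"
    proof
      fix t
      have "(u + t *\<^sub>R e) \<bullet> (u + t *\<^sub>R e) = u \<bullet> u + 2 * t * (u \<bullet> e) + t\<^sup>2"
        using e inner_commute[of e u] by (simp add: inner_add_left inner_add_right power2_eq_square distrib_left)
      then show "norm (u + t *\<^sub>R e) = sqrt (u \<bullet> u + 2 * t * (u \<bullet> e) + t\<^sup>2)"
        by (simp only: norm_eq_sqrt_inner)
    qed
    have q: "((\<lambda>t. u \<bullet> u + 2 * t * (u \<bullet> e) + t\<^sup>2) has_real_derivative 2 * (u \<bullet> e)) (at 0)"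
      by (auto intro!: derivative_eq_intros)
    have p: "u \<bullet> u + 2 * 0 * (u \<bullet> e) + 0\<^sup>2 = u \<bullet> u" by simp
    have sq: "(sqrt has_real_derivative inverse (sqrt (u \<bullet> u)) / 2) (at (u \<bullet> u + 2 * 0 * (u \<bullet> e) + 0\<^sup>2))"
      unfolding p using u by (intro DERIV_real_sqrt) simp
    have "((\<lambda>t. sqrt (u \<bullet> u + 2 * t * (u \<bullet> e) + t\<^sup>2)) has_real_derivative
        inverse (sqrt (u \<bullet> u)) / 2 * (2 * (u \<bullet> e))) (at 0)"
      by (rule DERIV_chain2[where f=sqrt and g="\<lambda>t. u \<bullet> u + 2 * t * (u \<bullet> e) + t\<^sup>2", OF sq q])
    moreover have "inverse (sqrt (u \<bullet> u)) / 2 * (2 * (u \<bullet> e)) = (u \<bullet> e) / norm u"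
    proof -
      have "inverse a / 2 * (2 * b) = b / a" for a b :: real
        by (cases "a = 0") (simp_all add: field_simps)
      then show ?thesis by (simp only: norm_eq_sqrt_inner)
    qed
    ultimately show ?thesis unfolding eq by simp
  qed
  have F': "(F has_real_derivative F1 ?n) (at (norm (u + 0 *\<^sub>R e)))"
    and F1': "(F1 has_real_derivative F2 ?n) (at (norm (u + 0 *\<^sub>R e)))"
    using F[of ?n] F1[of ?n] u by simp_all
  show "((\<lambda>t. F (norm (u + t *\<^sub>R e))) has_real_derivative F1 ?n * ((u \<bullet> e) / ?n)) (at 0)"
    by (rule DERIV_chain2[OF F' n])
  have ie: "(u + t *\<^sub>R e) \<bullet> e = u \<bullet> e + t" for t using e by (simp add: inner_add_left)
  show "((\<lambda>t. F1 (norm (u + t *\<^sub>R e)) * ((u + t *\<^sub>R e) \<bullet> e / norm (u + t *\<^sub>R e))) has_real_derivative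
      F2 ?n * ((u \<bullet> e) / ?n)\<^sup>2 + F1 ?n * (1 / ?n - (u \<bullet> e)\<^sup>2 / ?n ^ 3)) (at 0)"
  proof -
    have n0: "norm (u + 0 *\<^sub>R e) \<noteq> 0" using u by simp
    have "((\<lambda>t. F1 (norm (u + t *\<^sub>R e)) * ((u \<bullet> e + t) / norm (u + t *\<^sub>R e))) has_real_derivative
      (F2 ?n * ((u \<bullet> e) / ?n)) * ((u \<bullet> e + 0) / norm (u + 0 *\<^sub>R e))
      + ((0 + 1) * norm (u + 0 *\<^sub>R e) - (u \<bullet> e + 0) * ((u \<bullet> e) / ?n)) / (norm (u + 0 *\<^sub>R e) * norm (u + 0 *\<^sub>R e))
        * F1 (norm (u + 0 *\<^sub>R e))) (at 0)"
      by (intro DERIV_mult DERIV_divide DERIV_add DERIV_const DERIV_ident DERIV_chain2[OF F1' n] n n0)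
    moreover have "(F2 ?n * ((u \<bullet> e) / ?n)) * ((u \<bullet> e + 0) / norm (u + 0 *\<^sub>R e))
      + ((0 + 1) * norm (u + 0 *\<^sub>R e) - (u \<bullet> e + 0) * ((u \<bullet> e) / ?n)) / (norm (u + 0 *\<^sub>R e) * norm (u + 0 *\<^sub>R e))
        * F1 (norm (u + 0 *\<^sub>R e))
      = F2 ?n * ((u \<bullet> e) / ?n)\<^sup>2 + F1 ?n * (1 / ?n - (u \<bullet> e)\<^sup>2 / ?n ^ 3)"
      using u by (simp add: field_simps power2_eq_square power3_eq_cube)
    ultimately show ?thesis by (simp only: ie)
  qed
  have ie1: "\<bar>u \<bullet> e\<bar> \<le> ?n" using e by (simp add: Basis_le_norm)
  have sq: "(u \<bullet> e)\<^sup>2 \<le> ?n\<^sup>2" using ie1 by (simp add: abs_le_square_iff[symmetric])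
  have p1: "((u \<bullet> e) / ?n)\<^sup>2 \<le> 1" using sq u by (simp add: power_divide)
  have p2: "\<bar>1 / ?n - (u \<bullet> e)\<^sup>2 / ?n ^ 3\<bar> \<le> 2 / ?n"
  proof -
    have "(u \<bullet> e)\<^sup>2 / ?n ^ 3 \<le> ?n\<^sup>2 / ?n ^ 3" using sq u by (intro divide_right_mono) auto
    also have "\<dots> = 1 / ?n" using u by (simp add: power2_eq_square power3_eq_cube)
    finally have "(u \<bullet> e)\<^sup>2 / ?n ^ 3 \<le> 1 / ?n" .
    moreover have "0 \<le> (u \<bullet> e)\<^sup>2 / ?n ^ 3" "0 \<le> 1 / ?n" by simp_all
    moreover have "2 / ?n = 1 / ?n + 1 / ?n" by simp
    ultimately show ?thesis by linarith
  qed
  have "\<bar>F2 ?n * ((u \<bullet> e) / ?n)\<^sup>2\<bar> \<le> C * ?n powr (\<delta> - 2) * 1"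
    unfolding abs_mult using b(3)[of ?n] u p1 by (intro mult_mono) auto
  moreover have "\<bar>F1 ?n * (1 / ?n - (u \<bullet> e)\<^sup>2 / ?n ^ 3)\<bar> \<le> C * ?n powr (\<delta> - 1) * (2 / ?n)"
    unfolding abs_mult using b(2)[of ?n] u p2 by (intro mult_mono) auto
  moreover have "C * ?n powr (\<delta> - 1) * (2 / ?n) = 2 * C * ?n powr (\<delta> - 2)"
  proof -
    have "?n powr (\<delta> - 1) = ?n powr (\<delta> - 2) * ?n powr 1"
      unfolding powr_add[symmetric] by simp
    then show ?thesis using u by simp
  qed
  ultimately show "\<bar>F2 ?n * ((u \<bullet> e) / ?n)\<^sup>2 + F1 ?n * (1 / ?n - (u \<bullet> e)\<^sup>2 / ?n ^ 3)\<bar> \<le> 3 * C * ?n powr (\<delta> - 2)"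
    by linarith
qed (use assms in auto)

lemma one_minus_powr_le:
  assumes "0 \<le> x" "0 \<le> \<kappa>"
  shows "1 - (1 + x) powr (- \<kappa>) \<le> \<kappa> * (x::real)"
proof -
  have "1 - \<kappa> * x \<le> 1 - \<kappa> * ln (1 + x)"
    using ln_add_one_self_le_self[of x] assms by (simp add: mult_left_mono)
  also have "\<dots> \<le> exp (- \<kappa> * ln (1 + x))"
    using exp_ge_add_one_self[of "- \<kappa> * ln (1 + x)"] by simp
  also have "\<dots> = (1 + x) powr (- \<kappa>)" using assms by (simp add: powr_def)
  finally show ?thesis by simp
qed

lemma generalized_cauchy_0: "0 < \<delta> \<Longrightarrow> generalized_cauchy \<sigma>2 \<phi> \<delta> \<kappa> 0 = \<sigma>2"
  by (simp add: generalized_cauchy_def)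

lemma generalized_cauchy_power_smooth:
  assumes "0 < \<sigma>2" "0 < \<phi>" "0 < \<delta>" "\<delta> < 2" "0 < \<kappa>"
  shows "power_smooth \<delta> (generalized_cauchy \<sigma>2 \<phi> \<delta> \<kappa> :: 'a::euclidean_space \<Rightarrow> real)"
proof -
  define F where "F t = \<sigma>2 * (1 + \<phi> * t powr \<delta>) powr (- \<kappa>)" for t :: real
  define F1 where "F1 t = \<sigma>2 * (- \<kappa> * (1 + \<phi> * t powr \<delta>) powr (- \<kappa> - 1) * (\<phi> * (\<delta> * t powr (\<delta> - 1))))" for t :: real
  define F2 where "F2 t = \<sigma>2 * (- \<kappa> * ((- \<kappa> - 1) * (1 + \<phi> * t powr \<delta>) powr (- \<kappa> - 2) * (\<phi> * (\<delta> * t powr (\<delta> - 1)))) * (\<phi> * (\<delta> * t powr (\<delta> - 1)))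
     + - \<kappa> * (1 + \<phi> * t powr \<delta>) powr (- \<kappa> - 1) * (\<phi> * (\<delta> * ((\<delta> - 1) * t powr (\<delta> - 2)))))" for t :: real
  have pos: "0 < 1 + \<phi> * t powr \<delta>" for t using assms by (simp add: add_pos_nonneg)
  have dp: "((\<lambda>t. t powr a) has_real_derivative a * t powr (a - 1)) (at t)" if "0 < t" for a t :: real
    using that by (rule has_real_derivative_powr)
  have d1: "((\<lambda>t. 1 + \<phi> * t powr \<delta>) has_real_derivative \<phi> * (\<delta> * t powr (\<delta> - 1))) (at t)" if "0 < t" for t
    using DERIV_add[OF DERIV_const[of 1] DERIV_cmult[OF dp[OF that, of \<delta>], of \<phi>]] by simp
  have d2: "((\<lambda>t. (1 + \<phi> * t powr \<delta>) powr a) has_real_derivative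
      a * (1 + \<phi> * t powr \<delta>) powr (a - 1) * (\<phi> * (\<delta> * t powr (\<delta> - 1)))) (at t)" if "0 < t" for t a
    by (rule DERIV_chain2[OF dp[OF pos] d1[OF that]])
  have F1: "(F has_real_derivative F1 t) (at t)" if "0 < t" for t
    unfolding F_def F1_def using d2[OF that, of "- \<kappa>"] by (intro DERIV_cmult) simp
  have F2: "(F1 has_real_derivative F2 t) (at t)" if "0 < t" for t
  proof -
    have a: "((\<lambda>t. - \<kappa> * (1 + \<phi> * t powr \<delta>) powr (- \<kappa> - 1)) has_real_derivative
       - \<kappa> * ((- \<kappa> - 1) * (1 + \<phi> * t powr \<delta>) powr (- \<kappa> - 2) * (\<phi> * (\<delta> * t powr (\<delta> - 1))))) (at t)"
      using DERIV_cmult[OF d2[OF that, of "- \<kappa> - 1"], of "- \<kappa>"] by (simp add: diff_diff_eq)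
    have b: "((\<lambda>t. \<phi> * (\<delta> * t powr (\<delta> - 1))) has_real_derivative
       \<phi> * (\<delta> * ((\<delta> - 1) * t powr (\<delta> - 2)))) (at t)"
      using DERIV_cmult[OF DERIV_cmult[OF dp[OF that, of "\<delta> - 1"], of \<delta>], of \<phi>] by (simp add: diff_diff_eq)
    from DERIV_cmult[OF DERIV_mult[OF a b], of \<sigma>2] show ?thesis
      unfolding F1_def F2_def by (simp only: mult_ac add_ac)
  qed
  have le1: "(1 + \<phi> * t powr \<delta>) powr (- a) \<le> 1" if "0 \<le> a" for a t
  proof -
    have "(1 + \<phi> * t powr \<delta>) powr (- a) \<le> (1 + \<phi> * t powr \<delta>) powr 0"
      using assms that by (intro powr_mono) auto
    then show ?thesis using pos[of t] by simp
  qed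
  define C1 where "C1 = \<sigma>2 * (\<kappa> * (\<phi> * \<delta>))"
  define C2 where "C2 = \<sigma>2 * (\<kappa> * (\<kappa> + 1) * (\<phi> * \<delta>) * (\<phi> * \<delta>)) + \<sigma>2 * (\<kappa> * (\<phi> * (\<delta> * \<bar>\<delta> - 1\<bar>)))"
  define C where "C = \<sigma>2 * (\<kappa> * \<phi>) + C1 + C2"
  have Cn: "0 \<le> C1" "0 \<le> C2" "0 \<le> \<sigma>2 * (\<kappa> * \<phi>)" unfolding C1_def C2_def using assms by auto
  have "power_smooth \<delta> (\<lambda>u::'a. F (norm u))"
  proof (rule power_smooth_radial[of 1 C F F1 F2])
    show "0 \<le> C" using Cn by (simp add: C_def)
    fix t :: real assume t: "0 < t" "t < 1"
    show "(F has_real_derivative F1 t) (at t)" "(F1 has_real_derivative F2 t) (at t)"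
      using F1 F2 t by auto
    have "\<bar>F t - F 0\<bar> = \<sigma>2 * (1 - (1 + \<phi> * t powr \<delta>) powr (- \<kappa>))"
      using le1[of \<kappa> t] assms by (simp add: F_def right_diff_distrib abs_mult)
    also have "\<dots> \<le> \<sigma>2 * (\<kappa> * (\<phi> * t powr \<delta>))"
      using assms one_minus_powr_le[of "\<phi> * t powr \<delta>" \<kappa>] by (intro mult_left_mono) auto
    also have "\<dots> = \<sigma>2 * (\<kappa> * \<phi>) * t powr \<delta>" by simp
    also have "\<dots> \<le> C * t powr \<delta>" using Cn unfolding C_def by (intro mult_right_mono) auto
    finally show "\<bar>F t - F 0\<bar> \<le> C * t powr \<delta>" .
    have "\<bar>F1 t\<bar> = \<sigma>2 * (\<kappa> * (\<phi> * \<delta>)) * t powr (\<delta> - 1) * (1 + \<phi> * t powr \<delta>) powr (- (\<kappa> + 1))"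
      using assms unfolding F1_def by (simp add: abs_mult mult_ac)
    also have "\<dots> \<le> \<sigma>2 * (\<kappa> * (\<phi> * \<delta>)) * t powr (\<delta> - 1) * 1"
      using assms le1[of "\<kappa> + 1" t] by (intro mult_left_mono) auto
    also have "\<dots> = C1 * t powr (\<delta> - 1)" by (simp add: C1_def)
    also have "\<dots> \<le> C * t powr (\<delta> - 1)" using Cn unfolding C_def by (intro mult_right_mono) auto
    finally show "\<bar>F1 t\<bar> \<le> C * t powr (\<delta> - 1)" .
    \<comment> \<open>Here \<open>t < 1\<close> matters: \<open>t powr (2 * \<delta> - 2)\<close> is
      absorbed into \<open>t powr (\<delta> - 2)\<close>.\<close>
    have p: "t powr (\<delta> - 1) * t powr (\<delta> - 1) \<le> t powr (\<delta> - 2)"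
      unfolding powr_add[symmetric] using t assms by (intro powr_mono') auto
    have "\<bar>F2 t\<bar> \<le> \<bar>\<sigma>2 * (- \<kappa> * ((- \<kappa> - 1) * (1 + \<phi> * t powr \<delta>) powr (- \<kappa> - 2) * (\<phi> * (\<delta> * t powr (\<delta> - 1)))) * (\<phi> * (\<delta> * t powr (\<delta> - 1))))\<bar>
       + \<bar>\<sigma>2 * (- \<kappa> * (1 + \<phi> * t powr \<delta>) powr (- \<kappa> - 1) * (\<phi> * (\<delta> * ((\<delta> - 1) * t powr (\<delta> - 2)))))\<bar>"
      unfolding F2_def distrib_left by (rule abs_triangle_ineq)
    also have "\<dots> = \<sigma>2 * (\<kappa> * (\<kappa> + 1) * (\<phi> * \<delta>) * (\<phi> * \<delta>)) * (t powr (\<delta> - 1) * t powr (\<delta> - 1)) * (1 + \<phi> * t powr \<delta>) powr (- (\<kappa> + 2))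
       + \<sigma>2 * (\<kappa> * (\<phi> * (\<delta> * \<bar>\<delta> - 1\<bar>))) * t powr (\<delta> - 2) * (1 + \<phi> * t powr \<delta>) powr (- (\<kappa> + 1))"
    proof -
      have "\<bar>- \<kappa> - 1\<bar> = \<kappa> + 1" using assms by simp
      then show ?thesis
        using assms by (simp only: abs_mult abs_minus_cancel) (simp add: mult_ac)
    qed
    also have "\<dots> \<le> \<sigma>2 * (\<kappa> * (\<kappa> + 1) * (\<phi> * \<delta>) * (\<phi> * \<delta>)) * t powr (\<delta> - 2) * 1
       + \<sigma>2 * (\<kappa> * (\<phi> * (\<delta> * \<bar>\<delta> - 1\<bar>))) * t powr (\<delta> - 2) * 1"
      using assms le1[of "\<kappa> + 1" t] le1[of "\<kappa> + 2" t] p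
      by (intro add_mono mult_mono) auto
    also have "\<dots> = C2 * t powr (\<delta> - 2)" by (simp add: C2_def algebra_simps)
    also have "\<dots> \<le> C * t powr (\<delta> - 2)" using Cn unfolding C_def by (intro mult_right_mono) auto
    finally show "\<bar>F2 t\<bar> \<le> C * t powr (\<delta> - 2)" .
  qed auto
  then show ?thesis by (simp add: F_def generalized_cauchy_def[abs_def])
qed

text \<open>\<open>small_remainder\<close> speaks about \<open>u \<noteq> 0\<close> only, so the
  value at the origin has to be supplied; \<open>r 0 = 0\<close> makes \<open>r u\<close> an
  increment from the origin.\<close>

lemma small_remainder_power_smooth:
  fixes r :: "'a::euclidean_space \<Rightarrow> real"
  assumes r: "small_remainder \<alpha> r" and r0: "r 0 = 0"
  shows "power_smooth \<alpha> r"
proof -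
  obtain R D where R: "0 < R" and D0: "\<And>u. 0 < norm u \<Longrightarrow> norm u < R \<Longrightarrow> D [] u = r u"
    and D1: "\<And>bs b u. bs \<in> lists Basis \<Longrightarrow> b \<in> Basis \<Longrightarrow> 0 < norm u \<Longrightarrow> norm u < R \<Longrightarrow>
           ((\<lambda>t. D bs (u + t *\<^sub>R b)) has_real_derivative D (b # bs) u) (at 0)"
    and D2: "\<And>bs. bs \<in> lists Basis \<Longrightarrow> D bs \<in> o[at 0](\<lambda>u. norm u powr (\<alpha> - real (length bs)))"
    using r unfolding small_remainder_def by blast
  have ev: "\<forall>\<^sub>F u in at 0. \<bar>D bs u\<bar> \<le> norm u powr (\<alpha> - real (length bs))" if "bs \<in> lists Basis" for bs
    using landau_o.smallD[OF D2[OF that], of 1] by simp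
  have "\<forall>\<^sub>F u in at 0. \<forall>e\<in>Basis. \<bar>D [e,e] u\<bar> \<le> norm u powr (\<alpha> - 2)"
    by (intro eventually_ball_finite ballI) (use ev[of "[_,_]"] in auto)
  then have "\<forall>\<^sub>F u in at 0. (\<forall>e\<in>Basis. \<bar>D [e,e] u\<bar> \<le> norm u powr (\<alpha> - 2)) \<and> \<bar>D [] u\<bar> \<le> norm u powr \<alpha>"
    using ev[of "[]"] by (auto elim: eventually_elim2)
  then obtain d where d: "0 < d" "\<And>u. u \<noteq> 0 \<Longrightarrow> norm u < d \<Longrightarrow>
      (\<forall>e\<in>Basis. \<bar>D [e,e] u\<bar> \<le> norm u powr (\<alpha> - 2)) \<and> \<bar>D [] u\<bar> \<le> norm u powr \<alpha>"
    unfolding eventually_at by (auto simp: dist_norm)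
  show ?thesis
    unfolding power_smooth_def
  proof (rule exI[of _ 1], rule exI[of _ "min d R"], rule exI[of _ "\<lambda>e. D [e]"], rule exI[of _ "\<lambda>e. D [e,e]"],
      intro conjI allI impI ballI)
    fix u :: 'a assume u: "0 < norm u \<and> norm u < min d R"
    show "\<bar>r u - r 0\<bar> \<le> 1 * norm u powr \<alpha>" using d(2)[of u] D0[of u] u r0 by simp
    fix e :: 'a assume e: "e \<in> Basis"
    show "((\<lambda>t. D [e] (u + t *\<^sub>R e)) has_real_derivative D [e, e] u) (at 0)"
      using D1[of "[e]" e u] u e by simp
    show "\<bar>D [e, e] u\<bar> \<le> 1 * norm u powr (\<alpha> - 2)" using d(2)[of u] u e by simp
    have "open ({t. norm (u + t *\<^sub>R e) < R} \<inter> {t. 0 < norm (u + t *\<^sub>R e)})"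
      by (intro open_Int open_Collect_less continuous_intros)
    from eventually_nhds_in_open[OF this, of 0]
    have "\<forall>\<^sub>F t in nhds 0. norm (u + t *\<^sub>R e) < R \<and> 0 < norm (u + t *\<^sub>R e)"
      using u by simp
    then have "\<forall>\<^sub>F t in nhds 0. D [] (u + t *\<^sub>R e) = r (u + t *\<^sub>R e)"
      by eventually_elim (simp add: D0)
    moreover have "((\<lambda>t. D [] (u + t *\<^sub>R e)) has_real_derivative D [e] u) (at 0)"
      using D1[of "[]" e u] u e by auto
    ultimately show "((\<lambda>t. r (u + t *\<^sub>R e)) has_real_derivative D [e] u) (at 0)"
      by (subst (asm) DERIV_cong_ev[OF refl _ refl, where g="\<lambda>t. r (u + t *\<^sub>R e)"]) auto
  qed (use d R in auto)
qed

text \<open>Evenness forces the first derivative to vanish at 0. It is therefore of order t and the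
  increment of order \<open>t\<^sup>2\<close>, which are the bounds of
  \<open>power_smooth_radial\<close> with exponent 2.\<close>

lemma even_analytic_power_smooth:
  fixes A :: "real \<Rightarrow> real"
  assumes L: "0 < L" and an: "real_analytic_on A {-L..L}" and ev: "\<And>t. t \<in> {-L..L} \<Longrightarrow> A (- t) = A t"
  shows "power_smooth 2 (\<lambda>u::'a::euclidean_space. A (norm u))"
proof -
  obtain a r where r: "0 < r" and s: "\<And>y. \<bar>y\<bar> < r \<Longrightarrow> (\<lambda>n. a n * y ^ n) sums A y"
    using an L unfolding real_analytic_on_def by (force dest: bspec[of _ _ 0])
  define A0 where "A0 x = (\<Sum>n. a n * x ^ n)" for x
  define A1 where "A1 x = (\<Sum>n. diffs a n * x ^ n)" for x
  define A2 where "A2 x = (\<Sum>n. diffs (diffs a) n * x ^ n)" for x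
  define A3 where "A3 x = (\<Sum>n. diffs (diffs (diffs a)) n * x ^ n)" for x
  have s0: "summable (\<lambda>n. a n * y ^ n)" if "norm y < r" for y using s[of y] that by (auto simp: sums_iff)
  have s1: "summable (\<lambda>n. diffs a n * y ^ n)" if "norm y < r" for y
    by (rule termdiff_converges[OF that s0])
  have s2: "summable (\<lambda>n. diffs (diffs a) n * y ^ n)" if "norm y < r" for y
    by (rule termdiff_converges[OF that s1])
  have eq: "A0 y = A y" if "\<bar>y\<bar> < r" for y using s[OF that] by (simp add: A0_def sums_iff)
  have d0: "(A0 has_real_derivative A1 x) (at x)" if "\<bar>x\<bar> < r" for x
    unfolding A0_def A1_def by (rule termdiffs_strong'[OF s0]) (use that in auto)
  have d1: "(A1 has_real_derivative A2 x) (at x)" if "\<bar>x\<bar> < r" for x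
    unfolding A1_def A2_def by (rule termdiffs_strong'[OF s1]) (use that in auto)
  have d2: "(A2 has_real_derivative A3 x) (at x)" if "\<bar>x\<bar> < r" for x
    unfolding A2_def A3_def by (rule termdiffs_strong'[OF s2]) (use that in auto)
  define \<rho> where "\<rho> = min L (r / 2)"
  have \<rho>: "0 < \<rho>" "\<rho> \<le> L" "\<rho> < r" using L r by (auto simp: \<rho>_def)
  have "continuous_on {0..\<rho>} A2"
  proof (rule continuous_at_imp_continuous_on, rule ballI)
    fix x assume "x \<in> {0..\<rho>}"
    then show "isCont A2 x" using \<rho> by (intro DERIV_isCont[OF d2]) auto
  qed
  then have "bounded (A2 ` {0..\<rho>})"
    by (intro compact_imp_bounded compact_continuous_image) auto
  then obtain K where K: "0 < K" "\<And>t. 0 \<le> t \<Longrightarrow> t \<le> \<rho> \<Longrightarrow> \<bar>A2 t\<bar> \<le> K"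
    unfolding bounded_pos by auto
  have "A1 0 = 0"
  proof -
    have "((\<lambda>x. A0 (- x)) has_real_derivative A1 0 * (- 1)) (at 0)"
      by (rule DERIV_chain2[of A0]) (use d0[of 0] r in \<open>auto intro!: derivative_eq_intros\<close>)
    moreover have "\<forall>\<^sub>F x in nhds 0. x \<in> {- \<rho><..<\<rho>}"
      by (rule eventually_nhds_in_open) (use \<rho> in auto)
    then have "\<forall>\<^sub>F x in nhds 0. A0 (- x) = A0 x"
      by eventually_elim (use \<rho> ev eq in auto)
    ultimately have "(A0 has_real_derivative A1 0 * (- 1)) (at 0)"
      by (subst (asm) DERIV_cong_ev[OF refl _ refl, where g=A0]) auto
    from DERIV_unique[OF this d0[of 0]] r show ?thesis by simp
  qed
  have b1: "\<bar>A1 t\<bar> \<le> K * t" if "0 < t" "t \<le> \<rho>" for t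
  proof -
    have dd: "(A1 has_real_derivative A2 x) (at x)" if "0 \<le> x" "x \<le> t" for x
      using \<open>t \<le> \<rho>\<close> that \<rho> by (intro d1) auto
    obtain z where z: "0 < z" "z < t" "A1 t - A1 0 = (t - 0) * A2 z"
      using MVT2[OF \<open>0 < t\<close> dd] by blast
    then show ?thesis using K(2)[of z] that \<open>A1 0 = 0\<close> by (simp add: abs_mult mult.commute)
  qed
  have b0: "\<bar>A0 t - A0 0\<bar> \<le> K * t\<^sup>2" if "0 < t" "t \<le> \<rho>" for t
  proof -
    have dd: "(A0 has_real_derivative A1 x) (at x)" if "0 \<le> x" "x \<le> t" for x
      using \<open>t \<le> \<rho>\<close> that \<rho> by (intro d0) auto
    obtain z where z: "0 < z" "z < t" "A0 t - A0 0 = (t - 0) * A1 z"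
      using MVT2[OF \<open>0 < t\<close> dd] by blast
    have "\<bar>A1 z\<bar> \<le> K * t" using b1[of z] z that K(1) by (smt (verit) mult_left_mono)
    then have "t * \<bar>A1 z\<bar> \<le> t * (K * t)" using that by (intro mult_left_mono) auto
    then show ?thesis using z that by (simp add: abs_mult power2_eq_square mult_ac)
  qed
  have "power_smooth 2 (\<lambda>u::'a. A0 (norm u))"
  proof (rule power_smooth_radial[of \<rho> K A0 A1 A2])
    fix t :: real assume t: "0 < t" "t < \<rho>"
    show "(A0 has_real_derivative A1 t) (at t)" "(A1 has_real_derivative A2 t) (at t)"
      using t \<rho> by (auto intro!: d0 d1)
    show "\<bar>A0 t - A0 0\<bar> \<le> K * t powr 2" using b0[of t] t by simp
    show "\<bar>A1 t\<bar> \<le> K * t powr (2 - 1)" using b1[of t] t by simp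
    show "\<bar>A2 t\<bar> \<le> K * t powr (2 - 2)" using K(2)[of t] t by simp
  qed (use \<rho> K in auto)
  then show ?thesis
    by (rule power_smooth_cong[OF _ r]) (simp add: eq)
qed

text \<open>The analytic part has exponent 2 and \<open>B\<close> has exponent \<alpha>, whence the
  minimum. The expansion controls \<open>B\<close> on the right of 0; continuity then gives
  \<open>B 0 = 0\<close>, so that \<open>B\<close> is its own increment. The second statement
  records evenness and continuity for use with the cross-covariance.\<close>

lemma smooth_1d_power_smooth:
  fixes K :: "real \<Rightarrow> real"
  assumes "smooth_1d \<alpha> K"
  shows "power_smooth (min \<alpha> 2) (\<lambda>u::'a::euclidean_space. K (norm u))"
    and "\<exists>L>0. continuous_on {-L..L} K \<and> (\<forall>t\<in>{-L..L}. K (- t) = K t)"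
proof -
  have \<alpha>: "0 < \<alpha>" using assms unfolding smooth_1d_def by (elim conjE)
  from assms[unfolded smooth_1d_def] obtain L A B c D where L: "0 < L"
    and K': "\<forall>t\<in>{-L..L}. K t = A t + B t" and A': "\<forall>t\<in>{-L..L}. A (- t) = A t"
    and A2: "real_analytic_on A {-L..L}" and B': "\<forall>t\<in>{-L..L}. B (- t) = B t"
    and B2: "continuous_on {-L..L} B" and D0': "\<forall>t\<in>{0<..L}. D 0 t = B t"
    and D': "\<forall>k. \<forall>t\<in>{0<..L}. (D k has_real_derivative D (Suc k) t) (at t within {0<..L})"
    and o': "\<forall>k. (\<lambda>t. D k t - falling \<alpha> k * c * t powr (\<alpha> - real k)) \<in> o[at_right 0](\<lambda>t. t powr (\<alpha> - real k))"
    by (elim conjE exE) (rule that; assumption)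
  note K = bspec[OF K'] and A = bspec[OF A'] A2 and B = bspec[OF B'] B2
    and D0 = bspec[OF D0'] and D = bspec[OF spec[OF D']] and o = spec[OF o']
  have contA: "continuous_on {-L..L} A"
    unfolding continuous_on_eq_continuous_within
  proof
    fix t assume t: "t \<in> {-L..L}"
    obtain a r where r: "0 < r" and s: "\<And>y. \<bar>y - t\<bar> < r \<Longrightarrow> (\<lambda>n. a n * (y - t) ^ n) sums A y"
      using A(2) t unfolding real_analytic_on_def by blast
    have "isCont (\<lambda>x. \<Sum>n. a n * x ^ n) 0"
      by (rule DERIV_isCont[OF termdiffs_strong'[of r]]) (use s[of "t + _"] r in \<open>auto simp: sums_iff\<close>)
    then have "isCont (\<lambda>y. (\<Sum>n. a n * (y - t) ^ n)) t"
      using isCont_o2[where f="\<lambda>y. y - t" and g="\<lambda>x. \<Sum>n. a n * x ^ n" and a=t] by simp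
    moreover have "\<forall>\<^sub>F y in nhds t. y \<in> ball t r" by (rule eventually_nhds_in_open) (use r in auto)
    then have "\<forall>\<^sub>F y in nhds t. (\<Sum>n. a n * (y - t) ^ n) = A y"
      by eventually_elim (use s in \<open>auto simp: sums_iff dist_real_def abs_minus_commute\<close>)
    from isCont_cong[OF this] have "isCont (\<lambda>y. (\<Sum>n. a n * (y - t) ^ n)) t = isCont A t" .
    ultimately have "isCont A t" by simp
    then show "continuous (at t within {-L..L}) A" by (rule continuous_at_imp_continuous_at_within)
  qed
  have "continuous_on {-L..L} (\<lambda>t. A t + B t)" using contA B(2) by (intro continuous_intros)
  then have "continuous_on {-L..L} K" by (rule continuous_on_eq) (use K in auto)
  then show "\<exists>L>0. continuous_on {-L..L} K \<and> (\<forall>t\<in>{-L..L}. K (- t) = K t)"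
    using L K A B by (intro exI[of _ L]) auto
  \<comment> \<open>The little-o term is eventually at most
    \<open>1 * t powr (\<alpha> - real k)\<close>, hence the summand 1.\<close>
  define M where "M k = \<bar>falling \<alpha> k * c\<bar> + 1" for k
  have bk: "\<forall>\<^sub>F t in at_right 0. \<bar>D k t\<bar> \<le> M k * t powr (\<alpha> - real k)" for k
    using landau_o.smallD[OF o[of k] zero_less_one] eventually_at_right_less[of 0]
  proof (eventually_elim)
    case (elim t)
    have "\<bar>D k t\<bar> \<le> \<bar>D k t - falling \<alpha> k * c * t powr (\<alpha> - real k)\<bar> + \<bar>falling \<alpha> k * c * t powr (\<alpha> - real k)\<bar>"
      by linarith
    also have "\<dots> \<le> 1 * t powr (\<alpha> - real k) + \<bar>falling \<alpha> k * c\<bar> * t powr (\<alpha> - real k)"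
      using elim by (simp add: abs_mult)
    finally show ?case by (simp add: M_def algebra_simps)
  qed
  have "\<forall>\<^sub>F t in at_right 0. \<bar>D 0 t\<bar> \<le> M 0 * t powr (\<alpha> - real 0) \<and> \<bar>D 1 t\<bar> \<le> M 1 * t powr (\<alpha> - real 1)
     \<and> \<bar>D 2 t\<bar> \<le> M 2 * t powr (\<alpha> - real 2)"
    by (intro eventually_conj bk)
  then obtain b where b: "0 < b" "\<And>t. 0 < t \<Longrightarrow> t < b \<Longrightarrow> \<bar>D 0 t\<bar> \<le> M 0 * t powr \<alpha> \<and> \<bar>D 1 t\<bar> \<le> M 1 * t powr (\<alpha> - 1)
     \<and> \<bar>D 2 t\<bar> \<le> M 2 * t powr (\<alpha> - 2)"
    unfolding eventually_at_right_field by auto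
  have "B 0 = 0"
  proof -
    have "continuous (at 0 within {-L..L}) B" using B(2) L by (simp add: continuous_on_eq_continuous_within)
    then have "(B \<longlongrightarrow> B 0) (at 0 within {-L..L})" by (simp add: continuous_within)
    moreover have "at 0 within {-L..L} = at (0::real)" using L by (intro at_within_interior) auto
    ultimately have "(B \<longlongrightarrow> B 0) (at_right 0)"
      by (simp add: filterlim_at_split)
    moreover have "(B \<longlongrightarrow> 0) (at_right 0)"
    proof (rule Lim_null_comparison)
      show "((\<lambda>t. M 0 * t powr \<alpha>) \<longlongrightarrow> 0) (at_right 0)"
      proof -
        have "((\<lambda>t::real. t powr \<alpha>) \<longlongrightarrow> 0 powr \<alpha>) (at_right 0)"
          by (rule tendsto_powr2) (use \<alpha> in \<open>auto simp: eventually_at_right_field intro!: exI[of _ 1] tendsto_ident_at\<close>)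
        then show ?thesis using tendsto_mult_right_zero[of "\<lambda>t. t powr \<alpha>"] by simp
      qed
      show "\<forall>\<^sub>F t in at_right 0. norm (B t) \<le> M 0 * t powr \<alpha>"
        unfolding eventually_at_right_field using b L D0 by (intro exI[of _ "min b L"]) force
    qed
    ultimately show ?thesis by (intro tendsto_unique[of "at_right 0" B]) auto
  qed
  define \<rho> where "\<rho> = min b L"
  define F where "F t = (if t = 0 then 0 else D 0 t)" for t
  have Mp: "0 < M k" for k by (simp add: M_def)
  have at: "(D k has_real_derivative D (Suc k) t) (at t)" if "0 < t" "t < \<rho>" for k t
  proof -
    have "at t within {0<..L} = at t" using that by (intro at_within_interior interiorI[of "{0<..<L}"]) (auto simp: \<rho>_def)
    then show ?thesis using D[of t k] that by (simp add: \<rho>_def)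
  qed
  have "power_smooth \<alpha> (\<lambda>u::'a. F (norm u))"
  proof (rule power_smooth_radial[of \<rho> "M 0 + M 1 + M 2" F "D 1" "D 2"])
    fix t assume t: "0 < t" "t < \<rho>"
    have "\<forall>\<^sub>F s in nhds t. s \<in> {0<..}" by (rule eventually_nhds_in_open) (use t in auto)
    then have "\<forall>\<^sub>F s in nhds t. D 0 s = F s" by eventually_elim (auto simp: F_def)
    with at[OF t, of 0] show "(F has_real_derivative D 1 t) (at t)"
      by (subst (asm) DERIV_cong_ev[OF refl _ refl, where g=F]) auto
    show "(D 1 has_real_derivative D 2 t) (at t)" using at[OF t, of 1] by (simp add: numeral_2_eq_2)
    have m: "M k * t powr x \<le> (M 0 + M 1 + M 2) * t powr x" if "k = 0 \<or> k = 1 \<or> k = 2" for k x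
      using that Mp[of 0] Mp[of 1] Mp[of 2] by (intro mult_right_mono) auto
    have "\<bar>F t - F 0\<bar> \<le> M 0 * t powr \<alpha>" using b(2)[of t] t by (simp add: F_def \<rho>_def)
    from order_trans[OF this m] show "\<bar>F t - F 0\<bar> \<le> (M 0 + M 1 + M 2) * t powr \<alpha>" by blast
    have "\<bar>D 1 t\<bar> \<le> M 1 * t powr (\<alpha> - 1)" using b(2)[of t] t unfolding \<rho>_def by simp
    from order_trans[OF this m] show "\<bar>D 1 t\<bar> \<le> (M 0 + M 1 + M 2) * t powr (\<alpha> - 1)" by blast
    have "\<bar>D 2 t\<bar> \<le> M 2 * t powr (\<alpha> - 2)" using b(2)[of t] t unfolding \<rho>_def by simp
    from order_trans[OF this m] show "\<bar>D 2 t\<bar> \<le> (M 0 + M 1 + M 2) * t powr (\<alpha> - 2)" by blast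
  qed (use Mp[of 0] Mp[of 1] Mp[of 2] b L in \<open>auto simp: \<rho>_def\<close>)
  then have BB: "power_smooth (min \<alpha> 2) (\<lambda>u::'a. F (norm u))" by (rule power_smooth_mono) simp
  have "power_smooth 2 (\<lambda>u::'a. A (norm u))" by (rule even_analytic_power_smooth[OF L A(2,1)])
  then have "power_smooth (min \<alpha> 2) (\<lambda>u::'a. A (norm u))" by (rule power_smooth_mono) simp
  from power_smooth_add[OF this BB]
  show "power_smooth (min \<alpha> 2) (\<lambda>u::'a. K (norm u))"
  proof (rule power_smooth_cong[OF _ L])
    fix u :: 'a assume u: "norm u < L"
    have "K (norm u) = A (norm u) + B (norm u)" using u L by (intro K) (auto intro: order_trans[OF _ norm_ge_zero])
    moreover have "F (norm u) = B (norm u)" using u D0[of "norm u"] \<open>B 0 = 0\<close> by (auto simp: F_def)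
    ultimately show "K (norm u) = A (norm u) + F (norm u)" by simp
  qed
qed

section \<open>Difference stencils: first differences and discrete Laplacians\<close>

text \<open>What consistency requires of a stencil. By \<open>cov_bound\<close> its covariance
  function is controlled by second differences at finitely many shifted points, which gives decay in
  the lag. By \<open>variogram_neg\<close> the power variogram is strictly negative on the weights,
  which gives a lower bound of order \<open>h powr \<delta>\<close> for the variance.\<close>

locale difference_stencil =
  fixes V :: "'a::euclidean_space set" and w :: "'a \<Rightarrow> real" and V' :: "'a set" and K :: real
  assumes finite_V: "finite V" and sum_w: "sum w V = 0" and finite_V': "finite V'" and K_nonneg: "0 \<le> K"
    and cov_bound: "\<And>g h u \<beta>. (\<And>e v. e \<in> Basis \<Longrightarrow> v \<in> V' \<Longrightarrow> \<bar>second_difference h e g (u + h *\<^sub>R v)\<bar> \<le> \<beta>)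
       \<Longrightarrow> \<bar>stencil_cov V w h g u\<bar> \<le> K * \<beta>"
    and variogram_neg: "\<And>\<delta>. 0 < \<delta> \<Longrightarrow> \<delta> < 2 \<Longrightarrow>
       (\<Sum>v\<in>V. \<Sum>v'\<in>V. w v * w v' * norm (v - v') powr \<delta>) < 0"
begin

text \<open>Shifting the lag by \<open>h\<close> times a vector of norm at most \<open>R\<close>
  changes \<open>1 + norm u / h\<close> by a factor of at most \<open>1 + R\<close>, so the bound
  for second differences survives with another constant.\<close>

lemma stencil_cov_bound:
  assumes g: "power_smooth \<delta> g" and \<delta>: "0 < \<delta>" "\<delta> \<le> 2"
  shows "\<exists>C>0. \<exists>\<rho>>0. \<forall>h u. 0 < h \<and> h < \<rho> \<and> norm u < \<rho> \<longrightarrow>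
    \<bar>stencil_cov V w h g u\<bar> \<le> C * h powr \<delta> * (1 + norm u / h) powr (\<delta> - 2)"
proof -
  obtain C \<rho> where C: "0 < C" "0 < \<rho>"
    and b: "\<And>h u e. e \<in> Basis \<Longrightarrow> 0 < h \<Longrightarrow> norm u + h < \<rho> \<Longrightarrow>
     \<bar>second_difference h e g u\<bar> \<le> C * h powr \<delta> * (1 + norm u / h) powr (\<delta> - 2)"
    using power_smooth_second_difference[OF g \<delta>] by blast
  define R where "R = (\<Sum>v\<in>V'. norm v)"
  have R: "norm v \<le> R" if "v \<in> V'" for v
    unfolding R_def using finite_V' that by (intro member_le_sum) auto
  have R0: "0 \<le> R" unfolding R_def by (intro sum_nonneg) auto
  \<comment> \<open>The radius is divided by \<open>R + 2\<close> because the shifted lag plus one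
    spacing is bounded by \<open>\<rho>' + R * \<rho>' + \<rho>'\<close>.\<close>
  define \<rho>' where "\<rho>' = \<rho> / (R + 2)"
  have \<rho>': "0 < \<rho>'" using C R0 by (simp add: \<rho>'_def)
  have "\<bar>stencil_cov V w h g u\<bar> \<le> (K * C * (1 + R) powr (2 - \<delta>) + 1) * h powr \<delta> * (1 + norm u / h) powr (\<delta> - 2)"
    if h: "0 < h" "h < \<rho>'" and u: "norm u < \<rho>'" for h u
  proof -
    have "\<bar>stencil_cov V w h g u\<bar> \<le> K * (C * h powr \<delta> * ((1 + R) powr (2 - \<delta>) * (1 + norm u / h) powr (\<delta> - 2)))"
    proof (rule cov_bound)
      fix e v assume e: "e \<in> (Basis::'a set)" and v: "v \<in> V'"
      have nv: "norm (h *\<^sub>R v) \<le> h * R" using h R[OF v] by simp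
      have "norm (u + h *\<^sub>R v) + h \<le> norm u + h * R + h"
        using norm_triangle_ineq[of u "h *\<^sub>R v"] nv by linarith
      also have "\<dots> < \<rho>' + \<rho>' * R + \<rho>'"
        using u h R0 mult_right_mono[of h \<rho>' R] by linarith
      also have "\<dots> = \<rho>' * (R + 2)" by (simp add: algebra_simps)
      also have "\<dots> = \<rho>" using R0 by (simp add: \<rho>'_def)
      finally have "\<bar>second_difference h e g (u + h *\<^sub>R v)\<bar>
          \<le> C * h powr \<delta> * (1 + norm (u + h *\<^sub>R v) / h) powr (\<delta> - 2)"
        using b[OF e h(1)] by simp
      also have "C * h powr \<delta> * (1 + norm (u + h *\<^sub>R v) / h) powr (\<delta> - 2)
          \<le> C * h powr \<delta> * ((1 + norm u / h) / (1 + R)) powr (\<delta> - 2)"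
      proof (intro mult_left_mono powr_mono2')
        show "0 \<le> C * h powr \<delta>" using C by simp
        show "\<delta> - 2 \<le> 0" using \<delta> by simp
        show "0 < (1 + norm u / h) / (1 + R)" using h R0 by (simp add: add_pos_nonneg)
        have "norm u \<le> norm (u + h *\<^sub>R v) + h * R"
          using norm_diff_triangle_le[of u "u + h *\<^sub>R v" "norm (h *\<^sub>R v)" 0 "norm (u + h *\<^sub>R v)"]
            norm_triangle_ineq4[of "u + h *\<^sub>R v" "h *\<^sub>R v"] nv by simp
        then have "norm u / h \<le> (norm (u + h *\<^sub>R v) + h * R) / h" using h by (intro divide_right_mono) auto
        also have "\<dots> = norm (u + h *\<^sub>R v) / h + R" using h by (simp add: add_divide_distrib)
        finally have "1 + norm u / h \<le> (1 + norm (u + h *\<^sub>R v) / h) + R" by simp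
        also have "\<dots> \<le> (1 + norm (u + h *\<^sub>R v) / h) + R * (1 + norm (u + h *\<^sub>R v) / h)"
          using R0 h by (intro add_left_mono) (simp add: mult_le_cancel_left1)
        also have "\<dots> = (1 + norm (u + h *\<^sub>R v) / h) * (1 + R)"
        proof -
          have "(1 + x) + R * (1 + x) = (1 + x) * (1 + R)" for x by (simp add: algebra_simps)
          then show ?thesis .
        qed
        finally show "(1 + norm u / h) / (1 + R) \<le> 1 + norm (u + h *\<^sub>R v) / h"
          using R0 by (simp add: pos_divide_le_eq)
      qed
      also have "((1 + norm u / h) / (1 + R)) powr (\<delta> - 2) = (1 + R) powr (2 - \<delta>) * (1 + norm u / h) powr (\<delta> - 2)"
        using powr_minus[of "1 + R" "2 - \<delta>"] R0 by (simp add: powr_divide field_simps)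
      finally show "\<bar>second_difference h e g (u + h *\<^sub>R v)\<bar>
         \<le> C * h powr \<delta> * ((1 + R) powr (2 - \<delta>) * (1 + norm u / h) powr (\<delta> - 2))" .
    qed
    also have "\<dots> = K * C * (1 + R) powr (2 - \<delta>) * (h powr \<delta> * (1 + norm u / h) powr (\<delta> - 2))" by simp
    also have "\<dots> \<le> (K * C * (1 + R) powr (2 - \<delta>) + 1) * (h powr \<delta> * (1 + norm u / h) powr (\<delta> - 2))"
      by (intro mult_right_mono) auto
    finally show ?thesis by (simp add: mult.assoc)
  qed
  moreover have "0 < K * C * (1 + R) powr (2 - \<delta>) + 1"
    using K_nonneg C by (simp add: add_nonneg_pos)
  ultimately show ?thesis using \<rho>' by blast
qed

text \<open>As the weights sum to zero, the variance \<sigma>2 may be subtracted from the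
  covariance. The rest, divided by \<open>h powr \<delta>\<close>, tends to a negative multiple of
  \<open>norm x powr \<delta>\<close>, so the variance of the stencil divided by
  \<open>h powr \<delta>\<close> tends to a number \<open>\<gamma>\<close> that is positive by
  \<open>variogram_neg\<close>. Half of it serves as the constant.\<close>

lemma stencil_cov_0_lower:
  assumes "0 < \<sigma>2" "0 < \<phi>" "0 < \<delta>" "\<delta> < 2" "0 < \<kappa>"
  shows "\<exists>c>0. \<exists>\<rho>>0. \<forall>h. 0 < h \<and> h < \<rho> \<longrightarrow>
     c * h powr \<delta> \<le> stencil_cov V w h (generalized_cauchy \<sigma>2 \<phi> \<delta> \<kappa>) 0"
proof -
  let ?C = "generalized_cauchy \<sigma>2 \<phi> \<delta> \<kappa> :: 'a \<Rightarrow> real"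
  have pw0: "((\<lambda>h::real. h powr \<delta>) \<longlongrightarrow> 0) (at_right 0)"
  proof -
    have "((\<lambda>h::real. h powr \<delta>) \<longlongrightarrow> 0 powr \<delta>) (at_right 0)"
      by (rule tendsto_powr2) (use assms in \<open>auto simp: eventually_at_right_field intro!: exI[of _ 1] tendsto_ident_at\<close>)
    then show ?thesis by simp
  qed
  have lim: "((\<lambda>h. (?C (h *\<^sub>R x) - \<sigma>2) / h powr \<delta>) \<longlongrightarrow> - (\<sigma>2 * \<kappa> * \<phi>) * norm x powr \<delta>) (at_right 0)" for x :: 'a
  proof (cases "x = 0")
    case True
    then show ?thesis using assms by (simp add: generalized_cauchy_0)
  next
    case False
    define y where "y h = \<phi> * norm x powr \<delta> * h powr \<delta>" for h
    have "((\<lambda>y. (1 + y) powr (- \<kappa>)) has_real_derivative - \<kappa> * (1 + 0) powr (- \<kappa> - 1) * 1) (at 0)"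
      by (rule DERIV_chain2[where f="\<lambda>x. x powr (- \<kappa>)", OF has_real_derivative_powr]) (auto intro!: derivative_eq_intros)
    then have d: "((\<lambda>y. ((1 + y) powr (- \<kappa>) - 1) / y) \<longlongrightarrow> - \<kappa>) (at 0)"
      by (simp add: has_field_derivative_iff)
    have "filterlim y (at 0) (at_right 0)"
      unfolding filterlim_at
    proof
      show "(y \<longlongrightarrow> 0) (at_right 0)"
        unfolding y_def using tendsto_mult_right_zero[OF pw0] by simp
      show "\<forall>\<^sub>F h in at_right 0. y h \<in> UNIV \<and> y h \<noteq> 0"
        using eventually_at_right_less[of 0] by eventually_elim (use assms False in \<open>auto simp: y_def\<close>)
    qed
    from filterlim_compose[OF d this]
    have "((\<lambda>h. \<sigma>2 * (\<phi> * norm x powr \<delta>) * (((1 + y h) powr (- \<kappa>) - 1) / y h)) \<longlongrightarrow> \<sigma>2 * (\<phi> * norm x powr \<delta>) * (- \<kappa>)) (at_right 0)"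
      by (intro tendsto_mult tendsto_const)
    moreover have "\<forall>\<^sub>F h in at_right 0. \<sigma>2 * (\<phi> * norm x powr \<delta>) * (((1 + y h) powr (- \<kappa>) - 1) / y h) = (?C (h *\<^sub>R x) - \<sigma>2) / h powr \<delta>"
      using eventually_at_right_less[of 0]
    proof eventually_elim
      case (elim h)
      have "\<phi> * norm (h *\<^sub>R x) powr \<delta> = y h" using elim by (simp add: y_def powr_mult mult_ac)
      then show ?case using elim assms False
        by (simp add: generalized_cauchy_def y_def field_simps)
    qed
    ultimately show ?thesis by (subst (asm) filterlim_cong[OF refl refl]) (auto simp: mult_ac)
  qed
  define \<gamma> where "\<gamma> = (\<Sum>v\<in>V. \<Sum>v'\<in>V. w v * w v' * (- (\<sigma>2 * \<kappa> * \<phi>) * norm (v - v') powr \<delta>))"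
  have "\<gamma> = - (\<sigma>2 * \<kappa> * \<phi>) * (\<Sum>v\<in>V. \<Sum>v'\<in>V. w v * w v' * norm (v - v') powr \<delta>)"
    unfolding \<gamma>_def sum_distrib_left by (simp add: mult_ac)
  then have \<gamma>: "0 < \<gamma>" using variogram_neg[of \<delta>] assms by (simp add: mult_pos_neg)
  have "((\<lambda>h. \<Sum>v\<in>V. \<Sum>v'\<in>V. w v * w v' * ((?C (h *\<^sub>R (v - v')) - \<sigma>2) / h powr \<delta>)) \<longlongrightarrow> \<gamma>) (at_right 0)"
    unfolding \<gamma>_def by (intro tendsto_sum tendsto_mult tendsto_const lim)
  from order_tendstoD(1)[OF this, of "\<gamma> / 2"] \<gamma> obtain \<rho> where \<rho>: "0 < \<rho>"
    "\<And>h. 0 < h \<Longrightarrow> h < \<rho> \<Longrightarrow> \<gamma> / 2 < (\<Sum>v\<in>V. \<Sum>v'\<in>V. w v * w v' * ((?C (h *\<^sub>R (v - v')) - \<sigma>2) / h powr \<delta>))"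
    unfolding eventually_at_right_field by auto
  have "\<gamma> / 2 * h powr \<delta> \<le> stencil_cov V w h ?C 0" if h: "0 < h" "h < \<rho>" for h
  proof -
    have "(\<Sum>v\<in>V. \<Sum>v'\<in>V. w v * w v' * ((?C (h *\<^sub>R (v - v')) - \<sigma>2) / h powr \<delta>))
       = ((\<Sum>v\<in>V. \<Sum>v'\<in>V. w v * w v' * ?C (h *\<^sub>R (v - v'))) - (\<Sum>v\<in>V. \<Sum>v'\<in>V. w v * w v' * \<sigma>2)) / h powr \<delta>"
      by (simp add: sum_divide_distrib sum_subtractf diff_divide_distrib right_diff_distrib)
    also have "(\<Sum>v\<in>V. \<Sum>v'\<in>V. w v * w v' * \<sigma>2) = sum w V * sum w V * \<sigma>2"
      by (subst sum_product) (simp only: sum_distrib_right)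
    also have "(\<Sum>v\<in>V. \<Sum>v'\<in>V. w v * w v' * ?C (h *\<^sub>R (v - v'))) = stencil_cov V w h ?C 0"
      by (simp add: stencil_cov_def scaleR_diff_right)
    also have "(stencil_cov V w h ?C 0 - sum w V * sum w V * \<sigma>2) / h powr \<delta> = stencil_cov V w h ?C 0 / h powr \<delta>"
      by (simp add: sum_w)
    finally have "\<gamma> / 2 < stencil_cov V w h ?C 0 / h powr \<delta>" using \<rho>(2)[OF h] by simp
    then show ?thesis using h by (simp add: pos_less_divide_eq)
  qed
  then show ?thesis using \<gamma> \<rho>(1) by (intro exI[of _ "\<gamma> / 2"] conjI exI[of _ \<rho>]) auto
qed

end

definition first_difference_weight :: "'a::euclidean_space \<Rightarrow> real" where
  "first_difference_weight v = (if v = 0 then - 1 else 1)"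

definition laplacian_points :: "'a::euclidean_space set" where
  "laplacian_points = insert 0 (Basis \<union> uminus ` Basis)"

definition laplacian_weight :: "'a::euclidean_space \<Rightarrow> real" where
  "laplacian_weight v = (if v = 0 then - 2 * real DIM('a) else 1)"

lemma first_difference_stencil:
  fixes e :: "'a::euclidean_space"
  assumes e: "e \<in> Basis"
  shows "stencil {0, e} first_difference_weight h Z s = first_difference h e Z s"
  using e nonzero_Basis[OF e] by (simp add: stencil_def first_difference_weight_def first_difference_def)

lemma sum_laplacian:
  "(\<Sum>v\<in>laplacian_points. laplacian_weight v * f v) = (\<Sum>e\<in>(Basis::'a::euclidean_space set). f e + f (- e) - 2 * f 0)"
proof -
  have disj: "(Basis :: 'a set) \<inter> uminus ` Basis = {}"
  proof -
    have False if "e \<in> (Basis :: 'a set)" "- e \<in> Basis" for e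
    proof -
      have "e \<bullet> (- e) = (if e = - e then 1 else 0)" using that by (rule inner_Basis)
      moreover have "e \<bullet> e = 1" using that by (simp add: inner_Basis)
      ultimately show False by (auto split: if_splits)
    qed
    then show ?thesis by force
  qed
  have z: "0 \<notin> (Basis :: 'a set) \<union> uminus ` Basis" by (auto simp: nonzero_Basis)
  have nz: "v \<noteq> 0" if "v \<in> (Basis :: 'a set) \<union> uminus ` Basis" for v using that z by blast
  have "(\<Sum>v\<in>laplacian_points. laplacian_weight v * f v)
     = - 2 * real DIM('a) * f 0 + (\<Sum>v\<in>Basis \<union> uminus ` (Basis :: 'a set). laplacian_weight v * f v)"
    unfolding laplacian_points_def using z by (subst sum.insert) (auto simp: laplacian_weight_def)
  also have "(\<Sum>v\<in>Basis \<union> uminus ` (Basis :: 'a set). laplacian_weight v * f v) = (\<Sum>v\<in>Basis \<union> uminus ` (Basis :: 'a set). f v)"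
    by (intro sum.cong refl) (use nz in \<open>auto simp: laplacian_weight_def\<close>)
  also have "\<dots> = (\<Sum>v\<in>Basis. f v) + (\<Sum>v\<in>Basis. f (- v))"
    using disj by (subst sum.union_disjoint) (auto simp: sum.reindex inj_on_def)
  finally show ?thesis by (simp add: sum.distrib sum_subtractf)
qed

lemma laplacian_stencil:
  "stencil laplacian_points laplacian_weight h Z s = h\<^sup>2 * discrete_laplacian h Z s" if "h \<noteq> 0"
  using that unfolding stencil_def discrete_laplacian_def sum_laplacian[of "\<lambda>v. Z (s + h *\<^sub>R v)"] by simp

lemma difference_stencil_first_difference:
  fixes e :: "'a::euclidean_space"
  assumes e: "e \<in> Basis"
  shows "difference_stencil {0, e} first_difference_weight {0} 1"
proof
  have e0: "e \<noteq> 0" "0 \<noteq> e" using e nonzero_Basis by auto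
  show "sum first_difference_weight {0, e} = 0" using e0 by (simp add: first_difference_weight_def)
  fix g h u \<beta>
  assume b: "\<And>e v. e \<in> (Basis::'a set) \<Longrightarrow> v \<in> {0} \<Longrightarrow> \<bar>second_difference h e g (u + h *\<^sub>R v)\<bar> \<le> \<beta>"
  have "stencil_cov {0, e} first_difference_weight h g u = - second_difference h e g u"
    using e0 by (simp add: stencil_cov_def first_difference_weight_def second_difference_def)
  then show "\<bar>stencil_cov {0, e} first_difference_weight h g u\<bar> \<le> 1 * \<beta>" using b[OF e, of 0] by simp
next
  fix \<delta> :: real
  have e0: "e \<noteq> 0" "0 \<noteq> e" using e nonzero_Basis by auto
  assume "0 < \<delta>" "\<delta> < 2"
  then show "(\<Sum>v\<in>{0,e}. \<Sum>v'\<in>{0,e}. first_difference_weight v * first_difference_weight v' * norm (v - v') powr \<delta>) < 0"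
    using e0 e by (simp add: first_difference_weight_def)
qed auto

text \<open>Expanding one of the two sums by \<open>sum_laplacian\<close> leaves second differences
  at \<open>u - h *\<^sub>R v\<close>, which explains the negated point set. For the sign, let
  \<open>\<Phi>\<close> be the Laplacian of \<open>N\<close>. The form is the sum of
  \<open>\<Phi> e + \<Phi> (- e) - 2 * \<Phi> 0\<close>, and \<open>\<Phi> e\<close> is less than
  \<open>\<Phi> 0\<close>, twice the dimension, because \<open>2 powr \<delta> < 4\<close> on the
  diagonal and \<open>2 * sqrt 2 powr \<delta> < 4\<close> off it.\<close>

lemma difference_stencil_laplacian:
  "difference_stencil (laplacian_points :: 'a::euclidean_space set) laplacian_weight (uminus ` laplacian_points)
    (\<Sum>v\<in>(laplacian_points::'a set). \<bar>laplacian_weight v\<bar> * real DIM('a))"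
proof
  show "finite (laplacian_points :: 'a set)" "finite (uminus ` laplacian_points :: 'a set)"
    by (auto simp: laplacian_points_def)
  show "sum laplacian_weight (laplacian_points :: 'a set) = 0"
    using sum_laplacian[of "\<lambda>v::'a. 1"] by simp
  show "0 \<le> (\<Sum>v\<in>(laplacian_points::'a set). \<bar>laplacian_weight v\<bar> * real DIM('a))"
    by (intro sum_nonneg) auto
  fix g :: "'a \<Rightarrow> real" and h u \<beta>
  assume b: "\<And>e v. e \<in> Basis \<Longrightarrow> v \<in> uminus ` laplacian_points \<Longrightarrow> \<bar>second_difference h e g (u + h *\<^sub>R v)\<bar> \<le> \<beta>"
  have b': "\<bar>second_difference h e g (u - h *\<^sub>R v)\<bar> \<le> \<beta>" if "e \<in> Basis" "v \<in> laplacian_points" for e v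
    using b[of e "- v"] that by simp
  have "stencil_cov laplacian_points laplacian_weight h g u
     = (\<Sum>v\<in>laplacian_points. \<Sum>v'\<in>laplacian_points. laplacian_weight v' * (laplacian_weight v * g (u + h *\<^sub>R v' - h *\<^sub>R v)))"
    unfolding stencil_cov_def by (subst sum.swap) (simp add: mult_ac)
  also have "\<dots> = (\<Sum>v\<in>laplacian_points. \<Sum>e\<in>Basis. laplacian_weight v * second_difference h e g (u + h *\<^sub>R (- v)))"
    by (subst sum_laplacian) (simp add: second_difference_def algebra_simps)
  also have "\<bar>\<dots>\<bar> \<le> (\<Sum>v\<in>(laplacian_points::'a set). \<Sum>e\<in>(Basis::'a set). \<bar>laplacian_weight v\<bar> * \<beta>)"
    by (intro order_trans[OF sum_abs] sum_mono) (auto simp: abs_mult intro!: mult_left_mono b')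
  finally show "\<bar>stencil_cov laplacian_points laplacian_weight h g u\<bar>
     \<le> (\<Sum>v\<in>(laplacian_points::'a set). \<bar>laplacian_weight v\<bar> * real DIM('a)) * \<beta>"
    by (simp add: sum_distrib_left sum_distrib_right mult_ac)
next
  fix \<delta> :: real assume \<delta>: "0 < \<delta>" "\<delta> < 2"
  define N where "N v = norm v powr \<delta>" for v :: 'a
  have Ns: "N (- v) = N v" for v by (simp add: N_def)
  have N1: "N e = 1" if "e \<in> Basis" for e using that by (simp add: N_def)
  have lt: "N (e - e') + N (e + e') - 2 < 2" if e: "e \<in> Basis" and e': "e' \<in> Basis" for e e'
  proof (cases "e = e'")
    case True
    have "N (e + e) = 2 powr \<delta>" using e by (simp add: N_def scaleR_2[symmetric])
    also have "\<dots> < 2 powr 2" using \<delta> by (intro powr_less_mono) auto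
    finally show ?thesis using True by (simp add: N_def)
  next
    case False
    have o: "e \<bullet> e' = 0" "e' \<bullet> e = 0" "e \<bullet> e = 1" "e' \<bullet> e' = 1" using e e' False by (auto simp: inner_Basis)
    have "norm (e - e') = sqrt 2" "norm (e + e') = sqrt 2"
      using o by (simp_all add: norm_eq_sqrt_inner inner_diff_left inner_diff_right inner_add_left inner_add_right)
    moreover have "sqrt 2 powr \<delta> < sqrt 2 powr 2" using \<delta> by (intro powr_less_mono) auto
    ultimately show ?thesis by (simp add: N_def)
  qed
  define \<Phi> where "\<Phi> v = (\<Sum>e'\<in>Basis. N (v - e') + N (v + e') - 2 * N v)" for v
  have "(\<Sum>v\<in>(laplacian_points::'a set). \<Sum>v'\<in>laplacian_points. laplacian_weight v * laplacian_weight v' * norm (v - v') powr \<delta>)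
    = (\<Sum>v\<in>laplacian_points. laplacian_weight v * (\<Sum>v'\<in>laplacian_points. laplacian_weight v' * N (v - v')))"
    by (simp add: N_def sum_distrib_left mult.assoc)
  also have "\<dots> = (\<Sum>v\<in>laplacian_points. laplacian_weight v * \<Phi> v)"
    by (subst sum_laplacian) (simp add: \<Phi>_def)
  also have "\<dots> = (\<Sum>e\<in>(Basis::'a set). \<Phi> e + \<Phi> (- e) - 2 * \<Phi> 0)"
    by (rule sum_laplacian)
  also have "\<dots> < (\<Sum>e\<in>(Basis::'a set). 0)"
  proof (rule sum_strict_mono)
    fix e :: 'a assume e: "e \<in> Basis"
    have "\<Phi> e < (\<Sum>e'\<in>(Basis::'a set). 2)"
      unfolding \<Phi>_def by (intro sum_strict_mono) (use lt e N1 in auto)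
    moreover have "\<Phi> (- e) = \<Phi> e"
      unfolding \<Phi>_def
    proof (intro sum.cong refl)
      fix e' :: 'a
      show "N (- e - e') + N (- e + e') - 2 * N (- e) = N (e - e') + N (e + e') - 2 * N e"
        using Ns[of "e + e'"] Ns[of "e - e'"] Ns[of e] by simp
    qed
    moreover have "\<Phi> 0 = (\<Sum>e'\<in>(Basis::'a set). 2)"
      unfolding \<Phi>_def by (intro sum.cong refl) (use N1 Ns \<delta> in \<open>auto simp: N_def\<close>)
    ultimately show "\<Phi> e + \<Phi> (- e) - 2 * \<Phi> 0 < 0" by simp
  qed auto
  finally show "(\<Sum>v\<in>(laplacian_points::'a set). \<Sum>v'\<in>laplacian_points. laplacian_weight v * laplacian_weight v' * norm (v - v') powr \<delta>) < 0"
    by simp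
qed

section \<open>Lattice sums and consistency of least squares\<close>

text \<open>Each term is at most the increment of \<open>x powr (1 - q) / (1 - q)\<close> over the
  unit interval that ends there, and the increments telescope.\<close>

lemma sum_powr_le:
  assumes "0 < q" "q < (1::real)"
  shows "(\<Sum>j\<le>m. (1 + real j) powr (- q)) \<le> (1 + real m) powr (1 - q) / (1 - q)"
proof (induction m)
  case 0
  then show ?case using assms by (simp add: field_simps)
next
  case (Suc m)
  have "(1 + real (Suc m)) powr (1 - q) - (1 + real m) powr (1 - q) \<ge> (1 - q) * (1 + real (Suc m)) powr (- q)"
  proof -
    have dd: "((\<lambda>x. x powr (1 - q)) has_real_derivative (1 - q) * x powr (- q)) (at x)"
      if "1 + real m \<le> x" "x \<le> 1 + real (Suc m)" for x
      using has_real_derivative_powr[of x "1 - q"] that by simp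
    obtain z where z: "1 + real m < z" "z < 1 + real (Suc m)"
      "(1 + real (Suc m)) powr (1 - q) - (1 + real m) powr (1 - q) = (1 + real (Suc m) - (1 + real m)) * ((1 - q) * z powr (- q))"
      using MVT2[of "1 + real m" "1 + real (Suc m)" "\<lambda>x. x powr (1 - q)" "\<lambda>x. (1 - q) * x powr (- q)", OF _ dd] by auto
    have "(1 + real (Suc m)) powr (- q) \<le> z powr (- q)"
      using z assms by (intro powr_mono2') auto
    then show ?thesis using z(3) assms by (simp add: mult_left_mono)
  qed
  then have "(1 + real (Suc m)) powr (- q) \<le> ((1 + real (Suc m)) powr (1 - q) - (1 + real m) powr (1 - q)) / (1 - q)"
    using assms by (simp add: field_simps)
  with Suc show ?case by (simp add: diff_divide_distrib)
qed

lemma sum_int_powr_le: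
  assumes "0 < q" "q < (1::real)"
  shows "(\<Sum>j\<in>{- int m..int m}. (1 + real_of_int \<bar>j\<bar>) powr (- q)) \<le> 2 * (1 + real m) powr (1 - q) / (1 - q)"
proof -
  have "(\<Sum>j\<in>{- int m..int m}. (1 + real_of_int \<bar>j\<bar>) powr (- q))
     \<le> (\<Sum>j\<in>int ` {..m} \<union> (\<lambda>j. - int j) ` {..m}. (1 + real_of_int \<bar>j\<bar>) powr (- q))"
  proof (rule sum_mono2)
    show "{- int m..int m} \<subseteq> int ` {..m} \<union> (\<lambda>j. - int j) ` {..m}"
    proof
      fix j assume j: "j \<in> {- int m..int m}"
      show "j \<in> int ` {..m} \<union> (\<lambda>j. - int j) ` {..m}"
      proof (cases "0 \<le> j")
        case True
        then have "j = int (nat j)" "nat j \<le> m" using j by auto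
        then show ?thesis by blast
      next
        case False
        then have "j = - int (nat (- j))" "nat (- j) \<le> m" using j by auto
        then show ?thesis by blast
      qed
    qed
  qed auto
  also have "\<dots> \<le> (\<Sum>j\<in>int ` {..m}. (1 + real_of_int \<bar>j\<bar>) powr (- q)) + (\<Sum>j\<in>(\<lambda>j. - int j) ` {..m}. (1 + real_of_int \<bar>j\<bar>) powr (- q))"
    by (subst sum.union_inter[symmetric]) (auto intro: sum_nonneg)
  also have "\<dots> = 2 * (\<Sum>j\<le>m. (1 + real j) powr (- q))"
    by (subst sum.reindex, simp add: inj_on_def, subst sum.reindex, simp add: inj_on_def) simp
  also have "\<dots> \<le> 2 * ((1 + real m) powr (1 - q) / (1 - q))"
    using sum_powr_le[OF assms] by (intro mult_left_mono) auto
  finally show ?thesis by simp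
qed

lemma cube_iff: "s \<in> cube q l \<longleftrightarrow> (\<forall>b\<in>Basis. q \<bullet> b \<le> s \<bullet> b \<and> s \<bullet> b \<le> q \<bullet> b + l)"
  by (simp add: cube_def mem_box inner_add_left)

lemma regular_lattice_iff:
  "s \<in> regular_lattice p h \<longleftrightarrow> (\<exists>k :: 'a \<Rightarrow> int. \<forall>b\<in>Basis. s \<bullet> b = p \<bullet> b + h * of_int (k b))"
  for s :: "'a::euclidean_space"
proof -
  have "(s = p + h *\<^sub>R (\<Sum>b\<in>Basis. of_int (k b) *\<^sub>R b)) \<longleftrightarrow> (\<forall>b\<in>Basis. s \<bullet> b = p \<bullet> b + h * of_int (k b))" for k :: "'a \<Rightarrow> int"
    by (subst euclidean_eq_iff) (simp add: inner_add_left)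
  then show ?thesis unfolding regular_lattice_def by auto
qed

text \<open>The exponent \<pi> is shared equally among the coordinates:
  \<open>1 + norm (s - t) / h\<close> dominates each \<open>1 + \<bar>F t b\<bar>\<close>, so the
  summand is at most a product of one-dimensional powers with exponent
  \<open>\<pi> / DIM('a)\<close>, and the sum over the enclosing box factorizes. Since this exponent
  is below 1, each factor is of order \<open>h powr (\<pi> / DIM('a) - 1)\<close>.\<close>

lemma lattice_sum_bound:
  fixes q :: "'a::euclidean_space"
  assumes p: "0 < \<pi>" "\<pi> < real DIM('a)" and l: "0 < l" and h: "0 < h" "h \<le> 1"
    and S: "finite S" "S \<subseteq> cube q l \<inter> regular_lattice x h" and s: "s \<in> S"
  shows "(\<Sum>t\<in>S. (1 + norm (s - t) / h) powr (- \<pi>))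
     \<le> (2 * (1 + l) powr (1 - \<pi> / DIM('a)) / (1 - \<pi> / DIM('a))) ^ DIM('a) * h powr (\<pi> - DIM('a))"
proof -
  let ?d = "real DIM('a)"
  define r where "r = \<pi> / ?d"
  have d0: "0 < ?d" by simp
  have r: "0 < r" "r < 1" using p by (auto simp: r_def field_simps)
  define m where "m = nat \<lfloor>l / h\<rfloor>"
  have m: "real m \<le> l / h" "l / h < real m + 1" using l h by (auto simp: m_def)
  obtain ks where ks: "\<And>b. b \<in> Basis \<Longrightarrow> s \<bullet> b = x \<bullet> b + h * of_int (ks b)"
    using s S(2) regular_lattice_iff[of s x h] by blast
  have "\<forall>t\<in>S. \<exists>k. \<forall>b\<in>Basis. t \<bullet> b = x \<bullet> b + h * of_int (k b)"
    using S(2) regular_lattice_iff[of _ x h] by blast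
  then obtain kt where kt: "\<And>t b. t \<in> S \<Longrightarrow> b \<in> Basis \<Longrightarrow> t \<bullet> b = x \<bullet> b + h * of_int (kt t b)"
    by metis
  define F where "F t = (\<lambda>b\<in>Basis. ks b - kt t b)" for t
  have diff: "(s - t) \<bullet> b = h * of_int (F t b)" if "t \<in> S" "b \<in> Basis" for t b
    using ks kt that by (simp add: F_def inner_diff_left algebra_simps)
  have FB: "F ` S \<subseteq> PiE Basis (\<lambda>_. {- int m..int m})"
  proof
    fix f assume "f \<in> F ` S"
    then obtain t where t: "t \<in> S" "f = F t" by auto
    have "\<bar>F t b\<bar> \<le> int m" if b: "b \<in> Basis" for b
    proof -
      have "s \<in> cube q l" "t \<in> cube q l" using s t(1) S(2) by auto
      then have "q \<bullet> b \<le> s \<bullet> b" "s \<bullet> b \<le> q \<bullet> b + l" "q \<bullet> b \<le> t \<bullet> b" "t \<bullet> b \<le> q \<bullet> b + l"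
        using b by (auto simp: cube_iff)
      then have "\<bar>(s - t) \<bullet> b\<bar> \<le> l" unfolding inner_diff_left by linarith
      then have "h * \<bar>of_int (F t b)\<bar> \<le> l" using diff[OF t(1) b] h by (simp add: abs_mult)
      then have "\<bar>of_int (F t b)\<bar> \<le> l / h" using h by (simp add: field_simps)
      then have "of_int \<bar>F t b\<bar> < real m + 1" using m by linarith
      then show ?thesis by linarith
    qed
    then have "F t b \<in> {- int m..int m}" if "b \<in> Basis" for b using that by (force simp: abs_le_iff)
    moreover have "F t b = undefined" if "b \<notin> Basis" for b using that by (simp add: F_def)
    ultimately show "f \<in> PiE Basis (\<lambda>_. {- int m..int m})" unfolding t(2) by (intro PiE_I)
  qed
  have inj: "inj_on F S"
  proof (rule inj_onI)
    fix t t' assume t: "t \<in> S" "t' \<in> S" "F t = F t'"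
    have "t \<bullet> b = t' \<bullet> b" if "b \<in> Basis" for b
      using diff[OF t(1) that] diff[OF t(2) that] t(3) by (simp add: inner_diff_left)
    then show "t = t'" by (rule euclidean_eqI)
  qed
  define G where "G f = (\<Prod>b\<in>(Basis::'a set). (1 + real_of_int \<bar>f b\<bar>) powr (- r))" for f :: "'a \<Rightarrow> int"
  have pt: "(1 + norm (s - t) / h) powr (- \<pi>) \<le> G (F t)" if t: "t \<in> S" for t
  proof -
    have pos: "0 < 1 + norm (s - t) / h" using h by (simp add: add_pos_nonneg)
    have "(1 + norm (s - t) / h) powr (- \<pi>) = (\<Prod>b\<in>(Basis::'a set). (1 + norm (s - t) / h) powr (- r))"
      using pos by (simp add: powr_power r_def mult.commute)
    also have "\<dots> \<le> G (F t)"
      unfolding G_def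
    proof (intro prod_mono conjI powr_mono2')
      fix b :: 'a assume b: "b \<in> Basis"
      have "\<bar>h * of_int (F t b)\<bar> \<le> norm (s - t)" using Basis_le_norm[OF b, of "s - t"] diff[OF t b] by simp
      then show "1 + real_of_int \<bar>F t b\<bar> \<le> 1 + norm (s - t) / h" using h by (simp add: abs_mult field_simps)
    qed (use r in auto)
    finally show ?thesis .
  qed
  have "(\<Sum>t\<in>S. (1 + norm (s - t) / h) powr (- \<pi>)) \<le> (\<Sum>t\<in>S. G (F t))"
    by (intro sum_mono pt)
  also have "\<dots> = (\<Sum>f\<in>F ` S. G f)" using inj by (simp add: sum.reindex)
  also have "\<dots> \<le> (\<Sum>f\<in>PiE (Basis::'a set) (\<lambda>_. {- int m..int m}). G f)"
    using FB by (intro sum_mono2) (auto simp: G_def finite_PiE intro!: prod_nonneg)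
  also have "\<dots> = (\<Prod>b\<in>(Basis::'a set). \<Sum>j\<in>{- int m..int m}. (1 + real_of_int \<bar>j\<bar>) powr (- r))"
    unfolding G_def by (rule prod_sum_PiE[symmetric]) auto
  also have "\<dots> = (\<Sum>j\<in>{- int m..int m}. (1 + real_of_int \<bar>j\<bar>) powr (- r)) ^ DIM('a)" by simp
  also have "\<dots> \<le> (2 * (1 + l) powr (1 - r) / (1 - r) * h powr (r - 1)) ^ DIM('a)"
  proof (rule power_mono)
    have "1 + real m \<le> 1 + l / h" using m by simp
    also have "\<dots> \<le> (1 + l) / h" using h by (simp add: field_simps)
    finally have "(1 + real m) powr (1 - r) \<le> ((1 + l) / h) powr (1 - r)" using r by (intro powr_mono2) auto
    also have "\<dots> = (1 + l) powr (1 - r) * h powr (r - 1)"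
      using powr_minus_divide[of h "1 - r"] by (simp add: powr_divide)
    finally have "2 * (1 + real m) powr (1 - r) / (1 - r) \<le> 2 * ((1 + l) powr (1 - r) * h powr (r - 1)) / (1 - r)"
      using r by (intro divide_right_mono mult_left_mono) auto
    with sum_int_powr_le[OF r, of m]
    show "(\<Sum>j\<in>{- int m..int m}. (1 + real_of_int \<bar>j\<bar>) powr (- r)) \<le> 2 * (1 + l) powr (1 - r) / (1 - r) * h powr (r - 1)"
      by simp
  qed (auto intro!: sum_nonneg)
  also have "\<dots> = (2 * (1 + l) powr (1 - r) / (1 - r)) ^ DIM('a) * (h powr (r - 1)) ^ DIM('a)"
    by (rule power_mult_distrib)
  also have "(h powr (r - 1)) ^ DIM('a) = h powr (\<pi> - ?d)"
    using h by (simp add: powr_power r_def algebra_simps)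
  finally show ?thesis by (simp add: r_def)
qed

text \<open>\<open>S\<close> is only known to contain the lattice points that keep the margin
  \<open>h\<close> from the faces, where both transforms are certainly defined. From the first
  admissible index \<open>k0\<close> on, at least \<open>m\<close> of them fit along each axis, and
  \<open>8 * h \<le> l\<close> turns the loss by margins and rounding into
  \<open>l / (2 * h) \<le> m\<close>.\<close>

lemma lattice_inner_card:
  fixes q :: "'a::euclidean_space"
  assumes h: "0 < h" "8 * h \<le> l" and S: "finite S"
    and sub: "\<And>s. s \<in> regular_lattice x h \<Longrightarrow> (\<And>b. b \<in> Basis \<Longrightarrow> q \<bullet> b + h \<le> s \<bullet> b \<and> s \<bullet> b \<le> q \<bullet> b + l - h) \<Longrightarrow> s \<in> S"
  shows "(l / 2) ^ DIM('a) * h powr (- real DIM('a)) \<le> real (card S)"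
proof -
  define k0 where "k0 b = \<lceil>(q \<bullet> b + h - x \<bullet> b) / h\<rceil>" for b
  define m where "m = nat \<lfloor>(l - 2 * h) / h\<rfloor>"
  have lh: "0 \<le> (l - 2 * h) / h" using h by simp
  have m: "real m \<le> (l - 2 * h) / h" "(l - 2 * h) / h < real m + 1"
    using lh by (auto simp: m_def)
  have mh: "real m * h \<le> l - 2 * h" using m(1) h by (simp add: field_simps)
  have m2: "l / (2 * h) \<le> real m"
  proof -
    have "l / h - 2 < real m + 1" using m(2) h by (simp add: diff_divide_distrib)
    moreover have "8 \<le> l / h" using h by (simp add: field_simps)
    moreover have "l / (2 * h) = (l / h) / 2" by simp
    ultimately show ?thesis by linarith
  qed
  define g where "g f = (\<Sum>b\<in>Basis. (x \<bullet> b + h * of_int (k0 b + int (f b))) *\<^sub>R b)" for f :: "'a \<Rightarrow> nat"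
  have gb: "g f \<bullet> b = x \<bullet> b + h * of_int (k0 b + int (f b))" if "b \<in> Basis" for f b
    using that by (simp add: g_def)
  have gS: "g ` PiE Basis (\<lambda>_. {..<m}) \<subseteq> S"
  proof
    fix s assume "s \<in> g ` PiE Basis (\<lambda>_. {..<m})"
    then obtain f where f: "f \<in> PiE Basis (\<lambda>_. {..<m})" "s = g f" by auto
    show "s \<in> S"
    proof (rule sub)
      show "s \<in> regular_lattice x h"
        unfolding regular_lattice_iff f(2)
        by (rule exI[of _ "\<lambda>b. k0 b + int (f b)"]) (simp add: gb)
      fix b :: 'a assume b: "b \<in> Basis"
      have fb: "f b < m" using f b by auto
      have k: "(q \<bullet> b + h - x \<bullet> b) / h \<le> k0 b" "k0 b < (q \<bullet> b + h - x \<bullet> b) / h + 1"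
        unfolding k0_def by linarith+
      have k1: "q \<bullet> b + h - x \<bullet> b \<le> h * k0 b" using k(1) h by (simp add: field_simps)
      have k2: "h * k0 b < q \<bullet> b + h - x \<bullet> b + h" using k(2) h by (simp add: field_simps)
      have n1: "0 \<le> h * real (f b)" using h by simp
      have "h * (real (f b) + 1) \<le> h * real m" using fb h by (intro mult_left_mono) auto
      then have n2: "h * real (f b) + h \<le> l - 2 * h" using mh by (simp add: algebra_simps)
      show "q \<bullet> b + h \<le> s \<bullet> b \<and> s \<bullet> b \<le> q \<bullet> b + l - h"
      proof -
        have "x \<bullet> b + h * of_int (k0 b + int (f b)) = x \<bullet> b + h * k0 b + h * real (f b)"
          by (simp add: distrib_left)
        then show ?thesis unfolding f(2) gb[OF b] using k1 k2 n1 n2 by linarith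
      qed
    qed
  qed
  have inj: "inj_on g (PiE Basis (\<lambda>_. {..<m}))"
  proof (rule inj_onI)
    fix f f' assume f: "f \<in> PiE Basis (\<lambda>_. {..<m})" "f' \<in> PiE Basis (\<lambda>_. {..<m})" "g f = g f'"
    show "f = f'"
    proof (rule PiE_ext[OF f(1,2)])
      fix b :: 'a assume "b \<in> Basis"
      then show "f b = f' b" using f(3) gb[of b f] gb[of b f'] h by simp
    qed
  qed
  have "(l / 2) ^ DIM('a) * h powr (- real DIM('a)) = (l / (2 * h)) ^ DIM('a)"
    using h by (simp add: powr_minus powr_realpow power_divide field_simps)
  also have "\<dots> \<le> real m ^ DIM('a)" using m2 h by (intro power_mono) auto
  also have "\<dots> = real (card (PiE (Basis::'a set) (\<lambda>_. {..<m})))" by (simp add: card_PiE)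
  also have "\<dots> = real (card (g ` PiE Basis (\<lambda>_. {..<m})))" using inj by (simp add: card_image)
  also have "\<dots> \<le> real (card S)" using gS S by (simp add: card_mono)
  finally show ?thesis .
qed

lemma lattice_cube_finite:
  assumes "0 < h"
  shows "finite (cube q l \<inter> regular_lattice x h)"
proof -
  let ?S = "cube q l \<inter> regular_lattice x h"
  have "\<forall>t\<in>?S. \<exists>k. \<forall>b\<in>Basis. t \<bullet> b = x \<bullet> b + h * of_int (k b)"
    using regular_lattice_iff[of _ x h] by blast
  then obtain kt where kt: "\<And>t b. t \<in> ?S \<Longrightarrow> b \<in> Basis \<Longrightarrow> t \<bullet> b = x \<bullet> b + h * of_int (kt t b)"
    by metis
  define F where "F t = restrict (kt t) Basis" for t
  have "inj_on F ?S"
  proof (rule inj_onI)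
    fix t t' assume t: "t \<in> ?S" "t' \<in> ?S" "F t = F t'"
    have "t \<bullet> b = t' \<bullet> b" if "b \<in> Basis" for b
      using kt[OF t(1) that] kt[OF t(2) that] fun_cong[OF t(3), of b] that by (simp add: F_def)
    then show "t = t'" by (rule euclidean_eqI)
  qed
  moreover have "F ` ?S \<subseteq> PiE Basis (\<lambda>b. {\<lfloor>(q \<bullet> b - x \<bullet> b) / h\<rfloor>..\<lceil>(q \<bullet> b + l - x \<bullet> b) / h\<rceil>})"
  proof
    fix f assume "f \<in> F ` ?S"
    then obtain t where t: "t \<in> ?S" "f = F t" by auto
    have "\<lfloor>(q \<bullet> b - x \<bullet> b) / h\<rfloor> \<le> kt t b \<and> kt t b \<le> \<lceil>(q \<bullet> b + l - x \<bullet> b) / h\<rceil>" if b: "b \<in> Basis" for b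
    proof -
      have "q \<bullet> b \<le> t \<bullet> b" "t \<bullet> b \<le> q \<bullet> b + l" using t b by (auto simp: cube_iff)
      then have "(q \<bullet> b - x \<bullet> b) / h \<le> kt t b" "kt t b \<le> (q \<bullet> b + l - x \<bullet> b) / h"
        using kt[OF t(1) b] assms by (auto simp: field_simps)
      then show ?thesis by linarith
    qed
    then show "f \<in> PiE Basis (\<lambda>b. {\<lfloor>(q \<bullet> b - x \<bullet> b) / h\<rfloor>..\<lceil>(q \<bullet> b + l - x \<bullet> b) / h\<rceil>})"
      unfolding t(2) F_def by auto
  qed
  then have "finite (F ` ?S)" by (rule finite_subset) (auto intro!: finite_PiE)
  ultimately show ?thesis by (simp add: finite_image_iff)
qed

section \<open>Second moments of lattice sums\<close>

text \<open>The covariance bounds hold for lags below some \<rho> only. Blocks of diameter less than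
  \<rho> make them applicable, and the number of blocks does not depend on the spacing.\<close>

lemma cube_blocks:
  fixes q :: "'a::euclidean_space"
  assumes "0 < \<rho>"
  shows "\<exists>blk :: 'a \<Rightarrow> 'a \<Rightarrow> int. finite (blk ` cube q l) \<and>
     (\<forall>s t. blk s = blk t \<longrightarrow> norm (s - t) < \<rho>)"
proof -
  let ?d = "real DIM('a)"
  define \<eta> where "\<eta> = \<rho> / ?d"
  have \<eta>: "0 < \<eta>" using assms by (simp add: \<eta>_def)
  define blk where "blk s = (\<lambda>b\<in>Basis. \<lfloor>(s \<bullet> b) / \<eta>\<rfloor>)" for s :: 'a
  have "blk ` cube q l \<subseteq> PiE Basis (\<lambda>b. {\<lfloor>(q \<bullet> b) / \<eta>\<rfloor>..\<lfloor>(q \<bullet> b + l) / \<eta>\<rfloor>})"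
    unfolding blk_def using \<eta> by (auto simp: cube_iff intro!: floor_mono divide_right_mono)
  then have "finite (blk ` cube q l)" by (rule finite_subset) (auto intro!: finite_PiE)
  moreover have "norm (s - t) < \<rho>" if "blk s = blk t" for s t
  proof -
    have c: "\<bar>(s - t) \<bullet> b\<bar> < \<eta>" if b: "b \<in> Basis" for b
    proof -
      have "\<lfloor>(s \<bullet> b) / \<eta>\<rfloor> = \<lfloor>(t \<bullet> b) / \<eta>\<rfloor>" using fun_cong[OF \<open>blk s = blk t\<close>, of b] b by (simp add: blk_def)
      then have "\<bar>(s \<bullet> b) / \<eta> - (t \<bullet> b) / \<eta>\<bar> < 1" by linarith
      also have "(s \<bullet> b) / \<eta> - (t \<bullet> b) / \<eta> = ((s - t) \<bullet> b) / \<eta>" by (simp add: inner_diff_left diff_divide_distrib)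
      finally show ?thesis using \<eta> by (simp add: abs_divide)
    qed
    have "norm (s - t) \<le> (\<Sum>b\<in>Basis. \<bar>(s - t) \<bullet> b\<bar>)" by (rule norm_le_l1)
    also have "\<dots> < (\<Sum>b\<in>(Basis::'a set). \<eta>)" using c by (intro sum_strict_mono) auto
    also have "\<dots> = \<rho>" by (simp add: \<eta>_def)
    finally show ?thesis .
  qed
  ultimately show ?thesis by blast
qed

text \<open>By Cauchy-Schwarz over the blocks, the square of the total is at most the number of
  blocks times the sum of the squared block totals. Covariances between different blocks never
  appear.\<close>

lemma (in prob_space) block_second_moment:
  fixes R :: "'s \<Rightarrow> 'a \<Rightarrow> real" and blk :: "'s \<Rightarrow> 'b"
  assumes S: "finite S" and B: "finite B" "blk ` S \<subseteq> B"
    and i: "\<And>s t. s \<in> S \<Longrightarrow> t \<in> S \<Longrightarrow> integrable M (\<lambda>\<omega>. R s \<omega> * R t \<omega>)"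
  shows "integrable M (\<lambda>\<omega>. (\<Sum>s\<in>S. R s \<omega>)\<^sup>2)"
    and "(\<integral>\<omega>. (\<Sum>s\<in>S. R s \<omega>)\<^sup>2 \<partial>M)
       \<le> real (card B) * (\<Sum>s\<in>S. \<Sum>t\<in>{t\<in>S. blk s = blk t}. \<bar>\<integral>\<omega>. R s \<omega> * R t \<omega> \<partial>M\<bar>)"
proof -
  have sq: "(\<lambda>\<omega>. (\<Sum>s\<in>A. R s \<omega>)\<^sup>2) = (\<lambda>\<omega>. \<Sum>s\<in>A. \<Sum>t\<in>A. R s \<omega> * R t \<omega>)" for A
    by (simp add: power2_eq_square sum_product)
  have I: "integrable M (\<lambda>\<omega>. (\<Sum>s\<in>A. R s \<omega>)\<^sup>2)" if "A \<subseteq> S" for A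
    unfolding sq using that i by (intro Bochner_Integration.integrable_sum) blast
  show "integrable M (\<lambda>\<omega>. (\<Sum>s\<in>S. R s \<omega>)\<^sup>2)" by (rule I) simp
  let ?A = "\<lambda>b. {s\<in>S. blk s = b}"
  have pt: "(\<Sum>s\<in>S. R s \<omega>)\<^sup>2 \<le> real (card B) * (\<Sum>b\<in>B. (\<Sum>s\<in>?A b. R s \<omega>)\<^sup>2)" for \<omega>
    using sum_squared_le_sum_of_squares[of "\<lambda>b. \<Sum>s\<in>?A b. R s \<omega>" B] sum.group[OF S B, of "\<lambda>s. R s \<omega>"]
    by (simp add: mult.commute)
  have "(\<integral>\<omega>. (\<Sum>s\<in>S. R s \<omega>)\<^sup>2 \<partial>M) \<le> (\<integral>\<omega>. real (card B) * (\<Sum>b\<in>B. (\<Sum>s\<in>?A b. R s \<omega>)\<^sup>2) \<partial>M)"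
    by (intro integral_mono I pt integrable_mult_right Bochner_Integration.integrable_sum) auto
  also have "\<dots> = real (card B) * (\<Sum>b\<in>B. \<integral>\<omega>. (\<Sum>s\<in>?A b. R s \<omega>)\<^sup>2 \<partial>M)"
    using I[of "?A _"] by (subst integral_mult_right_zero, subst Bochner_Integration.integral_sum) auto
  also have "(\<Sum>b\<in>B. \<integral>\<omega>. (\<Sum>s\<in>?A b. R s \<omega>)\<^sup>2 \<partial>M) = (\<Sum>b\<in>B. \<Sum>s\<in>?A b. \<Sum>t\<in>?A b. \<integral>\<omega>. R s \<omega> * R t \<omega> \<partial>M)"
  proof (rule sum.cong[OF refl])
    fix b assume "b \<in> B"
    show "(\<integral>\<omega>. (\<Sum>s\<in>?A b. R s \<omega>)\<^sup>2 \<partial>M) = (\<Sum>s\<in>?A b. \<Sum>t\<in>?A b. \<integral>\<omega>. R s \<omega> * R t \<omega> \<partial>M)"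
      unfolding sq using i
      by (subst Bochner_Integration.integral_sum; (intro Bochner_Integration.integrable_sum sum.cong refl)?;
          (subst Bochner_Integration.integral_sum)?; auto)
  qed
  also have "\<dots> = (\<Sum>b\<in>B. \<Sum>s\<in>?A b. \<Sum>t\<in>{t\<in>S. blk s = blk t}. \<integral>\<omega>. R s \<omega> * R t \<omega> \<partial>M)"
    by (intro sum.cong refl) auto
  also have "\<dots> = (\<Sum>s\<in>S. \<Sum>t\<in>{t\<in>S. blk s = blk t}. \<integral>\<omega>. R s \<omega> * R t \<omega> \<partial>M)"
    by (rule sum.group[OF S B])
  also have "\<dots> \<le> (\<Sum>s\<in>S. \<Sum>t\<in>{t\<in>S. blk s = blk t}. \<bar>\<integral>\<omega>. R s \<omega> * R t \<omega> \<partial>M\<bar>)"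
    by (intro sum_mono) auto
  finally show "(\<integral>\<omega>. (\<Sum>s\<in>S. R s \<omega>)\<^sup>2 \<partial>M)
       \<le> real (card B) * (\<Sum>s\<in>S. \<Sum>t\<in>{t\<in>S. blk s = blk t}. \<bar>\<integral>\<omega>. R s \<omega> * R t \<omega> \<partial>M\<bar>)"
    by (simp add: mult_left_mono)
qed

text \<open>Chebyshev. Off the two exceptional events \<open>Num\<close> is below
  \<open>\<epsilon> * (v / 2)\<close> in absolute value, half of it from the mean \<open>m\<close>
  and half from the deviation, while \<open>Den\<close> exceeds \<open>v / 2\<close>. The event
  \<open>Den = 0\<close> is counted as a failure because division by zero yields 0.\<close>

lemma (in prob_space) ratio_tendsto_zero:
  fixes Num Den :: "nat \<Rightarrow> 'a \<Rightarrow> real" and v m :: "nat \<Rightarrow> real"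
  assumes meas [measurable]: "\<And>n. Num n \<in> borel_measurable M" "\<And>n. Den n \<in> borel_measurable M"
    and v: "\<forall>\<^sub>F n in sequentially. 0 < v n"
    and m: "(\<lambda>n. m n / v n) \<longlonglongrightarrow> 0"
    and I: "\<And>n. integrable M (\<lambda>\<omega>. (Num n \<omega> - m n)\<^sup>2)" "\<And>n. integrable M (\<lambda>\<omega>. (Den n \<omega> - v n)\<^sup>2)"
    and N: "(\<lambda>n. (\<integral>\<omega>. (Num n \<omega> - m n)\<^sup>2 \<partial>M) / (v n)\<^sup>2) \<longlonglongrightarrow> 0"
    and D: "(\<lambda>n. (\<integral>\<omega>. (Den n \<omega> - v n)\<^sup>2 \<partial>M) / (v n)\<^sup>2) \<longlonglongrightarrow> 0"
    and \<epsilon>: "0 < \<epsilon>"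
  shows "(\<lambda>n. prob {\<omega>\<in>space M. Den n \<omega> = 0 \<or> \<epsilon> < \<bar>Num n \<omega> / Den n \<omega>\<bar>}) \<longlonglongrightarrow> 0"
proof (rule Lim_null_comparison)
  let ?b = "\<lambda>n. (\<integral>\<omega>. (Num n \<omega> - m n)\<^sup>2 \<partial>M) / (v n)\<^sup>2 * (16 / \<epsilon>\<^sup>2) + (\<integral>\<omega>. (Den n \<omega> - v n)\<^sup>2 \<partial>M) / (v n)\<^sup>2 * 4"
  have "?b \<longlonglongrightarrow> 0 * (16 / \<epsilon>\<^sup>2) + 0 * 4"
    by (intro tendsto_add tendsto_mult N D tendsto_const)
  then show "?b \<longlonglongrightarrow> 0" by simp
  have "\<forall>\<^sub>F n in sequentially. \<bar>m n / v n\<bar> < \<epsilon> / 4"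
    using tendsto_rabs_zero[OF m] \<epsilon> by (intro order_tendstoD(2)) auto
  with v show "\<forall>\<^sub>F n in sequentially. norm (prob {\<omega>\<in>space M. Den n \<omega> = 0 \<or> \<epsilon> < \<bar>Num n \<omega> / Den n \<omega>\<bar>}) \<le> ?b n"
  proof eventually_elim
    case (elim n)
    have mb: "\<bar>m n\<bar> < \<epsilon> / 4 * v n" using elim by (simp add: abs_divide field_simps)
    let ?A = "{\<omega>\<in>space M. \<epsilon> / 4 * v n \<le> \<bar>Num n \<omega> - m n\<bar>}"
    let ?B = "{\<omega>\<in>space M. v n / 2 \<le> \<bar>Den n \<omega> - v n\<bar>}"
    have "prob {\<omega>\<in>space M. Den n \<omega> = 0 \<or> \<epsilon> < \<bar>Num n \<omega> / Den n \<omega>\<bar>} \<le> prob (?A \<union> ?B)"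
    proof (rule finite_measure_mono)
      show "{\<omega>\<in>space M. Den n \<omega> = 0 \<or> \<epsilon> < \<bar>Num n \<omega> / Den n \<omega>\<bar>} \<subseteq> ?A \<union> ?B"
      proof (rule subsetI, rule ccontr)
        fix \<omega> assume \<omega>: "\<omega> \<in> {\<omega>\<in>space M. Den n \<omega> = 0 \<or> \<epsilon> < \<bar>Num n \<omega> / Den n \<omega>\<bar>}" and "\<omega> \<notin> ?A \<union> ?B"
        then have a: "\<bar>Num n \<omega> - m n\<bar> < \<epsilon> / 4 * v n" and b: "\<bar>Den n \<omega> - v n\<bar> < v n / 2" by auto
        have den: "v n / 2 < Den n \<omega>" using b by linarith
        then have pos: "0 < Den n \<omega>" using elim by linarith
        have "\<bar>Num n \<omega>\<bar> < \<epsilon> * (v n / 2)" using a mb by linarith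
        also have "\<dots> < \<epsilon> * Den n \<omega>" using den \<epsilon> by simp
        finally have "\<bar>Num n \<omega> / Den n \<omega>\<bar> < \<epsilon>" using pos by (simp add: abs_divide pos_divide_less_eq)
        with \<omega> pos show False by auto
      qed
    qed measurable
    also have "\<dots> \<le> prob ?A + prob ?B" by (rule measure_Un_le) measurable
    also have "prob ?A \<le> (\<integral>\<omega>. (Num n \<omega> - m n)\<^sup>2 \<partial>M) / (\<epsilon> / 4 * v n)\<^sup>2"
      by (rule second_moment_method) (use I elim \<epsilon> in auto)
    also have "prob ?B \<le> (\<integral>\<omega>. (Den n \<omega> - v n)\<^sup>2 \<partial>M) / (v n / 2)\<^sup>2"
      by (rule second_moment_method) (use I elim \<epsilon> in auto)
    finally show ?case using \<epsilon> elim by (simp add: power_mult_distrib power_divide field_simps)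
  qed
qed

context gaussian_pair
begin

lemma stencil_integrable:
  assumes "finite V"
  shows "integrable M (\<lambda>\<omega>. stencil V w h (\<lambda>t. X t \<omega>) s)" "integrable M (\<lambda>\<omega>. stencil V w h (\<lambda>t. W t \<omega>) s)"
  unfolding stencil_def by (auto intro!: Bochner_Integration.integrable_sum)

text \<open>Wick's formula: the covariance of the products at \<open>s\<close> and at
  \<open>t\<close> consists of the two pairings that link the points. The third pairing is the
  product of the means and is removed by centring.\<close>

lemma stencil_product_moment:
  fixes V :: "'a set" and w :: "'a \<Rightarrow> real" and h :: real
  assumes V: "finite V" and w0: "sum w V = 0"
  defines "U \<equiv> \<lambda>s \<omega>. stencil V w h (\<lambda>t. X t \<omega>) s" and "Z \<equiv> \<lambda>s \<omega>. stencil V w h (\<lambda>t. W t \<omega>) s"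
    and "cX \<equiv> stencil_cov V w h (\<lambda>u. covariance M (X u) (X 0))"
    and "cW \<equiv> stencil_cov V w h (\<lambda>u. covariance M (W u) (W 0))"
    and "c12 \<equiv> stencil_cov V w h (\<lambda>u. covariance M (X u) (W 0))"
    and "c21 \<equiv> stencil_cov V w h (\<lambda>u. covariance M (W u) (X 0))"
  shows "integrable M (\<lambda>\<omega>. U s \<omega> * Z s \<omega>)" "integrable M (\<lambda>\<omega>. U s \<omega> * U s \<omega>)"
    and "integrable M (\<lambda>\<omega>. (U s \<omega> * Z s \<omega> - c12 0) * (U t \<omega> * Z t \<omega> - c12 0))"
    and "(\<integral>\<omega>. (U s \<omega> * Z s \<omega> - c12 0) * (U t \<omega> * Z t \<omega> - c12 0) \<partial>M) = cX (s - t) * cW (s - t) + c12 (s - t) * c21 (s - t)"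
    and "integrable M (\<lambda>\<omega>. (U s \<omega> * U s \<omega> - cX 0) * (U t \<omega> * U t \<omega> - cX 0))"
    and "(\<integral>\<omega>. (U s \<omega> * U s \<omega> - cX 0) * (U t \<omega> * U t \<omega> - cX 0) \<partial>M) = 2 * (cX (s - t))\<^sup>2"
proof -
  have G: "gaussian_variable M (\<lambda>\<omega>. a * U p \<omega> + b * Z p \<omega> + c * U q \<omega> + d * Z q \<omega>)" for a b c d p q
    unfolding U_def Z_def by (rule stencil_gaussian_four[OF V w0])
  have G1: "gaussian_variable M (\<lambda>\<omega>. a * U s \<omega> + b * Z s \<omega> + c * U t \<omega> + d * Z t \<omega>)" for a b c d by (rule G)
  have G2: "gaussian_variable M (\<lambda>\<omega>. a * U s \<omega> + b * U s \<omega> + c * U t \<omega> + d * U t \<omega>)" for a b c d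
    using G[of "a + b" s 0 "c + d" t 0] by (simp add: algebra_simps)
  have z: "(\<integral>\<omega>. U p \<omega> \<partial>M) = 0" "(\<integral>\<omega>. Z p \<omega> \<partial>M) = 0" for p
    unfolding U_def Z_def by (rule stencil_mean[OF V w0])+
  have mom: "(\<integral>\<omega>. U p \<omega> * U q \<omega> \<partial>M) = cX (p - q)" "(\<integral>\<omega>. U p \<omega> * Z q \<omega> \<partial>M) = c12 (p - q)"
     "(\<integral>\<omega>. Z p \<omega> * U q \<omega> \<partial>M) = c21 (p - q)" "(\<integral>\<omega>. Z p \<omega> * Z q \<omega> \<partial>M) = cW (p - q)" for p q
    unfolding U_def Z_def cX_def cW_def c12_def c21_def by (rule stencil_moments[OF V w0])+
  have i: "integrable M (\<lambda>\<omega>. U p \<omega> * Z p \<omega>)" "integrable M (\<lambda>\<omega>. U p \<omega> * U p \<omega>)" for p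
    using gaussian_variable_product_integrable[OF prob_space_axioms, of "U p" "Z p"]
      gaussian_variable_power_integrable[OF prob_space_axioms G[of 1 p 0 0 p 0], of 2]
      G[of 1 p 1 0 p 0] G[of 1 p "-1" 0 p 0] by (simp_all add: power2_eq_square)
  show "integrable M (\<lambda>\<omega>. U s \<omega> * Z s \<omega>)" "integrable M (\<lambda>\<omega>. U s \<omega> * U s \<omega>)" by (rule i)+
  note W1 = wick_fourth_moment[OF prob_space_axioms G1 z(1) z(2) z(1) z(2)]
  note W2 = wick_fourth_moment[OF prob_space_axioms G2 z(1) z(1) z(1) z(1)]
  have e1: "(\<lambda>\<omega>. (U s \<omega> * Z s \<omega> - c12 0) * (U t \<omega> * Z t \<omega> - c12 0)) =
    (\<lambda>\<omega>. U s \<omega> * Z s \<omega> * U t \<omega> * Z t \<omega> - c12 0 * (U s \<omega> * Z s \<omega>) - c12 0 * (U t \<omega> * Z t \<omega>) + (c12 0)\<^sup>2)"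
    by (auto simp: algebra_simps power2_eq_square)
  have e2: "(\<lambda>\<omega>. (U s \<omega> * U s \<omega> - cX 0) * (U t \<omega> * U t \<omega> - cX 0)) =
    (\<lambda>\<omega>. U s \<omega> * U s \<omega> * U t \<omega> * U t \<omega> - cX 0 * (U s \<omega> * U s \<omega>) - cX 0 * (U t \<omega> * U t \<omega>) + (cX 0)\<^sup>2)"
    by (auto simp: algebra_simps power2_eq_square)
  show "integrable M (\<lambda>\<omega>. (U s \<omega> * Z s \<omega> - c12 0) * (U t \<omega> * Z t \<omega> - c12 0))"
    unfolding e1 using W1(1) i by simp
  show "integrable M (\<lambda>\<omega>. (U s \<omega> * U s \<omega> - cX 0) * (U t \<omega> * U t \<omega> - cX 0))"
    unfolding e2 using W2(1) i by simp
  show "(\<integral>\<omega>. (U s \<omega> * Z s \<omega> - c12 0) * (U t \<omega> * Z t \<omega> - c12 0) \<partial>M) = cX (s - t) * cW (s - t) + c12 (s - t) * c21 (s - t)"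
    unfolding e1 using W1(1) i
    by (simp add: W1(2) mom prob_space power2_eq_square)
  show "(\<integral>\<omega>. (U s \<omega> * U s \<omega> - cX 0) * (U t \<omega> * U t \<omega> - cX 0) \<partial>M) = 2 * (cX (s - t))\<^sup>2"
    unfolding e2 using W2(1) i
    by (simp add: W2(2) mom prob_space power2_eq_square)
qed

end

lemma powr_tendsto_zero:
  fixes h :: "nat \<Rightarrow> real"
  assumes "h \<longlonglongrightarrow> 0" "\<And>n. 0 < h n" "0 < a"
  shows "(\<lambda>n. h n powr a) \<longlonglongrightarrow> 0"
proof -
  have "(\<lambda>n. h n powr a) \<longlonglongrightarrow> 0 powr a"
    by (rule tendsto_powr2) (use assms in \<open>auto intro!: less_imp_le always_eventually\<close>)
  then show ?thesis by simp
qed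

text \<open>Let N be the number of points. The decaying part of \<kappa> contributes N lattice sums
  and the flat part at most \<open>N\<^sup>2\<close> terms, while \<open>v\<^sup>2\<close> is at
  least \<open>N\<^sup>2 * c\<^sup>2 * h powr (2 * \<delta>)\<close>. A factor 1 / N is left over in
  the decaying part; since N is at least of order \<open>h powr (- d)\<close>, it cancels the
  \<open>- d\<close> in the exponent of the lattice sum.\<close>

lemma block_sum_ratio:
  fixes q :: "'a::euclidean_space" and \<kappa> :: "'a \<Rightarrow> 'a \<Rightarrow> real" and blk :: "'a \<Rightarrow> 'b"
  assumes \<pi>: "0 < \<pi>" "\<pi> < real DIM('a)" and l: "0 < l" and h: "0 < h" "h \<le> 1" "8 * h \<le> l"
    and S: "finite S" "S \<subseteq> cube q l \<inter> regular_lattice x h"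
    and sub: "\<And>s. s \<in> regular_lattice x h \<Longrightarrow> (\<And>b. b \<in> Basis \<Longrightarrow> q \<bullet> b + h \<le> s \<bullet> b \<and> s \<bullet> b \<le> q \<bullet> b + l - h) \<Longrightarrow> s \<in> S"
    and A: "0 \<le> A" "0 \<le> B" and c: "0 < c" "real (card S) * (c * h powr \<delta>) \<le> v"
    and \<kappa>: "\<And>s t. s \<in> S \<Longrightarrow> t \<in> S \<Longrightarrow> blk s = blk t \<Longrightarrow>
       \<bar>\<kappa> s t\<bar> \<le> A * h powr a * (1 + norm (s - t) / h) powr (- \<pi>) + B * h powr b"
  shows "(\<Sum>s\<in>S. \<Sum>t\<in>{t\<in>S. blk s = blk t}. \<bar>\<kappa> s t\<bar>) / v\<^sup>2
     \<le> A * (2 * (1 + l) powr (1 - \<pi> / DIM('a)) / (1 - \<pi> / DIM('a))) ^ DIM('a) / (l / 2) ^ DIM('a) / c\<^sup>2 * h powr (a - 2 * \<delta> + \<pi>)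
       + B / c\<^sup>2 * h powr (b - 2 * \<delta>)"
proof -
  let ?d = "DIM('a)"
  define N where "N = real (card S)"
  define CL where "CL = (2 * (1 + l) powr (1 - \<pi> / ?d) / (1 - \<pi> / ?d)) ^ ?d"
  have rd: "\<pi> / ?d < 1" using \<pi> by simp
  have CL: "0 \<le> CL" unfolding CL_def using rd by (intro zero_le_power divide_nonneg_nonneg) auto
  define cN where "cN = (l / 2) ^ ?d"
  have cN: "0 < cN" using l by (simp add: cN_def)
  have N: "cN * h powr (- real ?d) \<le> N"
    unfolding cN_def N_def by (rule lattice_inner_card[OF h(1,3) S(1) sub])
  have hp: "0 < h powr y" for y using h by simp
  have N0: "0 < N" by (rule less_le_trans[OF _ N]) (use cN hp in simp)
  have "(\<Sum>s\<in>S. \<Sum>t\<in>{t\<in>S. blk s = blk t}. \<bar>\<kappa> s t\<bar>)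
     \<le> (\<Sum>s\<in>S. \<Sum>t\<in>{t\<in>S. blk s = blk t}. A * h powr a * (1 + norm (s - t) / h) powr (- \<pi>) + B * h powr b)"
    by (intro sum_mono \<kappa>) auto
  also have "\<dots> \<le> (\<Sum>s\<in>S. \<Sum>t\<in>S. A * h powr a * (1 + norm (s - t) / h) powr (- \<pi>) + B * h powr b)"
    using A S by (intro sum_mono sum_mono2) auto
  also have "\<dots> = (\<Sum>s\<in>S. A * h powr a * (\<Sum>t\<in>S. (1 + norm (s - t) / h) powr (- \<pi>))) + N\<^sup>2 * (B * h powr b)"
    by (simp add: sum.distrib sum_distrib_left N_def power2_eq_square)
  also have "\<dots> \<le> (\<Sum>s\<in>S. A * h powr a * (CL * h powr (\<pi> - ?d))) + N\<^sup>2 * (B * h powr b)"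
    unfolding CL_def using A by (intro add_right_mono sum_mono mult_left_mono lattice_sum_bound[OF \<pi> l h(1,2) S]) auto
  also have "\<dots> = N * (A * CL * (h powr a * h powr (\<pi> - ?d))) + N\<^sup>2 * (B * h powr b)"
    by (simp add: N_def mult_ac)
  also have "\<dots> = N * (A * CL * h powr (a + \<pi> - ?d)) + N\<^sup>2 * (B * h powr b)"
    by (simp add: powr_add[symmetric] add_diff_eq)
  finally have top: "(\<Sum>s\<in>S. \<Sum>t\<in>{t\<in>S. blk s = blk t}. \<bar>\<kappa> s t\<bar>)
     \<le> N * (A * CL * h powr (a + \<pi> - ?d)) + N\<^sup>2 * (B * h powr b)" .
  have v0: "0 < N * (c * h powr \<delta>)" using N0 c hp by simp
  have v2: "(N * (c * h powr \<delta>))\<^sup>2 \<le> v\<^sup>2" using c v0 by (intro power_mono) (auto simp: N_def)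
  have vv: "(N * (c * h powr \<delta>))\<^sup>2 = N\<^sup>2 * (c\<^sup>2 * h powr (2 * \<delta>))"
    using h powr_add[of h \<delta> \<delta>] by (simp add: power_mult_distrib power2_eq_square)
  have "(\<Sum>s\<in>S. \<Sum>t\<in>{t\<in>S. blk s = blk t}. \<bar>\<kappa> s t\<bar>) / v\<^sup>2
     \<le> (N * (A * CL * h powr (a + \<pi> - ?d)) + N\<^sup>2 * (B * h powr b)) / (N\<^sup>2 * (c\<^sup>2 * h powr (2 * \<delta>)))"
    using top v2 v0 A CL N0 unfolding vv[symmetric] by (intro frac_le) (auto intro!: add_nonneg_nonneg mult_nonneg_nonneg)
  also have "\<dots> = A * CL / c\<^sup>2 * (h powr (a + \<pi> - ?d) / h powr (2 * \<delta>)) / N + B / c\<^sup>2 * (h powr b / h powr (2 * \<delta>))"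
    using N0 c by (simp add: add_divide_distrib power2_eq_square mult_ac)
  also have "\<dots> = A * CL / c\<^sup>2 * h powr (a - 2 * \<delta> + \<pi> - ?d) / N + B / c\<^sup>2 * h powr (b - 2 * \<delta>)"
    by (simp add: powr_diff[symmetric] algebra_simps)
  also have "\<dots> \<le> A * CL / c\<^sup>2 * h powr (a - 2 * \<delta> + \<pi> - ?d) / (cN * h powr (- real ?d)) + B / c\<^sup>2 * h powr (b - 2 * \<delta>)"
    using N cN hp A CL by (intro add_right_mono divide_left_mono mult_nonneg_nonneg divide_nonneg_nonneg mult_pos_pos) (auto simp: N0)
  also have "A * CL / c\<^sup>2 * h powr (a - 2 * \<delta> + \<pi> - ?d) / (cN * h powr (- real ?d)) = A * CL / cN / c\<^sup>2 * h powr (a - 2 * \<delta> + \<pi>)"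
  proof -
    have "h powr (a - 2 * \<delta> + \<pi> - ?d) = h powr (a - 2 * \<delta> + \<pi>) * h powr (- real ?d)"
      unfolding powr_add[symmetric] by simp
    then show ?thesis using hp[of "- real ?d"] by (simp add: field_simps)
  qed
  finally show ?thesis unfolding CL_def cN_def .
qed

lemma DIM1_Basis:
  assumes "DIM('a::euclidean_space) = 1" "b \<in> (Basis :: 'a set)"
  shows "Basis = {b}" "(u \<bullet> b) *\<^sub>R b = u" "norm u = \<bar>u \<bullet> b\<bar>"
proof -
  show B: "Basis = {b}" using assms by (metis card_1_singletonE singletonD)
  show e: "(u \<bullet> b) *\<^sub>R b = u" using euclidean_representation[of u] unfolding B by simp
  have "norm ((u \<bullet> b) *\<^sub>R b) = \<bar>u \<bullet> b\<bar>" using assms by simp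
  then show "norm u = \<bar>u \<bullet> b\<bar>" unfolding e .
qed

section \<open>Smoothness of the cross-covariance\<close>

context gaussian_pair
begin

text \<open>Mean square continuity of X carries over by the inequality between arithmetic and
  geometric means with a free weight \<open>a\<close>: a large \<open>a\<close> makes the share of
  the variance \<open>G\<close> of W small, and then u near 0 handles the other term. The purpose is
  to exclude a jump of the remainder at the origin.\<close>

lemma cross_covariance_continuous:
  assumes CX: "(\<lambda>u. covariance M (X u) (X 0)) \<midarrow>0\<rightarrow> covariance M (X 0) (X 0)"
  shows "(\<lambda>u. covariance M (X u) (W 0)) \<midarrow>0\<rightarrow> covariance M (X 0) (W 0)"
proof -
  let ?C = "\<lambda>u. covariance M (X u) (X 0)" and ?D = "\<lambda>u. covariance M (X u) (W 0)"
  define G where "G = covariance M (W 0) (W 0)"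
  define \<nu> where "\<nu> = (\<integral>\<omega>. W 0 \<omega> \<partial>M)"
  have Gnn: "0 \<le> G" unfolding G_def covariance_def by (intro integral_nonneg_AE) auto
  have alt: "covariance M (X s) (X t) = (\<integral>\<omega>. X s \<omega> * X t \<omega> \<partial>M) - (\<integral>\<omega>. X 0 \<omega> \<partial>M)\<^sup>2"
    "covariance M (X s) (W t) = (\<integral>\<omega>. X s \<omega> * W t \<omega> \<partial>M) - (\<integral>\<omega>. X 0 \<omega> \<partial>M) * \<nu>"
    "covariance M (W s) (W t) = (\<integral>\<omega>. W s \<omega> * W t \<omega> \<partial>M) - \<nu>\<^sup>2" for s t
    by (auto simp: covariance_alt mean_const(1)[of s] mean_const(1)[of t] mean_const(2)[of s] mean_const(2)[of t] \<nu>_def power2_eq_square)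
  have key: "\<bar>?D u - ?D 0\<bar> \<le> a * (?C 0 - ?C u) + G / (2 * a)" if a: "0 < a" for u a
  proof -
    have e: "?D u - ?D 0 = (\<integral>\<omega>. (X u \<omega> - X 0 \<omega>) * (W 0 \<omega> - \<nu>) \<partial>M)"
      by (simp add: alt left_diff_distrib right_diff_distrib mean_const(1)[of u])
    have e2: "(\<integral>\<omega>. (X u \<omega> - X 0 \<omega>)\<^sup>2 \<partial>M) = 2 * (?C 0 - ?C u)"
    proof -
      have "covariance M (X u) (X u) = ?C 0" using covariance_stationary(1)[of u u] by simp
      moreover have "(\<integral>\<omega>. X 0 \<omega> * X u \<omega> \<partial>M) = (\<integral>\<omega>. X u \<omega> * X 0 \<omega> \<partial>M)" by (simp add: mult.commute)
      ultimately show ?thesis by (simp add: alt power2_eq_square left_diff_distrib right_diff_distrib)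
    qed
    have e3: "(\<integral>\<omega>. (W 0 \<omega> - \<nu>)\<^sup>2 \<partial>M) = G"
      by (simp add: G_def covariance_def \<nu>_def power2_eq_square)
    have i: "integrable M (\<lambda>\<omega>. (X u \<omega> - X 0 \<omega>) * (W 0 \<omega> - \<nu>))" "integrable M (\<lambda>\<omega>. (X u \<omega> - X 0 \<omega>)\<^sup>2)" "integrable M (\<lambda>\<omega>. (W 0 \<omega> - \<nu>)\<^sup>2)"
      by (auto simp: power2_eq_square left_diff_distrib right_diff_distrib)
    have am: "\<bar>f * g\<bar> \<le> a / 2 * f\<^sup>2 + 1 / (2 * a) * g\<^sup>2" for f g :: real
    proof -
      have "0 \<le> (a * \<bar>f\<bar> - \<bar>g\<bar>)\<^sup>2" by simp
      then have "2 * a * \<bar>f * g\<bar> \<le> a\<^sup>2 * f\<^sup>2 + g\<^sup>2" by (simp add: power2_diff power_mult_distrib abs_mult algebra_simps)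
      then have "2 * a * \<bar>f * g\<bar> / (2 * a) \<le> (a\<^sup>2 * f\<^sup>2 + g\<^sup>2) / (2 * a)" using a by (intro divide_right_mono) auto
      then show ?thesis using a by (simp add: add_divide_distrib power2_eq_square)
    qed
    have "\<bar>?D u - ?D 0\<bar> \<le> (\<integral>\<omega>. \<bar>(X u \<omega> - X 0 \<omega>) * (W 0 \<omega> - \<nu>)\<bar> \<partial>M)"
      unfolding e by (rule integral_abs_bound)
    also have "\<dots> \<le> (\<integral>\<omega>. a / 2 * (X u \<omega> - X 0 \<omega>)\<^sup>2 + 1 / (2 * a) * (W 0 \<omega> - \<nu>)\<^sup>2 \<partial>M)"
      by (intro integral_mono am integrable_abs i Bochner_Integration.integrable_add integrable_mult_right)
    also have "\<dots> = a / 2 * (\<integral>\<omega>. (X u \<omega> - X 0 \<omega>)\<^sup>2 \<partial>M) + 1 / (2 * a) * (\<integral>\<omega>. (W 0 \<omega> - \<nu>)\<^sup>2 \<partial>M)"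
      using i by (subst Bochner_Integration.integral_add) auto
    finally show ?thesis unfolding e2 e3 by (simp add: right_diff_distrib diff_divide_distrib)
  qed
  show ?thesis
  proof (rule tendstoI)
    fix \<epsilon> :: real assume \<epsilon>: "0 < \<epsilon>"
    define a where "a = (G + 1) / \<epsilon>"
    have a: "0 < a" using Gnn \<epsilon> by (simp add: a_def)
    have "\<forall>\<^sub>F u in at 0. dist (?C u) (?C 0) < \<epsilon> / (4 * a)"
      by (rule tendstoD[OF CX]) (use a \<epsilon> in simp)
    then show "\<forall>\<^sub>F u in at 0. dist (?D u) (?D 0) < \<epsilon>"
    proof eventually_elim
      case (elim u)
      then have "?C 0 - ?C u \<le> \<epsilon> / (4 * a)" by (simp add: dist_real_def)
      then have "a * (?C 0 - ?C u) \<le> a * (\<epsilon> / (4 * a))" using a by (intro mult_left_mono) auto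
      also have "\<dots> = \<epsilon> / 4" using a by simp
      finally have "a * (?C 0 - ?C u) \<le> \<epsilon> / 4" .
      moreover have "G / (2 * a) \<le> \<epsilon> / 2"
        using Gnn \<epsilon> by (simp add: a_def field_simps)
      ultimately have "\<bar>?D u - ?D 0\<bar> < \<epsilon>" using key[OF a, of u] \<epsilon> by linarith
      then show ?case by (simp add: dist_real_def)
    qed
  qed
qed

lemma cross_covariance_power_smooth:
  assumes CX: "(\<lambda>u. covariance M (X u) (X 0)) \<midarrow>0\<rightarrow> covariance M (X 0) (X 0)"
    and sm: "smooth_cross_covariance \<alpha> (\<lambda>u. covariance M (X u) (W 0)) (\<lambda>u. covariance M (W u) (X 0))"
  shows "power_smooth (min \<alpha> 2) (\<lambda>u. covariance M (X u) (W 0))" "power_smooth (min \<alpha> 2) (\<lambda>u. covariance M (W u) (X 0))"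
proof -
  let ?D = "\<lambda>u. covariance M (X u) (W 0)" and ?E = "\<lambda>u. covariance M (W u) (X 0)"
  have E: "?E u = ?D (- u)" for u
  proof -
    have "?E u = covariance M (X 0) (W u)" unfolding covariance_def by (simp add: mult.commute)
    also have "\<dots> = ?D (- u)" using covariance_stationary(2)[of 0 u] by simp
    finally show ?thesis .
  qed
  have "power_smooth (min \<alpha> 2) ?D \<and> power_smooth (min \<alpha> 2) ?E"
  proof (cases "DIM('a) = 1")
    case True
    obtain b :: 'a where b: "b \<in> Basis" using nonempty_Basis by blast
    have s1: "smooth_1d \<alpha> (\<lambda>t. ?D (t *\<^sub>R b))" using sm True b by (simp add: smooth_cross_covariance_def)
    \<comment> \<open>In dimension one the decomposition is even, so the cross-covariance agrees
      near 0 with its reflection, which is the cross-covariance with the roles exchanged.\<close>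
    obtain L where L: "0 < L" "\<And>t. t \<in> {-L..L} \<Longrightarrow> ?D ((- t) *\<^sub>R b) = ?D (t *\<^sub>R b)"
      using smooth_1d_power_smooth(2)[OF s1] by auto
    have P: "power_smooth (min \<alpha> 2) (\<lambda>u::'a. ?D (norm u *\<^sub>R b))" by (rule smooth_1d_power_smooth(1)[OF s1])
    have D: "?D u = ?D (norm u *\<^sub>R b)" "?D (- u) = ?D (norm u *\<^sub>R b)" if "norm u < L" for u
    proof -
      note r = DIM1_Basis(2,3)[OF True b]
      have m: "u \<bullet> b \<in> {-L..L}" using that r(2)[of u] by auto
      have "?D (- u) = ?D u" using L(2)[OF m] r(1)[of u] by simp
      moreover have "norm u = u \<bullet> b \<or> norm u = - (u \<bullet> b)" using r(2)[of u] by auto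
      then have "?D (norm u *\<^sub>R b) = ?D u \<or> ?D (norm u *\<^sub>R b) = ?D (- u)"
        using r(1)[of u] r(1)[of "- u"] by auto
      ultimately show "?D u = ?D (norm u *\<^sub>R b)" "?D (- u) = ?D (norm u *\<^sub>R b)" by auto
    qed
    show ?thesis
      using power_smooth_cong[OF P L(1)] D E by simp
  next
    case False
    then have "DIM('a) > 1" using DIM_positive[where 'a='a] by linarith
    with sm have eq: "?D = ?E" and ex: "\<exists>K r. (\<forall>u. ?D u = K (norm u) + r u) \<and> smooth_1d \<alpha> (\<lambda>t. K \<bar>t\<bar>) \<and> small_remainder \<alpha> r"
      unfolding smooth_cross_covariance_def by blast+
    from ex obtain K r where K: "\<And>u. ?D u = K (norm u) + r u" and s1: "smooth_1d \<alpha> (\<lambda>t. K \<bar>t\<bar>)" and sr: "small_remainder \<alpha> r"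
      by blast
    have \<alpha>: "0 < \<alpha>" using s1 unfolding smooth_1d_def by (elim conjE)
    \<comment> \<open>\<open>small_remainder\<close> leaves \<open>r 0\<close> free. Continuity of
      the cross-covariance and of K makes r continuous at 0, and the bound on r gives the limit
      0.\<close>
    have r0: "r 0 = 0"
    proof -
      obtain L where L: "0 < L" "continuous_on {-L..L} (\<lambda>t. K \<bar>t\<bar>)"
        using smooth_1d_power_smooth(2)[OF s1] by auto
      have "continuous (at 0 within {-L..L}) (\<lambda>t. K \<bar>t\<bar>)" using L by (simp add: continuous_on_eq_continuous_within)
      moreover have "at 0 within {-L..L} = at (0::real)" using L by (intro at_within_interior) auto
      ultimately have "isCont (\<lambda>t. K \<bar>t\<bar>) 0" by simp
      then have "isCont (\<lambda>u::'a. K \<bar>norm u\<bar>) 0"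
        using isCont_o2[of 0 "norm :: 'a \<Rightarrow> real" "\<lambda>t. K \<bar>t\<bar>"] by simp
      then have k: "(\<lambda>u::'a. K (norm u)) \<midarrow>0\<rightarrow> K 0" by (simp add: isCont_def)
      have "(\<lambda>u. ?D u - K (norm u)) \<midarrow>0\<rightarrow> ?D 0 - K 0"
        by (intro tendsto_diff cross_covariance_continuous[OF CX] k)
      then have l1: "r \<midarrow>0\<rightarrow> r 0" using K by simp
      obtain R D where R: "0 < R" and D0: "\<And>u. 0 < norm u \<Longrightarrow> norm u < R \<Longrightarrow> D [] u = r u"
        and "\<And>bs b u. bs \<in> lists Basis \<Longrightarrow> b \<in> Basis \<Longrightarrow> 0 < norm u \<Longrightarrow> norm u < R \<Longrightarrow>
           ((\<lambda>t. D bs (u + t *\<^sub>R b)) has_real_derivative D (b # bs) u) (at 0)"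
        and D2: "\<And>bs. bs \<in> lists Basis \<Longrightarrow> D bs \<in> o[at 0](\<lambda>u. norm u powr (\<alpha> - real (length bs)))"
        using sr unfolding small_remainder_def by blast
      have "\<forall>\<^sub>F u in at 0. norm (D [] u) \<le> norm u powr \<alpha>"
        using landau_o.smallD[OF D2[of "[]"], of 1] by simp
      moreover have "\<forall>\<^sub>F u in at (0::'a). 0 < norm u \<and> norm u < R"
        unfolding eventually_at using R by (intro exI[of _ R]) (auto simp: dist_norm)
      ultimately have b: "\<forall>\<^sub>F u in at 0. norm (r u) \<le> norm u powr \<alpha>"
        by eventually_elim (simp add: D0)
      have "((\<lambda>u::'a. norm u powr \<alpha>) \<longlongrightarrow> 0 powr \<alpha>) (at 0)"
        by (rule tendsto_powr2) (use \<alpha> in \<open>auto intro!: tendsto_norm_zero tendsto_ident_at always_eventually\<close>)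
      then have "r \<midarrow>0\<rightarrow> 0" by (intro Lim_null_comparison[OF b]) simp
      with l1 show "r 0 = 0" by (rule LIM_unique)
    qed
    have "power_smooth (min \<alpha> 2) (\<lambda>u::'a. K (norm u))" using smooth_1d_power_smooth(1)[OF s1] by simp
    moreover have "power_smooth (min \<alpha> 2) r" by (rule power_smooth_mono[OF small_remainder_power_smooth[OF sr r0]]) simp
    ultimately have "power_smooth (min \<alpha> 2) (\<lambda>u. K (norm u) + r u)" by (rule power_smooth_add)
    then have "power_smooth (min \<alpha> 2) ?D" using K by simp
    then show ?thesis using eq by simp
  qed
  then show "power_smooth (min \<alpha> 2) ?D" "power_smooth (min \<alpha> 2) ?E" by auto
qed

end

section \<open>Consistency of the least squares estimators\<close>

context gaussian_pair
begin

lemma stencil_ols_consistent: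
  fixes V V' :: "'a set" and q :: 'a and x :: "nat \<Rightarrow> 'a" and S :: "nat \<Rightarrow> 'a set"
  assumes st: "difference_stencil V w V' K"
    and pX: "0 < \<sigma>X" "0 < \<phi>X" "0 < \<delta>X" "\<delta>X < 2" "0 < \<kappa>X"
    and pW: "0 < \<sigma>W" "0 < \<phi>W" "0 < \<delta>W" "\<delta>W < 2" "0 < \<kappa>W"
    and CX: "\<And>s t. covariance M (X s) (X t) = generalized_cauchy \<sigma>X \<phi>X \<delta>X \<kappa>X (s - t)"
    and CW: "\<And>s t. covariance M (W s) (W t) = generalized_cauchy \<sigma>W \<phi>W \<delta>W \<kappa>W (s - t)"
    and sm: "smooth_cross_covariance \<alpha> (\<lambda>u. covariance M (X u) (W 0)) (\<lambda>u. covariance M (W u) (X 0))"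
    and \<alpha>: "\<delta>X < \<alpha>" and gap: "\<delta>X < \<delta>W + real DIM('a)"
    and l: "0 < l" and h: "\<And>n. 0 < h n" "h \<longlonglongrightarrow> 0"
    and S: "\<And>n. S n \<subseteq> cube q l \<inter> regular_lattice (x n) (h n)"
    and sub: "\<And>n s. s \<in> regular_lattice (x n) (h n) \<Longrightarrow>
       (\<And>b. b \<in> Basis \<Longrightarrow> q \<bullet> b + h n \<le> s \<bullet> b \<and> s \<bullet> b \<le> q \<bullet> b + l - h n) \<Longrightarrow> s \<in> S n"
    and \<epsilon>: "0 < \<epsilon>"
  defines "U \<equiv> \<lambda>n s \<omega>. stencil V w (h n) (\<lambda>t. X t \<omega>) s" and "Z \<equiv> \<lambda>n s \<omega>. stencil V w (h n) (\<lambda>t. W t \<omega>) s"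
  shows "(\<lambda>n. prob {\<omega>\<in>space M. (\<Sum>s\<in>S n. U n s \<omega> * U n s \<omega>) = 0 \<or>
      \<epsilon> < \<bar>(\<Sum>s\<in>S n. U n s \<omega> * Z n s \<omega>) / (\<Sum>s\<in>S n. U n s \<omega> * U n s \<omega>)\<bar>}) \<longlonglongrightarrow> 0"
proof -
  interpret st: difference_stencil V w V' K by fact
  let ?d = "real DIM('a)"
  let ?CX = "\<lambda>u. covariance M (X u) (X 0)" and ?CW = "\<lambda>u. covariance M (W u) (W 0)"
  let ?C12 = "\<lambda>u. covariance M (X u) (W 0)" and ?C21 = "\<lambda>u. covariance M (W u) (X 0)"
  define cX where "cX n = stencil_cov V w (h n) ?CX" for n
  define cW where "cW n = stencil_cov V w (h n) ?CW" for n
  define c12 where "c12 n = stencil_cov V w (h n) ?C12" for n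
  define c21 where "c21 n = stencil_cov V w (h n) ?C21" for n
  have CX': "?CX = generalized_cauchy \<sigma>X \<phi>X \<delta>X \<kappa>X" and CW': "?CW = generalized_cauchy \<sigma>W \<phi>W \<delta>W \<kappa>W"
    by (auto simp: CX CW)
  have psX: "power_smooth \<delta>X ?CX" unfolding CX' by (rule generalized_cauchy_power_smooth[OF pX])
  have psW: "power_smooth \<delta>W ?CW" unfolding CW' by (rule generalized_cauchy_power_smooth[OF pW])
  have "?CX \<midarrow>0\<rightarrow> ?CX 0"
  proof -
    have "((\<lambda>u::'a. norm u powr \<delta>X) \<longlongrightarrow> 0 powr \<delta>X) (at 0)"
      by (rule tendsto_powr2) (use pX in \<open>auto intro!: tendsto_norm_zero tendsto_ident_at always_eventually\<close>)
    then have "((\<lambda>u::'a. \<sigma>X * (1 + \<phi>X * norm u powr \<delta>X) powr (- \<kappa>X)) \<longlongrightarrow> \<sigma>X * (1 + \<phi>X * 0) powr (- \<kappa>X)) (at 0)"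
      using pX by (intro tendsto_mult tendsto_powr tendsto_add tendsto_const) auto
    then show ?thesis using pX by (simp add: CX generalized_cauchy_def[abs_def])
  qed
  note ps = cross_covariance_power_smooth[OF this sm]
  \<comment> \<open>The effective exponent of the cross-covariance: second differences of its
    analytic part are of order \<open>h\<^sup>2\<close>, so an \<alpha> beyond 2 gains
    nothing.\<close>
  define \<delta>' where "\<delta>' = min \<alpha> 2"
  have \<delta>': "\<delta>X < \<delta>'" "\<delta>' \<le> 2" "0 < \<delta>'" using \<alpha> pX by (auto simp: \<delta>'_def)
  obtain KX \<rho>X where KX: "0 < KX" "0 < \<rho>X" "\<And>h u. 0 < h \<Longrightarrow> h < \<rho>X \<Longrightarrow> norm u < \<rho>X \<Longrightarrow>
      \<bar>stencil_cov V w h ?CX u\<bar> \<le> KX * h powr \<delta>X * (1 + norm u / h) powr (\<delta>X - 2)"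
    using st.stencil_cov_bound[OF psX] pX by (auto simp del: abs_le_iff)
  obtain KW \<rho>W where KW: "0 < KW" "0 < \<rho>W" "\<And>h u. 0 < h \<Longrightarrow> h < \<rho>W \<Longrightarrow> norm u < \<rho>W \<Longrightarrow>
      \<bar>stencil_cov V w h ?CW u\<bar> \<le> KW * h powr \<delta>W * (1 + norm u / h) powr (\<delta>W - 2)"
    using st.stencil_cov_bound[OF psW] pW by (auto simp del: abs_le_iff)
  obtain K12 \<rho>12 where K12: "0 < K12" "0 < \<rho>12" "\<And>h u. 0 < h \<Longrightarrow> h < \<rho>12 \<Longrightarrow> norm u < \<rho>12 \<Longrightarrow>
      \<bar>stencil_cov V w h ?C12 u\<bar> \<le> K12 * h powr \<delta>' * (1 + norm u / h) powr (\<delta>' - 2)"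
    using st.stencil_cov_bound[OF ps(1)[folded \<delta>'_def]] \<delta>' by (auto simp del: abs_le_iff)
  obtain K21 \<rho>21 where K21: "0 < K21" "0 < \<rho>21" "\<And>h u. 0 < h \<Longrightarrow> h < \<rho>21 \<Longrightarrow> norm u < \<rho>21 \<Longrightarrow>
      \<bar>stencil_cov V w h ?C21 u\<bar> \<le> K21 * h powr \<delta>' * (1 + norm u / h) powr (\<delta>' - 2)"
    using st.stencil_cov_bound[OF ps(2)[folded \<delta>'_def]] \<delta>' by (auto simp del: abs_le_iff)
  obtain c \<rho>c where c: "0 < c" "0 < \<rho>c" "\<And>h. 0 < h \<Longrightarrow> h < \<rho>c \<Longrightarrow> c * h powr \<delta>X \<le> stencil_cov V w h ?CX 0"
    using st.stencil_cov_0_lower[OF pX] unfolding CX' by auto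
  define \<rho> where "\<rho> = min (min (min \<rho>X \<rho>W) (min \<rho>12 \<rho>21)) \<rho>c"
  have \<rho>: "0 < \<rho>" "\<rho> \<le> \<rho>X" "\<rho> \<le> \<rho>W" "\<rho> \<le> \<rho>12" "\<rho> \<le> \<rho>21" "\<rho> \<le> \<rho>c"
    using KX KW K12 K21 c by (auto simp: \<rho>_def)
  have shrink: "(1 + norm u / h) powr (\<delta>' - 2) \<le> 1" if "0 < h" for u :: 'a and h
  proof -
    have "(1 + norm u / h) powr (\<delta>' - 2) \<le> (1 + norm u / h) powr 0"
      using that \<delta>' by (intro powr_mono) auto
    also have "\<dots> = 1" using that by (simp add: add_pos_nonneg less_imp_neq[symmetric])
    finally show ?thesis .
  qed
  have B12: "\<bar>stencil_cov V w h ?C12 u\<bar> \<le> K12 * h powr \<delta>'" "\<bar>stencil_cov V w h ?C21 u\<bar> \<le> K21 * h powr \<delta>'"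
    if "0 < h" "h < \<rho>" "norm u < \<rho>" for h u
  proof -
    have "\<bar>stencil_cov V w h ?C12 u\<bar> \<le> K12 * h powr \<delta>' * (1 + norm u / h) powr (\<delta>' - 2)"
      using that \<rho> by (intro K12(3)) auto
    also have "\<dots> \<le> K12 * h powr \<delta>' * 1" using K12 shrink[OF that(1)] by (intro mult_left_mono) auto
    finally show "\<bar>stencil_cov V w h ?C12 u\<bar> \<le> K12 * h powr \<delta>'" by simp
    have "\<bar>stencil_cov V w h ?C21 u\<bar> \<le> K21 * h powr \<delta>' * (1 + norm u / h) powr (\<delta>' - 2)"
      using that \<rho> by (intro K21(3)) auto
    also have "\<dots> \<le> K21 * h powr \<delta>' * 1" using K21 shrink[OF that(1)] by (intro mult_left_mono) auto
    finally show "\<bar>stencil_cov V w h ?C21 u\<bar> \<le> K21 * h powr \<delta>'" by simp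
  qed
  obtain blk :: "'a \<Rightarrow> 'a \<Rightarrow> int" where blk: "finite (blk ` cube q l)" "\<And>s t. blk s = blk t \<Longrightarrow> norm (s - t) < \<rho>"
    using cube_blocks[OF \<rho>(1)] by blast
  define MB where "MB = real (card (blk ` cube q l))"
  have finS: "finite (S n)" for n
    by (rule finite_subset[OF S lattice_cube_finite[OF h(1)]])
  define v where "v n = real (card (S n)) * cX n 0" for n
  define m where "m n = real (card (S n)) * c12 n 0" for n
  define Num where "Num n \<omega> = (\<Sum>s\<in>S n. U n s \<omega> * Z n s \<omega>)" for n \<omega>
  define Den where "Den n \<omega> = (\<Sum>s\<in>S n. U n s \<omega> * U n s \<omega>)" for n \<omega>
  define h0 where "h0 = min (min \<rho> 1) (l / 8)"
  have h0: "0 < h0" using \<rho> l by (simp add: h0_def)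
  have evh: "\<forall>\<^sub>F n in sequentially. h n < h0" by (rule order_tendstoD(2)[OF h(2) h0])
  have vlow: "real (card (S n)) * (c * h n powr \<delta>X) \<le> v n" if "h n < h0" for n
    unfolding v_def cX_def using c(3)[OF h(1), of n] that \<rho> by (intro mult_left_mono) (auto simp: h0_def)
  have Npos: "0 < real (card (S n))" if "h n < h0" for n
  proof -
    have "(l / 2) ^ DIM('a) * h n powr (- ?d) \<le> real (card (S n))"
      by (rule lattice_inner_card[OF h(1) _ finS sub]) (use that in \<open>auto simp: h0_def\<close>)
    moreover have "0 < (l / 2) ^ DIM('a) * h n powr (- ?d)" using l h(1)[of n] by simp
    ultimately show ?thesis by linarith
  qed
  have vpos: "0 < v n" if "h n < h0" for n
  proof -
    have "0 < real (card (S n)) * (c * h n powr \<delta>X)" using Npos[OF that] c h(1)[of n] by simp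
    then show ?thesis using vlow[OF that] by linarith
  qed
  \<comment> \<open>A decay exponent for the product of the covariances of X and W. The lower bound
    makes the final power \<open>h powr (\<delta>W - \<delta>X + \<pi>)\<close> tend to 0; the upper
    bounds keep \<pi> in the range of the lattice sum and below the decay of the product. The
    interval is nonempty by \<open>gap\<close> and \<open>\<delta>X < 2\<close>.\<close>
  obtain \<pi> where \<pi>: "max 0 (\<delta>X - \<delta>W) < \<pi>" "\<pi> < min ?d (4 - \<delta>X - \<delta>W)"
    using dense[of "max 0 (\<delta>X - \<delta>W)" "min ?d (4 - \<delta>X - \<delta>W)"] gap pX pW by auto
  \<comment> \<open>The same choice for the denominator, where both factors have exponent
    \<open>\<delta>X\<close>; the final power is \<open>h powr \<pi>'\<close>.\<close>
  obtain \<pi>' where \<pi>': "0 < \<pi>'" "\<pi>' < min ?d (4 - 2 * \<delta>X)"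
    using dense[of 0 "min ?d (4 - 2 * \<delta>X)"] pX by auto
  have moments: "integrable M (\<lambda>\<omega>. (Num n \<omega> - m n)\<^sup>2)"
    "(\<integral>\<omega>. (Num n \<omega> - m n)\<^sup>2 \<partial>M) \<le> MB * (\<Sum>s\<in>S n. \<Sum>t\<in>{t\<in>S n. blk s = blk t}. \<bar>cX n (s - t) * cW n (s - t) + c12 n (s - t) * c21 n (s - t)\<bar>)"
    "integrable M (\<lambda>\<omega>. (Den n \<omega> - v n)\<^sup>2)"
    "(\<integral>\<omega>. (Den n \<omega> - v n)\<^sup>2 \<partial>M) \<le> MB * (\<Sum>s\<in>S n. \<Sum>t\<in>{t\<in>S n. blk s = blk t}. \<bar>2 * (cX n (s - t))\<^sup>2\<bar>)" for n
  proof -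
    note mo = stencil_product_moment[OF st.finite_V st.sum_w, where h="h n"]
    have sb: "blk ` S n \<subseteq> blk ` cube q l" using S[of n] by auto
    have N: "Num n \<omega> - m n = (\<Sum>s\<in>S n. U n s \<omega> * Z n s \<omega> - c12 n 0)" for \<omega>
      by (simp add: Num_def m_def sum_subtractf)
    have D: "Den n \<omega> - v n = (\<Sum>s\<in>S n. U n s \<omega> * U n s \<omega> - cX n 0)" for \<omega>
      by (simp add: Den_def v_def sum_subtractf)
    have i1: "integrable M (\<lambda>\<omega>. (U n s \<omega> * Z n s \<omega> - c12 n 0) * (U n t \<omega> * Z n t \<omega> - c12 n 0))" for s t
      unfolding U_def Z_def c12_def by (rule mo(3))
    have i2: "integrable M (\<lambda>\<omega>. (U n s \<omega> * U n s \<omega> - cX n 0) * (U n t \<omega> * U n t \<omega> - cX n 0))" for s t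
      unfolding U_def cX_def by (rule mo(5))
    have e1: "(\<integral>\<omega>. (U n s \<omega> * Z n s \<omega> - c12 n 0) * (U n t \<omega> * Z n t \<omega> - c12 n 0) \<partial>M)
        = cX n (s - t) * cW n (s - t) + c12 n (s - t) * c21 n (s - t)" for s t
      unfolding U_def Z_def c12_def cX_def cW_def c21_def by (rule mo(4))
    have e2: "(\<integral>\<omega>. (U n s \<omega> * U n s \<omega> - cX n 0) * (U n t \<omega> * U n t \<omega> - cX n 0) \<partial>M) = 2 * (cX n (s - t))\<^sup>2" for s t
      unfolding U_def cX_def by (rule mo(6))
    show "integrable M (\<lambda>\<omega>. (Num n \<omega> - m n)\<^sup>2)"
      unfolding N by (rule block_second_moment(1)[OF finS blk(1) sb i1])
    show "integrable M (\<lambda>\<omega>. (Den n \<omega> - v n)\<^sup>2)"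
      unfolding D by (rule block_second_moment(1)[OF finS blk(1) sb i2])
    show "(\<integral>\<omega>. (Num n \<omega> - m n)\<^sup>2 \<partial>M) \<le> MB * (\<Sum>s\<in>S n. \<Sum>t\<in>{t\<in>S n. blk s = blk t}. \<bar>cX n (s - t) * cW n (s - t) + c12 n (s - t) * c21 n (s - t)\<bar>)"
      using block_second_moment(2)[OF finS blk(1) sb i1] unfolding N e1 MB_def .
    show "(\<integral>\<omega>. (Den n \<omega> - v n)\<^sup>2 \<partial>M) \<le> MB * (\<Sum>s\<in>S n. \<Sum>t\<in>{t\<in>S n. blk s = blk t}. \<bar>2 * (cX n (s - t))\<^sup>2\<bar>)"
      using block_second_moment(2)[OF finS blk(1) sb i2] unfolding D e2 MB_def .
  qed
  have MB0: "0 \<le> MB" by (simp add: MB_def)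
  define Q1 where "Q1 = (2 * (1 + l) powr (1 - \<pi> / DIM('a)) / (1 - \<pi> / DIM('a))) ^ DIM('a) / (l / 2) ^ DIM('a) / c\<^sup>2"
  define Q2 where "Q2 = (2 * (1 + l) powr (1 - \<pi>' / DIM('a)) / (1 - \<pi>' / DIM('a))) ^ DIM('a) / (l / 2) ^ DIM('a) / c\<^sup>2"
  \<comment> \<open>The cross term is bounded by a flat \<open>h powr (2 * \<delta>')\<close>
    without decay in the lag. It is counted for all pairs and still becomes negligible because
    \<open>\<delta>X < \<delta>'\<close>.\<close>
  have numb: "(\<integral>\<omega>. (Num n \<omega> - m n)\<^sup>2 \<partial>M) / (v n)\<^sup>2
      \<le> MB * ((KX * KW) * Q1 * h n powr ((\<delta>X + \<delta>W) - 2 * \<delta>X + \<pi>) + (K12 * K21) / c\<^sup>2 * h n powr (2 * \<delta>' - 2 * \<delta>X))"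
    if hn: "h n < h0" for n
  proof -
    have hb: "h n \<le> 1" "8 * h n \<le> l" "h n < \<rho>" using hn by (auto simp: h0_def)
    have "(\<Sum>s\<in>S n. \<Sum>t\<in>{t\<in>S n. blk s = blk t}. \<bar>cX n (s - t) * cW n (s - t) + c12 n (s - t) * c21 n (s - t)\<bar>) / (v n)\<^sup>2
      \<le> (KX * KW) * (2 * (1 + l) powr (1 - \<pi> / DIM('a)) / (1 - \<pi> / DIM('a))) ^ DIM('a) / (l / 2) ^ DIM('a) / c\<^sup>2 * h n powr ((\<delta>X + \<delta>W) - 2 * \<delta>X + \<pi>) + (K12 * K21) / c\<^sup>2 * h n powr (2 * \<delta>' - 2 * \<delta>X)"
    proof (rule block_sum_ratio[OF _ _ l h(1) hb(1,2) finS S sub _ _ c(1) vlow[OF hn]])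
      fix s t assume "blk s = blk t"
      then have n: "norm (s - t) < \<rho>" by (rule blk(2))
      let ?y = "1 + norm (s - t) / h n"
      have y: "1 \<le> ?y" using h(1)[of n] by simp
      have "\<bar>cX n (s - t)\<bar> * \<bar>cW n (s - t)\<bar> \<le> (KX * h n powr \<delta>X * ?y powr (\<delta>X - 2)) * (KW * h n powr \<delta>W * ?y powr (\<delta>W - 2))"
        unfolding cX_def cW_def using n hb \<rho> KX(1) h(1)[of n] by (intro mult_mono KX(3) KW(3)) auto
      also have "\<dots> = KX * KW * (h n powr \<delta>X * h n powr \<delta>W) * (?y powr (\<delta>X - 2) * ?y powr (\<delta>W - 2))"
        by (simp add: mult_ac)
      also have "\<dots> = KX * KW * h n powr (\<delta>X + \<delta>W) * ?y powr (\<delta>X - 2 + (\<delta>W - 2))"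
        by (simp only: powr_add)
      also have "\<dots> \<le> KX * KW * h n powr (\<delta>X + \<delta>W) * ?y powr (- \<pi>)"
        using y \<pi> KX KW by (intro mult_left_mono powr_mono) auto
      finally have a: "\<bar>cX n (s - t) * cW n (s - t)\<bar> \<le> KX * KW * h n powr (\<delta>X + \<delta>W) * ?y powr (- \<pi>)"
        by (simp add: abs_mult)
      have "\<bar>c12 n (s - t)\<bar> * \<bar>c21 n (s - t)\<bar> \<le> (K12 * h n powr \<delta>') * (K21 * h n powr \<delta>')"
        unfolding c12_def c21_def using n hb K12(1) h(1)[of n] by (intro mult_mono B12) auto
      also have "\<dots> = K12 * K21 * (h n powr \<delta>' * h n powr \<delta>')" by (simp add: mult_ac)
      also have "\<dots> = K12 * K21 * h n powr (2 * \<delta>')" unfolding powr_add[symmetric] by simp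
      finally have b: "\<bar>c12 n (s - t) * c21 n (s - t)\<bar> \<le> K12 * K21 * h n powr (2 * \<delta>')"
        by (simp add: abs_mult)
      show "\<bar>cX n (s - t) * cW n (s - t) + c12 n (s - t) * c21 n (s - t)\<bar>
         \<le> KX * KW * h n powr (\<delta>X + \<delta>W) * ?y powr (- \<pi>) + K12 * K21 * h n powr (2 * \<delta>')"
        using a b abs_triangle_ineq[of "cX n (s - t) * cW n (s - t)" "c12 n (s - t) * c21 n (s - t)"] by linarith
    qed (use \<pi> KX KW K12 K21 in auto)
    then have "MB * ((\<Sum>s\<in>S n. \<Sum>t\<in>{t\<in>S n. blk s = blk t}. \<bar>cX n (s - t) * cW n (s - t) + c12 n (s - t) * c21 n (s - t)\<bar>) / (v n)\<^sup>2)
      \<le> MB * ((KX * KW) * Q1 * h n powr ((\<delta>X + \<delta>W) - 2 * \<delta>X + \<pi>) + (K12 * K21) / c\<^sup>2 * h n powr (2 * \<delta>' - 2 * \<delta>X))"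
      using MB0 unfolding Q1_def by (intro mult_left_mono) (simp_all only: times_divide_eq_right)
    moreover have "(\<integral>\<omega>. (Num n \<omega> - m n)\<^sup>2 \<partial>M) / (v n)\<^sup>2 \<le> MB * (\<Sum>s\<in>S n. \<Sum>t\<in>{t\<in>S n. blk s = blk t}. \<bar>cX n (s - t) * cW n (s - t) + c12 n (s - t) * c21 n (s - t)\<bar>) / (v n)\<^sup>2"
      by (rule divide_right_mono[OF moments(2)]) simp
    ultimately show ?thesis by simp
  qed
  have denb: "(\<integral>\<omega>. (Den n \<omega> - v n)\<^sup>2 \<partial>M) / (v n)\<^sup>2
      \<le> MB * ((2 * (KX * KX)) * Q2 * h n powr ((\<delta>X + \<delta>X) - 2 * \<delta>X + \<pi>') + 0 / c\<^sup>2 * h n powr (0 - 2 * \<delta>X))"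
    if hn: "h n < h0" for n
  proof -
    have hb: "h n \<le> 1" "8 * h n \<le> l" "h n < \<rho>" using hn by (auto simp: h0_def)
    have "(\<Sum>s\<in>S n. \<Sum>t\<in>{t\<in>S n. blk s = blk t}. \<bar>2 * (cX n (s - t))\<^sup>2\<bar>) / (v n)\<^sup>2
      \<le> (2 * (KX * KX)) * (2 * (1 + l) powr (1 - \<pi>' / DIM('a)) / (1 - \<pi>' / DIM('a))) ^ DIM('a) / (l / 2) ^ DIM('a) / c\<^sup>2 * h n powr ((\<delta>X + \<delta>X) - 2 * \<delta>X + \<pi>') + 0 / c\<^sup>2 * h n powr (0 - 2 * \<delta>X)"
    proof (rule block_sum_ratio[OF _ _ l h(1) hb(1,2) finS S sub _ _ c(1) vlow[OF hn]])
      fix s t assume "blk s = blk t"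
      then have n: "norm (s - t) < \<rho>" by (rule blk(2))
      let ?y = "1 + norm (s - t) / h n"
      have y: "1 \<le> ?y" using h(1)[of n] by simp
      have "\<bar>cX n (s - t)\<bar> * \<bar>cX n (s - t)\<bar> \<le> (KX * h n powr \<delta>X * ?y powr (\<delta>X - 2)) * (KX * h n powr \<delta>X * ?y powr (\<delta>X - 2))"
        unfolding cX_def using n hb \<rho> KX(1) h(1)[of n] by (intro mult_mono KX(3)) auto
      also have "\<dots> = KX * KX * (h n powr \<delta>X * h n powr \<delta>X) * (?y powr (\<delta>X - 2) * ?y powr (\<delta>X - 2))"
        by (simp add: mult_ac)
      also have "\<dots> = KX * KX * h n powr (\<delta>X + \<delta>X) * ?y powr (\<delta>X - 2 + (\<delta>X - 2))"
        by (simp only: powr_add)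
      also have "\<dots> \<le> KX * KX * h n powr (\<delta>X + \<delta>X) * ?y powr (- \<pi>')"
        using y \<pi>' KX by (intro mult_left_mono powr_mono) auto
      finally show "\<bar>2 * (cX n (s - t))\<^sup>2\<bar> \<le> 2 * (KX * KX) * h n powr (\<delta>X + \<delta>X) * ?y powr (- \<pi>') + 0 * h n powr 0"
        by (simp add: power2_eq_square)
    qed (use \<pi>' KX in auto)
    then have "MB * ((\<Sum>s\<in>S n. \<Sum>t\<in>{t\<in>S n. blk s = blk t}. \<bar>2 * (cX n (s - t))\<^sup>2\<bar>) / (v n)\<^sup>2)
      \<le> MB * ((2 * (KX * KX)) * Q2 * h n powr ((\<delta>X + \<delta>X) - 2 * \<delta>X + \<pi>') + 0 / c\<^sup>2 * h n powr (0 - 2 * \<delta>X))"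
      using MB0 unfolding Q2_def by (intro mult_left_mono) (simp_all only: times_divide_eq_right)
    moreover have "(\<integral>\<omega>. (Den n \<omega> - v n)\<^sup>2 \<partial>M) / (v n)\<^sup>2 \<le> MB * (\<Sum>s\<in>S n. \<Sum>t\<in>{t\<in>S n. blk s = blk t}. \<bar>2 * (cX n (s - t))\<^sup>2\<bar>) / (v n)\<^sup>2"
      by (rule divide_right_mono[OF moments(4)]) simp
    ultimately show ?thesis by simp
  qed
  have "(\<lambda>n. prob {\<omega>\<in>space M. Den n \<omega> = 0 \<or> \<epsilon> < \<bar>Num n \<omega> / Den n \<omega>\<bar>}) \<longlonglongrightarrow> 0"
  proof (rule ratio_tendsto_zero[OF _ _ _ _ moments(1,3) _ _ \<epsilon>])
    have meas: "U n s \<in> borel_measurable M" "Z n s \<in> borel_measurable M" for n s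
      unfolding U_def Z_def using stencil_integrable[OF st.finite_V] by (auto dest: borel_measurable_integrable)
    then show "Num n \<in> borel_measurable M" "Den n \<in> borel_measurable M" for n
      unfolding Num_def Den_def by measurable
    show "\<forall>\<^sub>F n in sequentially. 0 < v n" using evh by eventually_elim (rule vpos)
    show "(\<lambda>n. m n / v n) \<longlonglongrightarrow> 0"
    proof (rule Lim_null_comparison)
      have "(\<lambda>n. K12 / c * h n powr (\<delta>' - \<delta>X)) \<longlonglongrightarrow> K12 / c * 0"
        using \<delta>' by (intro tendsto_mult tendsto_const powr_tendsto_zero h) auto
      then show "(\<lambda>n. K12 / c * h n powr (\<delta>' - \<delta>X)) \<longlonglongrightarrow> 0" by simp
      show "\<forall>\<^sub>F n in sequentially. norm (m n / v n) \<le> K12 / c * h n powr (\<delta>' - \<delta>X)"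
        using evh
      proof eventually_elim
        case (elim n)
        have "\<bar>m n\<bar> \<le> real (card (S n)) * (K12 * h n powr \<delta>')"
          unfolding m_def c12_def abs_mult using B12(1)[of "h n" 0] h(1)[of n] elim \<rho>(1)
          by (simp add: h0_def mult_left_mono)
        then have "norm (m n / v n) \<le> real (card (S n)) * (K12 * h n powr \<delta>') / v n"
          using vpos[OF elim] by (simp add: divide_right_mono)
        also have "\<dots> \<le> real (card (S n)) * (K12 * h n powr \<delta>') / (real (card (S n)) * (c * h n powr \<delta>X))"
          using vlow[OF elim] vpos[OF elim] Npos[OF elim] c(1) h(1)[of n] K12(1) by (intro divide_left_mono) auto
        also have "\<dots> = K12 / c * h n powr (\<delta>' - \<delta>X)"
          using Npos[OF elim] by (simp add: powr_diff)
        finally show ?case .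
      qed
    qed
    show "(\<lambda>n. (\<integral>\<omega>. (Num n \<omega> - m n)\<^sup>2 \<partial>M) / (v n)\<^sup>2) \<longlonglongrightarrow> 0"
    proof (rule Lim_null_comparison)
      have "(\<lambda>n. MB * ((KX * KW) * Q1 * h n powr ((\<delta>X + \<delta>W) - 2 * \<delta>X + \<pi>) + (K12 * K21) / c\<^sup>2 * h n powr (2 * \<delta>' - 2 * \<delta>X)))
          \<longlonglongrightarrow> MB * ((KX * KW) * Q1 * 0 + (K12 * K21) / c\<^sup>2 * 0)"
        using \<delta>' \<pi> by (intro tendsto_mult tendsto_add tendsto_const powr_tendsto_zero h) auto
      then show "(\<lambda>n. MB * ((KX * KW) * Q1 * h n powr ((\<delta>X + \<delta>W) - 2 * \<delta>X + \<pi>) + (K12 * K21) / c\<^sup>2 * h n powr (2 * \<delta>' - 2 * \<delta>X))) \<longlonglongrightarrow> 0" by simp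
      show "\<forall>\<^sub>F n in sequentially. norm ((\<integral>\<omega>. (Num n \<omega> - m n)\<^sup>2 \<partial>M) / (v n)\<^sup>2) \<le> MB * ((KX * KW) * Q1 * h n powr ((\<delta>X + \<delta>W) - 2 * \<delta>X + \<pi>) + (K12 * K21) / c\<^sup>2 * h n powr (2 * \<delta>' - 2 * \<delta>X))"
        using evh by eventually_elim (use numb in simp)
    qed
    show "(\<lambda>n. (\<integral>\<omega>. (Den n \<omega> - v n)\<^sup>2 \<partial>M) / (v n)\<^sup>2) \<longlonglongrightarrow> 0"
    proof (rule Lim_null_comparison)
      have "(\<lambda>n. MB * ((2 * (KX * KX)) * Q2 * h n powr ((\<delta>X + \<delta>X) - 2 * \<delta>X + \<pi>') + 0 / c\<^sup>2 * h n powr (0 - 2 * \<delta>X)))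
          \<longlonglongrightarrow> MB * ((2 * (KX * KX)) * Q2 * 0 + 0)"
        using \<pi>' by (intro tendsto_mult tendsto_add tendsto_const powr_tendsto_zero h) auto
      then show "(\<lambda>n. MB * ((2 * (KX * KX)) * Q2 * h n powr ((\<delta>X + \<delta>X) - 2 * \<delta>X + \<pi>') + 0 / c\<^sup>2 * h n powr (0 - 2 * \<delta>X))) \<longlonglongrightarrow> 0" by simp
      show "\<forall>\<^sub>F n in sequentially. norm ((\<integral>\<omega>. (Den n \<omega> - v n)\<^sup>2 \<partial>M) / (v n)\<^sup>2) \<le> MB * ((2 * (KX * KX)) * Q2 * h n powr ((\<delta>X + \<delta>X) - 2 * \<delta>X + \<pi>') + 0 / c\<^sup>2 * h n powr (0 - 2 * \<delta>X))"
        using evh by eventually_elim (use denb in simp)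
    qed
  qed
  then show ?thesis unfolding Num_def Den_def .
qed

end

lemma measurable_fst_borel: "(fst :: real \<times> real \<Rightarrow> real) \<in> borel_measurable borel"
  by (intro borel_measurable_continuous_onI continuous_intros)

lemma measurable_snd_borel: "(snd :: real \<times> real \<Rightarrow> real) \<in> borel_measurable borel"
  by (intro borel_measurable_continuous_onI continuous_intros)

lemma ols_scale: "c \<noteq> 0 \<Longrightarrow> ols S (\<lambda>s. c * U s) (\<lambda>s. c * V s) = ols S U V"
proof -
  assume "c \<noteq> 0"
  have "(\<Sum>s\<in>S. (c * U s) * (c * V s)) = c\<^sup>2 * (\<Sum>s\<in>S. U s * V s)"
    "(\<Sum>s\<in>S. (c * U s)\<^sup>2) = c\<^sup>2 * (\<Sum>s\<in>S. (U s)\<^sup>2)"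
    by (simp_all add: sum_distrib_left power2_eq_square mult_ac)
  then show ?thesis using \<open>c \<noteq> 0\<close> by (simp add: ols_def)
qed

text \<open>The transform of Y is \<beta> times that of X plus that of W, so the estimation error is
  the quotient treated in \<open>stencil_ols_consistent\<close>. The condition \<open>SD\<close>
  keeps all points in use inside \<open>D\<close>, where the observations are defined.\<close>

lemma stencil_ols_consistent_estimator:
  fixes D V V' :: "'a::euclidean_space set" and q :: 'a and x :: "nat \<Rightarrow> 'a" and S :: "nat \<Rightarrow> 'a set"
  assumes st: "difference_stencil V w V' K"
    and gap: "\<delta>X < \<delta>W + real DIM('a)"
    and l: "0 < l" and h: "\<And>n. 0 < h n" "h \<longlonglongrightarrow> 0"
    and S: "\<And>n. S n \<subseteq> cube q l \<inter> regular_lattice (x n) (h n)"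
    and sub: "\<And>n s. s \<in> regular_lattice (x n) (h n) \<Longrightarrow>
       (\<And>b. b \<in> Basis \<Longrightarrow> q \<bullet> b + h n \<le> s \<bullet> b \<and> s \<bullet> b \<le> q \<bullet> b + l - h n) \<Longrightarrow> s \<in> S n"
    and SD: "\<And>n s v. s \<in> S n \<Longrightarrow> v \<in> V \<Longrightarrow> s + h n *\<^sub>R v \<in> D"
  shows "consistent_estimator D (model_laws \<delta>X \<delta>W)
    (\<lambda>n z. ols (S n) (stencil V w (h n) (\<lambda>s. fst (z s))) (stencil V w (h n) (\<lambda>s. snd (z s))))"
  unfolding consistent_estimator_def
proof (intro conjI allI ballI impI)
  interpret st: difference_stencil V w V' K by fact
  fix n
  have c: "(\<lambda>z. z t :: real \<times> real) \<in> measurable (PiM D (\<lambda>_. borel)) borel" if "t \<in> D" for t :: 'a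
    using that by (rule measurable_component_singleton)
  have c1: "(\<lambda>z. fst (z t :: real \<times> real)) \<in> borel_measurable (PiM D (\<lambda>_. borel))"
    "(\<lambda>z. snd (z t :: real \<times> real)) \<in> borel_measurable (PiM D (\<lambda>_. borel))" if "t \<in> D" for t :: 'a
    using measurable_compose[OF c[OF that] measurable_fst_borel] measurable_compose[OF c[OF that] measurable_snd_borel]
    by auto
  have m: "(\<lambda>z. stencil V w (h n) (\<lambda>s. fst (z s :: real \<times> real)) s) \<in> borel_measurable (PiM D (\<lambda>_. borel))" if "s \<in> S n" for s
    unfolding stencil_def by (intro borel_measurable_sum borel_measurable_times borel_measurable_const c1 SD that)
  have m': "(\<lambda>z. stencil V w (h n) (\<lambda>s. snd (z s :: real \<times> real)) s) \<in> borel_measurable (PiM D (\<lambda>_. borel))" if "s \<in> S n" for s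
    unfolding stencil_def by (intro borel_measurable_sum borel_measurable_times borel_measurable_const c1 SD that)
  show "(\<lambda>z. ols (S n) (stencil V w (h n) (\<lambda>s. fst (z s))) (stencil V w (h n) (\<lambda>s. snd (z s))))
      \<in> borel_measurable (PiM D (\<lambda>_. borel))"
    unfolding ols_def power2_eq_square
    by (intro borel_measurable_divide borel_measurable_sum borel_measurable_times m m')
next
  interpret st: difference_stencil V w V' K by fact
  fix \<beta> \<epsilon> :: real and P :: "('a \<Rightarrow> real \<times> real) measure" assume P: "P \<in> model_laws \<delta>X \<delta>W" and \<epsilon>: "0 < \<epsilon>"
  let ?X = "\<lambda>(s::'a) (\<omega> :: 'a \<Rightarrow> real \<times> real). fst (\<omega> s)" and ?W = "\<lambda>(s::'a) (\<omega> :: 'a \<Rightarrow> real \<times> real). snd (\<omega> s)"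
  have adm: "prob_space P" "admissible_field \<delta>X \<delta>W P ?X ?W" using P by (auto simp: model_laws_def)
  interpret gaussian_pair P ?X ?W
    using adm by (intro gaussian_pair.intro gaussian_pair_axioms.intro) (auto simp: admissible_field_def)
  from adm(2) obtain \<kappa>X where "has_generalized_cauchy_covariance P ?X \<delta>X \<kappa>X"
    unfolding admissible_field_def by blast
  then obtain \<sigma>X \<phi>X where X: "0 < \<delta>X" "\<delta>X < 2" "0 < \<kappa>X" "0 < \<sigma>X" "0 < \<phi>X"
     "\<And>s t. covariance P (?X s) (?X t) = generalized_cauchy \<sigma>X \<phi>X \<delta>X \<kappa>X (s - t)"
    unfolding has_generalized_cauchy_covariance_def by blast
  from adm(2) obtain \<kappa>W where "has_generalized_cauchy_covariance P ?W \<delta>W \<kappa>W"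
    unfolding admissible_field_def by blast
  then obtain \<sigma>W \<phi>W where W: "0 < \<delta>W" "\<delta>W < 2" "0 < \<kappa>W" "0 < \<sigma>W" "0 < \<phi>W"
     "\<And>s t. covariance P (?W s) (?W t) = generalized_cauchy \<sigma>W \<phi>W \<delta>W \<kappa>W (s - t)"
    unfolding has_generalized_cauchy_covariance_def by blast
  from adm(2) obtain \<alpha> where \<alpha>: "\<delta>X < \<alpha>" "smooth_cross_covariance \<alpha>
        (\<lambda>u. covariance P (?X u) (?W 0)) (\<lambda>u. covariance P (?W u) (?X 0))"
    unfolding admissible_field_def by blast
  let ?U = "\<lambda>n s \<omega>. stencil V w (h n) (\<lambda>t. ?X t \<omega>) s" and ?Z = "\<lambda>n s \<omega>. stencil V w (h n) (\<lambda>t. ?W t \<omega>) s"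
  let ?B = "\<lambda>n. {\<omega>\<in>space P. (\<Sum>s\<in>S n. ?U n s \<omega> * ?U n s \<omega>) = 0 \<or>
      \<epsilon> < \<bar>(\<Sum>s\<in>S n. ?U n s \<omega> * ?Z n s \<omega>) / (\<Sum>s\<in>S n. ?U n s \<omega> * ?U n s \<omega>)\<bar>}"
  have lim: "(\<lambda>n. prob (?B n)) \<longlonglongrightarrow> 0"
    by (rule stencil_ols_consistent[OF st X(4,5,1,2,3) W(4,5,1,2,3) X(6) W(6) \<alpha>(2,1) gap l h S sub \<epsilon>])
  have meas: "?U n s \<in> borel_measurable P" "?Z n s \<in> borel_measurable P" for n s
    using stencil_integrable[OF st.finite_V] by (auto dest: borel_measurable_integrable)
  show "(\<lambda>n. prob {\<omega> \<in> space P. \<epsilon> < \<bar>ols (S n) (stencil V w (h n) (\<lambda>s. fst (observed_data D \<beta> \<omega> s)))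
         (stencil V w (h n) (\<lambda>s. snd (observed_data D \<beta> \<omega> s))) - \<beta>\<bar>}) \<longlonglongrightarrow> 0"
  proof (rule Lim_null_comparison[OF _ lim], rule always_eventually, rule allI)
    fix n
    have B: "?B n \<in> events" using meas by measurable
    have "prob {\<omega> \<in> space P. \<epsilon> < \<bar>ols (S n) (stencil V w (h n) (\<lambda>s. fst (observed_data D \<beta> \<omega> s)))
         (stencil V w (h n) (\<lambda>s. snd (observed_data D \<beta> \<omega> s))) - \<beta>\<bar>} \<le> prob (?B n)"
    proof (rule finite_measure_mono[OF _ B], rule subsetI, rule ccontr)
      fix \<omega> assume 1: "\<omega> \<in> {\<omega> \<in> space P. \<epsilon> < \<bar>ols (S n) (stencil V w (h n) (\<lambda>s. fst (observed_data D \<beta> \<omega> s)))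
         (stencil V w (h n) (\<lambda>s. snd (observed_data D \<beta> \<omega> s))) - \<beta>\<bar>}" and 2: "\<omega> \<notin> ?B n"
      let ?N = "\<Sum>s\<in>S n. ?U n s \<omega> * ?Z n s \<omega>" and ?D = "\<Sum>s\<in>S n. ?U n s \<omega> * ?U n s \<omega>"
      have D: "?D \<noteq> 0" and le: "\<bar>?N / ?D\<bar> \<le> \<epsilon>" using 1 2 by auto
      have U: "stencil V w (h n) (\<lambda>s. fst (observed_data D \<beta> \<omega> s)) s = ?U n s \<omega>" if "s \<in> S n" for s
        unfolding stencil_def by (intro sum.cong refl) (simp add: observed_data_def SD[OF that])
      have Y: "stencil V w (h n) (\<lambda>s. snd (observed_data D \<beta> \<omega> s)) s = \<beta> * ?U n s \<omega> + ?Z n s \<omega>" if "s \<in> S n" for s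
        unfolding stencil_def sum_distrib_left sum.distrib[symmetric]
        by (intro sum.cong refl) (simp add: observed_data_def SD[OF that] algebra_simps)
      have "ols (S n) (stencil V w (h n) (\<lambda>s. fst (observed_data D \<beta> \<omega> s))) (stencil V w (h n) (\<lambda>s. snd (observed_data D \<beta> \<omega> s)))
         = (\<Sum>s\<in>S n. ?U n s \<omega> * (\<beta> * ?U n s \<omega> + ?Z n s \<omega>)) / ?D"
        by (simp add: ols_def U Y power2_eq_square)
      also have "(\<Sum>s\<in>S n. ?U n s \<omega> * (\<beta> * ?U n s \<omega> + ?Z n s \<omega>)) = \<beta> * ?D + ?N"
        by (simp add: distrib_left sum.distrib sum_distrib_left mult_ac)
      also have "(\<beta> * ?D + ?N) / ?D = \<beta> + ?N / ?D" using D by (simp add: add_divide_distrib)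
      finally show False using 1 le by simp
    qed
    then show "norm (prob {\<omega> \<in> space P. \<epsilon> < \<bar>ols (S n) (stencil V w (h n) (\<lambda>s. fst (observed_data D \<beta> \<omega> s)))
         (stencil V w (h n) (\<lambda>s. snd (observed_data D \<beta> \<omega> s))) - \<beta>\<bar>}) \<le> prob (?B n)" by simp
  qed
qed

lemma regular_lattice_shift:
  assumes "s \<in> regular_lattice p h" "b \<in> Basis"
  shows "s + h *\<^sub>R b \<in> regular_lattice p h" "s - h *\<^sub>R b \<in> regular_lattice p h"
proof -
  obtain k :: "'a \<Rightarrow> int" where k: "\<And>c. c \<in> Basis \<Longrightarrow> s \<bullet> c = p \<bullet> c + h * of_int (k c)"
    using assms(1) unfolding regular_lattice_iff by blast
  have ib: "b \<bullet> c = (if c = b then 1 else 0)" if "c \<in> Basis" for c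
    using assms(2) that by (simp add: inner_Basis)
  show "s + h *\<^sub>R b \<in> regular_lattice p h"
    unfolding regular_lattice_iff
    by (rule exI[of _ "\<lambda>c. k c + (if c = b then 1 else 0)"]) (auto simp: inner_add_left k ib distrib_left)
  show "s - h *\<^sub>R b \<in> regular_lattice p h"
    unfolding regular_lattice_iff
    by (rule exI[of _ "\<lambda>c. k c - (if c = b then 1 else 0)"]) (auto simp: inner_diff_left k ib right_diff_distrib)
qed

lemma cube_shift:
  assumes s: "\<And>b. b \<in> Basis \<Longrightarrow> q \<bullet> b + h \<le> s \<bullet> b \<and> s \<bullet> b \<le> q \<bullet> b + l - h" and h: "0 < h" and b: "b \<in> Basis"
  shows "s \<in> cube q l" "s + h *\<^sub>R b \<in> cube q l" "s - h *\<^sub>R b \<in> cube q l"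
proof -
  have ib: "b \<bullet> c = (if c = b then 1 else 0)" if "c \<in> Basis" for c
    using b that by (simp add: inner_Basis)
  have s': "q \<bullet> c + h \<le> s \<bullet> c" "s \<bullet> c \<le> q \<bullet> c + l - h" if "c \<in> Basis" for c using s[OF that] by auto
  show "s \<in> cube q l" unfolding cube_iff using s' h by force
  show "s + h *\<^sub>R b \<in> cube q l" "s - h *\<^sub>R b \<in> cube q l"
    unfolding cube_iff using s' h by (auto simp: inner_add_left inner_diff_left ib) force+
qed

lemma first_difference_consistent:
  fixes D :: "'a::euclidean_space set"
  assumes gap: "\<delta>X < \<delta>W + real DIM('a)" and e: "e \<in> Basis" and l: "0 < l" and D: "cube q l \<subseteq> D"
    and h: "\<And>n. 0 < h n" "h \<longlonglongrightarrow> 0"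
  shows "consistent_estimator D (model_laws \<delta>X \<delta>W)
     (\<lambda>n. ols_first_difference (cube q l \<inter> regular_lattice (p n) (h n)) (h n) e)"
proof -
  let ?\<Lambda> = "\<lambda>n. cube q l \<inter> regular_lattice (p n) (h n)"
  let ?S = "\<lambda>n. {s\<in>?\<Lambda> n. s + h n *\<^sub>R e \<in> ?\<Lambda> n}"
  have "consistent_estimator D (model_laws \<delta>X \<delta>W)
    (\<lambda>n z. ols (?S n) (stencil {0, e} first_difference_weight (h n) (\<lambda>s. fst (z s))) (stencil {0, e} first_difference_weight (h n) (\<lambda>s. snd (z s))))"
  proof (rule stencil_ols_consistent_estimator[OF difference_stencil_first_difference[OF e] gap l h])
    show "s \<in> ?S n" if "s \<in> regular_lattice (p n) (h n)"
      "\<And>b. b \<in> Basis \<Longrightarrow> q \<bullet> b + h n \<le> s \<bullet> b \<and> s \<bullet> b \<le> q \<bullet> b + l - h n" for n s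
      using that cube_shift[OF that(2) h(1) e] regular_lattice_shift[OF that(1) e] by simp
  qed (use D in auto)
  moreover have "(\<lambda>n z. ols (?S n) (stencil {0, e} first_difference_weight (h n) (\<lambda>s. fst (z s))) (stencil {0, e} first_difference_weight (h n) (\<lambda>s. snd (z s))))
     = (\<lambda>n. ols_first_difference (?\<Lambda> n) (h n) e)"
    by (intro ext) (simp add: ols_first_difference_def ols_def first_difference_stencil[OF e])
  ultimately show ?thesis by simp
qed

lemma laplacian_consistent:
  fixes D :: "'a::euclidean_space set"
  assumes gap: "\<delta>X < \<delta>W + real DIM('a)" and l: "0 < l" and D: "cube q l \<subseteq> D"
    and h: "\<And>n. 0 < h n" "h \<longlonglongrightarrow> 0"
  shows "consistent_estimator D (model_laws \<delta>X \<delta>W)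
     (\<lambda>n. ols_laplacian (cube q l \<inter> regular_lattice (p n) (h n)) (h n))"
proof -
  let ?\<Lambda> = "\<lambda>n. cube q l \<inter> regular_lattice (p n) (h n)"
  let ?S = "\<lambda>n. {s\<in>?\<Lambda> n. \<forall>e\<in>Basis. s + h n *\<^sub>R e \<in> ?\<Lambda> n \<and> s - h n *\<^sub>R e \<in> ?\<Lambda> n}"
  have "consistent_estimator D (model_laws \<delta>X \<delta>W)
    (\<lambda>n z. ols (?S n) (stencil laplacian_points laplacian_weight (h n) (\<lambda>s. fst (z s))) (stencil laplacian_points laplacian_weight (h n) (\<lambda>s. snd (z s))))"
  proof (rule stencil_ols_consistent_estimator[OF difference_stencil_laplacian gap l h])
    fix n s
    assume a: "s \<in> regular_lattice (p n) (h n)"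
      "\<And>b. b \<in> Basis \<Longrightarrow> q \<bullet> b + h n \<le> s \<bullet> b \<and> s \<bullet> b \<le> q \<bullet> b + l - h n"
    obtain b :: 'a where b: "b \<in> Basis" using nonempty_Basis by blast
    show "s \<in> ?S n"
      using a(1) cube_shift[OF a(2) h(1)] b regular_lattice_shift[OF a(1)] by blast
  next
    fix n s v assume "s \<in> ?S n" "v \<in> (laplacian_points :: 'a set)"
    then show "s + h n *\<^sub>R v \<in> D" using D by (auto simp: laplacian_points_def)
  qed auto
  moreover have "(\<lambda>n z. ols (?S n) (stencil laplacian_points laplacian_weight (h n) (\<lambda>s. fst (z s))) (stencil laplacian_points laplacian_weight (h n) (\<lambda>s. snd (z s))))
     = (\<lambda>n. ols_laplacian (?\<Lambda> n) (h n))"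
  proof (intro ext)
    fix n z
    have hn: "h n \<noteq> 0" "(h n)\<^sup>2 \<noteq> 0" using h(1)[of n] by auto
    show "ols (?S n) (stencil laplacian_points laplacian_weight (h n) (\<lambda>s. fst (z s))) (stencil laplacian_points laplacian_weight (h n) (\<lambda>s. snd (z s)))
      = ols_laplacian (?\<Lambda> n) (h n) z"
      unfolding ols_laplacian_def laplacian_stencil[OF hn(1), abs_def] by (rule ols_scale[OF hn(2)])
  qed
  ultimately show ?thesis by simp
qed

lemma ball_contains_cube:
  fixes x :: "'a::euclidean_space"
  assumes "0 < r"
  shows "\<exists>l>0. cube x l \<subseteq> ball x r"
proof -
  define l where "l = r / (2 * real DIM('a))"
  have l: "0 < l" using assms by (simp add: l_def)
  have "cube x l \<subseteq> ball x r"
  proof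
    fix y assume y: "y \<in> cube x l"
    have "norm (y - x) \<le> (\<Sum>b\<in>Basis. \<bar>(y - x) \<bullet> b\<bar>)" by (rule norm_le_l1)
    also have "\<dots> \<le> (\<Sum>b\<in>(Basis::'a set). l)"
      using y by (intro sum_mono) (auto simp: cube_iff inner_diff_left)
    also have "\<dots> = r / 2" by (simp add: l_def)
    finally show "y \<in> ball x r" using assms by (simp add: dist_norm norm_minus_commute)
  qed
  then show ?thesis using l by blast
qed

lemma consistency_of_differences:
  fixes D :: "'a::euclidean_space set" and \<delta>X \<delta>W :: real
  assumes ball: "\<exists>x r. 0 < r \<and> ball x r \<subseteq> D" and gap: "\<delta>X < \<delta>W + real DIM('a)"
  shows "consistently_estimable D (model_laws \<delta>X \<delta>W)"
    and "\<forall>q l p h. \<forall>e\<in>Basis. 0 < l \<and> cube q l \<subseteq> D \<and> (\<forall>n. 0 < h n) \<and> h \<longlonglongrightarrow> 0 \<longrightarrow>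
               consistent_estimator D (model_laws \<delta>X \<delta>W)
                 (\<lambda>n. ols_first_difference (cube q l \<inter> regular_lattice (p n) (h n)) (h n) e)"
    and "\<forall>q l p h. 0 < l \<and> cube q l \<subseteq> D \<and> (\<forall>n. 0 < h n) \<and> h \<longlonglongrightarrow> 0 \<longrightarrow>
               consistent_estimator D (model_laws \<delta>X \<delta>W)
                 (\<lambda>n. ols_laplacian (cube q l \<inter> regular_lattice (p n) (h n)) (h n))"
proof -
  obtain x r where r: "0 < r" "ball x r \<subseteq> D" using ball by blast
  obtain l where l: "0 < l" "cube x l \<subseteq> ball x r" using ball_contains_cube[OF r(1)] by blast
  \<comment> \<open>The Laplacian estimator serves as the witness in every dimension, including
    one.\<close>
  have "consistent_estimator D (model_laws \<delta>X \<delta>W)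
     (\<lambda>n. ols_laplacian (cube x l \<inter> regular_lattice 0 (inverse (real (Suc n)))) (inverse (real (Suc n))))"
    by (rule laplacian_consistent[OF gap l(1) order_trans[OF l(2) r(2)] _ LIMSEQ_inverse_real_of_nat]) simp
  then show "consistently_estimable D (model_laws \<delta>X \<delta>W)" unfolding consistently_estimable_def by blast
qed (use first_difference_consistent[OF gap] laplacian_consistent[OF gap] in \<open>blast+\<close>)

section \<open>Gaussian processes from kernel factorizations\<close>

text \<open>Uniqueness of characteristic functions gives \<open>Z\<close> the law of
  \<open>sqrt v\<close> times a standard normal variable, from which the moments and the density are
  read off. The case \<open>v = 0\<close> lands in the second disjunct of
  \<open>gaussian_variable\<close>.\<close>

lemma centred_gaussian_char:
  assumes M: "prob_space M" and Z [measurable]: "Z \<in> borel_measurable M" and v: "0 \<le> v"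
    and char: "\<And>u. (CLINT \<omega>|M. iexp (u * Z \<omega>)) = complex_of_real (exp (- (u\<^sup>2 * v / 2)))"
  shows "gaussian_variable M Z" "integrable M (\<lambda>\<omega>. (Z \<omega>)\<^sup>2)" "(\<integral>\<omega>. Z \<omega> \<partial>M) = 0" "(\<integral>\<omega>. (Z \<omega>)\<^sup>2 \<partial>M) = v"
proof -
  interpret prob_space M by fact
  interpret Zd: real_distribution "distr M borel Z" by (rule real_distribution_distr) simp
  have cZ: "char (distr M borel Z) = (\<lambda>u. complex_of_real (exp (- (u\<^sup>2 * v / 2))))"
  proof
    fix u
    have "char (distr M borel Z) u = (CLINT \<omega>|M. iexp (u * Z \<omega>))"
      unfolding char_def by (subst integral_distr) auto
    then show "char (distr M borel Z) u = complex_of_real (exp (- (u\<^sup>2 * v / 2)))" unfolding char .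
  qed
  interpret S: real_distribution std_normal_distribution by (rule real_dist_normal_dist)
  have mm: "(\<lambda>x. sqrt v * x) \<in> borel_measurable std_normal_distribution" by simp
  interpret T: real_distribution "distr std_normal_distribution borel (\<lambda>x. sqrt v * x)"
    by (rule S.real_distribution_distr[OF mm])
  have "char (distr std_normal_distribution borel (\<lambda>x. sqrt v * x)) = (\<lambda>u. char std_normal_distribution (u * sqrt v))"
    unfolding char_def by (subst integral_distr) (simp_all add: mult.assoc)
  also have "\<dots> = char (distr M borel Z)"
    unfolding cZ char_std_normal_distribution using v by (simp add: power_mult_distrib)
  finally have eq: "distr M borel Z = distr std_normal_distribution borel (\<lambda>x. sqrt v * x)"
    using Levy_uniqueness[OF Zd.real_distribution_axioms T.real_distribution_axioms] by simp
  have int: "(\<integral>\<omega>. f (Z \<omega>) \<partial>M) = (\<integral>x. f (sqrt v * x) \<partial>std_normal_distribution)"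
    and intb: "integrable M (\<lambda>\<omega>. f (Z \<omega>)) \<longleftrightarrow> integrable std_normal_distribution (\<lambda>x. f (sqrt v * x))"
    if [measurable]: "f \<in> borel_measurable borel" for f :: "real \<Rightarrow> real"
  proof -
    show "(\<integral>\<omega>. f (Z \<omega>) \<partial>M) = (\<integral>x. f (sqrt v * x) \<partial>std_normal_distribution)"
      using arg_cong[OF eq, of "\<lambda>m. integral\<^sup>L m f"] by (simp add: integral_distr)
    show "integrable M (\<lambda>\<omega>. f (Z \<omega>)) \<longleftrightarrow> integrable std_normal_distribution (\<lambda>x. f (sqrt v * x))"
      using arg_cong[OF eq, of "\<lambda>m. integrable m f"] by (simp add: integrable_distr_eq)
  qed
  show "integrable M (\<lambda>\<omega>. (Z \<omega>)\<^sup>2)"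
    using intb[of "\<lambda>x. x\<^sup>2"] integrable_std_normal_distribution_moment[of 2] by (simp add: power_mult_distrib)
  show "(\<integral>\<omega>. Z \<omega> \<partial>M) = 0"
    using int[of "\<lambda>x. x"] integral_std_normal_distribution_moment_odd[of 1] by simp
  show "(\<integral>\<omega>. (Z \<omega>)\<^sup>2 \<partial>M) = v"
    using int[of "\<lambda>x. x\<^sup>2"] std_normal_distribution_even_moments(1)[of 1] v
    by (simp add: power_mult_distrib)
  show "gaussian_variable M Z"
  proof (cases "v = 0")
    case True
    have "(\<integral>\<omega>. (Z \<omega>)\<^sup>2 \<partial>M) = 0" by (simp add: \<open>(\<integral>\<omega>. (Z \<omega>)\<^sup>2 \<partial>M) = v\<close> True)
    then have "AE \<omega> in M. (Z \<omega>)\<^sup>2 = 0"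
      using \<open>integrable M (\<lambda>\<omega>. (Z \<omega>)\<^sup>2)\<close> by (subst (asm) integral_nonneg_eq_0_iff_AE) auto
    then have "AE \<omega> in M. Z \<omega> = 0" by eventually_elim simp
    then show ?thesis by (auto simp: gaussian_variable_def)
  next
    case False
    then have sv: "0 < sqrt v" using v by simp
    have d: "distributed std_normal_distribution lborel (\<lambda>x. x) (\<lambda>x. ennreal (std_normal_density x))"
      unfolding distributed_def by (simp add: distr_id2)
    have "distributed std_normal_distribution lborel (\<lambda>x. 0 + sqrt v * x) (normal_density (0 + sqrt v * 0) (\<bar>sqrt v\<bar> * 1))"
      by (rule S.normal_density_affine[OF d]) (use sv in auto)
    then have "distr std_normal_distribution lborel (\<lambda>x. sqrt v * x) = density lborel (normal_density 0 (sqrt v))"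
      using sv v by (simp add: distributed_def)
    moreover have "distr M lborel Z = distr M borel Z" by (rule distr_cong) auto
    moreover have "distr std_normal_distribution borel (\<lambda>x. sqrt v * x) = distr std_normal_distribution lborel (\<lambda>x. sqrt v * x)"
      by (rule distr_cong) auto
    ultimately have "distr M lborel Z = density lborel (normal_density 0 (sqrt v))"
      using eq by simp
    then have "distributed M lborel Z (normal_density 0 (sqrt v))"
      unfolding distributed_def by simp
    then show ?thesis using sv by (auto simp: gaussian_variable_def)
  qed
qed

abbreviation gauss_seq :: "(nat \<Rightarrow> real) measure" where
  "gauss_seq \<equiv> PiM UNIV (\<lambda>_. std_normal_distribution)"

interpretation std_normal: prob_space std_normal_distribution
  using real_dist_normal_dist by (simp add: real_distribution_def)

interpretation gauss_seq: prob_space gauss_seq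
  by (intro prob_space_PiM std_normal.prob_space_axioms)

lemma space_gauss_seq [simp]: "space gauss_seq = UNIV"
  by (simp add: space_PiM)

lemma prob_gauss_seq_UNIV [simp]: "gauss_seq.prob UNIV = 1"
  using gauss_seq.prob_space by simp

lemma sets_gauss_seq: "sets gauss_seq = sets (PiM UNIV (\<lambda>_. borel :: real measure))"
  by (intro sets_PiM_cong) auto

lemma gauss_seq_component [measurable]: "(\<lambda>\<xi>. \<xi> k) \<in> borel_measurable gauss_seq"
  using measurable_component_singleton[of k UNIV "\<lambda>_. std_normal_distribution"] by simp

lemma gauss_seq_sum_char:
  "(CLINT \<xi>|gauss_seq. iexp (u * (\<Sum>k<n. c k * \<xi> k))) = complex_of_real (exp (- (u\<^sup>2 * (\<Sum>k<n. (c k)\<^sup>2) / 2)))"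
proof -
  have ind0: "gauss_seq.indep_vars (\<lambda>i. borel) (\<lambda>i \<xi>. \<xi> i) UNIV"
  proof (subst gauss_seq.indep_vars_iff_distr_eq_PiM)
    have "distr gauss_seq (PiM UNIV (\<lambda>i. borel)) (\<lambda>x. \<lambda>i\<in>UNIV. x i) = gauss_seq"
      by (subst distr_cong[OF refl sets_gauss_seq[symmetric] refl]) (simp add: distr_id2 restrict_UNIV)
    also have "\<dots> = PiM UNIV (\<lambda>i. distr gauss_seq borel (\<lambda>\<xi>. \<xi> i))"
    proof (rule arg_cong[of _ _ "PiM UNIV"], rule ext)
      fix i
      have "distr gauss_seq borel (\<lambda>\<xi>. \<xi> i) = distr gauss_seq std_normal_distribution (\<lambda>\<xi>. \<xi> i)"
        by (rule distr_cong) auto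
      also have "\<dots> = std_normal_distribution"
        using distr_PiM_component[of UNIV "\<lambda>_. std_normal_distribution" i] std_normal.prob_space_axioms by simp
      finally show "std_normal_distribution = distr gauss_seq borel (\<lambda>\<xi>. \<xi> i)" ..
    qed
    finally show "distr gauss_seq (PiM UNIV (\<lambda>i. borel)) (\<lambda>x. \<lambda>i\<in>UNIV. x i) = PiM UNIV (\<lambda>i. distr gauss_seq borel (\<lambda>\<xi>. \<xi> i))" .
  qed auto
  have ind: "gauss_seq.indep_vars (\<lambda>i. borel) (\<lambda>i \<xi>. c i * \<xi> i) {..<n}"
    using gauss_seq.indep_vars_compose2[OF gauss_seq.indep_vars_subset[OF ind0 subset_UNIV, of "{..<n}"], of "\<lambda>i x. c i * x" "\<lambda>_. borel"]
    by simp
  have comp: "char (distr gauss_seq borel (\<lambda>\<xi>. c i * \<xi> i)) u = complex_of_real (exp (- ((u * c i)\<^sup>2 / 2)))" for i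
  proof -
    have "char (distr gauss_seq borel (\<lambda>\<xi>. c i * \<xi> i)) u = (CLINT \<xi>|gauss_seq. iexp ((u * c i) * \<xi> i))"
      unfolding char_def by (subst integral_distr) (simp_all add: mult.assoc)
    also have "\<dots> = (CLINT x|distr gauss_seq std_normal_distribution (\<lambda>\<xi>. \<xi> i). iexp ((u * c i) * x))"
      by (subst integral_distr) auto
    also have "distr gauss_seq std_normal_distribution (\<lambda>\<xi>. \<xi> i) = std_normal_distribution"
      using distr_PiM_component[of UNIV "\<lambda>_. std_normal_distribution" i] std_normal.prob_space_axioms by simp
    finally show ?thesis using fun_cong[OF char_std_normal_distribution, of "u * c i"] by (simp add: char_def)
  qed
  have "(CLINT \<xi>|gauss_seq. iexp (u * (\<Sum>k<n. c k * \<xi> k))) = char (distr gauss_seq borel (\<lambda>\<xi>. \<Sum>k<n. c k * \<xi> k)) u"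
    unfolding char_def by (subst integral_distr) simp_all
  also have "\<dots> = (\<Prod>k<n. complex_of_real (exp (- ((u * c k)\<^sup>2 / 2))))"
    by (simp add: gauss_seq.char_distr_sum[OF ind] comp)
  also have "\<dots> = complex_of_real (exp (\<Sum>k<n. - ((u * c k)\<^sup>2 / 2)))"
    by (simp add: exp_sum)
  also have "(\<Sum>k<n. - ((u * c k)\<^sup>2 / 2)) = - (u\<^sup>2 * (\<Sum>k<n. (c k)\<^sup>2) / 2)"
    by (simp add: power_mult_distrib sum_negf sum_divide_distrib sum_distrib_left)
  finally show ?thesis .
qed

lemma gauss_seq_sum_moments:
  "integrable gauss_seq (\<lambda>\<xi>. (\<Sum>k<n. c k * \<xi> k)\<^sup>2)" "(\<integral>\<xi>. (\<Sum>k<n. c k * \<xi> k)\<^sup>2 \<partial>gauss_seq) = (\<Sum>k<n. (c k)\<^sup>2)"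
  using centred_gaussian_char[OF gauss_seq.prob_space_axioms _ sum_nonneg gauss_seq_sum_char[where n=n and c=c]] by auto

text \<open>Indices along which the partial sums converge almost surely: the block between two of
  them has variance at most \<open>(1/4) ^ n\<close>, so its absolute mean is at most
  \<open>(1/2) ^ n\<close>. The choice depends on the coefficients, not on the sample point, and is
  total: monotonicity and \<open>n \<le> N n\<close> persist for coefficients that are not square
  summable.\<close>

definition tail_index :: "(nat \<Rightarrow> real) \<Rightarrow> nat \<Rightarrow> nat" where
  "tail_index e = (SOME N. mono N \<and> (\<forall>n. n \<le> N n) \<and>
      (summable (\<lambda>k. (e k)\<^sup>2) \<longrightarrow> (\<forall>n. (\<Sum>k\<in>{N n..<N (Suc n)}. (e k)\<^sup>2) \<le> (1/4) ^ n)))"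

lemma tail_index:
  "mono (tail_index e)" "n \<le> tail_index e n"
  "summable (\<lambda>k. (e k)\<^sup>2) \<Longrightarrow> (\<Sum>k\<in>{tail_index e n..<tail_index e (Suc n)}. (e k)\<^sup>2) \<le> (1/4) ^ n"
proof -
  have "\<exists>N. mono N \<and> (\<forall>n. n \<le> N n) \<and> (summable (\<lambda>k. (e k)\<^sup>2) \<longrightarrow> (\<forall>n. (\<Sum>k\<in>{N n..<N (Suc n)}. (e k)\<^sup>2) \<le> (1/4) ^ n))"
  proof (cases "summable (\<lambda>k. (e k)\<^sup>2)")
    case True
    have "\<forall>n. \<exists>N. \<forall>a\<ge>N. \<forall>b. norm (\<Sum>k\<in>{a..<b}. (e k)\<^sup>2) < (1/4) ^ n"
      using True unfolding summable_Cauchy by simp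
    then obtain N0 where N0: "\<And>n a b. N0 n \<le> a \<Longrightarrow> norm (\<Sum>k\<in>{a..<b}. (e k)\<^sup>2) < (1/4) ^ n" by metis
    define N where "N n = (\<Sum>m\<le>n. N0 m + 1)" for n
    have 1: "mono N" unfolding N_def by (intro monoI sum_mono2) auto
    have 2: "n \<le> N n" for n unfolding N_def by (induction n) auto
    have 3: "N0 n \<le> N n" for n unfolding N_def using member_le_sum[of n "{..n}" "\<lambda>m. N0 m + 1"] by simp
    have "(\<Sum>k\<in>{N n..<N (Suc n)}. (e k)\<^sup>2) \<le> (1/4) ^ n" for n using N0[OF 3, of n "N (Suc n)"] by simp
    with 1 2 show ?thesis by blast
  next
    case False
    then show ?thesis by (intro exI[of _ "\<lambda>n. n"]) (auto simp: mono_def)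
  qed
  from someI_ex[OF this]
  show "mono (tail_index e)" "n \<le> tail_index e n"
    "summable (\<lambda>k. (e k)\<^sup>2) \<Longrightarrow> (\<Sum>k\<in>{tail_index e n..<tail_index e (Suc n)}. (e k)\<^sup>2) \<le> (1/4) ^ n"
    unfolding tail_index_def by auto
qed

text \<open>The Gaussian series with coefficients \<open>e\<close>, as the limit of its partial sums along a
  subsequence on which they converge almost surely.\<close>

definition gauss_series :: "(nat \<Rightarrow> real) \<Rightarrow> (nat \<Rightarrow> real) \<Rightarrow> real" where
  "gauss_series e \<xi> = lim (\<lambda>n. \<Sum>k<tail_index e n. e k * \<xi> k)"

lemma gauss_series_measurable [measurable]: "gauss_series e \<in> borel_measurable gauss_seq"
  unfolding gauss_series_def[abs_def] by measurable

text \<open>The partial sums are eventually constant, so the identity holds at every sample point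
  and not only almost everywhere. The translation argument works with pointwise identities.\<close>

lemma gauss_series_finite:
  assumes "\<And>k. n \<le> k \<Longrightarrow> e k = 0"
  shows "gauss_series e \<xi> = (\<Sum>k<n. e k * \<xi> k)"
proof -
  have "(\<Sum>k<tail_index e m. e k * \<xi> k) = (\<Sum>k<n. e k * \<xi> k)" if "n \<le> m" for m
    using that tail_index(2)[of m e] assms by (intro sum.mono_neutral_right) auto
  then have "\<forall>\<^sub>F m in sequentially. (\<Sum>k<tail_index e m. e k * \<xi> k) = (\<Sum>k<n. e k * \<xi> k)"
    unfolding eventually_sequentially by blast
  then have "(\<lambda>m. \<Sum>k<tail_index e m. e k * \<xi> k) \<longlonglongrightarrow> (\<Sum>k<n. e k * \<xi> k)" by (rule tendsto_eventually)
  then show ?thesis unfolding gauss_series_def by (rule limI)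
qed

text \<open>The series reads only coordinates with nonzero coefficient, again pointwise. This is why
  translating coordinates reserved for W leaves X unchanged.\<close>

lemma gauss_series_cong:
  assumes "\<And>k. e k \<noteq> 0 \<Longrightarrow> \<xi> k = \<xi>' k"
  shows "gauss_series e \<xi> = gauss_series e \<xi>'"
proof -
  have "(\<Sum>k<n. e k * \<xi> k) = (\<Sum>k<n. e k * \<xi>' k)" for n
    using assms by (intro sum.cong refl) auto
  then show ?thesis unfolding gauss_series_def by simp
qed

lemma gauss_series_AE:
  assumes e: "summable (\<lambda>k. (e k)\<^sup>2)"
  shows "AE \<xi> in gauss_seq. (\<lambda>n. \<Sum>k<tail_index e n. e k * \<xi> k) \<longlonglongrightarrow> gauss_series e \<xi>"
proof -
  define S where "S n \<xi> = (\<Sum>k<tail_index e n. e k * \<xi> k)" for n \<xi>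
  have [measurable]: "S n \<in> borel_measurable gauss_seq" for n unfolding S_def by measurable
  have sq: "(\<integral>\<^sup>+\<xi>. ennreal \<bar>S (Suc n) \<xi> - S n \<xi>\<bar> \<partial>gauss_seq) \<le> ennreal ((1/2) ^ n)" for n
  proof -
    let ?a = "tail_index e n" and ?b = "tail_index e (Suc n)"
    have ab: "?a \<le> ?b" using tail_index(1)[of e] by (simp add: monoD)
    define c where "c k = (if ?a \<le> k then e k else 0)" for k
    have "(\<Sum>k<?b. c k * \<xi> k) = (\<Sum>k\<in>{?a..<?b}. e k * \<xi> k)" for \<xi>
      by (rule sum.mono_neutral_cong_right) (auto simp: c_def)
    moreover have "S (Suc n) \<xi> - S n \<xi> = (\<Sum>k\<in>{?a..<?b}. e k * \<xi> k)" for \<xi>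
      unfolding S_def using sum_diff_nat_ivl[of 0 ?a ?b "\<lambda>k. e k * \<xi> k"] ab by (simp add: lessThan_atLeast0)
    ultimately have D: "S (Suc n) \<xi> - S n \<xi> = (\<Sum>k<?b. c k * \<xi> k)" for \<xi> by simp
    have "(\<Sum>k<?b. (c k)\<^sup>2) = (\<Sum>k\<in>{?a..<?b}. (e k)\<^sup>2)"
      by (rule sum.mono_neutral_cong_right) (auto simp: c_def)
    then have m2: "integrable gauss_seq (\<lambda>\<xi>. (S (Suc n) \<xi> - S n \<xi>)\<^sup>2)"
      "(\<integral>\<xi>. (S (Suc n) \<xi> - S n \<xi>)\<^sup>2 \<partial>gauss_seq) \<le> (1/4) ^ n"
      unfolding D using gauss_seq_sum_moments[where n="?b" and c=c] tail_index(3)[OF e, of n] by auto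
    have pw: "(2::real) ^ n * (1/4) ^ n = (1/2) ^ n" "(1/2::real)^n * 2^n = 1"
      by (simp_all flip: power_mult_distrib)
    \<comment> \<open>Young's inequality with the weight that balances the standard deviation
      \<open>(1/2) ^ n\<close>: both summands then have mean at most
      \<open>(1/2) ^ n / 2\<close>.\<close>
    have am: "\<bar>x\<bar> \<le> 2 ^ n / 2 * x\<^sup>2 + (1/2) ^ n / 2" for x :: real
    proof -
      have "0 \<le> (1/2)^n * (2 ^ n * \<bar>x\<bar> - 1)\<^sup>2" by simp
      also have "\<dots> = ((1/2)^n * 2^n) * 2 ^ n * x\<^sup>2 - 2 * ((1/2)^n * 2 ^ n) * \<bar>x\<bar> + (1/2) ^ n"
        by (simp add: power2_eq_square algebra_simps)
      finally show ?thesis unfolding pw(2) by simp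
    qed
    have "(\<integral>\<^sup>+\<xi>. ennreal \<bar>S (Suc n) \<xi> - S n \<xi>\<bar> \<partial>gauss_seq)
        \<le> (\<integral>\<^sup>+\<xi>. ennreal (2 ^ n / 2 * (S (Suc n) \<xi> - S n \<xi>)\<^sup>2 + (1/2) ^ n / 2) \<partial>gauss_seq)"
      by (intro nn_integral_mono ennreal_leI am)
    also have "\<dots> = ennreal (\<integral>\<xi>. 2 ^ n / 2 * (S (Suc n) \<xi> - S n \<xi>)\<^sup>2 + (1/2) ^ n / 2 \<partial>gauss_seq)"
      using m2(1) by (intro nn_integral_eq_integral) auto
    also have "(\<integral>\<xi>. 2 ^ n / 2 * (S (Suc n) \<xi> - S n \<xi>)\<^sup>2 + (1/2) ^ n / 2 \<partial>gauss_seq)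
       = 2 ^ n / 2 * (\<integral>\<xi>. (S (Suc n) \<xi> - S n \<xi>)\<^sup>2 \<partial>gauss_seq) + (1/2) ^ n / 2"
      using m2(1) by (simp add: gauss_seq.prob_space)
    also have "\<dots> \<le> 2 ^ n / 2 * (1/4) ^ n + (1/2) ^ n / 2"
      using m2(2) by (intro add_right_mono mult_left_mono) auto
    also have "\<dots> = (1/2) ^ n" using pw(1) by simp
    finally show ?thesis by (simp add: ennreal_leI)
  qed
  have "(\<integral>\<^sup>+\<xi>. (\<Sum>n. ennreal \<bar>S (Suc n) \<xi> - S n \<xi>\<bar>) \<partial>gauss_seq) = (\<Sum>n. \<integral>\<^sup>+\<xi>. ennreal \<bar>S (Suc n) \<xi> - S n \<xi>\<bar> \<partial>gauss_seq)"
    by (rule nn_integral_suminf) simp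
  also have "\<dots> \<le> (\<Sum>n. ennreal ((1/2) ^ n))" by (intro suminf_le sq) auto
  also have "\<dots> = ennreal (\<Sum>n. (1/2) ^ n)" by (intro suminf_ennreal2) (auto intro: summable_geometric)
  also have "\<dots> < \<infinity>" by simp
  finally have "(\<integral>\<^sup>+\<xi>. (\<Sum>n. ennreal \<bar>S (Suc n) \<xi> - S n \<xi>\<bar>) \<partial>gauss_seq) \<noteq> \<infinity>" by simp
  then have "AE \<xi> in gauss_seq. (\<Sum>n. ennreal \<bar>S (Suc n) \<xi> - S n \<xi>\<bar>) \<noteq> \<infinity>"
    by (intro nn_integral_PInf_AE) auto
  then show ?thesis
  proof eventually_elim
    case (elim \<xi>)
    then have "summable (\<lambda>n. \<bar>S (Suc n) \<xi> - S n \<xi>\<bar>)" by (intro summable_suminf_not_top) auto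
    then have "summable (\<lambda>n. S (Suc n) \<xi> - S n \<xi>)" by (rule summable_rabs_cancel)
    then have "(\<lambda>n. \<Sum>m<n. S (Suc m) \<xi> - S m \<xi>) \<longlonglongrightarrow> (\<Sum>m. S (Suc m) \<xi> - S m \<xi>)" by (rule summable_LIMSEQ)
    then have "(\<lambda>n. S n \<xi> - S 0 \<xi>) \<longlonglongrightarrow> (\<Sum>m. S (Suc m) \<xi> - S m \<xi>)" by (simp only: sum_lessThan_telescope[of "\<lambda>n. S n \<xi>"])
    from tendsto_add[OF this tendsto_const[of "S 0 \<xi>"]] have "convergent (\<lambda>n. S n \<xi>)" by (auto simp: convergent_def)
    then have "(\<lambda>n. S n \<xi>) \<longlonglongrightarrow> lim (\<lambda>n. S n \<xi>)" by (simp add: convergent_LIMSEQ_iff)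
    then show ?case by (simp add: S_def gauss_series_def)
  qed
qed

text \<open>The truncated combination is a finite Gaussian sum, whose characteristic function is
  known from its variance. The variance tends to the quadratic form of \<open>K\<close>, the sums
  converge almost surely to \<open>Z\<close>, and bounded convergence transfers the formula to
  \<open>Z\<close>.\<close>

lemma gauss_process:
  fixes e :: "'j \<Rightarrow> nat \<Rightarrow> real" and K :: "'j \<Rightarrow> 'j \<Rightarrow> real" and a :: "'j \<Rightarrow> real"
  assumes K: "\<And>i j. (\<lambda>k. e i k * e j k) sums K i j" and J: "finite J"
  defines "Z \<equiv> \<lambda>\<xi>. \<Sum>j\<in>J. a j * gauss_series (e j) \<xi>"
  shows "gaussian_variable gauss_seq Z" "integrable gauss_seq (\<lambda>\<xi>. (Z \<xi>)\<^sup>2)" "(\<integral>\<xi>. Z \<xi> \<partial>gauss_seq) = 0"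
    "(\<integral>\<xi>. (Z \<xi>)\<^sup>2 \<partial>gauss_seq) = (\<Sum>i\<in>J. \<Sum>j\<in>J. a i * a j * K i j)"
proof -
  define v where "v = (\<Sum>i\<in>J. \<Sum>j\<in>J. a i * a j * K i j)"
  \<comment> \<open>Each series is cut at its own index \<open>tail_index (e j) n\<close>;
    \<open>c n k\<close> is the joint coefficient of coordinate \<open>k\<close>, and
    \<open>N n\<close> is a common bound for the indices.\<close>
  define c where "c n k = (\<Sum>j\<in>J. if k < tail_index (e j) n then a j * e j k else 0)" for n k
  define N where "N n = (\<Sum>j\<in>J. tail_index (e j) n)" for n
  have NJ: "tail_index (e j) n \<le> N n" if "j \<in> J" for j n
    unfolding N_def using J that by (intro member_le_sum) auto
  define Zn where "Zn n \<xi> = (\<Sum>k<N n. c n k * \<xi> k)" for n \<xi>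
  have Zn_eq: "Zn n \<xi> = (\<Sum>j\<in>J. a j * (\<Sum>k<tail_index (e j) n. e j k * \<xi> k))" for n \<xi>
  proof -
    have "Zn n \<xi> = (\<Sum>j\<in>J. \<Sum>k<N n. (if k < tail_index (e j) n then a j * e j k else 0) * \<xi> k)"
      unfolding Zn_def c_def sum_distrib_right by (rule sum.swap)
    also have "\<dots> = (\<Sum>j\<in>J. \<Sum>k<tail_index (e j) n. a j * (e j k * \<xi> k))"
      by (rule sum.cong[OF refl], rule sum.mono_neutral_cong_right) (use NJ in \<open>auto dest: less_le_trans\<close>)
    finally show ?thesis by (simp add: sum_distrib_left)
  qed
  have var: "(\<Sum>k<N n. (c n k)\<^sup>2) = (\<Sum>i\<in>J. \<Sum>j\<in>J. a i * a j * (\<Sum>k<min (tail_index (e i) n) (tail_index (e j) n). e i k * e j k))" for n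
  proof -
    have "(\<Sum>k<N n. (c n k)\<^sup>2) = (\<Sum>k<N n. \<Sum>i\<in>J. \<Sum>j\<in>J. (if k < tail_index (e i) n then a i * e i k else 0) * (if k < tail_index (e j) n then a j * e j k else 0))"
      unfolding c_def power2_eq_square sum_product ..
    also have "\<dots> = (\<Sum>i\<in>J. \<Sum>k<N n. \<Sum>j\<in>J. (if k < tail_index (e i) n then a i * e i k else 0) * (if k < tail_index (e j) n then a j * e j k else 0))"
      by (rule sum.swap)
    also have "\<dots> = (\<Sum>i\<in>J. \<Sum>j\<in>J. \<Sum>k<N n. (if k < tail_index (e i) n then a i * e i k else 0) * (if k < tail_index (e j) n then a j * e j k else 0))"
      by (intro sum.cong refl sum.swap)
    also have "\<dots> = (\<Sum>i\<in>J. \<Sum>j\<in>J. \<Sum>k<min (tail_index (e i) n) (tail_index (e j) n). a i * a j * (e i k * e j k))"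
      by (rule sum.cong[OF refl], rule sum.cong[OF refl], rule sum.mono_neutral_cong_right)
         (use NJ in \<open>auto dest: less_le_trans simp: mult_ac intro: min.coboundedI1\<close>)
    finally show ?thesis by (simp add: sum_distrib_left)
  qed
  have vlim: "(\<lambda>n. \<Sum>k<N n. (c n k)\<^sup>2) \<longlonglongrightarrow> v"
    unfolding var v_def
  proof (intro tendsto_sum tendsto_mult tendsto_const)
    fix i j
    have "filterlim (\<lambda>n. min (tail_index (e i) n) (tail_index (e j) n)) at_top sequentially"
      by (rule filterlim_at_top_mono[OF filterlim_ident]) (simp add: tail_index(2))
    then show "(\<lambda>n. \<Sum>k<min (tail_index (e i) n) (tail_index (e j) n). e i k * e j k) \<longlonglongrightarrow> K i j"
      using K[of i j] unfolding sums_def by (rule filterlim_compose[rotated])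
  qed
  have v0: "0 \<le> v" by (rule LIMSEQ_le_const[OF vlim]) (auto intro!: sum_nonneg)
  have AE: "AE \<xi> in gauss_seq. (\<lambda>n. Zn n \<xi>) \<longlonglongrightarrow> Z \<xi>"
  proof -
    have "AE \<xi> in gauss_seq. \<forall>j\<in>J. (\<lambda>n. \<Sum>k<tail_index (e j) n. e j k * \<xi> k) \<longlonglongrightarrow> gauss_series (e j) \<xi>"
      using J K by (intro AE_finite_allI gauss_series_AE) (auto simp: power2_eq_square sums_iff)
    then show ?thesis
    proof eventually_elim
      case (elim \<xi>)
      then show ?case unfolding Zn_eq Z_def by (intro tendsto_sum tendsto_mult tendsto_const) auto
    qed
  qed
  have Zm [measurable]: "Z \<in> borel_measurable gauss_seq" unfolding Z_def by measurable
  have Znm [measurable]: "Zn n \<in> borel_measurable gauss_seq" for n unfolding Zn_def by measurable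
  have char: "(CLINT \<xi>|gauss_seq. iexp (u * Z \<xi>)) = complex_of_real (exp (- (u\<^sup>2 * v / 2)))" for u
  proof (rule LIMSEQ_unique)
    show "(\<lambda>n. CLINT \<xi>|gauss_seq. iexp (u * Zn n \<xi>)) \<longlonglongrightarrow> (CLINT \<xi>|gauss_seq. iexp (u * Z \<xi>))"
    proof (rule integral_dominated_convergence[where w="\<lambda>_. 1"])
      show "AE \<xi> in gauss_seq. (\<lambda>n. iexp (u * Zn n \<xi>)) \<longlonglongrightarrow> iexp (u * Z \<xi>)"
        using AE by eventually_elim (intro tendsto_intros)
    qed auto
    show "(\<lambda>n. CLINT \<xi>|gauss_seq. iexp (u * Zn n \<xi>)) \<longlonglongrightarrow> complex_of_real (exp (- (u\<^sup>2 * v / 2)))"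
      unfolding Zn_def gauss_seq_sum_char by (intro tendsto_of_real tendsto_intros vlim) auto
  qed
  note G = centred_gaussian_char[OF gauss_seq.prob_space_axioms Zm v0 char]
  show "gaussian_variable gauss_seq Z" "integrable gauss_seq (\<lambda>\<xi>. (Z \<xi>)\<^sup>2)" "(\<integral>\<xi>. Z \<xi> \<partial>gauss_seq) = 0"
    "(\<integral>\<xi>. (Z \<xi>)\<^sup>2 \<partial>gauss_seq) = (\<Sum>i\<in>J. \<Sum>j\<in>J. a i * a j * K i j)"
    using G by (auto simp: v_def)
qed

section \<open>Gram-Schmidt factorization of positive semidefinite kernels\<close>

definition psd_kernel :: "('j \<Rightarrow> 'j \<Rightarrow> real) \<Rightarrow> bool" where
  "psd_kernel K \<longleftrightarrow> (\<forall>s t. K s t = K t s) \<and>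
     (\<forall>S c. finite S \<longrightarrow> 0 \<le> (\<Sum>s\<in>S. \<Sum>t\<in>S. c s * c t * K s t))"

lemma psd_kernel_sym: "psd_kernel K \<Longrightarrow> K s t = K t s"
  by (simp add: psd_kernel_def)

lemma psd_kernel_nonneg: "psd_kernel K \<Longrightarrow> finite S \<Longrightarrow> 0 \<le> (\<Sum>s\<in>S. \<Sum>t\<in>S. c s * c t * K s t)"
  by (simp add: psd_kernel_def)

lemma psd_kernel_diag: "psd_kernel K \<Longrightarrow> 0 \<le> K s s"
  using psd_kernel_nonneg[of K "{s}" "\<lambda>_. 1"] by simp

text \<open>Positivity for the weights \<open>c\<close> on \<open>S\<close> together with an extra
  weight \<open>x\<close> at \<open>p\<close>. The point \<open>p\<close> may already lie in
  \<open>S\<close>; then the two weights add.\<close>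

lemma psd_kernel_shifted:
  assumes K: "psd_kernel K" and S: "finite S"
  shows "0 \<le> (\<Sum>s\<in>S. \<Sum>t\<in>S. c s * c t * K s t) + 2 * x * (\<Sum>s\<in>S. c s * K s p) + x\<^sup>2 * K p p"
proof -
  define d where "d s = (if s \<in> S then c s else 0) + (if s = p then x else 0)" for s
  let ?T = "insert p S"
  have T: "finite ?T" using S by simp
  have lin: "(\<Sum>s\<in>?T. d s * f s) = (\<Sum>s\<in>S. c s * f s) + x * f p" for f :: "'a \<Rightarrow> real"
  proof -
    have "(\<Sum>s\<in>?T. d s * f s) = (\<Sum>s\<in>?T. (if s \<in> S then c s * f s else 0)) + (\<Sum>s\<in>?T. if s = p then x * f s else 0)"
      by (subst sum.distrib[symmetric]) (auto simp: d_def distrib_right intro!: sum.cong)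
    also have "(\<Sum>s\<in>?T. (if s \<in> S then c s * f s else 0)) = (\<Sum>s\<in>S. c s * f s)"
      using S by (intro sum.mono_neutral_cong_right) auto
    also have "(\<Sum>s\<in>?T. if s = p then x * f s else 0) = x * f p" using T by simp
    finally show ?thesis .
  qed
  have "0 \<le> (\<Sum>s\<in>?T. \<Sum>t\<in>?T. d s * d t * K s t)" by (rule psd_kernel_nonneg[OF K T])
  also have "\<dots> = (\<Sum>s\<in>?T. d s * (\<Sum>t\<in>?T. d t * K s t))" by (simp add: sum_distrib_left mult.assoc)
  also have "\<dots> = (\<Sum>s\<in>?T. d s * ((\<Sum>t\<in>S. c t * K s t) + x * K s p))" by (simp only: lin)
  also have "\<dots> = (\<Sum>s\<in>S. c s * ((\<Sum>t\<in>S. c t * K s t) + x * K s p)) + x * ((\<Sum>t\<in>S. c t * K p t) + x * K p p)" by (simp only: lin)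
  also have "(\<Sum>t\<in>S. c t * K p t) = (\<Sum>t\<in>S. c t * K t p)" using psd_kernel_sym[OF K] by simp
  finally show ?thesis
    by (simp add: distrib_left sum.distrib sum_distrib_left power2_eq_square mult_ac)
qed

lemma psd_kernel_Cauchy_Schwarz_sum:
  assumes K: "psd_kernel K" and S: "finite S"
  shows "(\<Sum>s\<in>S. c s * K s p)\<^sup>2 \<le> (\<Sum>s\<in>S. \<Sum>t\<in>S. c s * c t * K s t) * K p p"
proof (cases "K p p = 0")
  case True
  let ?L = "\<Sum>s\<in>S. c s * K s p" and ?Q = "\<Sum>s\<in>S. \<Sum>t\<in>S. c s * c t * K s t"
  have "?L = 0"
  proof (rule ccontr)
    assume L: "?L \<noteq> 0"
    \<comment> \<open>With a null diagonal entry the shifted form is affine in the extra weight, and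
      this weight gives it the value -1.\<close>
    have "0 \<le> ?Q + 2 * (- (?Q + 1) / (2 * ?L)) * ?L + (- (?Q + 1) / (2 * ?L))\<^sup>2 * K p p" by (rule psd_kernel_shifted[OF K S])
    moreover have "2 * (- (?Q + 1) / (2 * ?L)) * ?L = - (?Q + 1)" using L by (simp add: field_simps)
    ultimately show False using True by simp
  qed
  then show ?thesis using True by simp
next
  case False
  then have p: "0 < K p p" using psd_kernel_diag[OF K, of p] by simp
  let ?L = "\<Sum>s\<in>S. c s * K s p" and ?Q = "\<Sum>s\<in>S. \<Sum>t\<in>S. c s * c t * K s t"
  have "0 \<le> ?Q + 2 * (- ?L / K p p) * ?L + (- ?L / K p p)\<^sup>2 * K p p" by (rule psd_kernel_shifted[OF K S])
  also have "\<dots> = ?Q - ?L\<^sup>2 / K p p" using p by (simp add: power2_eq_square)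
  finally show ?thesis using p by (simp add: pos_divide_le_eq)
qed

lemma psd_kernel_Cauchy_Schwarz: "psd_kernel K \<Longrightarrow> (K s p)\<^sup>2 \<le> K s s * K p p"
  using psd_kernel_Cauchy_Schwarz_sum[of K "{s}" "\<lambda>_. 1" p] by simp

lemma psd_kernel_zero: "psd_kernel K \<Longrightarrow> K p p = 0 \<Longrightarrow> K s p = 0"
  using psd_kernel_Cauchy_Schwarz[of K s p] by simp

text \<open>One Cholesky step with pivot \<open>p\<close>. For \<open>K p p = 0\<close> the division
  convention gives 0 and nothing is removed, in agreement with \<open>psd_kernel_zero\<close>: the
  whole column vanishes.\<close>

definition gs_coeff :: "('j \<Rightarrow> 'j \<Rightarrow> real) \<Rightarrow> 'j \<Rightarrow> 'j \<Rightarrow> real" where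
  "gs_coeff K p s = K s p / sqrt (K p p)"

lemma psd_kernel_residual:
  assumes K: "psd_kernel K"
  shows "psd_kernel (\<lambda>s t. K s t - gs_coeff K p s * gs_coeff K p t)"
    and "K s p - gs_coeff K p s * gs_coeff K p p = 0"
proof -
  have e: "gs_coeff K p s * gs_coeff K p t = K s p * K t p / K p p" for s t
    unfolding gs_coeff_def using psd_kernel_diag[OF K, of p] by simp
  show "K s p - gs_coeff K p s * gs_coeff K p p = 0"
    unfolding e using psd_kernel_zero[OF K, of p s] by (cases "K p p = 0") auto
  show "psd_kernel (\<lambda>s t. K s t - gs_coeff K p s * gs_coeff K p t)"
    unfolding psd_kernel_def
  proof (intro conjI allI impI)
    fix s t show "K s t - gs_coeff K p s * gs_coeff K p t = K t s - gs_coeff K p t * gs_coeff K p s"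
      using psd_kernel_sym[OF K, of s t] by simp
  next
    fix S :: "'a set" and c :: "'a \<Rightarrow> real" assume S: "finite S"
    let ?L = "\<Sum>s\<in>S. c s * K s p" and ?Q = "\<Sum>s\<in>S. \<Sum>t\<in>S. c s * c t * K s t"
    have "(\<Sum>s\<in>S. \<Sum>t\<in>S. c s * c t * (K s t - gs_coeff K p s * gs_coeff K p t))
       = ?Q - (\<Sum>s\<in>S. \<Sum>t\<in>S. (c s * K s p) * (c t * K t p)) / K p p"
      unfolding e by (simp add: right_diff_distrib sum_subtractf sum_divide_distrib mult_ac)
    also have "\<dots> = ?Q - ?L\<^sup>2 / K p p" by (simp only: sum_product power2_eq_square)
    finally have eq: "(\<Sum>s\<in>S. \<Sum>t\<in>S. c s * c t * (K s t - gs_coeff K p s * gs_coeff K p t)) = ?Q - ?L\<^sup>2 / K p p" .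
    show "0 \<le> (\<Sum>s\<in>S. \<Sum>t\<in>S. c s * c t * (K s t - gs_coeff K p s * gs_coeff K p t))"
    proof (cases "K p p = 0")
      case True then show ?thesis unfolding eq using psd_kernel_nonneg[OF K S] by simp
    next
      case False
      then have "0 < K p p" using psd_kernel_diag[OF K, of p] by simp
      then show ?thesis unfolding eq using psd_kernel_Cauchy_Schwarz_sum[OF K S, of c p] by (simp add: pos_divide_le_eq)
    qed
  qed
qed

text \<open>For a Gaussian field with covariance \<open>K\<close> this is the conditional covariance
  given the values at the first \<open>n\<close> points of \<open>t\<close>.\<close>

fun gs_residual :: "('j \<Rightarrow> 'j \<Rightarrow> real) \<Rightarrow> (nat \<Rightarrow> 'j) \<Rightarrow> nat \<Rightarrow> 'j \<Rightarrow> 'j \<Rightarrow> real" where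
  "gs_residual K t 0 = K"
| "gs_residual K t (Suc n) = (\<lambda>s u. gs_residual K t n s u
     - gs_coeff (gs_residual K t n) (t n) s * gs_coeff (gs_residual K t n) (t n) u)"

definition gs_factor :: "('j \<Rightarrow> 'j \<Rightarrow> real) \<Rightarrow> (nat \<Rightarrow> 'j) \<Rightarrow> nat \<Rightarrow> 'j \<Rightarrow> real" where
  "gs_factor K t n = gs_coeff (gs_residual K t n) (t n)"

lemma gs_residual_eq: "gs_residual K t n s u = K s u - (\<Sum>k<n. gs_factor K t k s * gs_factor K t k u)"
  by (induction n) (auto simp: gs_factor_def)

context
  fixes K :: "'j \<Rightarrow> 'j \<Rightarrow> real" and t :: "nat \<Rightarrow> 'j"
  assumes K: "psd_kernel K"
begin

lemma gs_residual_psd: "psd_kernel (gs_residual K t n)"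
  by (induction n) (auto simp: K psd_kernel_residual(1))

lemma gs_residual_zero: "j < n \<Longrightarrow> gs_residual K t n s (t j) = 0"
proof (induction n arbitrary: s)
  case (Suc n)
  let ?R = "gs_residual K t n"
  show ?case
  proof (cases "j = n")
    case True
    then show ?thesis using psd_kernel_residual(2)[OF gs_residual_psd, of n s "t n"] by simp
  next
    case False
    then have j: "j < n" using Suc by simp
    have "?R (t j) (t n) = 0"
      using Suc.IH[OF j, of "t n"] psd_kernel_sym[OF gs_residual_psd, of n "t j" "t n"] by simp
    then show ?thesis using Suc.IH[OF j] by (simp add: gs_coeff_def)
  qed
qed simp

lemma gs_factor_zero: "j < n \<Longrightarrow> gs_factor K t n (t j) = 0"
proof -
  assume "j < n"
  then show ?thesis
    using gs_residual_zero[of j n "t n"] psd_kernel_sym[OF gs_residual_psd, of n "t j" "t n"]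
    by (simp add: gs_factor_def gs_coeff_def)
qed

lemma gs_factor_summable: "summable (\<lambda>k. (gs_factor K t k s)\<^sup>2)" "summable (\<lambda>k. gs_factor K t k s * gs_factor K t k u)"
proof -
  have sq: "summable (\<lambda>k. (gs_factor K t k s)\<^sup>2)" for s
  proof (rule bounded_imp_summable)
    fix n
    have "0 \<le> K s s - (\<Sum>k<Suc n. (gs_factor K t k s)\<^sup>2)"
      using psd_kernel_diag[OF gs_residual_psd, of "Suc n" s] unfolding gs_residual_eq by (simp add: power2_eq_square)
    then show "(\<Sum>k\<le>n. (gs_factor K t k s)\<^sup>2) \<le> K s s" by (simp add: lessThan_Suc_atMost)
  qed simp
  show "summable (\<lambda>k. (gs_factor K t k s)\<^sup>2)" by (rule sq)
  show "summable (\<lambda>k. gs_factor K t k s * gs_factor K t k u)"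
  proof (rule summable_comparison_test')
    show "summable (\<lambda>k. (gs_factor K t k s)\<^sup>2 + (gs_factor K t k u)\<^sup>2)" by (intro summable_add sq)
    fix k :: nat
    have "\<bar>x * y\<bar> \<le> x\<^sup>2 + y\<^sup>2" for x y :: real
    proof -
      have "2 * \<bar>x\<bar> * \<bar>y\<bar> \<le> x\<^sup>2 + y\<^sup>2" using sum_squares_bound[of "\<bar>x\<bar>" "\<bar>y\<bar>"] by simp
      moreover have "0 \<le> \<bar>x\<bar> * \<bar>y\<bar>" by simp
      ultimately show ?thesis unfolding abs_mult by linarith
    qed
    then show "norm (gs_factor K t k s * gs_factor K t k u) \<le> (gs_factor K t k s)\<^sup>2 + (gs_factor K t k u)\<^sup>2" by simp
  qed
qed

definition gs_limit :: "'j \<Rightarrow> 'j \<Rightarrow> real" where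
  "gs_limit s u = K s u - (\<Sum>k. gs_factor K t k s * gs_factor K t k u)"

lemma gs_limit_tendsto: "(\<lambda>n. gs_residual K t n s u) \<longlonglongrightarrow> gs_limit s u"
  unfolding gs_residual_eq gs_limit_def by (intro tendsto_diff tendsto_const summable_LIMSEQ gs_factor_summable)

lemma gs_limit_psd: "psd_kernel gs_limit"
  unfolding psd_kernel_def
proof (intro conjI allI impI)
  fix s u
  have "(\<lambda>n. gs_residual K t n s u) \<longlonglongrightarrow> gs_limit u s"
    using gs_limit_tendsto[of u s] psd_kernel_sym[OF gs_residual_psd] by simp
  then show "gs_limit s u = gs_limit u s" using gs_limit_tendsto[of s u] by (rule LIMSEQ_unique[rotated])
next
  fix S :: "'j set" and c :: "'j \<Rightarrow> real" assume S: "finite S"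
  have "(\<lambda>n. \<Sum>s\<in>S. \<Sum>u\<in>S. c s * c u * gs_residual K t n s u) \<longlonglongrightarrow> (\<Sum>s\<in>S. \<Sum>u\<in>S. c s * c u * gs_limit s u)"
    by (intro tendsto_sum tendsto_mult tendsto_const gs_limit_tendsto)
  then show "0 \<le> (\<Sum>s\<in>S. \<Sum>u\<in>S. c s * c u * gs_limit s u)"
    by (rule LIMSEQ_le_const) (use psd_kernel_nonneg[OF gs_residual_psd S] in auto)
qed

lemma gs_limit_zero: "gs_limit s (t j) = 0"
proof -
  have "\<forall>\<^sub>F n in sequentially. gs_residual K t n s (t j) = 0"
    unfolding eventually_sequentially using gs_residual_zero by (auto intro!: exI[of _ "Suc j"])
  then have "(\<lambda>n. gs_residual K t n s (t j)) \<longlonglongrightarrow> 0" by (rule tendsto_eventually)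
  then show ?thesis using gs_limit_tendsto LIMSEQ_unique by blast
qed

text \<open>Passing to the residual subtracts a sum of squares of differences of
  \<open>gs_factor\<close>, so distances in the metric of the kernel can only shrink. Together with
  a dense sequence this makes a residual vanish everywhere.\<close>

lemma gs_limit_increment: "gs_limit s s - 2 * gs_limit s u + gs_limit u u \<le> K s s - 2 * K s u + K u u"
proof -
  have "gs_residual K t n s s - 2 * gs_residual K t n s u + gs_residual K t n u u \<le> K s s - 2 * K s u + K u u" for n
  proof -
    have "0 \<le> (\<Sum>k<n. (gs_factor K t k s - gs_factor K t k u)\<^sup>2)" by (intro sum_nonneg) auto
    also have "\<dots> = (\<Sum>k<n. gs_factor K t k s * gs_factor K t k s) - 2 * (\<Sum>k<n. gs_factor K t k s * gs_factor K t k u)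
        + (\<Sum>k<n. gs_factor K t k u * gs_factor K t k u)"
      by (simp add: power2_eq_square algebra_simps sum.distrib sum_subtractf sum_distrib_left)
    finally have "0 \<le> (\<Sum>k<n. gs_factor K t k s * gs_factor K t k s) - 2 * (\<Sum>k<n. gs_factor K t k s * gs_factor K t k u)
        + (\<Sum>k<n. gs_factor K t k u * gs_factor K t k u)" .
    moreover have "0 \<le> a - 2 * b + c \<Longrightarrow> x - a - 2 * (y - b) + (z - c) \<le> x - 2 * y + z" for a b c x y z :: real by simp
    ultimately show ?thesis unfolding gs_residual_eq by blast
  qed
  then show ?thesis
    by (intro LIMSEQ_le_const2[OF tendsto_add[OF tendsto_diff[OF gs_limit_tendsto tendsto_mult[OF tendsto_const gs_limit_tendsto]] gs_limit_tendsto]]) auto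
qed

text \<open>The residual column at \<open>t n\<close> is the column of \<open>K\<close> there plus a
  combination of the columns at earlier points. The pivot is therefore the value of the form of
  \<open>K\<close> at a vector with entry 1 at \<open>t n\<close>: its remaining entries meet rows
  of the residual that vanish.\<close>

lemma gs_factor_pos:
  assumes strict: "\<And>S c. finite S \<Longrightarrow> (\<exists>s\<in>S. c s \<noteq> 0) \<Longrightarrow> 0 < (\<Sum>s\<in>S. \<Sum>u\<in>S. c s * c u * K s u)" and t: "inj t"
  shows "0 < gs_factor K t n (t n)"
proof -
  have "\<exists>b. \<forall>s. gs_residual K t n s u = K s u + (\<Sum>i<n. b i * K s (t i))" for n u
  proof (induction n arbitrary: u)
    case (Suc n)
    obtain b where b: "\<And>s. gs_residual K t n s u = K s u + (\<Sum>i<n. b i * K s (t i))" using Suc by blast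
    obtain b' where b': "\<And>s. gs_residual K t n s (t n) = K s (t n) + (\<Sum>i<n. b' i * K s (t i))" using Suc by blast
    let ?g = "gs_coeff (gs_residual K t n) (t n) u / sqrt (gs_residual K t n (t n) (t n))"
    have "gs_residual K t (Suc n) s u = K s u + (\<Sum>i<Suc n. (if i = n then - ?g else b i - ?g * b' i) * K s (t i))" for s
    proof -
      have "gs_residual K t (Suc n) s u = gs_residual K t n s u - ?g * gs_residual K t n s (t n)"
        by (simp add: gs_coeff_def)
      also have "\<dots> = K s u + ((\<Sum>i<n. (b i - ?g * b' i) * K s (t i)) - ?g * K s (t n))"
        unfolding b b' by (simp add: left_diff_distrib sum_subtractf sum_distrib_left distrib_left mult.assoc)
      finally show ?thesis by simp
    qed
    then show ?case by (intro exI[of _ "\<lambda>i. if i = n then - ?g else b i - ?g * b' i"] allI)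
  qed auto
  then obtain b where b: "\<And>s. gs_residual K t n s (t n) = K s (t n) + (\<Sum>i<n. b i * K s (t i))" by blast
  define c where "c i = (if i = n then 1 else b i)" for i
  have R: "gs_residual K t n s (t n) = (\<Sum>i<Suc n. c i * K s (t i))" for s by (simp add: b c_def)
  let ?S = "t ` {..<Suc n}"
  have inj: "inj_on t {..<Suc n}" using t by (rule inj_on_subset) simp
  define d where "d s = c (the_inv_into {..<Suc n} t s)" for s
  have d: "d (t i) = c i" if "i < Suc n" for i using that inj by (simp add: d_def the_inv_into_f_f)
  have "0 < (\<Sum>s\<in>?S. \<Sum>u\<in>?S. d s * d u * K s u)"
    by (rule strict) (auto simp: d c_def intro!: bexI[of _ n])
  also have "\<dots> = (\<Sum>j<Suc n. \<Sum>i<Suc n. c j * c i * K (t j) (t i))"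
    using inj by (simp only: sum.reindex comp_def) (intro sum.cong refl, simp add: d)
  also have "\<dots> = (\<Sum>j<Suc n. c j * gs_residual K t n (t j) (t n))"
    unfolding R by (simp add: sum_distrib_left mult.assoc del: sum.lessThan_Suc)
  also have "\<dots> = gs_residual K t n (t n) (t n)"
  proof -
    have "gs_residual K t n (t j) (t n) = 0" if "j < n" for j
      using gs_residual_zero[OF that, of "t n"] psd_kernel_sym[OF gs_residual_psd] by simp
    then show ?thesis by (simp add: c_def)
  qed
  finally show ?thesis by (simp add: gs_factor_def gs_coeff_def)
qed

end

text \<open>A positive residual variance at \<open>s\<close> contradicts a point \<open>t j\<close>
  that is close to \<open>s\<close> in the metric of \<open>K\<close>, since the residual vanishes
  at \<open>t j\<close>. \<open>L\<close> is kept apart from \<open>K\<close> because the dense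
  sequence is applied to a kernel that is already a residual of \<open>K\<close>.\<close>

lemma gs_limit_dense:
  assumes K: "psd_kernel K" and L: "psd_kernel L" and dense: "\<And>s \<epsilon>. 0 < \<epsilon> \<Longrightarrow> \<exists>j. K s s - 2 * K s (t j) + K (t j) (t j) < \<epsilon>"
    and le: "\<And>s u. L s s - 2 * L s u + L u u \<le> K s s - 2 * K s u + K u u"
  shows "gs_limit L t s u = 0"
proof -
  have d: "gs_limit L t s s = 0" for s
  proof (rule ccontr)
    assume "gs_limit L t s s \<noteq> 0"
    then have "0 < gs_limit L t s s" using psd_kernel_diag[OF gs_limit_psd[OF L], of t s] by simp
    from dense[OF this, of s] obtain j where "K s s - 2 * K s (t j) + K (t j) (t j) < gs_limit L t s s" by blast
    moreover have "gs_limit L t s s - 2 * gs_limit L t s (t j) + gs_limit L t (t j) (t j) \<le> K s s - 2 * K s (t j) + K (t j) (t j)"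
      using gs_limit_increment[OF L, of t s "t j"] le[of s "t j"] by linarith
    ultimately show False using gs_limit_zero[OF L, of t] by simp
  qed
  show ?thesis by (rule psd_kernel_zero[OF gs_limit_psd[OF L] d])
qed

text \<open>Gram-Schmidt along \<open>t\<close> first and then along the dense sequence \<open>r\<close>, so that the values at
  the points of \<open>t\<close> only involve finitely many coefficients of the first kind.\<close>

lemma kernel_factorization:
  fixes K :: "'j \<Rightarrow> 'j \<Rightarrow> real" and t r :: "nat \<Rightarrow> 'j"
  assumes K: "psd_kernel K" and dense: "\<And>s \<epsilon>. 0 < \<epsilon> \<Longrightarrow> \<exists>j. K s s - 2 * K s (r j) + K (r j) (r j) < \<epsilon>"
    and strict: "\<And>S c. finite S \<Longrightarrow> (\<exists>s\<in>S. c s \<noteq> 0) \<Longrightarrow> 0 < (\<Sum>s\<in>S. \<Sum>u\<in>S. c s * c u * K s u)" and t: "inj t"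
  obtains e f :: "'j \<Rightarrow> nat \<Rightarrow> real"
  where "\<And>s u. summable (\<lambda>k. e s k * e u k)" "\<And>s u. summable (\<lambda>k. f s k * f u k)"
    "\<And>s u. K s u = (\<Sum>k. e s k * e u k) + (\<Sum>k. f s k * f u k)"
    "\<And>j k. j < k \<Longrightarrow> e (t j) k = 0" "\<And>j. 0 < e (t j) j" "\<And>j k. f (t j) k = 0"
proof
  define L where "L = gs_limit K t"
  have L: "psd_kernel L" unfolding L_def by (rule gs_limit_psd[OF K])
  show "summable (\<lambda>k. gs_factor K t k s * gs_factor K t k u)" for s u by (rule gs_factor_summable(2)[OF K])
  show "summable (\<lambda>k. gs_factor L r k s * gs_factor L r k u)" for s u by (rule gs_factor_summable(2)[OF L])
  have "gs_limit L r s u = 0" for s u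
    by (rule gs_limit_dense[OF K L dense]) (use gs_limit_increment[OF K, of t] in \<open>auto simp: L_def\<close>)
  then have "L s u = (\<Sum>k. gs_factor L r k s * gs_factor L r k u)" for s u
    by (simp add: gs_limit_def[OF L])
  moreover have "L s u = K s u - (\<Sum>k. gs_factor K t k s * gs_factor K t k u)" for s u
    by (simp add: L_def gs_limit_def[OF K])
  ultimately show "K s u = (\<Sum>k. gs_factor K t k s * gs_factor K t k u) + (\<Sum>k. gs_factor L r k s * gs_factor L r k u)" for s u
    by (metis add.commute diff_add_cancel)
  show "j < k \<Longrightarrow> gs_factor K t k (t j) = 0" for j k by (rule gs_factor_zero[OF K])
  show "0 < gs_factor K t j (t j)" for j by (rule gs_factor_pos[OF K strict t])
  have "L (t j) (t j) = 0" for j unfolding L_def by (rule gs_limit_zero[OF K])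
  then have "(\<Sum>k. (gs_factor L r k (t j))\<^sup>2) = 0" for j
    using \<open>\<And>s u. L s u = (\<Sum>k. gs_factor L r k s * gs_factor L r k u)\<close>[of "t j" "t j"] by (simp add: power2_eq_square)
  then show "gs_factor L r k (t j) = 0" for j k
    using suminf_eq_zero_iff[OF gs_factor_summable(1)[OF L, of r "t j"]] by simp
qed

section \<open>Generalized Cauchy kernels\<close>

text \<open>The triangle kernel is the Gram matrix in L2 of the indicators of intervals of length
  \<open>a\<close>.\<close>

lemma interval_overlap:
  fixes a s t :: real
  assumes "0 < a"
  shows "integrable lborel (\<lambda>z. indicator {s - a/2..s + a/2} z * indicator {t - a/2..t + a/2} z :: real)"
    and "(\<integral>z. indicator {s - a/2..s + a/2} z * indicator {t - a/2..t + a/2} z \<partial>lborel) = max 0 (a - \<bar>s - t\<bar>)"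
proof -
  have eq: "(\<lambda>z. indicator {s - a/2..s + a/2} z * indicator {t - a/2..t + a/2} z :: real)
     = indicator {max s t - a/2..min s t + a/2}"
    by (auto simp: indicator_def fun_eq_iff)
  show "integrable lborel (\<lambda>z. indicator {s - a/2..s + a/2} z * indicator {t - a/2..t + a/2} z :: real)"
    unfolding eq by (intro integrable_real_indicator) (auto simp: emeasure_lborel_Icc_eq)
  show "(\<integral>z. indicator {s - a/2..s + a/2} z * indicator {t - a/2..t + a/2} z \<partial>lborel) = max 0 (a - \<bar>s - t\<bar>)"
    unfolding eq by (auto simp: max_def min_def abs_if not_le)
qed

lemma half_le_sin:
  fixes y :: real
  assumes "0 \<le> y" "y \<le> 1 / 2"
  shows "y / 2 \<le> sin y"
proof (cases "y = 0")
  case False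
  then have y: "0 < y" using assms by simp
  obtain z where z: "0 < z" "z < y" "sin y - sin 0 = (y - 0) * cos z"
    using MVT2[OF y, of sin cos] DERIV_sin by blast
  have "1 / 2 \<le> pi / 3" using pi_gt3 by simp
  then have "cos (pi / 3) \<le> cos z"
    using z assms pi_gt_zero by (intro cos_monotone_0_pi_le) linarith+
  then have "1 / 2 \<le> cos z" by (simp add: cos_60)
  then have "y * (1 / 2) \<le> y * cos z" using y by (intro mult_left_mono) auto
  then show ?thesis using z by simp
qed simp

text \<open>A moving average over a window of length \<open>a\<close> acts on cosines of frequency
  \<omega> as multiplication by \<open>2 * sin (\<omega> * a / 2) / \<omega>\<close>, whatever the
  phase. If \<open>\<bar>\<omega>\<bar> * a \<le> 1\<close>, this multiplier is at least
  \<open>a / 2\<close>.\<close>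

lemma cos_window:
  fixes a \<omega> \<theta> :: real
  assumes a: "0 < a" "\<bar>\<omega>\<bar> * a \<le> 1"
  shows "\<exists>m\<ge>a / 2. \<forall>s. has_bochner_integral lborel (\<lambda>z. cos (\<omega> * z + \<theta>) * indicator {s - a/2..s + a/2} z) (m * cos (\<omega> * s + \<theta>))"
proof (cases "\<omega> = 0")
  case True
  have "has_bochner_integral lborel (\<lambda>z. cos (\<omega> * z + \<theta>) * indicator {s - a/2..s + a/2} z) (a * cos (\<omega> * s + \<theta>))" for s
  proof -
    have "has_bochner_integral lborel (\<lambda>z. cos \<theta> * indicator {s - a/2..s + a/2} z) (cos \<theta> * a)"
      using a by (intro has_bochner_integral_mult_right) (auto simp: has_bochner_integral_iff emeasure_lborel_Icc_eq intro!: integrable_real_indicator)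
    then show ?thesis using True by (simp add: mult.commute)
  qed
  then show ?thesis using a by (intro exI[of _ a]) auto
next
  case False
  define m where "m = 2 * sin (\<bar>\<omega>\<bar> * a / 2) / \<bar>\<omega>\<bar>"
  have w: "0 < \<bar>\<omega>\<bar>" using False by simp
  have "\<bar>\<omega>\<bar> * a / 2 / 2 \<le> sin (\<bar>\<omega>\<bar> * a / 2)" using a w by (intro half_le_sin) auto
  then have "a / 2 \<le> m" using w by (simp add: m_def field_simps)
  moreover have "has_bochner_integral lborel (\<lambda>z. cos (\<omega> * z + \<theta>) * indicator {s - a/2..s + a/2} z) (m * cos (\<omega> * s + \<theta>))" for s
  proof -
    have "has_bochner_integral lborel (\<lambda>z. cos (\<omega> * z + \<theta>) * indicator {s - a/2..s + a/2} z)
       (sin (\<omega> * (s + a/2) + \<theta>) / \<omega> - sin (\<omega> * (s - a/2) + \<theta>) / \<omega>)"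
    proof (rule has_bochner_integral_FTC_Icc_real)
      show "s - a/2 \<le> s + a/2" using a by simp
      fix x show "((\<lambda>z. sin (\<omega> * z + \<theta>) / \<omega>) has_real_derivative cos (\<omega> * x + \<theta>)) (at x)"
        using False by (auto intro!: derivative_eq_intros)
    qed (intro continuous_intros)
    also have "sin (\<omega> * (s + a/2) + \<theta>) / \<omega> - sin (\<omega> * (s - a/2) + \<theta>) / \<omega> = 2 * sin (\<omega> * a / 2) / \<omega> * cos (\<omega> * s + \<theta>)"
    proof -
      have "\<omega> * (s + a/2) + \<theta> = (\<omega> * s + \<theta>) + \<omega> * a / 2" "\<omega> * (s - a/2) + \<theta> = (\<omega> * s + \<theta>) - \<omega> * a / 2"
        by (simp_all add: algebra_simps)
      then show ?thesis by (simp only: sin_add sin_diff) (simp add: diff_divide_distrib[symmetric])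
    qed
    also have "2 * sin (\<omega> * a / 2) / \<omega> = m" unfolding m_def by (simp add: abs_if)
    finally show ?thesis .
  qed
  ultimately show ?thesis by blast
qed

text \<open>The form is the squared L2 norm of a weighted sum of window indicators, which is
  supported in an interval of length \<open>hi - lo + a\<close>. Cauchy-Schwarz against the cosine
  on this interval, with \<open>cos_window\<close> for the inner product, gives the bound.\<close>

lemma triangle_quadratic_form:
  fixes S :: "real set"
  assumes S: "finite S" "S \<subseteq> {lo..hi}" and a: "0 < a" "\<bar>\<omega>\<bar> * a \<le> 1" and le: "lo \<le> hi"
  shows "(a / 2)\<^sup>2 * (\<Sum>s\<in>S. c s * cos (\<omega> * s + \<theta>))\<^sup>2 \<le> (hi - lo + a) * (\<Sum>s\<in>S. \<Sum>t\<in>S. c s * c t * max 0 (a - \<bar>s - t\<bar>))"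
proof -
  obtain m where m: "a / 2 \<le> m"
    and I: "\<And>s. has_bochner_integral lborel (\<lambda>z. cos (\<omega> * z + \<theta>) * indicator {s - a/2..s + a/2} z) (m * cos (\<omega> * s + \<theta>))"
    using cos_window[OF a] by blast
  define Z where "Z = (\<Sum>s\<in>S. c s * cos (\<omega> * s + \<theta>))"
  define q where "q = (\<Sum>s\<in>S. \<Sum>t\<in>S. c s * c t * max 0 (a - \<bar>s - t\<bar>))"
  define L where "L = hi - lo + a"
  have L: "0 < L" using le a by (simp add: L_def)
  define ind where "ind s z = (indicator {s - a/2..s + a/2} z :: real)" for s z :: real
  define J where "J z = (indicator {lo - a/2..hi + a/2} z :: real)" for z :: real
  define g where "g z = cos (\<omega> * z + \<theta>)" for z
  \<comment> \<open>The minimizer of \<open>q - 2 * \<mu> * (m * Z) + \<mu>\<^sup>2 * L\<close>;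
    Cauchy-Schwarz is written as nonnegativity of a square.\<close>
  define \<mu> where "\<mu> = m * Z / L"
  have indJ: "ind s z * J z = ind s z" if "s \<in> S" for s z
    using S(2) that by (auto simp: ind_def J_def indicator_def)
  have JJ: "J z * J z = J z" for z by (simp add: J_def indicator_def)
  have iJ: "integrable lborel (\<lambda>z. J z * (g z)\<^sup>2)"
  proof (rule Bochner_Integration.integrable_bound[where f=J])
    show "integrable lborel J" unfolding J_def by (intro integrable_real_indicator) (auto simp: emeasure_lborel_Icc_eq)
    show "AE z in lborel. norm (J z * (g z)\<^sup>2) \<le> norm (J z)"
      by (auto simp: J_def g_def indicator_def abs_square_le_1)
  qed (auto simp: J_def g_def)
  have JL: "(\<integral>z. J z * (g z)\<^sup>2 \<partial>lborel) \<le> L"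
  proof -
    have "integrable lborel J" unfolding J_def by (intro integrable_real_indicator) (auto simp: emeasure_lborel_Icc_eq)
    moreover have "J z * (g z)\<^sup>2 \<le> J z" for z by (simp add: J_def g_def indicator_def abs_square_le_1)
    ultimately have "(\<integral>z. J z * (g z)\<^sup>2 \<partial>lborel) \<le> (\<integral>z. J z \<partial>lborel)"
      by (intro integral_mono iJ)
    also have "\<dots> = L" using le a by (simp add: J_def L_def)
    finally show ?thesis .
  qed
  have exp: "((\<Sum>s\<in>S. c s * ind s z) - \<mu> * (g z * J z))\<^sup>2
     = (\<Sum>s\<in>S. \<Sum>t\<in>S. c s * c t * (ind s z * ind t z)) - 2 * \<mu> * (\<Sum>s\<in>S. c s * (g z * ind s z)) + \<mu>\<^sup>2 * (J z * (g z)\<^sup>2)" for z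
  proof -
    have "((\<Sum>s\<in>S. c s * ind s z) - \<mu> * (g z * J z))\<^sup>2 = (\<Sum>s\<in>S. c s * ind s z) * (\<Sum>s\<in>S. c s * ind s z)
       - 2 * \<mu> * (\<Sum>s\<in>S. c s * ind s z) * (g z * J z) + \<mu>\<^sup>2 * ((J z * J z) * (g z)\<^sup>2)"
      by (simp add: power2_eq_square algebra_simps)
    also have "(\<Sum>s\<in>S. c s * ind s z) * (\<Sum>s\<in>S. c s * ind s z) = (\<Sum>s\<in>S. \<Sum>t\<in>S. c s * c t * (ind s z * ind t z))"
      by (simp add: sum_product mult_ac)
    also have "2 * \<mu> * (\<Sum>s\<in>S. c s * ind s z) * (g z * J z) = 2 * \<mu> * (\<Sum>s\<in>S. c s * (g z * (ind s z * J z)))"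
      by (simp add: sum_distrib_left sum_distrib_right mult_ac)
    also have "(\<Sum>s\<in>S. c s * (g z * (ind s z * J z))) = (\<Sum>s\<in>S. c s * (g z * ind s z))"
      by (intro sum.cong refl) (simp add: indJ)
    finally show ?thesis unfolding JJ .
  qed
  have i1: "integrable lborel (\<lambda>z. ind s z * ind t z)" "(\<integral>z. ind s z * ind t z \<partial>lborel) = max 0 (a - \<bar>s - t\<bar>)" for s t
    unfolding ind_def using interval_overlap[OF a(1)] by auto
  have i2: "integrable lborel (\<lambda>z. g z * ind s z)" "(\<integral>z. g z * ind s z \<partial>lborel) = m * cos (\<omega> * s + \<theta>)" for s
    using I[of s] unfolding g_def ind_def by (auto simp: has_bochner_integral_iff)
  have "0 \<le> (\<integral>z. ((\<Sum>s\<in>S. c s * ind s z) - \<mu> * (g z * J z))\<^sup>2 \<partial>lborel)" by (rule integral_nonneg_AE) simp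
  also have "\<dots> = q - 2 * \<mu> * (\<Sum>s\<in>S. c s * (m * cos (\<omega> * s + \<theta>))) + \<mu>\<^sup>2 * (\<integral>z. J z * (g z)\<^sup>2 \<partial>lborel)"
    unfolding exp q_def
    by (rule has_bochner_integral_integral_eq,
        intro has_bochner_integral_add has_bochner_integral_diff has_bochner_integral_sum has_bochner_integral_mult_right)
       (auto simp: has_bochner_integral_iff i1 i2 iJ)
  also have "(\<Sum>s\<in>S. c s * (m * cos (\<omega> * s + \<theta>))) = m * Z"
    by (simp add: Z_def sum_distrib_left mult_ac)
  also have "q - 2 * \<mu> * (m * Z) + \<mu>\<^sup>2 * (\<integral>z. J z * (g z)\<^sup>2 \<partial>lborel) \<le> q - 2 * \<mu> * (m * Z) + \<mu>\<^sup>2 * L" using JL by (intro add_left_mono mult_left_mono) auto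
  also have "\<dots> = q - (m * Z)\<^sup>2 / L" using L by (simp add: \<mu>_def power2_eq_square)
  finally have "(m * Z)\<^sup>2 \<le> L * q" using L by (simp add: pos_divide_le_eq mult.commute)
  moreover have "(a / 2)\<^sup>2 * Z\<^sup>2 \<le> (m * Z)\<^sup>2"
    using m a by (simp add: power_mult_distrib mult_right_mono power_mono)
  ultimately show ?thesis by (simp add: Z_def q_def L_def)
qed

lemma triangle_quadratic_form_nonneg:
  fixes S :: "real set"
  assumes S: "finite S" and a: "0 < a"
  shows "0 \<le> (\<Sum>s\<in>S. \<Sum>t\<in>S. c s * c t * max 0 (a - \<bar>s - t\<bar>))"
proof (cases "S = {}")
  case False
  have "0 \<le> (a / 2)\<^sup>2 * (\<Sum>s\<in>S. c s * cos (0 * s + 0))\<^sup>2" by simp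
  also have "\<dots> \<le> (Max S - Min S + a) * (\<Sum>s\<in>S. \<Sum>t\<in>S. c s * c t * max 0 (a - \<bar>s - t\<bar>))"
    by (rule triangle_quadratic_form) (use S False a in \<open>auto intro: order_trans[OF Min_le Max_ge]\<close>)
  finally show ?thesis
    using S False a by (simp add: zero_le_mult_iff) (smt (verit) Max_ge Min_in)
qed simp

text \<open>Polya's criterion in quantitative form: a convex decreasing function is a mixture of triangles,
  up to a multiple of the identity coming from the behaviour at \<open>0\<close>.\<close>

lemma convex_quadratic_form:
  fixes g g1 g2 :: "real \<Rightarrow> real" and S :: "real set"
  assumes g: "continuous_on {0..R} g"
    and g1: "\<And>t. 0 < t \<Longrightarrow> (g has_real_derivative g1 t) (at t)"
    and g2: "\<And>t. 0 < t \<Longrightarrow> (g1 has_real_derivative g2 t) (at t)"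
    and g2c: "continuous_on {0<..} g2" and g2p: "\<And>t. 0 < t \<Longrightarrow> 0 < g2 t"
    and R: "0 < R" "0 \<le> g R" "g1 R \<le> 0"
    and S: "finite S" "\<And>s t. s \<in> S \<Longrightarrow> t \<in> S \<Longrightarrow> \<bar>s - t\<bar> \<le> R"
    and \<epsilon>: "0 < \<epsilon>" "\<epsilon> \<le> R" "\<And>s t. s \<in> S \<Longrightarrow> t \<in> S \<Longrightarrow> s \<noteq> t \<Longrightarrow> \<epsilon> \<le> \<bar>s - t\<bar>"
  shows "\<exists>\<rho>>0. \<forall>c. integral {\<epsilon>..R} (\<lambda>a. g2 a * (\<Sum>s\<in>S. \<Sum>t\<in>S. c s * c t * max 0 (a - \<bar>s - t\<bar>))) + \<rho> * (\<Sum>s\<in>S. (c s)\<^sup>2)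
     \<le> (\<Sum>s\<in>S. \<Sum>t\<in>S. c s * c t * g \<bar>s - t\<bar>)"
proof -
  have cont: "continuous_on {\<epsilon>..R} (\<lambda>a. g2 a * max 0 (a - t))" for t
    by (intro continuous_intros continuous_on_subset[OF g2c]) (use \<epsilon> in auto)
  have int: "(\<lambda>a. g2 a * max 0 (a - t)) integrable_on {\<epsilon>..R}" for t
    by (rule integrable_continuous_real[OF cont])
  have FTC: "((\<lambda>a. g2 a * (a - t)) has_integral (g1 R * (R - t) - g R) - (g1 u * (u - t) - g u)) {u..R}"
    if u: "0 < u" "u \<le> R" for u t
  proof (rule fundamental_theorem_of_calculus)
    show "u \<le> R" by fact
    fix x assume x: "x \<in> {u..R}"
    have "((\<lambda>a. g1 a * (a - t) - g a) has_real_derivative g2 x * (x - t)) (at x)"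
      using x u by (auto intro!: derivative_eq_intros g1 g2)
    then show "((\<lambda>a. g1 a * (a - t) - g a) has_vector_derivative g2 x * (x - t)) (at x within {u..R})"
      by (simp add: has_real_derivative_iff_has_vector_derivative has_vector_derivative_at_within)
  qed
  have far: "integral {\<epsilon>..R} (\<lambda>a. g2 a * max 0 (a - t)) = g1 R * (R - t) - g R + g t" if t: "\<epsilon> \<le> t" "t \<le> R" for t
  proof -
    have "integral {\<epsilon>..t} (\<lambda>a. g2 a * max 0 (a - t)) = integral {\<epsilon>..t} (\<lambda>a. 0)"
      by (intro integral_cong) auto
    moreover have "integral {t..R} (\<lambda>a. g2 a * max 0 (a - t)) = integral {t..R} (\<lambda>a. g2 a * (a - t))"
      by (intro integral_cong) auto
    moreover have "integral {t..R} (\<lambda>a. g2 a * (a - t)) = (g1 R * (R - t) - g R) - (g1 t * (t - t) - g t)"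
      using FTC[of t t] t \<epsilon> by (intro integral_unique) auto
    moreover have "integral {\<epsilon>..t} (\<lambda>a. g2 a * max 0 (a - t)) + integral {t..R} (\<lambda>a. g2 a * max 0 (a - t))
       = integral {\<epsilon>..R} (\<lambda>a. g2 a * max 0 (a - t))"
      using t int by (intro Henstock_Kurzweil_Integration.integral_combine) auto
    ultimately show ?thesis by simp
  qed
  \<comment> \<open>Formally the integral of \<open>a * g2 a\<close> from 0 to \<epsilon>. Distinct
    points are at least \<epsilon> apart, so triangles narrower than \<epsilon> see only the
    diagonal and add a multiple of the identity, which strict convexity makes positive. The possible
    singularity of \<open>g2\<close> at 0 is avoided in this way.\<close>
  define \<rho> where "\<rho> = g 0 - g \<epsilon> + \<epsilon> * g1 \<epsilon>"
  have near: "integral {\<epsilon>..R} (\<lambda>a. g2 a * max 0 (a - 0)) = g1 R * R - g R + g 0 - \<rho>"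
  proof -
    have "integral {\<epsilon>..R} (\<lambda>a. g2 a * max 0 (a - 0)) = integral {\<epsilon>..R} (\<lambda>a. g2 a * (a - 0))"
      using \<epsilon> by (intro integral_cong) auto
    also have "\<dots> = (g1 R * (R - 0) - g R) - (g1 \<epsilon> * (\<epsilon> - 0) - g \<epsilon>)"
      using FTC[of \<epsilon> 0] \<epsilon> by (intro integral_unique) auto
    finally show ?thesis by (simp add: \<rho>_def)
  qed
  have \<rho>: "0 < \<rho>"
  proof -
    have "continuous_on {0..\<epsilon>} g" using g \<epsilon> by (rule_tac continuous_on_subset) auto
    then obtain l z where z: "0 < z" "z < \<epsilon>" "DERIV g z :> l" "g \<epsilon> - g 0 = (\<epsilon> - 0) * l"
      using MVT[OF \<epsilon>(1), of g] g1 by (metis real_differentiable_def)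
    have l: "l = g1 z" using DERIV_unique[OF z(3) g1[OF z(1)]] .
    obtain y where y: "z < y" "y < \<epsilon>" "g1 \<epsilon> - g1 z = (\<epsilon> - z) * g2 y"
    proof -
      have "(g1 has_real_derivative g2 x) (at x)" if "z \<le> x" "x \<le> \<epsilon>" for x
        using that z by (intro g2) auto
      from MVT2[OF z(2) this] show ?thesis using that by blast
    qed
    have "0 < (\<epsilon> - z) * g2 y" using y z by (intro mult_pos_pos g2p) auto
    then have "g1 z < g1 \<epsilon>" using y by simp
    then have "\<epsilon> * g1 z < \<epsilon> * g1 \<epsilon>" using \<epsilon> by simp
    then show ?thesis using z(4) unfolding \<rho>_def l by simp
  qed
  \<comment> \<open>Taylor's formula at \<open>R\<close> with integral remainder, where the
    truncation by \<open>max 0\<close> extends the remainder below the distance of the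
    points.\<close>
  have rep: "g \<bar>s - t\<bar> = g R - g1 R * max 0 (R - \<bar>s - t\<bar>) + integral {\<epsilon>..R} (\<lambda>a. g2 a * max 0 (a - \<bar>s - t\<bar>)) + (if s = t then \<rho> else 0)"
    if "s \<in> S" "t \<in> S" for s t
    using near far[of "\<bar>s - t\<bar>"] S(2)[OF that] \<epsilon>(3)[OF that] R by (cases "s = t") (auto simp: max_def)
  have "integral {\<epsilon>..R} (\<lambda>a. g2 a * (\<Sum>s\<in>S. \<Sum>t\<in>S. c s * c t * max 0 (a - \<bar>s - t\<bar>))) + \<rho> * (\<Sum>s\<in>S. (c s)\<^sup>2)
     \<le> (\<Sum>s\<in>S. \<Sum>t\<in>S. c s * c t * g \<bar>s - t\<bar>)" for c
  proof -
    have "(\<Sum>s\<in>S. \<Sum>t\<in>S. c s * c t * g \<bar>s - t\<bar>) = (\<Sum>s\<in>S. \<Sum>t\<in>S. c s * c t * (g R - g1 R * max 0 (R - \<bar>s - t\<bar>)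
       + integral {\<epsilon>..R} (\<lambda>a. g2 a * max 0 (a - \<bar>s - t\<bar>)) + (if s = t then \<rho> else 0)))"
      by (intro sum.cong refl) (simp only: rep)
    also have "\<dots> = (\<Sum>s\<in>S. \<Sum>t\<in>S. c s * c t) * g R - g1 R * (\<Sum>s\<in>S. \<Sum>t\<in>S. c s * c t * max 0 (R - \<bar>s - t\<bar>))
       + (\<Sum>s\<in>S. \<Sum>t\<in>S. c s * c t * integral {\<epsilon>..R} (\<lambda>a. g2 a * max 0 (a - \<bar>s - t\<bar>))) + (\<Sum>s\<in>S. \<Sum>t\<in>S. c s * c t * (if s = t then \<rho> else 0))"
      by (simp only: distrib_left right_diff_distrib sum.distrib sum_subtractf sum_distrib_left sum_distrib_right mult_ac)
    also have "(\<Sum>s\<in>S. \<Sum>t\<in>S. c s * c t * (if s = t then \<rho> else 0)) = \<rho> * (\<Sum>s\<in>S. (c s)\<^sup>2)"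
      using S(1) by (simp add: sum_distrib_left power2_eq_square mult_ac if_distrib cong: if_cong)
    also have "(\<Sum>s\<in>S. \<Sum>t\<in>S. c s * c t) = (sum c S)\<^sup>2" by (simp add: power2_eq_square sum_product)
    also have "(\<Sum>s\<in>S. \<Sum>t\<in>S. c s * c t * integral {\<epsilon>..R} (\<lambda>a. g2 a * max 0 (a - \<bar>s - t\<bar>)))
       = integral {\<epsilon>..R} (\<lambda>a. \<Sum>s\<in>S. \<Sum>t\<in>S. c s * c t * (g2 a * max 0 (a - \<bar>s - t\<bar>)))"
      by (rule integral_unique[symmetric]) (intro has_integral_sum S(1) has_integral_mult_right integrable_integral int)
    also have "\<dots> = integral {\<epsilon>..R} (\<lambda>a. g2 a * (\<Sum>s\<in>S. \<Sum>t\<in>S. c s * c t * max 0 (a - \<bar>s - t\<bar>)))"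
      by (simp add: sum_distrib_left mult_ac)
    finally have eq: "(\<Sum>s\<in>S. \<Sum>t\<in>S. c s * c t * g \<bar>s - t\<bar>) = (sum c S)\<^sup>2 * g R - g1 R * (\<Sum>s\<in>S. \<Sum>t\<in>S. c s * c t * max 0 (R - \<bar>s - t\<bar>))
      + integral {\<epsilon>..R} (\<lambda>a. g2 a * (\<Sum>s\<in>S. \<Sum>t\<in>S. c s * c t * max 0 (a - \<bar>s - t\<bar>))) + \<rho> * (\<Sum>s\<in>S. (c s)\<^sup>2)" .
    have "0 \<le> (sum c S)\<^sup>2 * g R" using R by simp
    moreover have "g1 R * (\<Sum>s\<in>S. \<Sum>t\<in>S. c s * c t * max 0 (R - \<bar>s - t\<bar>)) \<le> 0"
      using triangle_quadratic_form_nonneg[OF S(1) R(1)] R(3) by (rule_tac mult_nonpos_nonneg)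
    ultimately show ?thesis unfolding eq by linarith
  qed
  then show ?thesis using \<rho> by blast
qed


section \<open>The Cauchy kernel with exponent below one as a mixture of triangles\<close>

definition cauchy_profile :: "real \<Rightarrow> real \<Rightarrow> real \<Rightarrow> real" where
  "cauchy_profile \<delta> \<kappa> t = (1 + t powr \<delta>) powr (- \<kappa>)"

definition cauchy_profile1 :: "real \<Rightarrow> real \<Rightarrow> real \<Rightarrow> real" where
  "cauchy_profile1 \<delta> \<kappa> t = - \<kappa> * \<delta> * (t powr (\<delta> - 1) * (1 + t powr \<delta>) powr (- \<kappa> - 1))"

text \<open>Arranged so that for positive \<open>t\<close>, \<open>\<kappa>\<close> and
  \<open>\<delta>\<close> with \<open>\<delta> < 1\<close> every summand is nonnegative: the
  convexity behind Polya's criterion.\<close>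

definition cauchy_profile2 :: "real \<Rightarrow> real \<Rightarrow> real \<Rightarrow> real" where
  "cauchy_profile2 \<delta> \<kappa> t = \<kappa> * \<delta> * ((1 - \<delta>) * (t powr (\<delta> - 2) * (1 + t powr \<delta>) powr (- \<kappa> - 1))
     + (\<kappa> + 1) * \<delta> * (t powr (\<delta> - 1) * t powr (\<delta> - 1) * (1 + t powr \<delta>) powr (- \<kappa> - 2)))"

lemma one_plus_powr_pos: "0 < 1 + (t::real) powr \<delta>"
  by (simp add: add_pos_nonneg)

lemma one_plus_powr_deriv:
  assumes "0 < t"
  shows "((\<lambda>t. (1 + t powr \<delta>) powr a) has_real_derivative a * (1 + t powr \<delta>) powr (a - 1) * (\<delta> * t powr (\<delta> - 1))) (at t)"
proof (rule DERIV_chain2[where f="\<lambda>x. x powr a"])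
  show "((\<lambda>x. x powr a) has_real_derivative a * (1 + t powr \<delta>) powr (a - 1)) (at (1 + t powr \<delta>))"
    by (rule has_real_derivative_powr[OF one_plus_powr_pos])
  show "((\<lambda>t. 1 + t powr \<delta>) has_real_derivative \<delta> * t powr (\<delta> - 1)) (at t)"
    using DERIV_add[OF DERIV_const[of 1] has_real_derivative_powr[OF assms, of \<delta>]] by simp
qed

lemma cauchy_profile_deriv:
  assumes t: "0 < t"
  shows "(cauchy_profile \<delta> \<kappa> has_real_derivative cauchy_profile1 \<delta> \<kappa> t) (at t)"
    and "(cauchy_profile1 \<delta> \<kappa> has_real_derivative cauchy_profile2 \<delta> \<kappa> t) (at t)"
proof -
  show "(cauchy_profile \<delta> \<kappa> has_real_derivative cauchy_profile1 \<delta> \<kappa> t) (at t)"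
    using one_plus_powr_deriv[OF t, of \<delta> "- \<kappa>"] unfolding cauchy_profile_def[abs_def] cauchy_profile1_def by (simp add: mult_ac)
  have "((\<lambda>t. - \<kappa> * \<delta> * (t powr (\<delta> - 1) * (1 + t powr \<delta>) powr (- \<kappa> - 1))) has_real_derivative
     - \<kappa> * \<delta> * ((\<delta> - 1) * t powr (\<delta> - 1 - 1) * (1 + t powr \<delta>) powr (- \<kappa> - 1)
      + (- \<kappa> - 1) * (1 + t powr \<delta>) powr (- \<kappa> - 1 - 1) * (\<delta> * t powr (\<delta> - 1)) * t powr (\<delta> - 1))) (at t)"
    by (intro DERIV_cmult DERIV_mult one_plus_powr_deriv has_real_derivative_powr t)
  moreover have "- \<kappa> * \<delta> * ((\<delta> - 1) * t powr (\<delta> - 1 - 1) * (1 + t powr \<delta>) powr (- \<kappa> - 1)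
      + (- \<kappa> - 1) * (1 + t powr \<delta>) powr (- \<kappa> - 1 - 1) * (\<delta> * t powr (\<delta> - 1)) * t powr (\<delta> - 1)) = cauchy_profile2 \<delta> \<kappa> t"
    unfolding cauchy_profile2_def by (simp add: algebra_simps)
  ultimately show "(cauchy_profile1 \<delta> \<kappa> has_real_derivative cauchy_profile2 \<delta> \<kappa> t) (at t)"
    unfolding cauchy_profile1_def[abs_def] by simp
qed

lemma cauchy_profile2_continuous: "continuous_on {0<..} (cauchy_profile2 \<delta> \<kappa>)"
proof -
  have "1 + t powr \<delta> \<noteq> 0" for t using one_plus_powr_pos[of t \<delta>] by simp
  then show ?thesis unfolding cauchy_profile2_def[abs_def] by (intro continuous_intros) auto
qed

lemma cauchy_profile_0: "0 < \<delta> \<Longrightarrow> cauchy_profile \<delta> \<kappa> 0 = 1"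
  by (simp add: cauchy_profile_def)

text \<open>The triangle of width \<open>a\<close> has density at least
  \<open>c0 * a powr (\<delta> - 2)\<close> for \<open>a \<le> 1\<close>. Widths between
  \<open>a0 / 2\<close> and \<open>a0\<close>, with \<open>a0\<close> the inverse of
  \<open>max 1 \<bar>\<omega>\<bar>\<close>, resolve the frequency \<omega>; by
  \<open>triangle_quadratic_form\<close> each yields a multiple of
  \<open>a\<^sup>2 * Z\<^sup>2\<close>, and integration over them gives the order
  \<open>a0 powr (1 + \<delta>)\<close>. The constant depends on the diameter bound
  \<open>R\<close>, but not on the number or spacing of the points.\<close>

lemma cauchy_profile_quadratic_form:
  fixes S :: "real set"
  assumes p: "0 < \<delta>" "\<delta> < 1" "0 < \<kappa>" and R: "1 \<le> R"
  shows "\<exists>C>0. \<forall>S c. finite S \<and> (\<forall>s\<in>S. \<forall>t\<in>S. \<bar>s - t\<bar> \<le> R) \<longrightarrow>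
     (\<forall>\<omega> \<theta>. (\<Sum>s\<in>S. c s * cos (\<omega> * s + \<theta>))\<^sup>2 \<le> C * (max 1 \<bar>\<omega>\<bar>) powr (1 + \<delta>) * (\<Sum>s\<in>S. \<Sum>t\<in>S. c s * c t * cauchy_profile \<delta> \<kappa> \<bar>s - t\<bar>))
     \<and> ((\<exists>s\<in>S. c s \<noteq> 0) \<longrightarrow> 0 < (\<Sum>s\<in>S. \<Sum>t\<in>S. c s * c t * cauchy_profile \<delta> \<kappa> \<bar>s - t\<bar>))"
proof -
  \<comment> \<open>For \<open>t \<le> 1\<close> the base \<open>1 + t powr \<delta>\<close> is at
    most 2, which accounts for the power of 2; the second summand of \<open>cauchy_profile2\<close>
    is dropped.\<close>
  define c0 where "c0 = \<kappa> * \<delta> * ((1 - \<delta>) * 2 powr (- \<kappa> - 1))"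
  have c0: "0 < c0" using p by (simp add: c0_def)
  have low: "c0 * t powr (\<delta> - 2) \<le> cauchy_profile2 \<delta> \<kappa> t" if t: "0 < t" "t \<le> 1" for t
  proof -
    have "t powr \<delta> \<le> 1" using t p powr_mono2[of \<delta> t 1] by simp
    then have "2 powr (- \<kappa> - 1) \<le> (1 + t powr \<delta>) powr (- \<kappa> - 1)"
      using p one_plus_powr_pos[of t \<delta>] by (intro powr_mono2') auto
    then have "t powr (\<delta> - 2) * 2 powr (- \<kappa> - 1) \<le> t powr (\<delta> - 2) * (1 + t powr \<delta>) powr (- \<kappa> - 1)"
      by (intro mult_left_mono) auto
    then have "(1 - \<delta>) * (t powr (\<delta> - 2) * 2 powr (- \<kappa> - 1)) \<le> (1 - \<delta>) * (t powr (\<delta> - 2) * (1 + t powr \<delta>) powr (- \<kappa> - 1))"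
      by (rule mult_left_mono) (use p in simp)
    then have "(1 - \<delta>) * (t powr (\<delta> - 2) * 2 powr (- \<kappa> - 1)) + 0 \<le> (1 - \<delta>) * (t powr (\<delta> - 2) * (1 + t powr \<delta>) powr (- \<kappa> - 1))
        + (\<kappa> + 1) * \<delta> * (t powr (\<delta> - 1) * t powr (\<delta> - 1) * (1 + t powr \<delta>) powr (- \<kappa> - 2))"
      by (rule add_mono) (use p in simp)
    then have "\<kappa> * \<delta> * ((1 - \<delta>) * (t powr (\<delta> - 2) * 2 powr (- \<kappa> - 1)) + 0) \<le> cauchy_profile2 \<delta> \<kappa> t"
      unfolding cauchy_profile2_def by (rule mult_left_mono) (use p in simp)
    then show ?thesis by (simp add: c0_def mult_ac)
  qed
  have pos2: "0 < cauchy_profile2 \<delta> \<kappa> t" if "0 < t" for t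
    unfolding cauchy_profile2_def using p that one_plus_powr_pos[of t \<delta>]
    by (intro mult_pos_pos add_pos_nonneg) auto
  \<comment> \<open>Obtained by inverting \<open>a0 / 2\<close>, the length of the range of widths,
    times \<open>c0 * (a0 / 2) powr \<delta> / (4 * (R + 1))\<close>.\<close>
  define C where "C = 8 * (R + 1) * 2 powr \<delta> / c0"
  have C: "0 < C" using R c0 by (simp add: C_def)
  have main: "(\<forall>\<omega> \<theta>. (\<Sum>s\<in>S. c s * cos (\<omega> * s + \<theta>))\<^sup>2 \<le> C * (max 1 \<bar>\<omega>\<bar>) powr (1 + \<delta>) * (\<Sum>s\<in>S. \<Sum>t\<in>S. c s * c t * cauchy_profile \<delta> \<kappa> \<bar>s - t\<bar>))
     \<and> ((\<exists>s\<in>S. c s \<noteq> 0) \<longrightarrow> 0 < (\<Sum>s\<in>S. \<Sum>t\<in>S. c s * c t * cauchy_profile \<delta> \<kappa> \<bar>s - t\<bar>))"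
    if S: "finite S" "\<forall>s\<in>S. \<forall>t\<in>S. \<bar>s - t\<bar> \<le> R" and ne: "S \<noteq> {}" for S c
  proof -
    define Q where "Q = (\<Sum>s\<in>S. \<Sum>t\<in>S. c s * c t * cauchy_profile \<delta> \<kappa> \<bar>s - t\<bar>)"
    define q where "q a = (\<Sum>s\<in>S. \<Sum>t\<in>S. c s * c t * max 0 (a - \<bar>s - t\<bar>))" for a
    have q0: "0 \<le> q a" if "0 < a" for a unfolding q_def by (rule triangle_quadratic_form_nonneg[OF S(1) that])
    have qc: "continuous_on A q" for A unfolding q_def by (intro continuous_intros)
    \<comment> \<open>A lower bound for the distances of distinct points; the inserted 1 keeps the
      set nonempty when \<open>S\<close> has a single point.\<close>
    define sep where "sep = Min (insert 1 ((\<lambda>(s,t). \<bar>s - t\<bar>) ` {(s,t)\<in>S \<times> S. s \<noteq> t}))"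
    have fin: "finite (insert 1 ((\<lambda>(s,t). \<bar>s - t\<bar>) ` {(s,t)\<in>S \<times> S. s \<noteq> t}))"
      using S(1) by (auto intro: finite_subset[of _ "S \<times> S"])
    have sep: "0 < sep" unfolding sep_def using fin by (subst Min_gr_iff) auto
    have sep': "sep \<le> \<bar>s - t\<bar>" if "s \<in> S" "t \<in> S" "s \<noteq> t" for s t
      unfolding sep_def using fin that by (intro Min_le) auto
    have cont: "continuous_on {0..R} (cauchy_profile \<delta> \<kappa>)"
    proof -
      have "1 + t powr \<delta> \<noteq> 0" for t using one_plus_powr_pos[of t \<delta>] by simp
      then show ?thesis unfolding cauchy_profile_def[abs_def] using p
        by (intro continuous_on_powr continuous_intros continuous_on_powr') auto
    qed
    have gR: "0 \<le> cauchy_profile \<delta> \<kappa> R" "cauchy_profile1 \<delta> \<kappa> R \<le> 0"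
      using p by (auto simp: cauchy_profile_def cauchy_profile1_def)
    have form: "\<exists>\<rho>>0. integral {\<epsilon>..R} (\<lambda>a. cauchy_profile2 \<delta> \<kappa> a * q a) + \<rho> * (\<Sum>s\<in>S. (c s)\<^sup>2) \<le> Q"
      if "0 < \<epsilon>" "\<epsilon> \<le> R" "\<epsilon> \<le> sep" for \<epsilon>
    proof -
      have "\<exists>\<rho>>0. \<forall>c. integral {\<epsilon>..R} (\<lambda>a. cauchy_profile2 \<delta> \<kappa> a * (\<Sum>s\<in>S. \<Sum>t\<in>S. c s * c t * max 0 (a - \<bar>s - t\<bar>))) + \<rho> * (\<Sum>s\<in>S. (c s)\<^sup>2)
        \<le> (\<Sum>s\<in>S. \<Sum>t\<in>S. c s * c t * cauchy_profile \<delta> \<kappa> \<bar>s - t\<bar>)"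
        by (rule convex_quadratic_form[OF cont cauchy_profile_deriv cauchy_profile2_continuous pos2 _ gR S(1)])
           (use R S(2) that sep' in \<open>auto intro: order_trans\<close>)
      then show ?thesis unfolding Q_def q_def by blast
    qed
    have intble: "(\<lambda>a. cauchy_profile2 \<delta> \<kappa> a * q a) integrable_on {\<epsilon>..b}" if "0 < \<epsilon>" for \<epsilon> b
      by (intro integrable_continuous_real continuous_intros qc continuous_on_subset[OF cauchy_profile2_continuous]) (use that in auto)
    have Qb: "(\<Sum>s\<in>S. c s * cos (\<omega> * s + \<theta>))\<^sup>2 \<le> C * (max 1 \<bar>\<omega>\<bar>) powr (1 + \<delta>) * Q" for \<omega> \<theta>
    proof -
      define Z where "Z = (\<Sum>s\<in>S. c s * cos (\<omega> * s + \<theta>))"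
      define a0 where "a0 = 1 / max 1 \<bar>\<omega>\<bar>"
      have a0: "0 < a0" "a0 \<le> 1" "\<bar>\<omega>\<bar> * a0 \<le> 1" by (auto simp: a0_def max_def field_simps)
      define K where "K = c0 * (a0 / 2) powr \<delta> / (4 * (R + 1)) * Z\<^sup>2"
      have K0: "0 \<le> K" using c0 R by (simp add: K_def)
      have point: "K \<le> cauchy_profile2 \<delta> \<kappa> a * q a" if a: "a0 / 2 \<le> a" "a \<le> a0" for a
      proof -
        have ap: "0 < a" "a \<le> 1" using a a0 by auto
        have "\<bar>\<omega>\<bar> * a \<le> \<bar>\<omega>\<bar> * a0" using a by (intro mult_left_mono) auto
        then have "\<bar>\<omega>\<bar> * a \<le> 1" using a0 by linarith
        then have t: "(a / 2)\<^sup>2 * Z\<^sup>2 \<le> (Max S - Min S + a) * q a"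
          unfolding Z_def q_def using S(1) ne ap by (intro triangle_quadratic_form) (auto intro: order_trans[OF Min_le Max_ge])
        have "Max S \<in> S" "Min S \<in> S" using S(1) ne by auto
        then have "Max S - Min S + a \<le> R + 1" using S(2) ap by force
        then have "(a / 2)\<^sup>2 * Z\<^sup>2 \<le> (R + 1) * q a" using t q0[OF ap(1)] by (meson mult_right_mono order_trans)
        then have qa: "a\<^sup>2 / (4 * (R + 1)) * Z\<^sup>2 \<le> q a" using R by (simp add: field_simps power2_eq_square)
        have "K \<le> c0 * a powr \<delta> / (4 * (R + 1)) * Z\<^sup>2"
          unfolding K_def using a a0 c0 p R by (intro mult_right_mono divide_right_mono mult_left_mono powr_mono2) auto
        also have "a powr \<delta> = a powr (\<delta> - 2) * a\<^sup>2"
          using ap powr_add[of a "\<delta> - 2" 2] by simp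
        also have "c0 * (a powr (\<delta> - 2) * a\<^sup>2) / (4 * (R + 1)) * Z\<^sup>2 = (c0 * a powr (\<delta> - 2)) * (a\<^sup>2 / (4 * (R + 1)) * Z\<^sup>2)"
          by simp
        also have "\<dots> \<le> cauchy_profile2 \<delta> \<kappa> a * q a"
          using low[OF ap] qa c0 R pos2[OF ap(1)] by (intro mult_mono) auto
        finally show ?thesis .
      qed
      define \<epsilon> where "\<epsilon> = min sep (a0 / 2)"
      have \<epsilon>: "0 < \<epsilon>" "\<epsilon> \<le> sep" "\<epsilon> \<le> a0 / 2" "\<epsilon> \<le> R" using sep a0 R by (auto simp: \<epsilon>_def)
      have "a0 / 2 * K = integral {a0 / 2..a0} (\<lambda>a. K)" using a0 by simp
      also have "\<dots> \<le> integral {a0 / 2..a0} (\<lambda>a. cauchy_profile2 \<delta> \<kappa> a * q a)"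
        using a0 by (intro integral_le intble) (auto intro: point)
      also have "\<dots> \<le> integral {\<epsilon>..R} (\<lambda>a. cauchy_profile2 \<delta> \<kappa> a * q a)"
        using a0 \<epsilon> R by (intro integral_subset_le intble) (auto intro!: mult_nonneg_nonneg less_imp_le[OF pos2] q0)
      also have "\<dots> \<le> Q"
      proof -
        obtain \<rho> where r: "0 < \<rho>" "integral {\<epsilon>..R} (\<lambda>a. cauchy_profile2 \<delta> \<kappa> a * q a) + \<rho> * (\<Sum>s\<in>S. (c s)\<^sup>2) \<le> Q"
          using form[OF \<epsilon>(1,4,2)] by blast
        have "0 \<le> \<rho> * (\<Sum>s\<in>S. (c s)\<^sup>2)" using r(1) by (intro mult_nonneg_nonneg sum_nonneg) auto
        then show ?thesis using r(2) by linarith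
      qed
      finally have "a0 / 2 * K \<le> Q" .
      moreover have "a0 / 2 * K = Z\<^sup>2 * (a0 powr (1 + \<delta>) / C)"
      proof -
        have "a0 powr (1 + \<delta>) = a0 * a0 powr \<delta>" using a0 by (simp add: powr_add)
        then show ?thesis using R c0 by (simp add: K_def C_def powr_divide field_simps)
      qed
      moreover have "a0 powr (1 + \<delta>) = 1 / (max 1 \<bar>\<omega>\<bar>) powr (1 + \<delta>)" by (simp add: a0_def powr_divide)
      ultimately have "Z\<^sup>2 * (1 / (max 1 \<bar>\<omega>\<bar>) powr (1 + \<delta>) / C) \<le> Q" by (simp only:)
      moreover have "0 < (max 1 \<bar>\<omega>\<bar>) powr (1 + \<delta>)" by simp
      ultimately show ?thesis using C by (simp add: Z_def field_simps)
    qed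
    moreover have "0 < Q" if nz: "\<exists>s\<in>S. c s \<noteq> 0"
    proof -
      define \<epsilon> where "\<epsilon> = min sep R"
      have \<epsilon>: "0 < \<epsilon>" "\<epsilon> \<le> sep" "\<epsilon> \<le> R" using sep R by (auto simp: \<epsilon>_def)
      obtain \<rho> where r: "0 < \<rho>" "integral {\<epsilon>..R} (\<lambda>a. cauchy_profile2 \<delta> \<kappa> a * q a) + \<rho> * (\<Sum>s\<in>S. (c s)\<^sup>2) \<le> Q"
        using form[OF \<epsilon>(1,3,2)] by blast
      have "0 \<le> integral {\<epsilon>..R} (\<lambda>a. cauchy_profile2 \<delta> \<kappa> a * q a)"
        using \<epsilon> by (intro integral_nonneg intble) (auto intro!: mult_nonneg_nonneg less_imp_le[OF pos2] q0)
      moreover have "0 < (\<Sum>s\<in>S. (c s)\<^sup>2)"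
        using nz S(1) by (metis (mono_tags, lifting) sum_pos2 zero_le_power2 zero_less_power2)
      ultimately show ?thesis using r by (smt (verit) mult_pos_pos)
    qed
    ultimately show ?thesis unfolding Q_def by blast
  qed
  show ?thesis
  proof (intro exI[of _ C] conjI C allI impI)
    fix S :: "real set" and c :: "real \<Rightarrow> real" and \<omega> \<theta> assume S: "finite S \<and> (\<forall>s\<in>S. \<forall>t\<in>S. \<bar>s - t\<bar> \<le> R)"
    show "(\<Sum>s\<in>S. c s * cos (\<omega> * s + \<theta>))\<^sup>2 \<le> C * (max 1 \<bar>\<omega>\<bar>) powr (1 + \<delta>) * (\<Sum>s\<in>S. \<Sum>t\<in>S. c s * c t * cauchy_profile \<delta> \<kappa> \<bar>s - t\<bar>)"
      using main[of S c] S by (cases "S = {}") auto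
  next
    fix S :: "real set" and c :: "real \<Rightarrow> real" assume S: "finite S \<and> (\<forall>s\<in>S. \<forall>t\<in>S. \<bar>s - t\<bar> \<le> R)" and "\<exists>s\<in>S. c s \<noteq> 0"
    then show "0 < (\<Sum>s\<in>S. \<Sum>t\<in>S. c s * c t * cauchy_profile \<delta> \<kappa> \<bar>s - t\<bar>)"
      using main[of S c] by auto
  qed
qed

text \<open>Finite mixtures of centred Gaussians, and their closure in the topology of pointwise
  convergence. The closure is stable under products and limits, which yields \<open>1 / (1 + \<bar>t\<bar>\<^sup>\<delta>)\<close>.\<close>

inductive gauss_mix :: "(real \<Rightarrow> real) \<Rightarrow> bool" where
  gauss_mix_exp: "0 \<le> u \<Longrightarrow> gauss_mix (\<lambda>t. exp (- u * t\<^sup>2))"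
| gauss_mix_add: "gauss_mix f \<Longrightarrow> gauss_mix g \<Longrightarrow> gauss_mix (\<lambda>t. f t + g t)"
| gauss_mix_cmult: "0 \<le> c \<Longrightarrow> gauss_mix f \<Longrightarrow> gauss_mix (\<lambda>t. c * f t)"

lemma gauss_mix_mult:
  assumes "gauss_mix f" "gauss_mix g" shows "gauss_mix (\<lambda>t. f t * g t)"
  using assms(1)
proof induction
  case (gauss_mix_exp u)
  from assms(2) show ?case
  proof induction
    case (gauss_mix_exp v)
    have "(\<lambda>t. exp (- u * t\<^sup>2) * exp (- v * t\<^sup>2)) = (\<lambda>t. exp (- (u + v) * t\<^sup>2))"
      by (simp add: exp_add[symmetric] algebra_simps)
    then show ?case using gauss_mix.gauss_mix_exp[of "u + v"] gauss_mix_exp \<open>0 \<le> u\<close> by simp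
  next
    case (gauss_mix_add f g)
    then show ?case using gauss_mix.gauss_mix_add by (simp add: distrib_left)
  next
    case (gauss_mix_cmult c f)
    then show ?case using gauss_mix.gauss_mix_cmult[of c] by (simp add: mult.left_commute)
  qed
next
  case (gauss_mix_add f g)
  then show ?case using gauss_mix.gauss_mix_add by (simp add: distrib_right)
next
  case (gauss_mix_cmult c f)
  then show ?case using gauss_mix.gauss_mix_cmult[of c] by (simp add: mult.assoc)
qed

lemma gauss_mix_const: "0 \<le> c \<Longrightarrow> gauss_mix (\<lambda>t. c)"
  using gauss_mix_cmult[OF _ gauss_mix_exp[of 0]] by simp

lemma gauss_mix_sum: "(\<And>i. i \<in> I \<Longrightarrow> gauss_mix (f i)) \<Longrightarrow> gauss_mix (\<lambda>t. \<Sum>i\<in>I. f i t)"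
  by (induction I rule: infinite_finite_induct) (auto intro: gauss_mix_const gauss_mix_add)

lemma gauss_mix_power: "gauss_mix f \<Longrightarrow> gauss_mix (\<lambda>t. f t ^ n)"
  by (induction n) (auto intro: gauss_mix_const gauss_mix_mult)

definition gauss_mix_closure :: "(real \<Rightarrow> real) \<Rightarrow> bool" where
  "gauss_mix_closure f \<longleftrightarrow> (\<forall>T \<epsilon>. finite T \<and> 0 < \<epsilon> \<longrightarrow> (\<exists>g. gauss_mix g \<and> (\<forall>t\<in>T. \<bar>g t - f t\<bar> < \<epsilon>)))"

lemma gauss_mix_closure_limit:
  assumes F: "F \<noteq> bot" and f: "\<And>x. gauss_mix_closure (f x)" and lim: "\<And>t. ((\<lambda>x. f x t) \<longlongrightarrow> l t) F"
  shows "gauss_mix_closure l"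
  unfolding gauss_mix_closure_def
proof (intro allI impI, elim conjE)
  fix T :: "real set" and \<epsilon> :: real assume T: "finite T" and e: "0 < \<epsilon>"
  have "\<forall>\<^sub>F x in F. \<forall>t\<in>T. dist (f x t) (l t) < \<epsilon> / 2"
    using e by (intro eventually_ball_finite T ballI tendstoD lim) auto
  then obtain x where x: "\<And>t. t \<in> T \<Longrightarrow> dist (f x t) (l t) < \<epsilon> / 2"
    using eventually_happens'[OF F] by blast
  obtain g where g: "gauss_mix g" "\<And>t. t \<in> T \<Longrightarrow> \<bar>g t - f x t\<bar> < \<epsilon> / 2"
    using f[of x] T e unfolding gauss_mix_closure_def by (meson half_gt_zero)
  have "\<bar>g t - l t\<bar> < \<epsilon>" if "t \<in> T" for t
    using x[OF that] g(2)[OF that] unfolding dist_real_def by linarith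
  then show "\<exists>g. gauss_mix g \<and> (\<forall>t\<in>T. \<bar>g t - l t\<bar> < \<epsilon>)" using g(1) by blast
qed

lemma gauss_mix_in_closure: "gauss_mix f \<Longrightarrow> gauss_mix_closure f"
  unfolding gauss_mix_closure_def by (intro allI impI exI[of _ f]) auto

lemma gauss_mix_closure_sequence:
  assumes f: "gauss_mix_closure f" and T: "finite T"
  shows "\<exists>g. (\<forall>n. gauss_mix (g n)) \<and> (\<forall>t\<in>T. (\<lambda>n. g n t) \<longlonglongrightarrow> f t)"
proof -
  have "\<forall>n. \<exists>g. gauss_mix g \<and> (\<forall>t\<in>T. \<bar>g t - f t\<bar> < inverse (real (Suc n)))"
    using f T unfolding gauss_mix_closure_def by (simp del: of_nat_Suc)
  then obtain g where g: "\<And>n. gauss_mix (g n)" "\<And>n t. t \<in> T \<Longrightarrow> \<bar>g n t - f t\<bar> < inverse (real (Suc n))"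
    by metis
  have "(\<lambda>n. g n t) \<longlonglongrightarrow> f t" if "t \<in> T" for t
  proof (rule Lim_null[THEN iffD2], rule Lim_null_comparison[OF _ LIMSEQ_inverse_real_of_nat])
    show "\<forall>\<^sub>F n in sequentially. norm (g n t - f t) \<le> inverse (real (Suc n))"
      using g(2)[OF that] by (intro always_eventually allI) (simp add: less_imp_le del: of_nat_Suc)
  qed
  then show ?thesis using g(1) by blast
qed

section \<open>The kernel \<open>1 / (1 + \<bar>t\<bar> powr \<delta>)\<close> as a limit of
  Gaussian mixtures\<close>

context
  fixes a q :: real
  assumes a: "0 < a" "a < 1" and q: "1 < q"
begin

text \<open>Up to a constant, \<open>s powr a\<close> is the integral of
  \<open>(1 - exp (- u * s)) * u powr (- a - 1)\<close> over positive u. These are the terms of its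
  Riemann sum at the geometric nodes \<open>q powr j\<close>, where \<open>du / u\<close> has
  constant weight.\<close>

definition bern_term :: "real \<Rightarrow> int \<Rightarrow> real" where
  "bern_term s j = q powr (- a * of_int j) * (1 - exp (- (q powr (of_int j)) * s))"

lemma bern_term_nonneg: "0 \<le> s \<Longrightarrow> 0 \<le> bern_term s j"
  by (simp add: bern_term_def)

text \<open>Geometric decay on both sides. For large positive indices the bracket is at most 1 and
  the ratio is \<open>q powr (- a)\<close>; for large negative ones the bracket is at most
  \<open>q powr j * s\<close> and the ratio is \<open>q powr (a - 1)\<close>.\<close>

lemma bern_term_summable:
  assumes s: "0 \<le> s"
  shows "bern_term s summable_on UNIV"
proof -
  have g: "(\<lambda>n::nat. c * r ^ n) summable_on UNIV" if "0 \<le> r" "r < 1" "0 \<le> c" for c r :: real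
    using that by (intro summable_nonneg_imp_summable_on summable_mult summable_geometric) auto
  have pos: "bern_term s summable_on range int"
  proof -
    have "bern_term s (int n) \<le> 1 * (q powr - a) ^ n" for n
    proof -
      have "bern_term s (int n) \<le> q powr (- a * of_int (int n)) * 1"
        unfolding bern_term_def by (intro mult_left_mono) auto
      also have "\<dots> = (q powr - a) ^ n" using q by (simp add: powr_power mult.commute)
      finally show ?thesis by simp
    qed
    moreover have "q powr - a < 1" using a q by (simp add: powr_less_one)
    ultimately have "(\<lambda>n. bern_term s (int n)) summable_on UNIV"
      using bern_term_nonneg[OF s] q by (intro summable_on_comparison_test[OF g[of "q powr - a" 1]]) auto
    then show ?thesis by (subst summable_on_reindex) (auto simp: o_def)
  qed
  have neg: "bern_term s summable_on range (\<lambda>n. - int n - 1)"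
  proof -
    have "bern_term s (- int n - 1) \<le> s * (q powr (a - 1)) ^ n" for n
    proof -
      have "1 - exp (- (q powr (of_int (- int n - 1))) * s) \<le> q powr (of_int (- int n - 1)) * s"
        using exp_ge_add_one_self[of "- (q powr (of_int (- int n - 1))) * s"] by simp
      then have "bern_term s (- int n - 1) \<le> q powr (- a * of_int (- int n - 1)) * (q powr (of_int (- int n - 1)) * s)"
        unfolding bern_term_def by (intro mult_left_mono) auto
      also have "\<dots> = s * (q powr ((a - 1) * (real n + 1)))"
      proof -
        have gen: "q powr x * (q powr y * s) = s * q powr z" if "z = x + y" for x y z unfolding that by (simp add: powr_add)
        show ?thesis by (rule gen) (simp add: algebra_simps)
      qed
      also have "\<dots> \<le> s * (q powr ((a - 1) * real n))"
      proof -
        have "(a - 1) * (real n + 1) \<le> (a - 1) * real n" using a by (intro mult_left_mono_neg) auto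
        then show ?thesis using q s by (intro mult_left_mono[OF powr_mono]) auto
      qed
      also have "\<dots> = s * (q powr (a - 1)) ^ n" using q by (simp add: powr_power mult.commute)
      finally show ?thesis .
    qed
    moreover have "q powr (a - 1) < 1" using a q by (simp add: powr_less_one)
    ultimately have "(\<lambda>n. bern_term s (- int n - 1)) summable_on UNIV"
      using bern_term_nonneg[OF s] q s by (intro summable_on_comparison_test[OF g[of "q powr (a - 1)" s]]) auto
    then show ?thesis by (subst summable_on_reindex) (auto simp: o_def inj_on_def)
  qed
  have "UNIV = range int \<union> range (\<lambda>n. - int n - 1)"
  proof (intro equalityI subsetI)
    fix j :: int
    show "j \<in> range int \<union> range (\<lambda>n. - int n - 1)"
    proof (cases "0 \<le> j")
      case True then show ?thesis by (intro UnI1 image_eqI[of _ _ "nat j"]) auto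
    next
      case False then show ?thesis by (intro UnI2 image_eqI[of _ _ "nat (- j - 1)"]) auto
    qed
  qed auto
  then show ?thesis using summable_on_union[OF pos neg] by simp
qed

definition bern_sum :: "real \<Rightarrow> real" where
  "bern_sum s = infsum (bern_term s) UNIV"

text \<open>Multiplying \<open>s\<close> by a power of \<open>q\<close> shifts the summation index,
  so the sum is exactly homogeneous of degree \<open>a\<close> under powers of
  \<open>q\<close>.\<close>

lemma bern_sum_scale: "bern_sum (q powr (of_int k) * s) = q powr (a * of_int k) * bern_sum s"
proof -
  have "bern_sum (q powr (of_int k) * s) = infsum (\<lambda>j. bern_term (q powr (of_int k) * s) j) UNIV" by (simp add: bern_sum_def)
  also have "\<dots> = infsum (\<lambda>j. bern_term (q powr (of_int k) * s) (j - k)) UNIV"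
    by (rule infsum_reindex_bij_betw[symmetric, where g="\<lambda>j. j - k"]) (auto intro!: bij_betwI[where g="\<lambda>j. j + k"])
  also have "\<dots> = infsum (\<lambda>j. q powr (a * of_int k) * bern_term s j) UNIV"
  proof (intro infsum_cong)
    fix j
    have "q powr (of_int (j - k)) * (q powr (of_int k) * s) = q powr (of_int j) * s"
      using q by (simp add: powr_diff)
    moreover have "q powr (- a * of_int (j - k)) = q powr (a * of_int k) * q powr (- a * of_int j)"
      unfolding powr_add[symmetric] by (simp add: algebra_simps)
    ultimately show "bern_term (q powr (of_int k) * s) (j - k) = q powr (a * of_int k) * bern_term s j"
      unfolding bern_term_def by (simp add: mult.assoc)
  qed
  also have "\<dots> = q powr (a * of_int k) * bern_sum s" unfolding bern_sum_def by (rule infsum_cmult_right')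
  finally show ?thesis .
qed

lemma bern_sum_mono: "0 \<le> s \<Longrightarrow> s \<le> s' \<Longrightarrow> bern_sum s \<le> bern_sum s'"
  unfolding bern_sum_def
  by (intro infsum_mono bern_term_summable) (auto simp: bern_term_def intro!: mult_left_mono)

lemma bern_sum_pos: "0 < bern_sum 1"
proof -
  have "bern_term 1 0 \<le> bern_sum 1"
    unfolding bern_sum_def
    using infsum_mono2[of "bern_term 1" "{0}" UNIV] bern_term_summable[of 1] bern_term_nonneg[of 1] by simp
  moreover have "0 < bern_term 1 0" using q by (simp add: bern_term_def)
  ultimately show ?thesis by linarith
qed

lemma bern_sum_0: "bern_sum 0 = 0"
proof -
  have "bern_term 0 = (\<lambda>j. 0)" by (simp add: fun_eq_iff bern_term_def)
  then show ?thesis by (simp add: bern_sum_def)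
qed

text \<open>\<open>s\<close> lies between two consecutive powers of \<open>q\<close>, where
  homogeneity gives the sum; monotonicity in between costs at most a factor \<open>q powr a\<close>,
  which tends to 1 with \<open>q\<close>.\<close>

lemma bern_sum_ratio:
  assumes s: "0 \<le> s"
  shows "q powr (- a) * s powr a \<le> bern_sum s / bern_sum 1" "bern_sum s / bern_sum 1 \<le> q powr a * s powr a"
proof -
  have "q powr (- a) * s powr a \<le> bern_sum s / bern_sum 1 \<and> bern_sum s / bern_sum 1 \<le> q powr a * s powr a"
  proof (cases "s = 0")
    case True then show ?thesis by (simp add: bern_sum_0)
  next
    case False
    then have sp: "0 < s" using s by simp
    define k where "k = \<lfloor>log q s\<rfloor>"
    have k: "of_int k \<le> log q s" "log q s \<le> of_int (k + 1)" unfolding k_def by linarith+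
    have lo: "q powr (of_int k) \<le> s" and hi: "s \<le> q powr (of_int (k + 1))"
      using k sp q by (simp_all add: le_log_iff log_le_iff)
    have "q powr (a * of_int k) * bern_sum 1 \<le> bern_sum s"
      using bern_sum_mono[OF _ lo] bern_sum_scale[of k 1] by simp
    moreover have "bern_sum s \<le> q powr (a * of_int (k + 1)) * bern_sum 1"
      using bern_sum_mono[OF s hi] bern_sum_scale[of "k + 1" 1] by simp
    ultimately have r: "q powr (a * of_int k) \<le> bern_sum s / bern_sum 1" "bern_sum s / bern_sum 1 \<le> q powr (a * of_int (k + 1))"
      using bern_sum_pos by (simp_all add: field_simps)
    have sa: "s powr a = q powr (a * log q s)"
    proof -
      have "s powr a = (q powr log q s) powr a" using sp q by simp
      then show ?thesis by (simp only: powr_powr mult.commute)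
    qed
    have am: "a * of_int k \<le> a * log q s" "a * log q s \<le> a * of_int (k + 1)"
      using k a by (intro mult_left_mono; simp)+
    have "q powr (- a) * s powr a \<le> q powr (a * of_int k)"
      unfolding sa powr_add[symmetric] using am q by (intro powr_mono) (auto simp: distrib_left)
    moreover have "q powr (a * of_int (k + 1)) \<le> q powr a * s powr a"
      unfolding sa powr_add[symmetric] using am q by (intro powr_mono) (auto simp: distrib_left)
    ultimately show ?thesis using r by linarith
  qed
  then show "q powr (- a) * s powr a \<le> bern_sum s / bern_sum 1" "bern_sum s / bern_sum 1 \<le> q powr a * s powr a" by auto
qed

text \<open>For a finite set of indices the denominator is \<open>(1 + M) - k t\<close> with a
  Gaussian mixture \<open>k\<close> between 0 and \<open>M\<close>. The geometric series in
  \<open>k t / (1 + M)\<close> converges and its partial sums are Gaussian mixtures. Exhausting the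
  integers by finite sets is a second limit.\<close>

lemma resolvent_closure:
  assumes \<phi>: "0 < \<phi>"
  shows "gauss_mix_closure (\<lambda>t. 1 / (1 + \<phi> * bern_sum (t\<^sup>2)))"
proof (rule gauss_mix_closure_limit[of "finite_subsets_at_top UNIV"])
  show "((\<lambda>F. 1 / (1 + \<phi> * (\<Sum>j\<in>F. bern_term (t\<^sup>2) j))) \<longlongrightarrow> 1 / (1 + \<phi> * bern_sum (t\<^sup>2))) (finite_subsets_at_top UNIV)" for t
  proof (intro tendsto_divide tendsto_add tendsto_mult tendsto_const)
    show "(sum (bern_term (t\<^sup>2)) \<longlongrightarrow> bern_sum (t\<^sup>2)) (finite_subsets_at_top UNIV)"
      using bern_term_summable[of "t\<^sup>2"] unfolding bern_sum_def by (simp add: has_sum_infsum has_sum_def[symmetric])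
    have "0 \<le> bern_sum (t\<^sup>2)" unfolding bern_sum_def by (intro infsum_nonneg) (simp add: bern_term_nonneg)
    then have "0 < 1 + \<phi> * bern_sum (t\<^sup>2)" using \<phi> by (simp add: add_pos_nonneg)
    then show "1 + \<phi> * bern_sum (t\<^sup>2) \<noteq> 0" by simp
  qed
  fix F :: "int set"
  define w where "w j = q powr (- a * of_int j)" for j :: int
  define M where "M = \<phi> * (\<Sum>j\<in>F. w j)"
  define k where "k t = \<phi> * (\<Sum>j\<in>F. w j * exp (- (q powr (of_int j)) * t\<^sup>2))" for t :: real
  have M0: "0 \<le> M" unfolding M_def w_def using \<phi> by (intro mult_nonneg_nonneg sum_nonneg) auto
  have kmix: "gauss_mix k"
    unfolding k_def w_def using \<phi> by (intro gauss_mix_cmult gauss_mix_sum gauss_mix_exp) auto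
  have w0: "0 \<le> w j" for j by (simp add: w_def)
  have k: "0 \<le> k t" "k t \<le> M" for t
  proof -
    show "0 \<le> k t" unfolding k_def using \<phi> w0 by (intro mult_nonneg_nonneg sum_nonneg) auto
    have "w j * exp (- (q powr (of_int j)) * t\<^sup>2) \<le> w j * 1" for j
      by (rule mult_left_mono[OF _ w0]) simp
    then have "(\<Sum>j\<in>F. w j * exp (- (q powr (of_int j)) * t\<^sup>2)) \<le> (\<Sum>j\<in>F. w j)" by (intro sum_mono) simp
    then show "k t \<le> M" unfolding k_def M_def using \<phi> by (intro mult_left_mono) auto
  qed
  have eq: "1 + \<phi> * (\<Sum>j\<in>F. bern_term (t\<^sup>2) j) = (1 + M) - k t" for t
    by (simp add: M_def k_def w_def bern_term_def sum_subtractf right_diff_distrib)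
  show "gauss_mix_closure (\<lambda>t. 1 / (1 + \<phi> * (\<Sum>j\<in>F. bern_term (t\<^sup>2) j)))"
  proof (rule gauss_mix_closure_limit[of sequentially])
    fix n
    have "gauss_mix (\<lambda>t. 1 / (1 + M) * (\<Sum>i<n. (1 / (1 + M) * k t) ^ i))"
      using M0 by (intro gauss_mix_cmult gauss_mix_sum gauss_mix_power kmix) auto
    then show "gauss_mix_closure (\<lambda>t. 1 / (1 + M) * (\<Sum>i<n. (1 / (1 + M) * k t) ^ i))" by (rule gauss_mix_in_closure)
  next
    fix t
    have "norm (1 / (1 + M) * k t) < 1" using k[of t] M0 by simp
    from geometric_sums[OF this] have "(\<lambda>n. \<Sum>i<n. (1 / (1 + M) * k t) ^ i) \<longlonglongrightarrow> 1 / (1 - 1 / (1 + M) * k t)"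
      by (simp add: sums_def)
    then have "(\<lambda>n. 1 / (1 + M) * (\<Sum>i<n. (1 / (1 + M) * k t) ^ i)) \<longlonglongrightarrow> 1 / (1 + M) * (1 / (1 - 1 / (1 + M) * k t))"
      by (intro tendsto_mult tendsto_const)
    moreover have "1 / (1 + M) * (1 / (1 - 1 / (1 + M) * k t)) = 1 / (1 + \<phi> * (\<Sum>j\<in>F. bern_term (t\<^sup>2) j))"
    proof -
      have "(1 + M) * (1 - 1 / (1 + M) * k t) = (1 + M) - k t" using M0 by (simp add: field_simps)
      then show ?thesis unfolding eq by (simp add: divide_divide_eq_left)
    qed
    ultimately show "(\<lambda>n. 1 / (1 + M) * (\<Sum>i<n. (1 / (1 + M) * k t) ^ i)) \<longlonglongrightarrow> 1 / (1 + \<phi> * (\<Sum>j\<in>F. bern_term (t\<^sup>2) j))"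
      by simp
  qed simp
qed simp

end

text \<open>The Bernstein sums are taken at \<open>t\<^sup>2\<close>, so their exponent is
  \<open>\<delta> / 2\<close>, which is below 1 exactly when \<open>\<delta> < 2\<close>. Normalized
  at 1 they agree with \<open>\<bar>t\<bar> powr \<delta>\<close> up to factors that tend to 1 with
  \<open>q\<close>.\<close>

lemma cauchy_kernel_closure:
  assumes \<delta>: "0 < \<delta>" "\<delta> < 2"
  shows "gauss_mix_closure (\<lambda>t. 1 / (1 + \<bar>t\<bar> powr \<delta>))"
proof -
  define a where "a = \<delta> / 2"
  have a: "0 < a" "a < 1" using \<delta> by (auto simp: a_def)
  define q where "q n = 1 + inverse (real (Suc n))" for n
  have q: "1 < q n" for n by (simp add: q_def)
  have qlim: "q \<longlonglongrightarrow> 1"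
    unfolding q_def using tendsto_add[OF tendsto_const[of 1] LIMSEQ_inverse_real_of_nat] by simp
  define \<psi> where "\<psi> n s = bern_sum a (q n) s / bern_sum a (q n) 1" for n s
  have lim: "(\<lambda>n. \<psi> n (t\<^sup>2)) \<longlonglongrightarrow> \<bar>t\<bar> powr \<delta>" for t
  proof (rule tendsto_sandwich[OF always_eventually always_eventually])
    have t: "(t\<^sup>2) powr a = \<bar>t\<bar> powr \<delta>"
    proof -
      have "t\<^sup>2 = \<bar>t\<bar> powr 2" by (simp add: powr_numeral)
      then show ?thesis by (simp only: powr_powr a_def) simp
    qed
    show "\<forall>n. q n powr (- a) * \<bar>t\<bar> powr \<delta> \<le> \<psi> n (t\<^sup>2)" "\<forall>n. \<psi> n (t\<^sup>2) \<le> q n powr a * \<bar>t\<bar> powr \<delta>"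
      using bern_sum_ratio[OF a q, of "t\<^sup>2"] t by (auto simp: \<psi>_def)
    have pl: "(\<lambda>n. q n powr x * \<bar>t\<bar> powr \<delta>) \<longlonglongrightarrow> \<bar>t\<bar> powr \<delta>" for x
    proof -
      have "(\<lambda>n. q n powr x * \<bar>t\<bar> powr \<delta>) \<longlonglongrightarrow> 1 powr x * \<bar>t\<bar> powr \<delta>"
        by (intro tendsto_mult tendsto_const tendsto_powr qlim) auto
      then show ?thesis by simp
    qed
    show "(\<lambda>n. q n powr (- a) * \<bar>t\<bar> powr \<delta>) \<longlonglongrightarrow> \<bar>t\<bar> powr \<delta>" by (rule pl)
    show "(\<lambda>n. q n powr a * \<bar>t\<bar> powr \<delta>) \<longlonglongrightarrow> \<bar>t\<bar> powr \<delta>" by (rule pl)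
  qed
  show ?thesis
  proof (rule gauss_mix_closure_limit[of sequentially])
    show "gauss_mix_closure (\<lambda>t. 1 / (1 + \<psi> n (t\<^sup>2)))" for n
      using resolvent_closure[OF a q, of "1 / bern_sum a (q n) 1" n] bern_sum_pos[OF a q] by (simp add: \<psi>_def)
    show "(\<lambda>n. 1 / (1 + \<psi> n (t\<^sup>2))) \<longlonglongrightarrow> 1 / (1 + \<bar>t\<bar> powr \<delta>)" for t
      by (intro tendsto_divide tendsto_add tendsto_const lim) (smt (verit) powr_ge_zero)
  qed simp
qed

section \<open>Traces against the Cauchy kernel\<close>

lemma integral_cos_std_normal:
  "integrable std_normal_distribution (\<lambda>z. cos (s * z))"
  "(\<integral>z. cos (s * z) \<partial>std_normal_distribution) = exp (- (s\<^sup>2) / 2)"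
proof -
  interpret S: real_distribution std_normal_distribution by (rule real_dist_normal_dist)
  show "integrable std_normal_distribution (\<lambda>z. cos (s * z))"
    by (rule std_normal.integrable_const_bound[where B=1]) auto
  have i: "integrable std_normal_distribution (\<lambda>z. iexp (s * z))" by (rule std_normal.integrable_iexp) auto
  have "Re (char std_normal_distribution s) = (\<integral>z. Re (iexp (s * z)) \<partial>std_normal_distribution)"
    unfolding char_def by (rule integral_Re[OF i, symmetric])
  also have "(\<lambda>z. Re (iexp (s * z))) = (\<lambda>z. cos (s * z))" by (simp add: Re_exp)
  finally show "(\<integral>z. cos (s * z) \<partial>std_normal_distribution) = exp (- (s\<^sup>2) / 2)"
    by (simp add: char_std_normal_distribution)
qed

text \<open>A Gaussian kernel is the mean of \<open>cos (sqrt (2 * u) * z * t)\<close> over a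
  standard normal \<open>z\<close>, so the bound on the cosine forms is averaged over a random
  frequency. The factor 4 is the 2 of the pointwise bound times the mean 2 of
  \<open>1 + z\<^sup>2\<close>.\<close>

lemma gaussian_kernel_trace:
  fixes x :: "'i \<Rightarrow> real" and G :: "'i \<Rightarrow> 'i \<Rightarrow> real"
  assumes u: "0 \<le> u" and \<tau>: "0 < \<tau>" "\<tau> < 2"
    and G: "\<And>\<omega>. 0 \<le> (\<Sum>i\<in>I. \<Sum>j\<in>I. G i j * cos (\<omega> * (x i - x j)))"
      "\<And>\<omega>. (\<Sum>i\<in>I. \<Sum>j\<in>I. G i j * cos (\<omega> * (x i - x j))) \<le> M * (max 1 \<bar>\<omega>\<bar>) powr \<tau>"
  shows "0 \<le> (\<Sum>i\<in>I. \<Sum>j\<in>I. G i j * exp (- u * (x i - x j)\<^sup>2))"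
    "(\<Sum>i\<in>I. \<Sum>j\<in>I. G i j * exp (- u * (x i - x j)\<^sup>2)) \<le> M * (1 + 4 * u powr (\<tau> / 2))"
proof -
  interpret S: real_distribution std_normal_distribution by (rule real_dist_normal_dist)
  let ?N = std_normal_distribution
  define F where "F z = (\<Sum>i\<in>I. \<Sum>j\<in>I. G i j * cos ((sqrt (2 * u) * z) * (x i - x j)))" for z
  have e: "has_bochner_integral ?N (\<lambda>z. cos ((sqrt (2 * u) * z) * t)) (exp (- u * t\<^sup>2))" for t
    using integral_cos_std_normal[of "sqrt (2 * u) * t"] u by (simp add: has_bochner_integral_iff power_mult_distrib mult_ac)
  have hF: "has_bochner_integral ?N F (\<Sum>i\<in>I. \<Sum>j\<in>I. G i j * exp (- u * (x i - x j)\<^sup>2))"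
    unfolding F_def by (intro has_bochner_integral_sum has_bochner_integral_mult_right e)
  then have iF: "integrable ?N F" and eq: "(\<Sum>i\<in>I. \<Sum>j\<in>I. G i j * exp (- u * (x i - x j)\<^sup>2)) = (\<integral>z. F z \<partial>?N)"
    by (auto simp: has_bochner_integral_iff)
  show "0 \<le> (\<Sum>i\<in>I. \<Sum>j\<in>I. G i j * exp (- u * (x i - x j)\<^sup>2))"
    unfolding eq by (rule integral_nonneg_AE) (simp add: F_def G(1))
  have M: "0 \<le> M" using order_trans[OF G(1) G(2), of 0] by simp
  have pt: "F z \<le> M * (1 + 2 * u powr (\<tau> / 2) * (1 + z\<^sup>2))" for z
  proof -
    have a: "(max 1 w) powr \<tau> \<le> 1 + w powr \<tau>" if "0 \<le> w" for w :: real
      using that by (cases "w \<le> 1") (auto simp: max_def)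
    have b: "\<bar>z\<bar> powr \<tau> \<le> 1 + z\<^sup>2"
    proof (cases "\<bar>z\<bar> \<le> 1")
      case True
      then have "\<bar>z\<bar> powr \<tau> \<le> 1 powr \<tau>" using \<tau> by (intro powr_mono2) auto
      then show ?thesis by (simp add: add_increasing2)
    next
      case False
      then have "\<bar>z\<bar> powr \<tau> \<le> \<bar>z\<bar> powr 2" using \<tau> by (intro powr_mono) auto
      then show ?thesis using False by (simp add: powr_numeral)
    qed
    have c: "(sqrt (2 * u)) powr \<tau> \<le> 2 * u powr (\<tau> / 2)"
    proof -
      have "(sqrt (2 * u)) powr \<tau> = (2 * u) powr (\<tau> / 2)"
        using u by (simp add: powr_half_sqrt[symmetric] powr_powr)
      also have "\<dots> = 2 powr (\<tau> / 2) * u powr (\<tau> / 2)" by (rule powr_mult)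
      also have "\<dots> \<le> 2 powr 1 * u powr (\<tau> / 2)" using \<tau> by (intro mult_right_mono powr_mono) auto
      finally show ?thesis by simp
    qed
    have "F z \<le> M * (max 1 \<bar>sqrt (2 * u) * z\<bar>) powr \<tau>" unfolding F_def by (rule G(2))
    also have "\<dots> \<le> M * (1 + \<bar>sqrt (2 * u) * z\<bar> powr \<tau>)" using M a by (intro mult_left_mono) auto
    also have "\<bar>sqrt (2 * u) * z\<bar> powr \<tau> = sqrt (2 * u) powr \<tau> * \<bar>z\<bar> powr \<tau>" using u by (simp add: abs_mult powr_mult)
    also have "M * (1 + sqrt (2 * u) powr \<tau> * \<bar>z\<bar> powr \<tau>) \<le> M * (1 + (2 * u powr (\<tau> / 2)) * (1 + z\<^sup>2))"
      using M b c by (intro mult_left_mono add_left_mono mult_mono) auto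
    finally show ?thesis .
  qed
  have m2: "integrable ?N (\<lambda>z. z\<^sup>2)" "(\<integral>z. z\<^sup>2 \<partial>?N) = 1"
    using integrable_std_normal_distribution_moment[of 2] std_normal_distribution_even_moments(1)[of 1] by simp_all
  have "(\<integral>z. F z \<partial>?N) \<le> (\<integral>z. M * (1 + 2 * u powr (\<tau> / 2) * (1 + z\<^sup>2)) \<partial>?N)"
    using m2 by (intro integral_mono iF pt) auto
  also have "\<dots> = M * (1 + 4 * u powr (\<tau> / 2))"
    using m2 std_normal.prob_space by (simp add: algebra_simps)
  finally show "(\<Sum>i\<in>I. \<Sum>j\<in>I. G i j * exp (- u * (x i - x j)\<^sup>2)) \<le> M * (1 + 4 * u powr (\<tau> / 2))"
    unfolding eq .
qed

text \<open>The approximating mixtures come without control of their mixing weights, so the bound is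
  made linear in the function and uses finitely many of its values; then it passes to pointwise
  limits. A component with u about \<open>4 ^ j\<close> is detected by the drop
  \<open>g 0 - g ((1/2) ^ j)\<close>, which is at least 1/2 for it, and its cost
  \<open>u powr (\<tau> / 2)\<close> is comparable to \<open>(2 powr \<tau>) ^ j\<close>. For the
  Cauchy kernel this drop is at most \<open>((1/2) powr \<delta>) ^ j\<close>, so the sum is
  geometric with ratio \<open>2 powr (\<tau> - \<delta>)\<close>.\<close>

lemma cauchy_kernel_trace:
  fixes x :: "'i \<Rightarrow> real" and G :: "'i \<Rightarrow> 'i \<Rightarrow> real"
  assumes I: "finite I" and \<tau>: "0 < \<tau>" "\<tau> < \<delta>" "\<delta> < 2"
    and G: "\<And>\<omega>. 0 \<le> (\<Sum>i\<in>I. \<Sum>j\<in>I. G i j * cos (\<omega> * (x i - x j)))"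
      "\<And>\<omega>. (\<Sum>i\<in>I. \<Sum>j\<in>I. G i j * cos (\<omega> * (x i - x j))) \<le> M * (max 1 \<bar>\<omega>\<bar>) powr \<tau>"
  shows "0 \<le> (\<Sum>i\<in>I. \<Sum>j\<in>I. G i j * (1 / (1 + \<bar>x i - x j\<bar> powr \<delta>)))"
    "(\<Sum>i\<in>I. \<Sum>j\<in>I. G i j * (1 / (1 + \<bar>x i - x j\<bar> powr \<delta>))) \<le> M * (5 + 32 / (1 - 2 powr (\<tau> - \<delta>)))"
proof -
  define \<Lambda> where "\<Lambda> g = (\<Sum>i\<in>I. \<Sum>j\<in>I. G i j * g (x i - x j))" for g :: "real \<Rightarrow> real"
  define B where "B = (\<Sum>i\<in>I. \<Sum>j\<in>I. \<bar>G i j\<bar>)"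
  have B: "0 \<le> B" unfolding B_def by (intro sum_nonneg) auto
  have M: "0 \<le> M" using order_trans[OF G(1) G(2), of 0] by simp
  have \<tau>2: "\<tau> < 2" using \<tau> by simp
  \<comment> \<open>The 5 pays for components with \<open>u \<le> 1\<close>. The 32 is
    \<open>4 * 4\<close>, from \<open>4 * u powr (\<tau> / 2)\<close> and
    \<open>u \<le> 4 ^ Suc j\<close>, divided by the drop 1/2. The last term pays crudely for
    components with \<open>u \<ge> 4 ^ J\<close>; for the Cauchy kernel it disappears as
    \<open>J\<close> grows.\<close>
  define R where "R J g = M * (5 * g 0 + (\<Sum>j<J. 32 * (2 powr \<tau>) ^ j * (g 0 - g ((1/2) ^ j)))) + 2 * B * (g 0 - g ((1/2) ^ J))"
    for J and g :: "real \<Rightarrow> real"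
  have mix: "0 \<le> \<Lambda> g \<and> \<Lambda> g \<le> R J g" if "gauss_mix g" for g J
    using that
  proof induction
    case (gauss_mix_exp u)
    let ?e = "\<lambda>t. exp (- u * t\<^sup>2)"
    note k = gaussian_kernel_trace[OF gauss_mix_exp \<tau>(1) \<tau>2 G, folded \<Lambda>_def[of ?e]]
    have nn: "0 \<le> ?e 0 - ?e t" for t using gauss_mix_exp by simp
    have sq: "((1/2::real) ^ j)\<^sup>2 = (1/4) ^ j" for j by (simp add: power2_eq_square flip: power_mult_distrib)
    have sn: "0 \<le> (\<Sum>j<J. 32 * (2 powr \<tau>) ^ j * (?e 0 - ?e ((1/2) ^ j)))"
      by (intro sum_nonneg mult_nonneg_nonneg nn) auto
    have bn: "0 \<le> 2 * B * (?e 0 - ?e ((1/2) ^ J))" using B nn by (intro mult_nonneg_nonneg) auto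
    have half: "1 / 2 \<le> 1 - exp (- y)" if "1 \<le> y" for y :: real
    proof -
      have "2 \<le> exp y" using that exp_ge_add_one_self[of y] by linarith
      then have "inverse (exp y) \<le> inverse 2" by (intro le_imp_inverse_le) auto
      then show ?thesis by (simp add: exp_minus)
    qed
    have "\<Lambda> ?e \<le> R J ?e"
    proof (cases "u \<le> 1")
      case True
      then have "u powr (\<tau> / 2) \<le> 1 powr (\<tau> / 2)" using gauss_mix_exp \<tau> by (intro powr_mono2) auto
      then have "M * (1 + 4 * u powr (\<tau> / 2)) \<le> M * 5" using M by (intro mult_left_mono) auto
      moreover have "0 \<le> M * (\<Sum>j<J. 32 * (2 powr \<tau>) ^ j * (?e 0 - ?e ((1/2) ^ j)))" using M sn by (intro mult_nonneg_nonneg)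
      ultimately show ?thesis using k(2) bn unfolding R_def distrib_left by simp
    next
      case False
      define j where "j = nat \<lfloor>log 4 u\<rfloor>"
      have l: "0 \<le> log 4 u" using False by simp
      have j: "real j \<le> log 4 u" "log 4 u \<le> real (Suc j)" using l unfolding j_def by linarith+
      have u4: "4 ^ j \<le> u" "u \<le> 4 ^ Suc j"
        using j False by (simp_all add: le_log_iff log_le_iff powr_realpow[symmetric] del: of_nat_Suc power_Suc)
      show ?thesis
      proof (cases "j < J")
        case True
        have "u powr (\<tau> / 2) \<le> (4 ^ Suc j) powr (\<tau> / 2)" using u4 False \<tau> by (intro powr_mono2) auto
        also have "\<dots> = (2 powr \<tau>) ^ Suc j"
        proof -
          have "(4::real) ^ Suc j = (2 ^ Suc j) powr 2" by (simp add: powr_numeral power2_eq_square flip: power_mult_distrib)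
          then have "(4 ^ Suc j) powr (\<tau> / 2) = (2 ^ Suc j) powr \<tau>" by (simp only: powr_powr) simp
          also have "\<dots> = (2 powr \<tau>) ^ Suc j" by (simp only: powr_realpow[symmetric] powr_powr powr_gt_zero zero_less_numeral mult.commute)
          finally show ?thesis .
        qed
        also have "\<dots> \<le> 4 * (2 powr \<tau>) ^ j"
        proof -
          have "2 powr \<tau> \<le> 2 powr 2" using \<tau>2 by (intro powr_mono) auto
          then show ?thesis by (simp add: mult_right_mono)
        qed
        finally have up: "u powr (\<tau> / 2) \<le> 4 * (2 powr \<tau>) ^ j" .
        have "1 \<le> u * (1/4) ^ j" using u4 by (simp add: power_divide field_simps)
        then have "1 / 2 \<le> ?e 0 - ?e ((1/2) ^ j)" using half unfolding sq by simp
        then have "16 * (2 powr \<tau>) ^ j \<le> 32 * (2 powr \<tau>) ^ j * (?e 0 - ?e ((1/2) ^ j))"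
          using mult_left_mono[of "1/2" "?e 0 - ?e ((1/2) ^ j)" "32 * (2 powr \<tau>) ^ j"] by simp
        also have "\<dots> \<le> (\<Sum>j<J. 32 * (2 powr \<tau>) ^ j * (?e 0 - ?e ((1/2) ^ j)))"
          using True by (intro member_le_sum mult_nonneg_nonneg nn) auto
        finally have "1 + 4 * u powr (\<tau> / 2) \<le> 5 * ?e 0 + (\<Sum>j<J. 32 * (2 powr \<tau>) ^ j * (?e 0 - ?e ((1/2) ^ j)))"
          using up by simp
        from mult_left_mono[OF this M] show ?thesis using k(2) bn unfolding R_def by linarith
      next
        case False
        then have "(4::real) ^ J \<le> 4 ^ j" by (intro power_increasing) auto
        then have "4 ^ J \<le> u" using u4(1) by linarith
        then have "1 \<le> u * (1/4) ^ J" by (simp add: power_divide field_simps)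
        then have "1 / 2 \<le> ?e 0 - ?e ((1/2) ^ J)" using half unfolding sq by simp
        then have "2 * B * (1 / 2) \<le> 2 * B * (?e 0 - ?e ((1/2) ^ J))" using B by (intro mult_left_mono) auto
        moreover have "\<Lambda> ?e \<le> B"
          unfolding \<Lambda>_def B_def
        proof (intro sum_mono)
          fix i j
          have "G i j * ?e (x i - x j) \<le> \<bar>G i j\<bar> * ?e (x i - x j)" by (rule mult_right_mono) auto
          also have "\<dots> \<le> \<bar>G i j\<bar> * 1" by (rule mult_left_mono) (use gauss_mix_exp in auto)
          finally have "G i j * ?e (x i - x j) \<le> \<bar>G i j\<bar> * 1" .
          then show "G i j * ?e (x i - x j) \<le> \<bar>G i j\<bar>" by simp
        qed
        moreover have "0 \<le> M * (5 * ?e 0 + (\<Sum>j<J. 32 * (2 powr \<tau>) ^ j * (?e 0 - ?e ((1/2) ^ j))))"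
          using M sn by (intro mult_nonneg_nonneg) auto
        ultimately show ?thesis unfolding R_def by linarith
      qed
    qed
    then show ?case using k(1) by simp
  next
    case (gauss_mix_add f g)
    have "\<Lambda> (\<lambda>t. f t + g t) = \<Lambda> f + \<Lambda> g" by (simp add: \<Lambda>_def distrib_left sum.distrib)
    moreover have "R J (\<lambda>t. f t + g t) = R J f + R J g"
      by (simp add: R_def algebra_simps sum.distrib sum_subtractf sum_distrib_left)
    ultimately show ?case using gauss_mix_add by simp
  next
    case (gauss_mix_cmult c f)
    have "\<Lambda> (\<lambda>t. c * f t) = c * \<Lambda> f" by (simp add: \<Lambda>_def sum_distrib_left mult_ac)
    moreover have "R J (\<lambda>t. c * f t) = c * R J f"
      by (simp add: R_def algebra_simps sum_subtractf sum_distrib_left)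
    ultimately show ?case using gauss_mix_cmult by (simp add: mult_left_mono)
  qed
  define f where "f t = 1 / (1 + \<bar>t\<bar> powr \<delta>)" for t :: real
  have cl: "gauss_mix_closure f" unfolding f_def using \<tau> by (intro cauchy_kernel_closure) auto
  have both: "0 \<le> \<Lambda> f \<and> \<Lambda> f \<le> R J f" for J
  proof -
    let ?T = "insert 0 ((\<lambda>j. (1/2) ^ j) ` {..J} \<union> (\<lambda>(i,j). x i - x j) ` (I \<times> I))"
    have "finite ?T" using I by auto
    from gauss_mix_closure_sequence[OF cl this] obtain g where g: "\<And>n. gauss_mix (g n)" "\<And>t. t \<in> ?T \<Longrightarrow> (\<lambda>n. g n t) \<longlonglongrightarrow> f t"
      by blast
    have L: "(\<lambda>n. \<Lambda> (g n)) \<longlonglongrightarrow> \<Lambda> f" unfolding \<Lambda>_def by (intro tendsto_sum tendsto_mult tendsto_const g) auto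
    have Rl: "(\<lambda>n. R J (g n)) \<longlonglongrightarrow> R J f" unfolding R_def
      by (intro tendsto_sum tendsto_mult tendsto_const tendsto_add tendsto_diff g) auto
    show ?thesis
      using LIMSEQ_le_const[OF L] LIMSEQ_le[OF L Rl] mix[OF g(1)] by blast
  qed
  show "0 \<le> (\<Sum>i\<in>I. \<Sum>j\<in>I. G i j * (1 / (1 + \<bar>x i - x j\<bar> powr \<delta>)))"
    using both[of 0] by (simp add: \<Lambda>_def f_def)
  define r where "r = (2::real) powr (\<tau> - \<delta>)"
  have r: "0 < r" "r < 1" using \<tau> by (auto simp: r_def powr_less_one)
  have fd: "f 0 - f t \<le> \<bar>t\<bar> powr \<delta>" for t
  proof -
    have "1 - 1 / (1 + u) = u / (1 + u)" if "0 \<le> u" for u :: real using that by (simp add: field_simps)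
    from this[of "\<bar>t\<bar> powr \<delta>"] have "f 0 - f t = \<bar>t\<bar> powr \<delta> / (1 + \<bar>t\<bar> powr \<delta>)" by (simp add: f_def)
    also have "\<dots> \<le> \<bar>t\<bar> powr \<delta> / 1" by (intro divide_left_mono) (auto simp: one_plus_powr_pos)
    finally show ?thesis by simp
  qed
  have f0: "f 0 = 1" by (simp add: f_def)
  have hp: "\<bar>(1/2::real) ^ j\<bar> powr \<delta> = ((1/2) powr \<delta>) ^ j" for j
    by (simp add: powr_realpow[symmetric] powr_powr mult.commute)
  have bound: "\<Lambda> f \<le> M * (5 + 32 / (1 - r)) + 2 * B * ((1/2) powr \<delta>) ^ J" for J
  proof -
    have "(\<Sum>j<J. 32 * (2 powr \<tau>) ^ j * (f 0 - f ((1/2) ^ j))) \<le> (\<Sum>j<J. 32 * (2 powr \<tau>) ^ j * ((1/2) powr \<delta>) ^ j)"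
      using fd[of "(1/2) ^ _"] unfolding hp by (intro sum_mono mult_left_mono) auto
    also have "\<dots> = 32 * (\<Sum>j<J. r ^ j)"
    proof -
      have "2 powr \<tau> * (1/2) powr \<delta> = r" by (simp add: r_def powr_diff powr_divide)
      then show ?thesis by (simp add: sum_distrib_left mult.assoc flip: power_mult_distrib)
    qed
    also have "\<dots> \<le> 32 * (1 / (1 - r))"
      using r by (intro mult_left_mono) (auto simp: sum_gp_strict divide_right_mono)
    finally have "M * (5 * f 0 + (\<Sum>j<J. 32 * (2 powr \<tau>) ^ j * (f 0 - f ((1/2) ^ j)))) \<le> M * (5 + 32 / (1 - r))"
      using M f0 by (intro mult_left_mono) auto
    moreover have "2 * B * (f 0 - f ((1/2) ^ J)) \<le> 2 * B * ((1/2) powr \<delta>) ^ J"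
      using B fd[of "(1/2) ^ J"] unfolding hp by (intro mult_left_mono) auto
    ultimately show ?thesis using both[of J] unfolding R_def by linarith
  qed
  have "(\<lambda>J. M * (5 + 32 / (1 - r)) + 2 * B * ((1/2) powr \<delta>) ^ J) \<longlonglongrightarrow> M * (5 + 32 / (1 - r)) + 2 * B * 0"
    using \<tau> powr_less_mono2[of \<delta> "1/2" 1] by (intro tendsto_add tendsto_mult tendsto_const LIMSEQ_power_zero) simp
  then have "\<Lambda> f \<le> M * (5 + 32 / (1 - r)) + 2 * B * 0"
    by (rule LIMSEQ_le_const) (use bound in auto)
  then show "(\<Sum>i\<in>I. \<Sum>j\<in>I. G i j * (1 / (1 + \<bar>x i - x j\<bar> powr \<delta>))) \<le> M * (5 + 32 / (1 - 2 powr (\<tau> - \<delta>)))"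
    by (simp add: \<Lambda>_def f_def r_def)
qed

lemma sum_cos_difference:
  "(\<Sum>s\<in>S. \<Sum>t\<in>S. c s * c t * cos (\<omega> * (x s - x t))) = (\<Sum>s\<in>S. c s * cos (\<omega> * x s))\<^sup>2 + (\<Sum>s\<in>S. c s * sin (\<omega> * x s))\<^sup>2"
  for c x :: "'i \<Rightarrow> real"
  by (simp add: right_diff_distrib cos_diff power2_eq_square sum_product sum.distrib distrib_left mult_ac)

text \<open>The lower bound of \<open>cauchy_kernel_trace\<close> for the rank one matrix
  \<open>c s * c t\<close>. Its growth condition is met by the sum \<open>M\<close> of the absolute
  values, with the exponent \<open>\<delta> / 2\<close> below \<delta>.\<close>

lemma cauchy_kernel_psd:
  assumes \<delta>: "0 < \<delta>" "\<delta> < 2"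
  shows "psd_kernel (\<lambda>s t. cauchy_profile \<delta> 1 \<bar>s - t\<bar>)"
  unfolding psd_kernel_def
proof (intro conjI allI impI)
  fix s t :: real show "cauchy_profile \<delta> 1 \<bar>s - t\<bar> = cauchy_profile \<delta> 1 \<bar>t - s\<bar>" by (simp add: abs_minus_commute)
next
  fix S :: "real set" and c :: "real \<Rightarrow> real" assume S: "finite S"
  define M where "M = (\<Sum>s\<in>S. \<Sum>t\<in>S. \<bar>c s * c t\<bar>)"
  have M: "0 \<le> M" unfolding M_def by (intro sum_nonneg) auto
  have "0 \<le> (\<Sum>s\<in>S. \<Sum>t\<in>S. (c s * c t) * (1 / (1 + \<bar>s - t\<bar> powr \<delta>)))"
  proof (rule cauchy_kernel_trace(1)[OF S, of "\<delta> / 2" \<delta> _ "\<lambda>s. s" M])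
    fix \<omega>
    show "0 \<le> (\<Sum>s\<in>S. \<Sum>t\<in>S. c s * c t * cos (\<omega> * (s - t)))" using sum_cos_difference[where S=S and c=c and \<omega>=\<omega> and x="\<lambda>s. s"] by simp
    have "(\<Sum>s\<in>S. \<Sum>t\<in>S. c s * c t * cos (\<omega> * (s - t))) \<le> M"
      unfolding M_def
    proof (intro sum_mono)
      fix s t
      have "\<bar>c s * c t\<bar> * \<bar>cos (\<omega> * (s - t))\<bar> \<le> \<bar>c s * c t\<bar> * 1" by (rule mult_left_mono) auto
      then show "c s * c t * cos (\<omega> * (s - t)) \<le> \<bar>c s * c t\<bar>"
        using abs_ge_self[of "c s * c t * cos (\<omega> * (s - t))"] unfolding abs_mult[of "c s * c t" "cos (\<omega> * (s - t))"] by linarith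
    qed
    also have "\<dots> \<le> M * (max 1 \<bar>\<omega>\<bar>) powr (\<delta> / 2)"
      using M \<delta> by (simp add: mult_le_cancel_left1 ge_one_powr_ge_zero)
    finally show "(\<Sum>s\<in>S. \<Sum>t\<in>S. c s * c t * cos (\<omega> * (s - t))) \<le> M * (max 1 \<bar>\<omega>\<bar>) powr (\<delta> / 2)" .
  qed (use \<delta> in auto)
  moreover have "cauchy_profile \<delta> 1 y = 1 / (1 + y powr \<delta>)" for y
    using one_plus_powr_pos[of y \<delta>] by (simp add: cauchy_profile_def powr_minus inverse_eq_divide)
  ultimately show "0 \<le> (\<Sum>s\<in>S. \<Sum>t\<in>S. c s * c t * cauchy_profile \<delta> 1 \<bar>s - t\<bar>)" by simp
qed

text \<open>A vanishing combination of translates is impossible because the kernel is \<open>C\<^sup>2\<close> away from \<open>0\<close>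
  but its second difference at \<open>0\<close> is of order \<open>\<eta>\<^sup>\<delta>\<close>.\<close>

lemma cauchy_kernel_strict:
  fixes S :: "real set"
  assumes \<delta>: "0 < \<delta>" "\<delta> < 2" and S: "finite S" and nz: "\<exists>s\<in>S. c s \<noteq> 0"
  shows "0 < (\<Sum>s\<in>S. \<Sum>t\<in>S. c s * c t * cauchy_profile \<delta> 1 \<bar>s - t\<bar>)"
proof (rule ccontr)
  let ?f = "cauchy_profile \<delta> 1"
  let ?Q = "\<Sum>s\<in>S. \<Sum>t\<in>S. c s * c t * ?f \<bar>s - t\<bar>"
  assume "\<not> 0 < ?Q"
  then have Q: "?Q = 0" using psd_kernel_nonneg[OF cauchy_kernel_psd[OF \<delta>] S, of c] by simp
  \<comment> \<open>By Cauchy-Schwarz a null vector of the form gives a combination of translates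
    that vanishes at every real \<open>p\<close>, not only on \<open>S\<close>; this permits second
    differences.\<close>
  have zero: "(\<Sum>s\<in>S. c s * ?f \<bar>s - p\<bar>) = 0" for p
    using psd_kernel_Cauchy_Schwarz_sum[OF cauchy_kernel_psd[OF \<delta>] S, of c p] Q by simp
  obtain p where p: "p \<in> S" "c p \<noteq> 0" using nz by blast
  define E where "E s K \<longleftrightarrow> (\<forall>\<^sub>F \<eta> in at_right 0. \<bar>?f \<bar>s - (p + \<eta>)\<bar> + ?f \<bar>s - (p - \<eta>)\<bar> - 2 * ?f \<bar>s - p\<bar>\<bar> \<le> K * \<eta>\<^sup>2)" for s K
  have far: "\<exists>K. E s K"
    if "s \<noteq> p" for s
  proof -
    define d where "d = \<bar>s - p\<bar>"
    have d: "0 < d" using that by (simp add: d_def)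
    have "continuous_on {d/2..3*d/2} (cauchy_profile2 \<delta> 1)"
      by (rule continuous_on_subset[OF cauchy_profile2_continuous]) (use d in auto)
    then have "bounded (cauchy_profile2 \<delta> 1 ` {d/2..3*d/2})" by (intro compact_imp_bounded compact_continuous_image) auto
    then obtain K where "\<forall>t\<in>{d/2..3*d/2}. \<bar>cauchy_profile2 \<delta> 1 t\<bar> \<le> K"
      unfolding bounded_pos by auto
    then have K: "\<And>t. d / 2 \<le> t \<Longrightarrow> t \<le> 3 * d / 2 \<Longrightarrow> \<bar>cauchy_profile2 \<delta> 1 t\<bar> \<le> K" by simp
    have "\<bar>?f \<bar>s - (p + \<eta>)\<bar> + ?f \<bar>s - (p - \<eta>)\<bar> - 2 * ?f \<bar>s - p\<bar>\<bar> \<le> (2 * K) * \<eta>\<^sup>2" if \<eta>: "0 < \<eta>" "\<eta> < d / 2" for \<eta>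
    proof -
      have sh: "((\<lambda>t. F (d + t)) has_real_derivative F' (d + t)) (at t)"
        if "(F has_real_derivative F' (d + t)) (at (d + t))" for F F' :: "real \<Rightarrow> real" and t
        using DERIV_shift[of F "F' (d + t)" t d] that by (simp add: add.commute)
      have "\<bar>?f (d + \<eta>) + ?f (d + (- \<eta>)) - 2 * ?f (d + 0)\<bar> \<le> 2 * \<eta>\<^sup>2 * K"
      proof (rule second_difference_mean_value[OF \<eta>(1)])
        fix t :: real assume t: "\<bar>t\<bar> \<le> \<eta>"
        then have "0 < d + t" "d / 2 \<le> d + t" "d + t \<le> 3 * d / 2" using \<eta> by linarith+
        then show "((\<lambda>t. ?f (d + t)) has_real_derivative cauchy_profile1 \<delta> 1 (d + t)) (at t)"
          "((\<lambda>t. cauchy_profile1 \<delta> 1 (d + t)) has_real_derivative cauchy_profile2 \<delta> 1 (d + t)) (at t)"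
          "\<bar>cauchy_profile2 \<delta> 1 (d + t)\<bar> \<le> K"
          using K by (auto intro!: sh cauchy_profile_deriv)
      qed
      moreover have "\<bar>s - (p + \<eta>)\<bar> = d + \<eta> \<and> \<bar>s - (p - \<eta>)\<bar> = d - \<eta> \<or> \<bar>s - (p + \<eta>)\<bar> = d - \<eta> \<and> \<bar>s - (p - \<eta>)\<bar> = d + \<eta>"
        using \<eta> unfolding d_def by (cases "p \<le> s") auto
      ultimately show ?thesis unfolding d_def[symmetric] by (auto simp: mult_ac)
    qed
    then show ?thesis using d unfolding E_def eventually_at_right_field
      by (intro exI[of _ "2 * K"] exI[of _ "d / 2"] conjI allI impI) simp_all
  qed
  obtain K where "\<And>s. s \<noteq> p \<Longrightarrow> E s (K s)"
    using far by metis
  then have K: "\<And>s. s \<in> S - {p} \<Longrightarrow> \<forall>\<^sub>F \<eta> in at_right 0. \<bar>?f \<bar>s - (p + \<eta>)\<bar> + ?f \<bar>s - (p - \<eta>)\<bar> - 2 * ?f \<bar>s - p\<bar>\<bar> \<le> K s * \<eta>\<^sup>2"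
    unfolding E_def by blast
  define K' where "K' = (\<Sum>s\<in>S - {p}. \<bar>c s\<bar> * K s)"
  have "\<forall>\<^sub>F \<eta> in at_right 0. \<forall>s\<in>S - {p}. \<bar>?f \<bar>s - (p + \<eta>)\<bar> + ?f \<bar>s - (p - \<eta>)\<bar> - 2 * ?f \<bar>s - p\<bar>\<bar> \<le> K s * \<eta>\<^sup>2"
    using S K by (intro eventually_ball_finite) auto
  moreover have "\<forall>\<^sub>F \<eta> in at_right (0::real). 0 < \<eta> \<and> \<eta> < 1" unfolding eventually_at_right_field by (intro exI[of _ 1]) auto
  \<comment> \<open>At \<open>p\<close> the second difference of the kernel has size at least
    \<open>\<eta> powr \<delta>\<close>, while the other translates contribute at most a multiple of
    \<open>\<eta>\<^sup>2\<close>. Division by \<open>\<eta> powr \<delta>\<close> leaves a bound on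
    \<open>c p\<close> that tends to 0.\<close>
  ultimately have "\<forall>\<^sub>F \<eta> in at_right 0. \<bar>c p\<bar> \<le> K' * \<eta> powr (2 - \<delta>)"
  proof eventually_elim
    case (elim \<eta>)
    have "0 = (\<Sum>s\<in>S. c s * ?f \<bar>s - (p + \<eta>)\<bar>) + (\<Sum>s\<in>S. c s * ?f \<bar>s - (p - \<eta>)\<bar>) - 2 * (\<Sum>s\<in>S. c s * ?f \<bar>s - p\<bar>)"
      unfolding zero by simp
    also have "\<dots> = (\<Sum>s\<in>S. c s * (?f \<bar>s - (p + \<eta>)\<bar> + ?f \<bar>s - (p - \<eta>)\<bar> - 2 * ?f \<bar>s - p\<bar>))"
      by (simp add: sum.distrib sum_subtractf sum_distrib_left algebra_simps)
    also have "\<dots> = c p * (2 * ?f \<eta> - 2) + (\<Sum>s\<in>S - {p}. c s * (?f \<bar>s - (p + \<eta>)\<bar> + ?f \<bar>s - (p - \<eta>)\<bar> - 2 * ?f \<bar>s - p\<bar>))"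
      using elim by (subst sum.remove[OF S p(1)]) (simp add: cauchy_profile_0[OF \<delta>(1)])
    finally have "\<bar>c p * (2 * ?f \<eta> - 2)\<bar> = \<bar>\<Sum>s\<in>S - {p}. c s * (?f \<bar>s - (p + \<eta>)\<bar> + ?f \<bar>s - (p - \<eta>)\<bar> - 2 * ?f \<bar>s - p\<bar>)\<bar>"
      by linarith
    also have "\<dots> \<le> (\<Sum>s\<in>S - {p}. \<bar>c s\<bar> * (K s * \<eta>\<^sup>2))"
      using elim by (intro order_trans[OF sum_abs] sum_mono) (auto simp: abs_mult intro!: mult_left_mono)
    also have "\<dots> = K' * \<eta>\<^sup>2" by (simp add: K'_def sum_distrib_right mult.assoc)
    finally have b: "\<bar>c p\<bar> * \<bar>2 * ?f \<eta> - 2\<bar> \<le> K' * \<eta>\<^sup>2" by (simp add: abs_mult)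
    have e1: "\<eta> powr \<delta> \<le> 1" using elim \<delta> powr_mono2[of \<delta> \<eta> 1] by simp
    have "1 - ?f \<eta> = \<eta> powr \<delta> / (1 + \<eta> powr \<delta>)"
      using one_plus_powr_pos[of \<eta> \<delta>] by (simp add: cauchy_profile_def powr_minus field_simps)
    moreover have "\<eta> powr \<delta> / 2 \<le> \<eta> powr \<delta> / (1 + \<eta> powr \<delta>)" using e1 one_plus_powr_pos[of \<eta> \<delta>] by (intro divide_left_mono) auto
    ultimately have "\<eta> powr \<delta> \<le> \<bar>2 * ?f \<eta> - 2\<bar>" by linarith
    then have "\<bar>c p\<bar> * \<eta> powr \<delta> \<le> K' * \<eta>\<^sup>2" using b by (meson abs_ge_zero mult_left_mono order_trans)
    also have "\<eta>\<^sup>2 = \<eta> powr (2 - \<delta>) * \<eta> powr \<delta>" using elim by (simp add: powr_add[symmetric])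
    finally have "\<bar>c p\<bar> * \<eta> powr \<delta> \<le> (K' * \<eta> powr (2 - \<delta>)) * \<eta> powr \<delta>" by simp
    then show ?case using elim by simp
  qed
  moreover have "((\<lambda>\<eta>. K' * \<eta> powr (2 - \<delta>)) \<longlongrightarrow> 0) (at_right 0)"
  proof -
    have "((\<lambda>\<eta>::real. \<eta> powr (2 - \<delta>)) \<longlongrightarrow> 0 powr (2 - \<delta>)) (at_right 0)"
      by (rule tendsto_powr2) (use \<delta> in \<open>auto simp: eventually_at_right_field intro!: exI[of _ 1] tendsto_ident_at\<close>)
    then show ?thesis using tendsto_mult_right_zero by fastforce
  qed
  ultimately have "\<bar>c p\<bar> \<le> 0" by (intro tendsto_lowerbound) auto
  then show False using p by simp
qed

section \<open>Translations of a Gaussian sequence\<close>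

text \<open>Completing the square: the density of the shifted normal law relative to the original
  one is \<open>exp (x * y - y\<^sup>2 / 2)\<close>.\<close>

lemma std_normal_shift:
  assumes [measurable]: "f \<in> borel_measurable borel"
  shows "(\<integral>\<^sup>+x. f (x + y) \<partial>std_normal_distribution) = (\<integral>\<^sup>+x. f x * ennreal (exp (x * y - y\<^sup>2 / 2)) \<partial>std_normal_distribution)"
proof -
  have d: "std_normal_density (x - y) = std_normal_density x * exp (x * y - y\<^sup>2 / 2)" for x
    unfolding std_normal_density_def by (simp add: power2_eq_square exp_add[symmetric] algebra_simps add_divide_distrib diff_divide_distrib)
  have "(\<integral>\<^sup>+x. f (x + y) \<partial>std_normal_distribution) = (\<integral>\<^sup>+x. ennreal (std_normal_density x) * f (x + y) \<partial>lborel)"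
    by (subst nn_integral_density) auto
  also have "\<dots> = (\<integral>\<^sup>+x. ennreal (std_normal_density (x - y)) * f x \<partial>lborel)"
    by (subst nn_integral_real_affine[of "\<lambda>x. ennreal (std_normal_density (x - y)) * f x" 1 y]) (auto simp: add.commute)
  also have "\<dots> = (\<integral>\<^sup>+x. ennreal (std_normal_density x) * (f x * ennreal (exp (x * y - y\<^sup>2 / 2))) \<partial>lborel)"
    unfolding d by (intro nn_integral_cong) (simp add: ennreal_mult' mult_ac)
  also have "\<dots> = (\<integral>\<^sup>+x. f x * ennreal (exp (x * y - y\<^sup>2 / 2)) \<partial>std_normal_distribution)"
    by (subst nn_integral_density) auto
  finally show ?thesis .
qed

lemma gauss_seq_split:
  assumes f [measurable]: "f \<in> borel_measurable gauss_seq"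
  shows "(\<integral>\<^sup>+\<xi>. f \<xi> \<partial>gauss_seq) = (\<integral>\<^sup>+X. (\<integral>\<^sup>+x. f (X(i := x)) \<partial>std_normal_distribution) \<partial>PiM (UNIV - {i}) (\<lambda>_. std_normal_distribution))"
proof -
  let ?N = std_normal_distribution and ?R = "PiM (UNIV - {i}) (\<lambda>_. std_normal_distribution)"
  interpret R: prob_space ?R by (intro prob_space_PiM std_normal.prob_space_axioms)
  interpret P: pair_sigma_finite ?N ?R ..
  have ins: "insert i (UNIV - {i}) = UNIV" by auto
  have eq: "gauss_seq = distr (?N \<Otimes>\<^sub>M ?R) gauss_seq (\<lambda>(x, X). X(i := x))"
    using distr_pair_PiM_eq_PiM[of "UNIV - {i}" "\<lambda>_. ?N" i] std_normal.prob_space_axioms unfolding ins by simp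
  have m [measurable]: "(\<lambda>(x, X). X(i := x)) \<in> measurable (?N \<Otimes>\<^sub>M ?R) gauss_seq"
    unfolding split_beta' by (rule measurable_fun_upd[where J="UNIV - {i}"]) auto
  have "(\<integral>\<^sup>+\<xi>. f \<xi> \<partial>gauss_seq) = (\<integral>\<^sup>+z. f ((\<lambda>(x, X). X(i := x)) z) \<partial>(?N \<Otimes>\<^sub>M ?R))"
    by (subst eq, subst nn_integral_distr) auto
  also have "\<dots> = (\<integral>\<^sup>+X. (\<integral>\<^sup>+x. f (X(i := x)) \<partial>?N) \<partial>?R)"
    by (subst P.nn_integral_snd[symmetric]) (auto simp: measurable_compose[OF m f])
  finally show ?thesis .
qed

text \<open>The amount of translation may depend on the other coordinates. By \<open>yi\<close> it
  is constant along lines in direction \<open>i\<close>, so the one-dimensional formula applies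
  under Fubini.\<close>

lemma gauss_seq_shift_one:
  assumes f [measurable]: "f \<in> borel_measurable gauss_seq" and y [measurable]: "y \<in> borel_measurable gauss_seq"
    and yi: "\<And>\<xi> x. y (\<xi>(i := x)) = y \<xi>"
  shows "(\<integral>\<^sup>+\<xi>. f (\<xi>(i := \<xi> i + y \<xi>)) \<partial>gauss_seq) = (\<integral>\<^sup>+\<xi>. f \<xi> * ennreal (exp (\<xi> i * y \<xi> - (y \<xi>)\<^sup>2 / 2)) \<partial>gauss_seq)"
proof -
  have sm [measurable]: "(\<lambda>\<xi>. \<xi>(i := \<xi> i + y \<xi>)) \<in> measurable gauss_seq gauss_seq"
    by (rule measurable_fun_upd[where J=UNIV]) auto
  have "(\<integral>\<^sup>+\<xi>. f (\<xi>(i := \<xi> i + y \<xi>)) \<partial>gauss_seq)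
     = (\<integral>\<^sup>+X. (\<integral>\<^sup>+x. f (X(i := x + y X)) \<partial>std_normal_distribution) \<partial>PiM (UNIV - {i}) (\<lambda>_. std_normal_distribution))"
    by (subst gauss_seq_split[where i=i]) (auto simp: yi)
  also have "\<dots> = (\<integral>\<^sup>+X. (\<integral>\<^sup>+x. f (X(i := x)) * ennreal (exp (x * y X - (y X)\<^sup>2 / 2)) \<partial>std_normal_distribution) \<partial>PiM (UNIV - {i}) (\<lambda>_. std_normal_distribution))"
  proof (rule nn_integral_cong)
    fix X assume X: "X \<in> space (PiM (UNIV - {i}) (\<lambda>_. std_normal_distribution))"
    have ins: "insert i (UNIV - {i}) = UNIV" by auto
    have "(\<lambda>x. X(i := x)) \<in> measurable std_normal_distribution gauss_seq"
      using measurable_component_update[OF X, of i] unfolding ins by simp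
    then have "(\<lambda>x. f (X(i := x))) \<in> borel_measurable std_normal_distribution" by (rule measurable_compose) simp
    then have "(\<lambda>x. f (X(i := x))) \<in> borel_measurable borel" by simp
    from std_normal_shift[OF this, of "y X"]
    show "(\<integral>\<^sup>+x. f (X(i := x + y X)) \<partial>std_normal_distribution) = (\<integral>\<^sup>+x. f (X(i := x)) * ennreal (exp (x * y X - (y X)\<^sup>2 / 2)) \<partial>std_normal_distribution)" .
  qed
  also have "\<dots> = (\<integral>\<^sup>+\<xi>. f \<xi> * ennreal (exp (\<xi> i * y \<xi> - (y \<xi>)\<^sup>2 / 2)) \<partial>gauss_seq)"
    using gauss_seq_split[where i=i and f="\<lambda>\<xi>. f \<xi> * ennreal (exp (\<xi> i * y \<xi> - (y \<xi>)\<^sup>2 / 2))"] by (simp add: yi)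
  finally show ?thesis .
qed

definition coord_shift :: "nat set \<Rightarrow> (nat \<Rightarrow> (nat \<Rightarrow> real) \<Rightarrow> real) \<Rightarrow> (nat \<Rightarrow> real) \<Rightarrow> nat \<Rightarrow> real" where
  "coord_shift J y \<xi> = (\<lambda>k. if k \<in> J then \<xi> k + y k \<xi> else \<xi> k)"

lemma coord_shift_measurable:
  assumes "\<And>k. k \<in> J \<Longrightarrow> y k \<in> borel_measurable gauss_seq"
  shows "coord_shift J y \<in> measurable gauss_seq gauss_seq"
proof (rule measurable_PiM_single')
  fix k :: nat
  show "(\<lambda>\<xi>. coord_shift J y \<xi> k) \<in> measurable gauss_seq std_normal_distribution"
    using assms[of k] by (cases "k \<in> J") (auto simp: coord_shift_def)
qed (auto simp: space_PiM)

context
  fixes I :: "nat set" and y :: "nat \<Rightarrow> (nat \<Rightarrow> real) \<Rightarrow> real"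
  assumes I: "finite I" and y [measurable]: "\<And>k. y k \<in> borel_measurable gauss_seq"
    and indep: "\<And>k \<xi> \<xi>'. (\<And>i. i \<notin> I \<Longrightarrow> \<xi> i = \<xi>' i) \<Longrightarrow> y k \<xi> = y k \<xi>'"
begin

text \<open>The shifts are random, yet they read no coordinate of \<open>I\<close>. Translating one
  coordinate therefore leaves the other shifts unchanged, and the formula for one coordinate can be
  iterated.\<close>

lemma gauss_seq_shift:
  assumes "J \<subseteq> I" "f \<in> borel_measurable gauss_seq"
  shows "(\<integral>\<^sup>+\<xi>. f (coord_shift J y \<xi>) \<partial>gauss_seq) = (\<integral>\<^sup>+\<xi>. f \<xi> * ennreal (exp (\<Sum>i\<in>J. \<xi> i * y i \<xi> - (y i \<xi>)\<^sup>2 / 2)) \<partial>gauss_seq)"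
  using finite_subset[OF assms(1) I] assms
proof (induction J arbitrary: f rule: finite_induct)
  case empty
  then show ?case by (simp add: coord_shift_def)
next
  case (insert i J)
  note [measurable] = insert.prems(2)
  have [measurable]: "coord_shift J y \<in> measurable gauss_seq gauss_seq" by (rule coord_shift_measurable) simp
  have yi: "y k (\<xi>(i := x)) = y k \<xi>" for k \<xi> x
    using insert.prems(1) by (intro indep) auto
  have ys: "y k (coord_shift J y \<xi>) = y k \<xi>" for k \<xi>
    using insert.prems(1) by (intro indep) (auto simp: coord_shift_def)
  have sh: "coord_shift (insert i J) y \<xi> = coord_shift J y (\<xi>(i := \<xi> i + y i \<xi>))" for \<xi>
    using insert.hyps by (auto simp: coord_shift_def yi fun_eq_iff)
  let ?E = "\<lambda>\<xi>. ennreal (exp (\<xi> i * y i \<xi> - (y i \<xi>)\<^sup>2 / 2))"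
  have "(\<integral>\<^sup>+\<xi>. f (coord_shift (insert i J) y \<xi>) \<partial>gauss_seq) = (\<integral>\<^sup>+\<xi>. f (coord_shift J y \<xi>) * ?E \<xi> \<partial>gauss_seq)"
    unfolding sh by (rule gauss_seq_shift_one) (auto simp: yi)
  also have "\<dots> = (\<integral>\<^sup>+\<xi>. f (coord_shift J y \<xi>) * ?E (coord_shift J y \<xi>) \<partial>gauss_seq)"
    unfolding ys using insert.hyps by (simp add: coord_shift_def)
  also have "\<dots> = (\<integral>\<^sup>+\<xi>. (f \<xi> * ?E \<xi>) * ennreal (exp (\<Sum>i\<in>J. \<xi> i * y i \<xi> - (y i \<xi>)\<^sup>2 / 2)) \<partial>gauss_seq)"
    using insert.prems by (intro insert.IH) auto
  also have "\<dots> = (\<integral>\<^sup>+\<xi>. f \<xi> * ennreal (exp (\<Sum>i\<in>insert i J. \<xi> i * y i \<xi> - (y i \<xi>)\<^sup>2 / 2)) \<partial>gauss_seq)"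
    using insert.hyps by (simp add: exp_add ennreal_mult' mult.assoc)
  finally show ?case .
qed

end

text \<open>The Hellinger affinity of the two laws is the expectation of \<open>exp (- \<bar>y\<bar>\<^sup>2 / 8)\<close>, so the laws
  cannot be separated.\<close>

lemma gauss_seq_shift_affinity:
  fixes I :: "nat set" and y :: "nat \<Rightarrow> (nat \<Rightarrow> real) \<Rightarrow> real"
  assumes I: "finite I" and y [measurable]: "\<And>k. y k \<in> borel_measurable gauss_seq"
    and indep: "\<And>k \<xi> \<xi>'. (\<And>i. i \<notin> I \<Longrightarrow> \<xi> i = \<xi>' i) \<Longrightarrow> y k \<xi> = y k \<xi>'"
    and int: "integrable gauss_seq (\<lambda>\<xi>. \<Sum>i\<in>I. (y i \<xi>)\<^sup>2)" and small: "(\<integral>\<xi>. (\<Sum>i\<in>I. (y i \<xi>)\<^sup>2) \<partial>gauss_seq) \<le> 4"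
    and A [measurable]: "A \<in> sets gauss_seq"
  shows "3 / 32 \<le> gauss_seq.prob {\<xi>. coord_shift I y \<xi> \<notin> A} + gauss_seq.prob A"
proof -
  define s where "s \<xi> = (\<Sum>i\<in>I. (y i \<xi>)\<^sup>2)" for \<xi>
  define L where "L \<xi> = exp (\<Sum>i\<in>I. \<xi> i * y i \<xi> - (y i \<xi>)\<^sup>2 / 2)" for \<xi>
  define H where "H \<xi> = exp (\<Sum>i\<in>I. \<xi> i * y i \<xi> / 2 - (y i \<xi>)\<^sup>2 / 4)" for \<xi>
  have [measurable]: "s \<in> borel_measurable gauss_seq" "L \<in> borel_measurable gauss_seq" "H \<in> borel_measurable gauss_seq"
    unfolding s_def L_def H_def by measurable
  have [measurable]: "coord_shift I y \<in> measurable gauss_seq gauss_seq" by (rule coord_shift_measurable) simp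
  have shift: "(\<integral>\<^sup>+\<xi>. f (coord_shift I y \<xi>) \<partial>gauss_seq) = (\<integral>\<^sup>+\<xi>. f \<xi> * ennreal (L \<xi>) \<partial>gauss_seq)"
    if "f \<in> borel_measurable gauss_seq" for f
    unfolding L_def by (rule gauss_seq_shift[where y=y, OF I y indep subset_refl that])
  have ys: "y k (coord_shift I z \<xi>) = y k \<xi>" for k \<xi> z
    by (intro indep) (auto simp: coord_shift_def)
  have s_shift: "s (coord_shift I z \<xi>) = s \<xi>" for z \<xi> by (simp add: s_def ys)
  \<comment> \<open>\<open>H\<close> is the square root of the density \<open>L\<close>. It equals
    \<open>exp (- s / 8)\<close> times the density of the translation by \<open>y / 2\<close>, under
    which \<open>s\<close> is invariant; integration gives the affinity.\<close>
  have HL: "H \<xi> = exp (- s \<xi> / 8) * exp (\<Sum>i\<in>I. \<xi> i * (y i \<xi> / 2) - (y i \<xi> / 2)\<^sup>2 / 2)" for \<xi>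
    unfolding H_def s_def exp_add[symmetric]
    by (simp add: sum_negf[symmetric] sum_divide_distrib sum.distrib[symmetric] power_divide)
  have "(\<integral>\<^sup>+\<xi>. ennreal (exp (- s \<xi> / 8)) \<partial>gauss_seq) = (\<integral>\<^sup>+\<xi>. ennreal (exp (- s (coord_shift I (\<lambda>k \<xi>. y k \<xi> / 2) \<xi>) / 8)) \<partial>gauss_seq)"
    by (simp add: s_shift)
  also have "\<dots> = (\<integral>\<^sup>+\<xi>. ennreal (exp (- s \<xi> / 8)) * ennreal (exp (\<Sum>i\<in>I. \<xi> i * (y i \<xi> / 2) - (y i \<xi> / 2)\<^sup>2 / 2)) \<partial>gauss_seq)"
  proof (rule gauss_seq_shift[OF I _ _ subset_refl])
    show "y k \<xi> / 2 = y k \<xi>' / 2" if "\<And>i. i \<notin> I \<Longrightarrow> \<xi> i = \<xi>' i" for k \<xi> \<xi>' using indep[OF that] by simp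
  qed measurable
  also have "\<dots> = (\<integral>\<^sup>+\<xi>. ennreal (H \<xi>) \<partial>gauss_seq)" unfolding HL by (simp add: ennreal_mult')
  finally have aff: "(\<integral>\<^sup>+\<xi>. ennreal (H \<xi>) \<partial>gauss_seq) = (\<integral>\<^sup>+\<xi>. ennreal (exp (- s \<xi> / 8)) \<partial>gauss_seq)" ..
  have "ennreal (1 / 2) \<le> ennreal (\<integral>\<xi>. exp (- s \<xi> / 8) \<partial>gauss_seq)"
  proof (rule ennreal_leI)
    have ie: "integrable gauss_seq (\<lambda>\<xi>. exp (- s \<xi> / 8))"
      by (rule gauss_seq.integrable_const_bound[where B=1]) (auto simp: s_def intro!: sum_nonneg)
    have "1 / 2 \<le> (\<integral>\<xi>. 1 - s \<xi> / 8 \<partial>gauss_seq)" using int small by (simp add: s_def)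
    also have "\<dots> \<le> (\<integral>\<xi>. exp (- s \<xi> / 8) \<partial>gauss_seq)"
    proof (rule integral_mono[OF _ ie])
      show "1 - s \<xi> / 8 \<le> exp (- s \<xi> / 8)" for \<xi> using exp_ge_add_one_self[of "- s \<xi> / 8"] by simp
    qed (use int in \<open>simp add: s_def\<close>)
    finally show "1 / 2 \<le> (\<integral>\<xi>. exp (- s \<xi> / 8) \<partial>gauss_seq)" .
  qed
  also have "\<dots> = (\<integral>\<^sup>+\<xi>. ennreal (exp (- s \<xi> / 8)) \<partial>gauss_seq)"
    by (rule nn_integral_eq_integral[symmetric]) (auto intro!: gauss_seq.integrable_const_bound[where B=1] simp: s_def sum_nonneg)
  also have "\<dots> = (\<integral>\<^sup>+\<xi>. ennreal (H \<xi>) \<partial>gauss_seq)" by (rule aff[symmetric])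
  \<comment> \<open>The squares of \<open>2 * H - 1/4\<close> and \<open>H / 4 - 2\<close> give
    \<open>H \<le> 4 * H\<^sup>2 + 1/16\<close> and \<open>H \<le> H\<^sup>2 / 16 + 4\<close>. The
    first is used off \<open>A\<close>, the second on \<open>A\<close>, and
    \<open>(1/2 - 1/8) / 4\<close> is the constant 3/32.\<close>
  also have "\<dots> \<le> (\<integral>\<^sup>+\<xi>. 4 * (indicator (- A) \<xi> * ennreal (L \<xi>)) + 4 * indicator A \<xi> + ennreal (1/16) + ennreal (1/16) * ennreal (L \<xi>) \<partial>gauss_seq)"
  proof (rule nn_integral_mono)
    fix \<xi>
    have "H \<xi> * H \<xi> = L \<xi>" unfolding H_def L_def exp_add[symmetric] sum.distrib[symmetric] by (intro arg_cong[of _ _ exp] sum.cong) auto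
    then have HH: "(H \<xi>)\<^sup>2 = L \<xi>" by (simp add: power2_eq_square)
    have H0: "0 < H \<xi>" "0 < L \<xi>" by (auto simp: H_def L_def)
    have "0 \<le> (2 * H \<xi> - 1 / 4)\<^sup>2" "0 \<le> (H \<xi> / 4 - 2)\<^sup>2" by auto
    then have b: "H \<xi> \<le> 4 * L \<xi> + 1 / 16" "H \<xi> \<le> L \<xi> / 16 + 4" unfolding HH[symmetric] by (auto simp: power2_eq_square algebra_simps)
    show "ennreal (H \<xi>) \<le> 4 * (indicator (- A) \<xi> * ennreal (L \<xi>)) + 4 * indicator A \<xi> + ennreal (1/16) + ennreal (1/16) * ennreal (L \<xi>)"
    proof (cases "\<xi> \<in> A")
      case True
      have "ennreal (H \<xi>) \<le> ennreal (4 + 1/16 + 1/16 * L \<xi>)" using b by (intro ennreal_leI) simp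
      also have "\<dots> = 4 + ennreal (1/16) + ennreal (1/16) * ennreal (L \<xi>)"
        using H0 by (simp add: ennreal_plus[symmetric] ennreal_mult[symmetric] ennreal_numeral[symmetric] del: ennreal_numeral ennreal_plus)
      finally show ?thesis using True by simp
    next
      case False
      have "ennreal (H \<xi>) \<le> ennreal (4 * L \<xi> + 1/16 + 1/16 * L \<xi>)" using b H0 by (intro ennreal_leI) simp
      also have "\<dots> = 4 * ennreal (L \<xi>) + ennreal (1/16) + ennreal (1/16) * ennreal (L \<xi>)"
        using H0 by (simp add: ennreal_plus[symmetric] ennreal_mult[symmetric] ennreal_numeral[symmetric] del: ennreal_numeral ennreal_plus)
      finally show ?thesis using False by simp
    qed
  qed
  also have "\<dots> = 4 * (\<integral>\<^sup>+\<xi>. indicator (- A) \<xi> * ennreal (L \<xi>) \<partial>gauss_seq) + 4 * emeasure gauss_seq A + ennreal (1/16)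
      + ennreal (1/16) * (\<integral>\<^sup>+\<xi>. ennreal (L \<xi>) \<partial>gauss_seq)"
    using gauss_seq.emeasure_space_1 by (simp add: nn_integral_add nn_integral_cmult)
  also have "(\<integral>\<^sup>+\<xi>. ennreal (L \<xi>) \<partial>gauss_seq) = 1"
  proof -
    have "(\<integral>\<^sup>+\<xi>. 1 \<partial>gauss_seq) = (\<integral>\<^sup>+\<xi>. 1 * ennreal (L \<xi>) \<partial>gauss_seq)" using shift[where f="\<lambda>_. 1"] by simp
    moreover have "(\<integral>\<^sup>+\<xi>. 1 \<partial>gauss_seq) = 1" by (simp add: gauss_seq.emeasure_space_1 del: space_gauss_seq)
    ultimately show ?thesis by simp
  qed
  also have "(\<integral>\<^sup>+\<xi>. indicator (- A) \<xi> * ennreal (L \<xi>) \<partial>gauss_seq) = (\<integral>\<^sup>+\<xi>. indicator (- A) (coord_shift I y \<xi>) \<partial>gauss_seq)"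
    using shift[of "indicator (- A)"] sets.compl_sets[OF A] by (simp add: Compl_eq_Diff_UNIV)
  also have "(\<integral>\<^sup>+\<xi>. indicator (- A) (coord_shift I y \<xi>) \<partial>gauss_seq) = (\<integral>\<^sup>+\<xi>. indicator {\<xi>. coord_shift I y \<xi> \<notin> A} \<xi> \<partial>gauss_seq)"
    by (intro nn_integral_cong) (simp add: indicator_def)
  also have "\<dots> = emeasure gauss_seq {\<xi>. coord_shift I y \<xi> \<notin> A}"
    by (rule nn_integral_indicator) (use measurable_sets[OF coord_shift_measurable[of I y] sets.compl_sets[OF A]] in \<open>auto simp: vimage_def Compl_eq_Diff_UNIV\<close>)
  finally have "ennreal (1 / 2) \<le> 4 * emeasure gauss_seq {\<xi>. coord_shift I y \<xi> \<notin> A} + 4 * emeasure gauss_seq A + ennreal (1/16) + ennreal (1/16) * 1" .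
  also have "\<dots> = ennreal (4 * gauss_seq.prob {\<xi>. coord_shift I y \<xi> \<notin> A} + 4 * gauss_seq.prob A + 1/16 + 1/16)"
    by (simp add: gauss_seq.emeasure_eq_measure ennreal_plus[symmetric] ennreal_mult[symmetric] ennreal_numeral[symmetric] del: ennreal_numeral ennreal_plus)
  finally show ?thesis by (subst (asm) ennreal_le_iff) auto
qed

section \<open>Failure of consistent estimation\<close>

definition cylinders :: "'a set \<Rightarrow> 'a set \<Rightarrow> ('a \<Rightarrow> 'b::topological_space) set set" where
  "cylinders D T = {{z \<in> D \<rightarrow>\<^sub>E UNIV. z s \<in> B} | s B. s \<in> T \<and> B \<in> sets borel}"

lemma sets_PiM_borel_cylinders: "sets (PiM D (\<lambda>_. borel)) = sigma_sets (D \<rightarrow>\<^sub>E UNIV) (cylinders D D)"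
  unfolding cylinders_def by (subst sets_PiM_single) simp

lemma cylinders_mono: "T \<subseteq> T' \<Longrightarrow> cylinders D T \<subseteq> cylinders D T'"
  by (auto simp: cylinders_def)

text \<open>The sets with countable support form a sigma-algebra because countable unions of
  countable sets are countable. Events defined by an estimator thus depend on countably many points
  of \<open>D\<close>, even if \<open>D\<close> is uncountable.\<close>

lemma countable_support:
  assumes "A \<in> sets (PiM D (\<lambda>_. borel))"
  shows "\<exists>T. countable T \<and> T \<subseteq> D \<and> A \<in> sigma_sets (D \<rightarrow>\<^sub>E UNIV) (cylinders D T)"
  using assms unfolding sets_PiM_borel_cylinders
proof (induction A rule: sigma_sets.induct)
  case (Basic A)
  then obtain s B where "A = {z \<in> D \<rightarrow>\<^sub>E UNIV. z s \<in> B}" "s \<in> D" "B \<in> sets borel"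
    by (auto simp: cylinders_def)
  then show ?case by (intro exI[of _ "{s}"] conjI sigma_sets.Basic) (auto simp: cylinders_def)
next
  case Empty
  show ?case by (intro exI[of _ "{}"] conjI sigma_sets.Empty) auto
next
  case (Compl A)
  then show ?case by (auto intro: sigma_sets.Compl)
next
  case (Union A)
  define P where "P i T \<longleftrightarrow> countable T \<and> T \<subseteq> D \<and> A i \<in> sigma_sets (D \<rightarrow>\<^sub>E UNIV) (cylinders D T)" for i T
  have "\<exists>T. P i T" for i unfolding P_def by (rule Union.IH)
  then obtain T where "\<And>i. P i (T i)" by metis
  then have T: "\<And>i. countable (T i)" "\<And>i. T i \<subseteq> D" "\<And>i. A i \<in> sigma_sets (D \<rightarrow>\<^sub>E UNIV) (cylinders D (T i))"
    by (auto simp: P_def)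
  have "A i \<in> sigma_sets (D \<rightarrow>\<^sub>E UNIV) (cylinders D (\<Union>i. T i))" for i
    by (rule subsetD[OF sigma_sets_mono' T(3)]) (auto intro!: cylinders_mono)
  then show ?case using T(1,2) by (intro exI[of _ "\<Union>i. T i"] conjI sigma_sets.Union) auto
qed

text \<open>Two laws are to be compared with the same finite set of coordinates and the same
  approximating event, hence the family of measures indexed by \<open>bool\<close>. In a countable
  union the tail is cut at one index \<open>n\<close> that serves both.\<close>

lemma cylinder_approximation:
  fixes M :: "bool \<Rightarrow> ('a \<Rightarrow> 'b::topological_space) measure"
  assumes M: "\<And>b. finite_measure (M b)" and sets_M: "\<And>b. sets (M b) = sets (PiM D (\<lambda>_. borel))" and T: "T \<subseteq> D"
    and A: "A \<in> sigma_sets (D \<rightarrow>\<^sub>E UNIV) (cylinders D T)" and \<epsilon>: "0 < \<epsilon>"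
  shows "\<exists>F A'. finite F \<and> F \<subseteq> T \<and> A' \<in> sets (PiM D (\<lambda>_. borel))
    \<and> (\<forall>z\<in>D \<rightarrow>\<^sub>E UNIV. \<forall>z'\<in>D \<rightarrow>\<^sub>E UNIV. (\<forall>s\<in>F. z s = z' s) \<longrightarrow> (z \<in> A' \<longleftrightarrow> z' \<in> A'))
    \<and> (\<forall>b. measure (M b) (sym_diff A A') < \<epsilon>)"
  using A \<epsilon>
proof (induction A arbitrary: \<epsilon> rule: sigma_sets.induct)
  case (Basic A)
  then obtain s B where sB: "A = {z \<in> D \<rightarrow>\<^sub>E UNIV. z s \<in> B}" "s \<in> T" "B \<in> sets borel"
    by (auto simp: cylinders_def)
  have "A \<in> sigma_sets (D \<rightarrow>\<^sub>E UNIV) (cylinders D D)"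
    by (rule subsetD[OF sigma_sets_mono' sigma_sets.Basic[OF Basic.hyps]]) (rule cylinders_mono[OF T])
  then show ?case using sB Basic.prems unfolding sets_PiM_borel_cylinders
    by (intro exI[of _ "{s}"] exI[of _ A]) auto
next
  case Empty
  then show ?case by (intro exI[of _ "{}"]) auto
next
  case (Compl A)
  obtain F A' where A': "finite F" "F \<subseteq> T" "A' \<in> sets (PiM D (\<lambda>_. borel))"
    "\<forall>z\<in>D \<rightarrow>\<^sub>E UNIV. \<forall>z'\<in>D \<rightarrow>\<^sub>E UNIV. (\<forall>s\<in>F. z s = z' s) \<longrightarrow> (z \<in> A' \<longleftrightarrow> z' \<in> A')"
    "\<forall>b. measure (M b) (sym_diff A A') < \<epsilon>"
    using Compl.IH[OF Compl.prems] by blast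
  have sub: "A \<subseteq> D \<rightarrow>\<^sub>E UNIV" by (rule sigma_sets_into_sp[OF _ Compl.hyps]) (auto simp: cylinders_def)
  have sub': "A' \<subseteq> D \<rightarrow>\<^sub>E UNIV" using sets.sets_into_space[OF A'(3)] by (simp add: space_PiM)
  let ?B = "(D \<rightarrow>\<^sub>E UNIV) - A'"
  have B: "?B \<in> sets (PiM D (\<lambda>_. borel))"
    using sets.compl_sets[OF A'(3)] by (simp add: space_PiM)
  have eq: "sym_diff ((D \<rightarrow>\<^sub>E UNIV) - A) ?B = sym_diff A A'" using sub sub' by blast
  show ?case
  proof (rule exI[of _ F], rule exI[of _ ?B], intro conjI ballI allI impI)
    fix z z' :: "'a \<Rightarrow> 'b" assume "z \<in> D \<rightarrow>\<^sub>E UNIV" "z' \<in> D \<rightarrow>\<^sub>E UNIV" "\<forall>s\<in>F. z s = z' s"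
    then show "z \<in> ?B \<longleftrightarrow> z' \<in> ?B" using A'(4)[rule_format, of z z'] by blast
  next
    fix b show "measure (M b) (sym_diff ((D \<rightarrow>\<^sub>E UNIV) - A) ?B) < \<epsilon>" unfolding eq using A'(5) by blast
  qed (use A'(1,2) B in blast)+
next
  case (Union A)
  have Am: "A i \<in> sets (M b)" for i b
    using subsetD[OF sigma_sets_mono'[OF cylinders_mono[OF T]] Union.hyps] unfolding sets_M sets_PiM_borel_cylinders .
  have "\<exists>n. measure (M b) ((\<Union>i. A i) - (\<Union>i<n. A i)) < \<epsilon> / 2" for b
  proof -
    interpret finite_measure "M b" by (rule M)
    have "(\<lambda>n. measure (M b) (\<Union>i<n. A i)) \<longlonglongrightarrow> measure (M b) (\<Union>n. \<Union>i<n. A i)"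
      using Am by (intro finite_Lim_measure_incseq) (auto simp: incseq_def dest: less_le_trans)
    moreover have "(\<Union>n. \<Union>i<n. A i) = (\<Union>i. A i)" by auto
    ultimately have "\<forall>\<^sub>F n in sequentially. measure (M b) (\<Union>i. A i) - \<epsilon> / 2 < measure (M b) (\<Union>i<n. A i)"
      using Union.prems by (intro order_tendstoD(1)) auto
    then obtain n where "measure (M b) (\<Union>i. A i) - \<epsilon> / 2 < measure (M b) (\<Union>i<n. A i)"
      by (auto simp: eventually_sequentially)
    moreover have "measure (M b) ((\<Union>i. A i) - (\<Union>i<n. A i)) = measure (M b) (\<Union>i. A i) - measure (M b) (\<Union>i<n. A i)"
      using Am by (intro finite_measure_Diff) auto
    ultimately show ?thesis by (intro exI[of _ n]) linarith
  qed
  then obtain N where N: "\<And>b. measure (M b) ((\<Union>i. A i) - (\<Union>i<N b. A i)) < \<epsilon> / 2" by metis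
  define n where "n = max (N True) (N False)"
  have tail: "measure (M b) ((\<Union>i. A i) - (\<Union>i<n. A i)) < \<epsilon> / 2" for b
  proof -
    interpret finite_measure "M b" by (rule M)
    have "N b \<le> n" by (cases b) (auto simp: n_def)
    then have "measure (M b) ((\<Union>i. A i) - (\<Union>i<n. A i)) \<le> measure (M b) ((\<Union>i. A i) - (\<Union>i<N b. A i))"
      using Am by (intro finite_measure_mono) (auto dest: less_le_trans)
    then show ?thesis using N[of b] by linarith
  qed
  define \<eta> where "\<eta> = \<epsilon> / (2 * (real n + 1))"
  have \<eta>: "0 < \<eta>" using Union.prems by (simp add: \<eta>_def)
  define P where "P i F A' \<longleftrightarrow> finite F \<and> F \<subseteq> T \<and> A' \<in> sets (PiM D (\<lambda>_. borel))
    \<and> (\<forall>z\<in>D \<rightarrow>\<^sub>E UNIV. \<forall>z'\<in>D \<rightarrow>\<^sub>E UNIV. (\<forall>s\<in>F. z s = z' s) \<longrightarrow> (z \<in> A' \<longleftrightarrow> z' \<in> A'))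
    \<and> (\<forall>b. measure (M b) (sym_diff (A i) A') < \<eta>)" for i F A'
  have "\<exists>F A'. P i F A'" for i unfolding P_def by (rule Union.IH[OF \<eta>])
  then obtain F A' where P: "\<And>i. P i (F i) (A' i)" by metis
  have A': "\<And>i. finite (F i)" "\<And>i. F i \<subseteq> T" "\<And>i. A' i \<in> sets (PiM D (\<lambda>_. borel))"
    "\<And>i. \<forall>z\<in>D \<rightarrow>\<^sub>E UNIV. \<forall>z'\<in>D \<rightarrow>\<^sub>E UNIV. (\<forall>s\<in>F i. z s = z' s) \<longrightarrow> (z \<in> A' i \<longleftrightarrow> z' \<in> A' i)"
    "\<And>i b. measure (M b) (sym_diff (A i) (A' i)) < \<eta>"
    using P unfolding P_def by blast+
  have "measure (M b) (sym_diff (\<Union>i. A i) (\<Union>i<n. A' i)) < \<epsilon>" for b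
  proof -
    interpret finite_measure "M b" by (rule M)
    have A'm: "A' i \<in> sets (M b)" for i using A'(3) by (simp add: sets_M)
    have "measure (M b) (sym_diff (\<Union>i. A i) (\<Union>i<n. A' i))
      \<le> measure (M b) (((\<Union>i. A i) - (\<Union>i<n. A i)) \<union> (\<Union>i<n. sym_diff (A i) (A' i)))"
      using Am A'm by (intro finite_measure_mono) auto
    also have "\<dots> \<le> measure (M b) ((\<Union>i. A i) - (\<Union>i<n. A i)) + measure (M b) (\<Union>i<n. sym_diff (A i) (A' i))"
      using Am A'm by (intro measure_Un_le) auto
    also have "measure (M b) (\<Union>i<n. sym_diff (A i) (A' i)) \<le> (\<Sum>i<n. measure (M b) (sym_diff (A i) (A' i)))"
      using Am A'm by (intro measure_UNION_le) auto
    also have "\<dots> \<le> (\<Sum>i<n. \<eta>)" using A'(5) by (intro sum_mono less_imp_le)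
    also have "\<dots> \<le> \<epsilon> / 2" using Union.prems by (simp add: \<eta>_def field_simps)
    finally show ?thesis using tail[of b] by linarith
  qed
  moreover have "z \<in> (\<Union>i<n. A' i) \<longleftrightarrow> z' \<in> (\<Union>i<n. A' i)"
    if z: "z \<in> D \<rightarrow>\<^sub>E UNIV" "z' \<in> D \<rightarrow>\<^sub>E UNIV" "\<forall>s\<in>(\<Union>i<n. F i). z s = z' s" for z z'
  proof -
    have "z \<in> A' i \<longleftrightarrow> z' \<in> A' i" if "i < n" for i
      by (rule A'(4)[rule_format, OF z(1,2)]) (use z(3) that in blast)
    then show ?thesis by blast
  qed
  moreover have "finite (\<Union>i<n. F i)" "(\<Union>i<n. F i) \<subseteq> T" "(\<Union>i<n. A' i) \<in> sets (PiM D (\<lambda>_. borel))"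
    using A'(1,2,3) by auto
  ultimately show ?case
    by (intro exI[of _ "\<Union>i<n. F i"] exI[of _ "\<Union>i<n. A' i"] conjI ballI allI impI)
qed

section \<open>Triangular systems and the whitened trace\<close>

context
  fixes e :: "nat \<Rightarrow> nat \<Rightarrow> real"
  assumes tri: "\<And>j k. j < k \<Longrightarrow> e j k = 0" and diag: "\<And>j. e j j \<noteq> 0"
begin

text \<open>Whitening: when \<open>e\<close> is a Cholesky factor of the covariance of W, this is
  the vector that \<open>e\<close> maps to \<open>f\<close>. The recursive equation may unfold
  without end at a symbolic index, so it is removed from the simplifier.\<close>

fun forward_solve :: "(nat \<Rightarrow> real) \<Rightarrow> nat \<Rightarrow> real" where
  "forward_solve f k = (f k - (\<Sum>m<k. e k m * forward_solve f m)) / e k k"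

declare forward_solve.simps [simp del]

lemma forward_solve: "(\<Sum>k\<le>j. e j k * forward_solve f k) = f j"
proof -
  have "(\<Sum>k\<le>j. e j k * forward_solve f k) = (\<Sum>k<j. e j k * forward_solve f k) + e j j * forward_solve f j"
    by (simp add: lessThan_Suc_atMost[symmetric])
  also have "e j j * forward_solve f j = f j - (\<Sum>k<j. e j k * forward_solve f k)"
    using diag[of j] by (subst forward_solve.simps) simp
  finally show ?thesis by simp
qed

lemma forward_solve_unique:
  assumes "\<And>j. j \<le> n \<Longrightarrow> (\<Sum>k\<le>j. e j k * y k) = f j" and "k \<le> n"
  shows "forward_solve f k = y k"
  using assms(2)
proof (induction k rule: less_induct)
  case (less k)
  have "f k = (\<Sum>m\<le>k. e k m * y m)" using assms(1) less.prems by simp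
  also have "\<dots> = (\<Sum>m<k. e k m * y m) + e k k * y k" by (simp add: lessThan_Suc_atMost[symmetric])
  also have "(\<Sum>m<k. e k m * y m) = (\<Sum>m<k. e k m * forward_solve f m)"
    using less by (intro sum.cong refl) simp
  finally show ?case using diag[of k] by (subst forward_solve.simps) simp
qed

text \<open>The entries of the inverse of the lower triangular matrix \<open>e\<close>.\<close>

definition dual_coeff :: "nat \<Rightarrow> nat \<Rightarrow> real" where
  "dual_coeff k i = forward_solve (\<lambda>j. if j = i then 1 else 0) k"

lemma forward_solve_linear:
  assumes "k \<le> n"
  shows "forward_solve f k = (\<Sum>i\<le>n. dual_coeff k i * f i)"
proof (rule forward_solve_unique[OF _ assms])
  fix j assume j: "j \<le> n"
  have "(\<Sum>k\<le>j. e j k * (\<Sum>i\<le>n. dual_coeff k i * f i)) = (\<Sum>k\<le>j. \<Sum>i\<le>n. f i * (e j k * dual_coeff k i))"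
    by (simp add: sum_distrib_left mult_ac)
  also have "\<dots> = (\<Sum>i\<le>n. f i * (\<Sum>k\<le>j. e j k * dual_coeff k i))"
    by (subst sum.swap) (simp add: sum_distrib_left)
  also have "\<dots> = (\<Sum>i\<le>n. f i * (if j = i then 1 else 0))"
    unfolding dual_coeff_def forward_solve ..
  also have "\<dots> = f j" using j by (simp add: if_distrib cong: if_cong)
  finally show "(\<Sum>k\<le>j. e j k * (\<Sum>i\<le>n. dual_coeff k i * f i)) = f j" .
qed

lemma dual_coeff_biorthogonal:
  assumes "k \<le> n" "m \<le> n"
  shows "(\<Sum>i\<le>n. dual_coeff k i * e i m) = (if k = m then 1 else 0)"
proof -
  have "(\<Sum>i\<le>n. dual_coeff k i * e i m) = forward_solve (\<lambda>i. e i m) k" by (rule forward_solve_linear[OF assms(1), symmetric])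
  also have "\<dots> = (if k = m then 1 else 0)"
  proof (rule forward_solve_unique[OF _ assms(1)])
    fix j show "(\<Sum>k\<le>j. e j k * (if k = m then 1 else 0)) = e j m"
      using tri[of j m] by (simp add: if_distrib cong: if_cong)
  qed
  finally show ?thesis .
qed

text \<open>Duality. The hypothesis bounds the functional \<open>f\<close> by the norm that
  \<open>e\<close> induces. Testing it with the \<open>c\<close> that the transpose of
  \<open>e\<close> maps to the solution gives \<open>S * S \<le> B * S\<close>, where
  \<open>S\<close> is the squared norm of the solution.\<close>

lemma forward_solve_norm_bound:
  assumes B: "\<And>c. (\<Sum>i\<le>n. c i * f i)\<^sup>2 \<le> B * (\<Sum>m\<le>n. (\<Sum>i\<le>n. c i * e i m)\<^sup>2)" and B0: "0 \<le> B"
  shows "(\<Sum>k\<le>n. (forward_solve f k)\<^sup>2) \<le> B"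
proof -
  let ?y = "forward_solve f"
  define c where "c i = (\<Sum>k\<le>n. ?y k * dual_coeff k i)" for i
  define S where "S = (\<Sum>k\<le>n. (?y k)\<^sup>2)"
  have c: "(\<Sum>i\<le>n. c i * g i) = (\<Sum>k\<le>n. ?y k * (\<Sum>i\<le>n. dual_coeff k i * g i))" for g
    unfolding c_def sum_distrib_left sum_distrib_right by (subst sum.swap) (simp add: mult_ac)
  have "(\<Sum>i\<le>n. c i * f i) = S"
    unfolding c S_def power2_eq_square by (intro sum.cong refl) (simp add: forward_solve_linear)
  moreover have "(\<Sum>i\<le>n. c i * e i m) = ?y m" if "m \<le> n" for m
  proof -
    have "(\<Sum>i\<le>n. c i * e i m) = (\<Sum>k\<le>n. ?y k * (if k = m then 1 else 0))"
      unfolding c using that by (intro sum.cong refl) (simp add: dual_coeff_biorthogonal)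
    also have "\<dots> = ?y m" using that by (simp add: if_distrib cong: if_cong)
    finally show ?thesis .
  qed
  ultimately have "S * S \<le> B * S" using B[of c] by (simp add: S_def power2_eq_square)
  moreover have "0 \<le> S" unfolding S_def by (intro sum_nonneg) auto
  ultimately show ?thesis using B0 unfolding S_def[symmetric] by (cases "S = 0") auto
qed

end

text \<open>The matrix \<open>G\<close> is the inverse of the covariance matrix of W, written
  through the inverse of its Cholesky factor. \<open>forward_solve_norm_bound\<close> turns the
  Polya type bound into a bound on its cosine forms with exponent \<open>1 + \<delta>W\<close>, and
  \<open>cauchy_kernel_trace\<close> applies with this exponent since it is below
  \<open>\<delta>X\<close>. \<open>B\<close> is chosen before \<open>e\<close> and \<open>n\<close>,
  so it is uniform over finite sets of points.\<close>

lemma whitened_trace_bound: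
  assumes \<delta>: "0 < \<delta>W" "\<delta>W < 1" "0 < \<kappa>" "1 + \<delta>W < \<delta>X" "\<delta>X < 2" and t: "inj t" "\<And>i j. \<bar>t i - t j\<bar> \<le> R"
  shows "\<exists>B\<ge>0. \<forall>e n. (\<forall>j k. j < k \<longrightarrow> e j k = 0) \<and> (\<forall>j. e j j \<noteq> 0)
      \<and> (\<forall>i j. cauchy_profile \<delta>W \<kappa> \<bar>t i - t j\<bar> = (\<Sum>m\<le>max i j. e i m * e j m)) \<longrightarrow>
    (\<Sum>k\<le>n. \<Sum>i\<le>n. \<Sum>j\<le>n. dual_coeff e k i * dual_coeff e k j * cauchy_profile \<delta>X 1 \<bar>t i - t j\<bar>) \<le> B"
proof -
  let ?KW = "\<lambda>i j. cauchy_profile \<delta>W \<kappa> \<bar>t i - t j\<bar>"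
  obtain C where C: "0 < C" "\<And>S c \<omega> \<theta>. finite S \<Longrightarrow> (\<forall>s\<in>S. \<forall>u\<in>S. \<bar>s - u\<bar> \<le> max 1 R) \<Longrightarrow>
      (\<Sum>s\<in>S. c s * cos (\<omega> * s + \<theta>))\<^sup>2 \<le> C * (max 1 \<bar>\<omega>\<bar>) powr (1 + \<delta>W) * (\<Sum>s\<in>S. \<Sum>u\<in>S. c s * c u * cauchy_profile \<delta>W \<kappa> \<bar>s - u\<bar>)"
    using cauchy_profile_quadratic_form[OF \<delta>(1,2,3), of "max 1 R"] by force
  \<comment> \<open>The factor is \<open>2 * C\<close> because the cosine of a difference splits
    into a cosine form and a sine form, and the sine is a cosine with phase
    \<open>- (pi / 2)\<close>.\<close>
  define B where "B = (2 * C) * (5 + 32 / (1 - 2 powr ((1 + \<delta>W) - \<delta>X)))"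
  have "2 powr (1 + \<delta>W - \<delta>X) < 1" using \<delta> powr_less_one[of 2 "1 + \<delta>W - \<delta>X"] by simp
  then have B0: "0 \<le> B" using C(1) by (simp add: B_def)
  moreover have "(\<Sum>k\<le>n. \<Sum>i\<le>n. \<Sum>j\<le>n. dual_coeff e k i * dual_coeff e k j * cauchy_profile \<delta>X 1 \<bar>t i - t j\<bar>) \<le> B"
    if e: "\<forall>j k. j < k \<longrightarrow> e j k = 0" "\<forall>j. e j j \<noteq> 0" "\<forall>i j. ?KW i j = (\<Sum>m\<le>max i j. e i m * e j m)" for e n
  proof -
    note e1 = e(1)[rule_format] and e2 = e(2)[rule_format]
    let ?a = "dual_coeff e"
    have KWe: "?KW i j = (\<Sum>m\<le>n. e i m * e j m)" if "i \<le> n" "j \<le> n" for i j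
      unfolding e(3)[rule_format] using that e1 by (intro sum.mono_neutral_left) auto
    have QW: "(\<Sum>m\<le>n. (\<Sum>i\<le>n. c i * e i m)\<^sup>2) = (\<Sum>i\<le>n. \<Sum>j\<le>n. c i * c j * ?KW i j)" for c
    proof -
      have "(\<Sum>m\<le>n. (\<Sum>i\<le>n. c i * e i m)\<^sup>2) = (\<Sum>m\<le>n. \<Sum>i\<le>n. \<Sum>j\<le>n. c i * c j * (e i m * e j m))"
        by (simp add: power2_eq_square sum_product mult_ac)
      also have "\<dots> = (\<Sum>i\<le>n. \<Sum>m\<le>n. \<Sum>j\<le>n. c i * c j * (e i m * e j m))" by (rule sum.swap)
      also have "\<dots> = (\<Sum>i\<le>n. \<Sum>j\<le>n. \<Sum>m\<le>n. c i * c j * (e i m * e j m))" by (intro sum.cong refl sum.swap)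
      also have "\<dots> = (\<Sum>i\<le>n. \<Sum>j\<le>n. c i * c j * ?KW i j)"
        by (intro sum.cong refl) (simp add: KWe sum_distrib_left)
      finally show ?thesis .
    qed
    have trig: "(\<Sum>k\<le>n. (\<Sum>i\<le>n. ?a k i * cos (\<omega> * t i + \<theta>))\<^sup>2) \<le> C * (max 1 \<bar>\<omega>\<bar>) powr (1 + \<delta>W)" for \<omega> \<theta>
    proof -
      have "(\<Sum>k\<le>n. (forward_solve e (\<lambda>i. cos (\<omega> * t i + \<theta>)) k)\<^sup>2) \<le> C * (max 1 \<bar>\<omega>\<bar>) powr (1 + \<delta>W)"
      proof (rule forward_solve_norm_bound[OF e1 e2])
        fix c :: "nat \<Rightarrow> real"
        define c' where "c' s = c (inv t s)" for s
        have c': "c' (t i) = c i" for i using t(1) by (simp add: c'_def)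
        have inj: "inj_on t {..n}" using t(1) by (rule inj_on_subset) simp
        have "(\<Sum>s\<in>t ` {..n}. c' s * cos (\<omega> * s + \<theta>))\<^sup>2
          \<le> C * (max 1 \<bar>\<omega>\<bar>) powr (1 + \<delta>W) * (\<Sum>s\<in>t ` {..n}. \<Sum>u\<in>t ` {..n}. c' s * c' u * cauchy_profile \<delta>W \<kappa> \<bar>s - u\<bar>)"
          by (rule C(2)) (use t(2) in \<open>auto simp: le_max_iff_disj\<close>)
        then show "(\<Sum>i\<le>n. c i * cos (\<omega> * t i + \<theta>))\<^sup>2 \<le> C * (max 1 \<bar>\<omega>\<bar>) powr (1 + \<delta>W) * (\<Sum>m\<le>n. (\<Sum>i\<le>n. c i * e i m)\<^sup>2)"
          unfolding QW sum.reindex[OF inj] by (simp add: c')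
      qed (use C(1) in auto)
      moreover have "forward_solve e (\<lambda>i. cos (\<omega> * t i + \<theta>)) k = (\<Sum>i\<le>n. ?a k i * cos (\<omega> * t i + \<theta>))" if "k \<le> n" for k
        by (rule forward_solve_linear[OF e1 e2 that])
      ultimately show ?thesis by simp
    qed
    define G where "G i j = (\<Sum>k\<le>n. ?a k i * ?a k j)" for i j
    have G: "(\<Sum>i\<le>n. \<Sum>j\<le>n. G i j * g i j) = (\<Sum>k\<le>n. \<Sum>i\<le>n. \<Sum>j\<le>n. ?a k i * ?a k j * g i j)" for g
    proof -
      have "(\<Sum>i\<le>n. \<Sum>j\<le>n. G i j * g i j) = (\<Sum>i\<le>n. \<Sum>j\<le>n. \<Sum>k\<le>n. ?a k i * ?a k j * g i j)"
        by (simp add: G_def sum_distrib_right)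
      also have "\<dots> = (\<Sum>i\<le>n. \<Sum>k\<le>n. \<Sum>j\<le>n. ?a k i * ?a k j * g i j)" by (intro sum.cong refl sum.swap)
      also have "\<dots> = (\<Sum>k\<le>n. \<Sum>i\<le>n. \<Sum>j\<le>n. ?a k i * ?a k j * g i j)" by (rule sum.swap)
      finally show ?thesis .
    qed
    have Gc: "(\<Sum>i\<le>n. \<Sum>j\<le>n. G i j * cos (\<omega> * (t i - t j)))
       = (\<Sum>k\<le>n. (\<Sum>i\<le>n. ?a k i * cos (\<omega> * t i))\<^sup>2) + (\<Sum>k\<le>n. (\<Sum>i\<le>n. ?a k i * sin (\<omega> * t i))\<^sup>2)" for \<omega>
      unfolding G sum_cos_difference sum.distrib ..
    have sn: "(\<Sum>k\<le>n. (\<Sum>i\<le>n. ?a k i * sin (\<omega> * t i))\<^sup>2) = (\<Sum>k\<le>n. (\<Sum>i\<le>n. ?a k i * cos (\<omega> * t i + (- (pi / 2))))\<^sup>2)" for \<omega>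
      by (simp add: cos_diff)
    have "(\<Sum>i\<le>n. \<Sum>j\<le>n. G i j * (1 / (1 + \<bar>t i - t j\<bar> powr \<delta>X))) \<le> B"
      unfolding B_def
    proof (rule cauchy_kernel_trace(2))
      fix \<omega>
      show "0 \<le> (\<Sum>i\<le>n. \<Sum>j\<le>n. G i j * cos (\<omega> * (t i - t j)))" unfolding Gc by (intro add_nonneg_nonneg sum_nonneg) auto
      show "(\<Sum>i\<le>n. \<Sum>j\<le>n. G i j * cos (\<omega> * (t i - t j))) \<le> 2 * C * max 1 \<bar>\<omega>\<bar> powr (1 + \<delta>W)"
        unfolding Gc sn using trig[of \<omega> 0] trig[of \<omega> "- (pi/2)"] by simp
    qed (use \<delta> in auto)
    moreover have "cauchy_profile \<delta>X 1 y = 1 / (1 + y powr \<delta>X)" for y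
      using one_plus_powr_pos[of y \<delta>X] by (simp add: cauchy_profile_def powr_minus inverse_eq_divide)
    ultimately show ?thesis unfolding G by simp
  qed
  ultimately show ?thesis by blast
qed

section \<open>A pair of independent fields as a member of the model\<close>

lemma gaussian_variable_distr:
  assumes \<Phi> [measurable]: "\<Phi> \<in> measurable M N" and Z [measurable]: "Z \<in> borel_measurable N"
    and g: "gaussian_variable M (\<lambda>\<omega>. Z (\<Phi> \<omega>))"
  shows "gaussian_variable (distr M N \<Phi>) Z"
proof -
  have "distr (distr M N \<Phi>) lborel Z = distr M lborel (\<lambda>\<omega>. Z (\<Phi> \<omega>))"
    by (subst distr_distr) (auto simp: comp_def)
  moreover have "(AE \<omega> in distr M N \<Phi>. Z \<omega> = \<mu>) \<longleftrightarrow> (AE \<omega> in M. Z (\<Phi> \<omega>) = \<mu>)" for \<mu>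
    by (rule AE_distr_iff) measurable
  ultimately show ?thesis using g by (auto simp: gaussian_variable_def distributed_def)
qed

lemma gauss_series_moments:
  assumes K: "\<And>i j. (\<lambda>k. e i k * e j k) sums K i j"
  shows "(\<integral>\<xi>. gauss_series (e i) \<xi> \<partial>gauss_seq) = 0"
    "(\<integral>\<xi>. gauss_series (e i) \<xi> * gauss_series (e j) \<xi> \<partial>gauss_seq) = K i j"
proof -
  have one: "integrable gauss_seq (\<lambda>\<xi>. (gauss_series (e i) \<xi>)\<^sup>2)" "(\<integral>\<xi>. gauss_series (e i) \<xi> \<partial>gauss_seq) = 0"
    "(\<integral>\<xi>. (gauss_series (e i) \<xi>)\<^sup>2 \<partial>gauss_seq) = K i i" for i
    using gauss_process(2-4)[where e=e and K=K and J="{i}" and a="\<lambda>_. 1", OF K] by simp_all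
  show "(\<integral>\<xi>. gauss_series (e i) \<xi> \<partial>gauss_seq) = 0" by (rule one)
  show "(\<integral>\<xi>. gauss_series (e i) \<xi> * gauss_series (e j) \<xi> \<partial>gauss_seq) = K i j"
  proof (cases "i = j")
    case True
    then show ?thesis using one(3)[of i] by (simp add: power2_eq_square)
  next
    case False
    have sym: "K j i = K i j" using K[of i j] sums_unique2[OF K[of j i]] by (simp add: mult.commute)
    have two: "integrable gauss_seq (\<lambda>\<xi>. (gauss_series (e i) \<xi> + gauss_series (e j) \<xi>)\<^sup>2)"
      "(\<integral>\<xi>. (gauss_series (e i) \<xi> + gauss_series (e j) \<xi>)\<^sup>2 \<partial>gauss_seq) = K i i + 2 * K i j + K j j"
      using gauss_process(2,4)[where e=e and K=K and J="{i, j}" and a="\<lambda>_. 1", OF K] False sym by simp_all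
    have p: "gauss_series (e i) \<xi> * gauss_series (e j) \<xi>
        = ((gauss_series (e i) \<xi> + gauss_series (e j) \<xi>)\<^sup>2 - (gauss_series (e i) \<xi>)\<^sup>2 - (gauss_series (e j) \<xi>)\<^sup>2) / 2" for \<xi>
      by (simp add: power2_eq_square algebra_simps)
    show ?thesis unfolding p by (simp add: two one(1,3))
  qed
qed

definition gauss_pair :: "('a \<Rightarrow> nat \<Rightarrow> real) \<Rightarrow> ('a \<Rightarrow> nat \<Rightarrow> real) \<Rightarrow> (nat \<Rightarrow> real) \<Rightarrow> 'a \<Rightarrow> real \<times> real" where
  "gauss_pair u v \<xi> s = (gauss_series (u s) \<xi>, gauss_series (v s) \<xi>)"

lemma gauss_pair_measurable [measurable]: "gauss_pair u v \<in> measurable gauss_seq (PiM UNIV (\<lambda>_. borel))"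
proof (rule measurable_PiM_single')
  fix s show "(\<lambda>\<xi>. gauss_pair u v \<xi> s) \<in> borel_measurable gauss_seq"
    unfolding gauss_pair_def by (rule borel_measurable_Pair) auto
qed (auto simp: space_PiM)

text \<open>Made for the cross-covariance of independent fields. The exponent 3 is not an even
  integer and exceeds every \<open>\<delta>X < 2\<close>; the constant of the expansion is
  0.\<close>

lemma smooth_1d_zero: "smooth_1d 3 (\<lambda>t. 0)"
  unfolding smooth_1d_def
proof (intro conjI)
  show "\<nexists>m::int. (3::real) = 2 * of_int m"
  proof
    assume "\<exists>m::int. (3::real) = 2 * of_int m"
    then obtain m :: int where "real_of_int 3 = real_of_int (2 * m)" by auto
    then show False unfolding of_int_eq_iff by presburger
  qed
  show "\<exists>L A B. 0 < L \<and> (\<forall>t\<in>{-L..L}. (0::real) = A t + B t) \<and>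
        (\<forall>t\<in>{-L..L}. A (- t) = A t) \<and> real_analytic_on A {-L..L} \<and>
        (\<forall>t\<in>{-L..L}. B (- t) = B t) \<and> continuous_on {-L..L} B \<and>
        (\<exists>c D. (\<forall>t\<in>{0<..L}. D 0 t = B t) \<and>
           (\<forall>k. \<forall>t\<in>{0<..L}.
              (D k has_real_derivative D (Suc k) t) (at t within {0<..L})) \<and>
           (\<forall>k. (\<lambda>t. D k t - falling 3 k * c * t powr (3 - real k))
                  \<in> o[at_right 0](\<lambda>t. t powr (3 - real k))))"
  proof (rule exI[of _ 1], rule exI[of _ "\<lambda>_. 0"], rule exI[of _ "\<lambda>_. 0"], intro conjI)
    show "real_analytic_on (\<lambda>_. 0) {-1..1}"
      unfolding real_analytic_on_def by (intro ballI exI[of _ "\<lambda>_. 0"] exI[of _ 1]) auto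
    show "\<exists>c D. (\<forall>t\<in>{0<..1}. D 0 t = 0) \<and>
           (\<forall>k. \<forall>t\<in>{0<..1}. (D k has_real_derivative D (Suc k) t) (at t within {0<..1})) \<and>
           (\<forall>k. (\<lambda>t. D k t - falling 3 k * c * t powr (3 - real k)) \<in> o[at_right 0](\<lambda>t. t powr (3 - real k)))"
      by (rule exI[of _ 0], rule exI[of _ "\<lambda>_ _. 0"]) auto
  qed auto
qed simp

text \<open>X and W are read from disjoint sets of coordinates, which \<open>UV\<close> expresses,
  so all cross-covariances vanish. The pair is treated as one Gaussian family, indexed by points
  together with a truth value that tells X from W.\<close>

lemma gauss_pair_law:
  fixes u v :: "'a::euclidean_space \<Rightarrow> nat \<Rightarrow> real"
  assumes dim: "DIM('a) = 1" and \<delta>: "0 < \<delta>X" "\<delta>X < 2" "0 < \<delta>W" "\<delta>W < 2"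
    and \<kappa>: "0 < \<kappa>X" "1 < \<delta>X * \<kappa>X" "0 < \<kappa>W" "1 < \<delta>W * \<kappa>W"
    and U: "\<And>s s'. (\<lambda>k. u s k * u s' k) sums generalized_cauchy 1 1 \<delta>X \<kappa>X (s - s')"
    and V: "\<And>s s'. (\<lambda>k. v s k * v s' k) sums generalized_cauchy 1 1 \<delta>W \<kappa>W (s - s')"
    and UV: "\<And>s s' k. u s k * v s' k = 0"
    and posU: "\<And>(S :: 'a set) a. finite S \<Longrightarrow> \<exists>s\<in>S. a s \<noteq> 0 \<Longrightarrow> 0 < (\<Sum>s\<in>S. \<Sum>s'\<in>S. a s * a s' * generalized_cauchy 1 1 \<delta>X \<kappa>X (s - s'))"
    and posV: "\<And>(S :: 'a set) a. finite S \<Longrightarrow> \<exists>s\<in>S. a s \<noteq> 0 \<Longrightarrow> 0 < (\<Sum>s\<in>S. \<Sum>s'\<in>S. a s * a s' * generalized_cauchy 1 1 \<delta>W \<kappa>W (s - s'))"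
  shows "distr gauss_seq (PiM UNIV (\<lambda>_. borel)) (gauss_pair u v) \<in> model_laws \<delta>X \<delta>W"
proof -
  let ?KX = "\<lambda>s s' :: 'a. generalized_cauchy 1 1 \<delta>X \<kappa>X (s - s')" and ?KW = "\<lambda>s s' :: 'a. generalized_cauchy 1 1 \<delta>W \<kappa>W (s - s')"
  let ?P = "distr gauss_seq (PiM UNIV (\<lambda>_. borel)) (gauss_pair u v)"
  let ?X = "\<lambda>(s::'a) \<omega>. fst (\<omega> s :: real \<times> real)" and ?W = "\<lambda>(s::'a) \<omega>. snd (\<omega> s :: real \<times> real)"
  define e where "e = (\<lambda>(b, s). if b then u s else v s)"
  define K where "K = (\<lambda>(b, s) (b', s'). if b = b' then (if b then ?KX s s' else ?KW s s') else 0)"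
  have K: "(\<lambda>k. e i k * e j k) sums K i j" for i j
  proof -
    obtain b s b' s' where ij: "i = (b, s)" "j = (b', s')" by (cases i, cases j)
    have VU: "v s k * u s' k = 0" for k using UV[of s' k s] by (simp add: mult.commute)
    show ?thesis unfolding ij e_def K_def by (cases b; cases b') (simp_all add: U V UV VU)
  qed
  have m [measurable]: "?X s \<in> borel_measurable (PiM UNIV (\<lambda>_. borel))" "?W s \<in> borel_measurable (PiM UNIV (\<lambda>_. borel))" for s :: 'a
  proof -
    have c: "(\<lambda>\<omega>. \<omega> s :: real \<times> real) \<in> borel_measurable (PiM UNIV (\<lambda>_. borel))"
      by (rule measurable_component_singleton) simp
    show "?X s \<in> borel_measurable (PiM UNIV (\<lambda>_. borel))" "?W s \<in> borel_measurable (PiM UNIV (\<lambda>_. borel))"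
      using measurable_compose[OF c measurable_fst_borel] measurable_compose[OF c measurable_snd_borel] by simp_all
  qed
  have mean: "(\<integral>\<omega>. ?X s \<omega> \<partial>?P) = 0" "(\<integral>\<omega>. ?W s \<omega> \<partial>?P) = 0" for s
    using gauss_series_moments(1)[where e=e and K=K, OF K, of "(True, s)"] gauss_series_moments(1)[where e=e and K=K, OF K, of "(False, s)"]
    by (simp_all add: integral_distr gauss_pair_def e_def)
  have cov: "covariance ?P (?X s) (?X s') = ?KX s s'" "covariance ?P (?W s) (?W s') = ?KW s s'"
    "covariance ?P (?X s) (?W s') = 0" "covariance ?P (?W s) (?X s') = 0" for s s'
    unfolding covariance_def mean
    using gauss_series_moments(2)[where e=e and K=K, OF K, of "(True, s)" "(True, s')"] gauss_series_moments(2)[where e=e and K=K, OF K, of "(False, s)" "(False, s')"]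
      gauss_series_moments(2)[where e=e and K=K, OF K, of "(True, s)" "(False, s')"] gauss_series_moments(2)[where e=e and K=K, OF K, of "(False, s)" "(True, s')"]
    by (simp_all add: integral_distr gauss_pair_def e_def K_def)
  have "bivariate_gaussian_field ?P ?X ?W"
    unfolding bivariate_gaussian_field_def
  proof (intro allI impI gaussian_variable_distr[OF gauss_pair_measurable])
    fix S :: "'a set" and a b :: "'a \<Rightarrow> real" assume S: "finite S"
    show "(\<lambda>\<omega>. \<Sum>s\<in>S. a s * ?X s \<omega> + b s * ?W s \<omega>) \<in> borel_measurable (PiM UNIV (\<lambda>_. borel))" by measurable
    have "(\<Sum>s\<in>S. a s * ?X s (gauss_pair u v \<xi>) + b s * ?W s (gauss_pair u v \<xi>))
       = (\<Sum>j\<in>UNIV \<times> S. (if fst j then a (snd j) else b (snd j)) * gauss_series (e j) \<xi>)" for \<xi>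
      unfolding sum.cartesian_product[symmetric, of "\<lambda>c s. (if c then a s else b s) * gauss_series (e (c, s)) \<xi>", unfolded split_beta' prod.collapse]
      by (simp add: UNIV_bool gauss_pair_def e_def sum.distrib add.commute)
    then show "gaussian_variable gauss_seq (\<lambda>\<xi>. \<Sum>s\<in>S. a s * ?X s (gauss_pair u v \<xi>) + b s * ?W s (gauss_pair u v \<xi>))"
      using gauss_process(1)[where e=e and K=K and J="UNIV \<times> S", OF K] S by simp
  qed
  moreover have "nondegenerate_field ?P ?X ?W"
    unfolding nondegenerate_field_def cov
  proof (intro allI impI, elim conjE)
    fix S :: "'a set" and a b :: "'a \<Rightarrow> real" assume S: "finite S" and nz: "\<exists>s\<in>S. a s \<noteq> 0 \<or> b s \<noteq> 0"
    have z: "(\<Sum>s\<in>S. \<Sum>s'\<in>S. c s * c s' * k s s') = 0" if "\<not> (\<exists>s\<in>S. c s \<noteq> 0)" for c :: "'a \<Rightarrow> real" and k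
      using that by (intro sum.neutral ballI) auto
    let ?A = "\<Sum>s\<in>S. \<Sum>s'\<in>S. a s * a s' * ?KX s s'" and ?B = "\<Sum>s\<in>S. \<Sum>s'\<in>S. b s * b s' * ?KW s s'"
    have "(\<exists>s\<in>S. a s \<noteq> 0) \<and> 0 < ?A \<or> \<not> (\<exists>s\<in>S. a s \<noteq> 0) \<and> ?A = 0" using posU[OF S, of a] z[of a ?KX] by blast
    moreover have "(\<exists>s\<in>S. b s \<noteq> 0) \<and> 0 < ?B \<or> \<not> (\<exists>s\<in>S. b s \<noteq> 0) \<and> ?B = 0" using posV[OF S, of b] z[of b ?KW] by blast
    ultimately have "0 < ?A + ?B" using nz by (elim disjE conjE) (auto intro: add_pos_pos)
    then show "0 < (\<Sum>s\<in>S. \<Sum>s'\<in>S. a s * a s' * ?KX s s' + a s * b s' * 0 + b s * a s' * 0 + b s * b s' * ?KW s s')"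
      by (simp add: sum.distrib)
  qed
  moreover have "stationary_field ?P ?X ?W"
    unfolding stationary_field_def cov mean by simp
  moreover have "has_generalized_cauchy_covariance ?P ?X \<delta>X \<kappa>X" "has_generalized_cauchy_covariance ?P ?W \<delta>W \<kappa>W"
    unfolding has_generalized_cauchy_covariance_def cov using \<delta> \<kappa> by (auto intro!: exI[of _ 1])
  moreover have "smooth_cross_covariance 3 (\<lambda>s. covariance ?P (?X s) (?W 0)) (\<lambda>s. covariance ?P (?W s) (?X 0))"
    unfolding smooth_cross_covariance_def cov using dim smooth_1d_zero by simp
  ultimately have "admissible_field \<delta>X \<delta>W ?P ?X ?W"
    unfolding admissible_field_def using dim \<kappa> \<delta> by (intro conjI exI[of _ \<kappa>X] exI[of _ \<kappa>W] exI[of _ 3]) auto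
  then show ?thesis
    unfolding model_laws_def using gauss_seq.prob_space_distr[OF gauss_pair_measurable] by simp
qed

lemma cauchy_profile_dense:
  assumes "0 < \<delta>" "0 < \<epsilon>"
  shows "\<exists>j. cauchy_profile \<delta> \<kappa> \<bar>s - s\<bar> - 2 * cauchy_profile \<delta> \<kappa> \<bar>s - of_rat (nat_to_rat_surj j)\<bar>
      + cauchy_profile \<delta> \<kappa> \<bar>of_rat (nat_to_rat_surj j) - of_rat (nat_to_rat_surj j)\<bar> < \<epsilon>"
proof -
  have "((\<lambda>t. \<bar>t\<bar> powr \<delta>) \<longlongrightarrow> 0) (at (0::real))"
    using assms by (intro tendsto_zero_powrI[where b=\<delta>] tendsto_rabs_zero tendsto_ident_at tendsto_const) auto
  then have "((\<lambda>t. cauchy_profile \<delta> \<kappa> \<bar>t\<bar>) \<longlongrightarrow> (1 + 0) powr (- \<kappa>)) (at 0)"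
    unfolding cauchy_profile_def by (intro tendsto_powr tendsto_add tendsto_const) auto
  then have "\<forall>\<^sub>F t in at 0. 1 - \<epsilon> / 2 < cauchy_profile \<delta> \<kappa> \<bar>t\<bar>"
    using assms(2) by (intro order_tendstoD(1)) auto
  then obtain d where d: "0 < d" "\<And>t. t \<noteq> 0 \<Longrightarrow> \<bar>t\<bar> < d \<Longrightarrow> 1 - \<epsilon> / 2 < cauchy_profile \<delta> \<kappa> \<bar>t\<bar>"
    unfolding eventually_at by (auto simp: dist_real_def)
  obtain q where q: "s < of_rat q" "of_rat q < s + d" using of_rat_dense[of s "s + d"] d(1) by auto
  obtain j where j: "q = nat_to_rat_surj j" using surj_nat_to_rat_surj by (metis surjD)
  have "1 - \<epsilon> / 2 < cauchy_profile \<delta> \<kappa> \<bar>s - of_rat q\<bar>" using q by (intro d(2)) auto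
  then show ?thesis unfolding j using assms(1) by (intro exI[of _ j]) (simp add: cauchy_profile_0)
qed

lemma cauchy_profile_strict:
  fixes S :: "real set"
  assumes "0 < \<delta>" "\<delta> < 1" "0 < \<kappa>" and S: "finite S" "\<exists>s\<in>S. c s \<noteq> 0"
  shows "0 < (\<Sum>s\<in>S. \<Sum>u\<in>S. c s * c u * cauchy_profile \<delta> \<kappa> \<bar>s - u\<bar>)"
proof -
  obtain R where R: "\<And>s. s \<in> S \<Longrightarrow> \<bar>s\<bar> \<le> R" using finite_imp_bounded[OF S(1)] by (auto simp: bounded_iff)
  have "\<forall>s\<in>S. \<forall>u\<in>S. \<bar>s - u\<bar> \<le> max 1 (2 * R)"
  proof (intro ballI)
    fix s u assume "s \<in> S" "u \<in> S"
    then show "\<bar>s - u\<bar> \<le> max 1 (2 * R)" using R[of s] R[of u] by linarith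
  qed
  moreover have "(1::real) \<le> max 1 (2 * R)" by simp
  ultimately show ?thesis using cauchy_profile_quadratic_form[OF assms(1-3), of "max 1 (2 * R)"] S by meson
qed

text \<open>Coordinates are allotted modulo 4: odd ones to X, multiples of 4 to the triangular part
  of W along \<open>t\<close>, and the class of 2 to the remainder of W, which vanishes at the
  points of \<open>t\<close>. At these points W is thus a finite sum over coordinates that X never
  reads.\<close>

lemma cauchy_pair_factorization:
  fixes t :: "nat \<Rightarrow> real"
  assumes \<delta>: "0 < \<delta>W" "\<delta>W < 1" "0 < \<kappa>" "0 < \<delta>X" "\<delta>X < 2" and t: "inj t"
  obtains u v :: "real \<Rightarrow> nat \<Rightarrow> real" and e :: "nat \<Rightarrow> nat \<Rightarrow> real"
  where "\<And>x y. (\<lambda>k. u x k * u y k) sums cauchy_profile \<delta>X 1 \<bar>x - y\<bar>"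
    "\<And>x y. (\<lambda>k. v x k * v y k) sums cauchy_profile \<delta>W \<kappa> \<bar>x - y\<bar>"
    "\<And>x y k. u x k * v y k = 0" "\<And>x k. u x (4 * k) = 0"
    "\<And>j k. j < k \<Longrightarrow> e j k = 0" "\<And>j. 0 < e j j"
    "\<And>j k. v (t j) k = (if 4 dvd k then e j (k div 4) else 0)"
    "\<And>i j. cauchy_profile \<delta>W \<kappa> \<bar>t i - t j\<bar> = (\<Sum>m\<le>max i j. e i m * e j m)"
proof -
  let ?KX = "\<lambda>x y. cauchy_profile \<delta>X 1 \<bar>x - y\<bar>" and ?KW = "\<lambda>x y. cauchy_profile \<delta>W \<kappa> \<bar>x - y\<bar>"
  let ?r = "\<lambda>j. real_of_rat (nat_to_rat_surj j)"
  have psdW: "psd_kernel ?KW"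
    unfolding psd_kernel_def
  proof (intro conjI allI impI)
    fix s t :: real show "?KW s t = ?KW t s" by (simp add: abs_minus_commute)
  next
    fix S :: "real set" and c :: "real \<Rightarrow> real" assume S: "finite S"
    show "0 \<le> (\<Sum>s\<in>S. \<Sum>t\<in>S. c s * c t * ?KW s t)"
    proof (cases "\<exists>s\<in>S. c s \<noteq> 0")
      case True
      then show ?thesis using cauchy_profile_strict[OF \<delta>(1-3) S, of c] by simp
    next
      case False
      then have "(\<Sum>s\<in>S. \<Sum>t\<in>S. c s * c t * ?KW s t) = 0" by (intro sum.neutral ballI) simp
      then show ?thesis by simp
    qed
  qed
  obtain e f where W: "\<And>s u. summable (\<lambda>k. e s k * e u k)" "\<And>s u. summable (\<lambda>k. f s k * f u k)"
    "\<And>s u. ?KW s u = (\<Sum>k. e s k * e u k) + (\<Sum>k. f s k * f u k)"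
    "\<And>j k. j < k \<Longrightarrow> e (t j) k = 0" "\<And>j. 0 < e (t j) j" "\<And>j k. f (t j) k = 0"
    by (rule kernel_factorization[where K="?KW" and t=t and r="?r", OF psdW
        cauchy_profile_dense[OF \<delta>(1)] cauchy_profile_strict[OF \<delta>(1-3)] t]) blast+
  obtain e' f' where X: "\<And>s u. summable (\<lambda>k. e' s k * e' u k)" "\<And>s u. summable (\<lambda>k. f' s k * f' u k)"
    "\<And>s u. ?KX s u = (\<Sum>k. e' s k * e' u k) + (\<Sum>k. f' s k * f' u k)"
    by (rule kernel_factorization[where K="?KX" and t=t and r="?r", OF cauchy_kernel_psd[OF \<delta>(4,5)]
        cauchy_profile_dense[OF \<delta>(4)] cauchy_kernel_strict[OF \<delta>(4,5)] t]) blast+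
  define mix where "mix a b k = (if even k then a (k div 2) else b ((k - 1) div 2))" for a b :: "nat \<Rightarrow> real" and k :: nat
  have mix_sums: "(\<lambda>k. mix a b k * mix a' b' k) sums (p + q)"
    if "(\<lambda>k. a k * a' k) sums p" "(\<lambda>k. b k * b' k) sums q" for a b a' b' p q
  proof -
    have "(\<lambda>k. mix a b k * mix a' b' k) = (\<lambda>k. if even k then a (k div 2) * a' (k div 2) else b ((k - 1) div 2) * b' ((k - 1) div 2))"
      by (auto simp: mix_def)
    then show ?thesis using sums_if[OF that(2,1)] by (simp add: add.commute)
  qed
  define u where "u x = mix (\<lambda>_. 0) (mix (e' x) (f' x))" for x
  define v where "v x = mix (mix (e x) (f x)) (\<lambda>_. 0)" for x
  show thesis
  proof (rule that[of u v "\<lambda>j. e (t j)"])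
    fix x y
    have "(\<lambda>k. u x k * u y k) sums (0 + ((\<Sum>k. e' x k * e' y k) + (\<Sum>k. f' x k * f' y k)))"
      unfolding u_def by (intro mix_sums summable_sums X) simp
    then show "(\<lambda>k. u x k * u y k) sums ?KX x y" unfolding X(3) by simp
    have "(\<lambda>k. v x k * v y k) sums (((\<Sum>k. e x k * e y k) + (\<Sum>k. f x k * f y k)) + 0)"
      unfolding v_def by (intro mix_sums summable_sums W) simp
    then show "(\<lambda>k. v x k * v y k) sums ?KW x y" unfolding W(3) by simp
  next
    fix x y k show "u x k * v y k = 0" by (simp add: u_def v_def mix_def)
  next
    fix x k show "u x (4 * k) = 0" by (simp add: u_def mix_def)
  next
    fix j k
    show "v (t j) k = (if 4 dvd k then e (t j) (k div 4) else 0)"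
    proof (cases "4 dvd k")
      case True
      then obtain m where "k = 4 * m" by blast
      then show ?thesis by (simp add: v_def mix_def)
    next
      case False
      then have "\<not> (even k \<and> even (k div 2))" by presburger
      then show ?thesis using False W(6) by (auto simp: v_def mix_def)
    qed
  next
    fix i j
    have "(\<Sum>k. e (t i) k * e (t j) k) = (\<Sum>m\<le>max i j. e (t i) m * e (t j) m)"
      by (rule suminf_finite) (auto simp: W(4))
    then show "?KW (t i) (t j) = (\<Sum>m\<le>max i j. e (t i) m * e (t j) m)" using W(3)[of "t i" "t j"] by (simp add: W(6))
  qed (use W(4,5) in auto)
qed

lemma observed_data_measurable:
  "observed_data D \<beta> \<in> measurable (PiM UNIV (\<lambda>_. borel)) (PiM D (\<lambda>_. borel))"
  unfolding observed_data_def
proof (rule measurable_restrict)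
  fix s
  have c: "(\<lambda>\<omega>. \<omega> s :: real \<times> real) \<in> borel_measurable (PiM UNIV (\<lambda>_. borel))"
    by (rule measurable_component_singleton) simp
  note [measurable] = measurable_compose[OF c measurable_fst_borel] measurable_compose[OF c measurable_snd_borel]
  show "(\<lambda>\<omega>. (fst (\<omega> s), fst (\<omega> s) * \<beta> + snd (\<omega> s))) \<in> borel_measurable (PiM UNIV (\<lambda>_. borel))"
    by (rule borel_measurable_Pair) measurable
qed

text \<open>Translating finitely many Gaussian coordinates of \<open>W\<close> by the whitened values of \<open>\<beta> X\<close> turns
  \<open>(X, W)\<close> into \<open>(X, W + \<beta> X)\<close> at finitely many points.\<close>

lemma gauss_pair_shift_affinity:
  fixes u v :: "real \<Rightarrow> nat \<Rightarrow> real" and e :: "nat \<Rightarrow> nat \<Rightarrow> real" and t :: "nat \<Rightarrow> real"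
  assumes U: "\<And>x y. (\<lambda>k. u x k * u y k) sums K x y" and u0: "\<And>x k. u x (4 * k) = 0"
    and tri: "\<And>j k. j < k \<Longrightarrow> e j k = 0" and diag: "\<And>j. e j j \<noteq> 0"
    and v: "\<And>j k. v (t j) k = (if 4 dvd k then e j (k div 4) else 0)"
    and trace: "(\<Sum>k\<le>N. \<Sum>i\<le>N. \<Sum>j\<le>N. dual_coeff e k i * dual_coeff e k j * K (t i) (t j)) \<le> B" and \<beta>: "\<beta>\<^sup>2 * B \<le> 4"
  obtains \<Psi> where "\<And>x \<xi>. gauss_series (u x) (\<Psi> \<xi>) = gauss_series (u x) \<xi>"
    "\<And>j \<xi>. j \<le> N \<Longrightarrow> gauss_series (v (t j)) (\<Psi> \<xi>) = gauss_series (u (t j)) \<xi> * \<beta> + gauss_series (v (t j)) \<xi>"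
    "\<And>A. A \<in> sets gauss_seq \<Longrightarrow> 3 / 32 \<le> gauss_seq.prob {\<xi>. \<Psi> \<xi> \<notin> A} + gauss_seq.prob A"
proof -
  let ?X = "\<lambda>l. gauss_series (u (t l))"
  define I where "I = (\<lambda>k. 4 * k) ` {..N}"
  have I: "finite I" by (simp add: I_def)
  \<comment> \<open>The values of X whitened by the factor of W. Their squares sum to a variable
    whose mean is the trace bounded by \<open>B\<close>.\<close>
  define w where "w k \<xi> = (\<Sum>l\<le>N. dual_coeff e k l * ?X l \<xi>)" for k \<xi>
  define y where "y i \<xi> = \<beta> * w (i div 4) \<xi>" for i \<xi>
  have w_m [measurable]: "w k \<in> borel_measurable gauss_seq" for k unfolding w_def by measurable
  have y_m: "y i \<in> borel_measurable gauss_seq" for i unfolding y_def by measurable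
  have ser: "gauss_series (u x) \<xi> = gauss_series (u x) \<xi>'" if "\<And>i. i \<notin> I \<Longrightarrow> \<xi> i = \<xi>' i" for x \<xi> \<xi>'
  proof (rule gauss_series_cong)
    fix k assume "u x k \<noteq> 0"
    then have "k \<notin> I" using u0 by (auto simp: I_def)
    then show "\<xi> k = \<xi>' k" by (rule that)
  qed
  have indep: "y k \<xi> = y k \<xi>'" if "\<And>i. i \<notin> I \<Longrightarrow> \<xi> i = \<xi>' i" for k \<xi> \<xi>'
    unfolding y_def w_def using ser[OF that] by simp
  define \<Psi> where "\<Psi> = coord_shift I y"
  have w2: "integrable gauss_seq (\<lambda>\<xi>. (w k \<xi>)\<^sup>2)"
    "(\<integral>\<xi>. (w k \<xi>)\<^sup>2 \<partial>gauss_seq) = (\<Sum>i\<le>N. \<Sum>j\<le>N. dual_coeff e k i * dual_coeff e k j * K (t i) (t j))" for k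
    unfolding w_def
    using gauss_process(2,4)[where e="\<lambda>l. u (t l)" and K="\<lambda>i j. K (t i) (t j)" and J="{..N}" and a="dual_coeff e k", OF U]
    by simp_all
  have inj: "inj_on (\<lambda>k. 4 * k) {..N::nat}" by (auto simp: inj_on_def)
  have ysum: "(\<Sum>i\<in>I. (y i \<xi>)\<^sup>2) = (\<Sum>k\<le>N. \<beta>\<^sup>2 * (w k \<xi>)\<^sup>2)" for \<xi>
    unfolding I_def sum.reindex[OF inj] by (simp add: y_def power_mult_distrib)
  have yint: "integrable gauss_seq (\<lambda>\<xi>. \<Sum>i\<in>I. (y i \<xi>)\<^sup>2)"
    unfolding ysum by (intro Bochner_Integration.integrable_sum integrable_mult_right w2(1))
  have "(\<integral>\<xi>. (\<Sum>i\<in>I. (y i \<xi>)\<^sup>2) \<partial>gauss_seq) = \<beta>\<^sup>2 * (\<Sum>k\<le>N. \<Sum>i\<le>N. \<Sum>j\<le>N. dual_coeff e k i * dual_coeff e k j * K (t i) (t j))"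
    unfolding ysum using w2 by (subst Bochner_Integration.integral_sum) (simp_all add: sum_distrib_left)
  also have "\<dots> \<le> \<beta>\<^sup>2 * B" by (intro mult_left_mono trace) simp
  finally have ysmall: "(\<integral>\<xi>. (\<Sum>i\<in>I. (y i \<xi>)\<^sup>2) \<partial>gauss_seq) \<le> 4" using \<beta> by linarith
  have vs: "gauss_series (v (t j)) \<xi> = (\<Sum>k\<le>j. e j k * \<xi> (4 * k))" for j \<xi>
  proof -
    have "gauss_series (v (t j)) \<xi> = (\<Sum>k<4 * j + 4. v (t j) k * \<xi> k)"
      by (rule gauss_series_finite) (auto simp: v intro!: tri)
    also have "\<dots> = (\<Sum>k\<in>(\<lambda>k. 4 * k) ` {..j}. v (t j) k * \<xi> k)"
      by (rule sum.mono_neutral_right) (auto simp: v tri elim!: dvdE)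
    also have "\<dots> = (\<Sum>k\<le>j. e j k * \<xi> (4 * k))"
      by (subst sum.reindex) (auto simp: inj_on_def v)
    finally show ?thesis .
  qed
  show thesis
  proof (rule that[of \<Psi>])
    show "gauss_series (u x) (\<Psi> \<xi>) = gauss_series (u x) \<xi>" for x \<xi>
      by (rule ser) (simp add: \<Psi>_def coord_shift_def)
    show "gauss_series (v (t j)) (\<Psi> \<xi>) = ?X j \<xi> * \<beta> + gauss_series (v (t j)) \<xi>" if j: "j \<le> N" for j \<xi>
    proof -
      \<comment> \<open>For indices up to \<open>N\<close> whitening by \<open>dual_coeff\<close>
        agrees with forward substitution, and \<open>e\<close> maps the result back to the values of
        X.\<close>
      have sh: "\<Psi> \<xi> (4 * k) = \<xi> (4 * k) + \<beta> * forward_solve e (\<lambda>l. ?X l \<xi>) k" if "k \<le> j" for k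
        using that j forward_solve_linear[where e=e and k=k and n=N and f="\<lambda>l. ?X l \<xi>", OF tri diag]
        by (simp add: \<Psi>_def coord_shift_def I_def y_def w_def)
      have "gauss_series (v (t j)) (\<Psi> \<xi>) = (\<Sum>k\<le>j. e j k * \<xi> (4 * k) + \<beta> * (e j k * forward_solve e (\<lambda>l. ?X l \<xi>) k))"
        unfolding vs by (intro sum.cong refl) (simp add: sh distrib_left mult.left_commute)
      also have "\<dots> = gauss_series (v (t j)) \<xi> + \<beta> * ?X j \<xi>"
        unfolding sum.distrib vs sum_distrib_left[symmetric]
        using forward_solve[where e=e and j=j and f="\<lambda>l. ?X l \<xi>", OF tri diag] by simp
      finally show ?thesis by simp
    qed
    show "3 / 32 \<le> gauss_seq.prob {\<xi>. \<Psi> \<xi> \<notin> A} + gauss_seq.prob A" if "A \<in> sets gauss_seq" for A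
      unfolding \<Psi>_def by (rule gauss_seq_shift_affinity[where y=y, OF I y_m indep yint ysmall that])
  qed
qed

section \<open>Two values of \<beta> that no estimator separates\<close>

lemma not_consistently_estimable:
  fixes D :: "'a::euclidean_space set"
  assumes dim: "DIM('a) = 1" and bnd: "bounded D" and ball: "0 < r" "ball x0 r \<subseteq> D"
    and \<delta>: "0 < \<delta>W" "\<delta>W + 1 < \<delta>X" "\<delta>X < 2"
  shows "\<not> consistently_estimable D (model_laws \<delta>X \<delta>W)"
proof
  assume "consistently_estimable D (model_laws \<delta>X \<delta>W)"
  then obtain E where E: "\<And>n. E n \<in> borel_measurable (PiM D (\<lambda>_. borel))"
    "\<And>\<beta> P \<epsilon>. P \<in> model_laws \<delta>X \<delta>W \<Longrightarrow> 0 < \<epsilon> \<Longrightarrow>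
      (\<lambda>n. measure P {\<omega> \<in> space P. \<bar>E n (observed_data D \<beta> \<omega>) - \<beta>\<bar> > \<epsilon>}) \<longlonglongrightarrow> 0"
    unfolding consistently_estimable_def consistent_estimator_def by blast
  let ?\<Omega> = "PiM D (\<lambda>_. borel) :: ('a \<Rightarrow> real \<times> real) measure"
  define b where "b = (SOME b :: 'a. b \<in> Basis)"
  have b: "b \<in> Basis" unfolding b_def using nonempty_Basis by (simp add: some_in_eq)
  define \<tau> where "\<tau> s = s \<bullet> b" for s
  have \<tau>: "norm (s - s') = \<bar>\<tau> s - \<tau> s'\<bar>" for s s'
    using DIM1_Basis(3)[OF dim b, of "s - s'"] by (simp add: \<tau>_def inner_diff_left)
  have \<tau>_inj: "inj \<tau>" using \<tau> by (metis diff_self abs_zero eq_iff_diff_eq_0 injI norm_eq_zero)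
  \<comment> \<open>These events test against the candidate value \<open>1 / (m + 1)\<close>, for
    all \<open>m\<close> at once. The \<open>m\<close> finally used comes from the trace bound,
    which depends on the points \<open>t\<close>, and \<open>t\<close> has to cover the supports of
    the events. Ranging over all \<open>m\<close> breaks the circle.\<close>
  define A where "A n m = {z \<in> space ?\<Omega>. 1 / (2 * (real m + 1)) < \<bar>E n z\<bar>}" for n m :: nat
  have A: "A n m \<in> sets ?\<Omega>" for n m
  proof -
    note [measurable] = E(1)
    show ?thesis unfolding A_def by measurable
  qed
  define Q where "Q nm T \<longleftrightarrow> countable T \<and> T \<subseteq> D \<and> A (fst nm) (snd nm) \<in> sigma_sets (D \<rightarrow>\<^sub>E UNIV) (cylinders D T)" for nm T
  have "\<exists>T. Q nm T" for nm unfolding Q_def by (rule countable_support[OF A])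
  then obtain T where "\<And>nm. Q nm (T nm)" by metis
  then have T: "countable (T nm)" "T nm \<subseteq> D" "A (fst nm) (snd nm) \<in> sigma_sets (D \<rightarrow>\<^sub>E UNIV) (cylinders D (T nm))" for nm
    by (auto simp: Q_def)
  \<comment> \<open>An infinite countable subset of \<open>D\<close> is added so that the resulting
    set of points can be enumerated injectively by all natural numbers.\<close>
  have "infinite D" using ball infinite_super[OF ball(2)] uncountable_ball[OF ball(1), of x0] countable_finite by blast
  then obtain T0 where T0: "T0 \<subseteq> D" "countable T0" "infinite T0" by (metis infinite_countable_subset')
  define T1 where "T1 = T0 \<union> (\<Union>nm. T nm)"
  have T1: "T1 \<subseteq> D" "countable T1" "infinite T1" using T(2) T0(1) T(1) T0(2,3) unfolding T1_def by (blast, simp, simp)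
  define t where "t = from_nat_into (\<tau> ` T1)"
  have "infinite (\<tau> ` T1)" using T1(3) finite_imageD[OF _ inj_on_subset[OF \<tau>_inj subset_UNIV]] by blast
  then have t_bij: "bij_betw t UNIV (\<tau> ` T1)"
    unfolding t_def using T1(2) by (intro bij_betw_from_nat_into) auto
  then have t: "inj t" "range t = \<tau> ` T1" by (auto simp: bij_betw_def)
  obtain R where R: "\<And>s. s \<in> D \<Longrightarrow> norm s \<le> R" using bnd by (auto simp: bounded_iff)
  have tR: "\<bar>t i - t j\<bar> \<le> 2 * R" for i j
  proof -
    have "t i \<in> \<tau> ` T1" "t j \<in> \<tau> ` T1" using t(2) by auto
    then obtain s s' where s: "s \<in> T1" "s' \<in> T1" "t i = \<tau> s" "t j = \<tau> s'" by blast
    then have "norm s \<le> R" "norm s' \<le> R" using R T1(1) by auto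
    then show ?thesis using norm_triangle_ineq4[of s s'] unfolding s(3,4) \<tau>[symmetric] by linarith
  qed
  \<comment> \<open>Any \<open>\<kappa>\<close> with \<open>\<delta>W * \<kappa> > 1\<close> would
    do. For X the value 1 is admissible because \<open>\<delta>X > 1\<close>.\<close>
  define \<kappa> where "\<kappa> = 2 / \<delta>W"
  have \<kappa>: "0 < \<kappa>" "\<delta>W * \<kappa> = 2" using \<delta> by (auto simp: \<kappa>_def)
  have \<delta>': "0 < \<delta>X" "\<delta>W < 1" "1 + \<delta>W < \<delta>X" using \<delta> by auto
  obtain B where B: "0 \<le> B" "\<forall>e n. (\<forall>j k. j < k \<longrightarrow> e j k = 0) \<and> (\<forall>j. e j j \<noteq> 0)
      \<and> (\<forall>i j. cauchy_profile \<delta>W \<kappa> \<bar>t i - t j\<bar> = (\<Sum>m\<le>max i j. e i m * e j m)) \<longrightarrow>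
    (\<Sum>k\<le>n. \<Sum>i\<le>n. \<Sum>j\<le>n. dual_coeff e k i * dual_coeff e k j * cauchy_profile \<delta>X 1 \<bar>t i - t j\<bar>) \<le> B"
    using whitened_trace_bound[where t=t and R="2 * R", OF \<delta>(1) \<delta>'(2) \<kappa>(1) \<delta>'(3) \<delta>(3) t(1) tR]
    by (elim exE conjE) (rule that)
  obtain u v e where uv: "\<And>x y. (\<lambda>k. u x k * u y k) sums cauchy_profile \<delta>X 1 \<bar>x - y\<bar>"
    "\<And>x y. (\<lambda>k. v x k * v y k) sums cauchy_profile \<delta>W \<kappa> \<bar>x - y\<bar>"
    "\<And>x y k. u x k * v y k = 0" "\<And>x k. u x (4 * k) = 0"
    "\<And>j k. j < k \<Longrightarrow> e j k = 0" "\<And>j. 0 < e j j"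
    "\<And>j k. v (t j) k = (if 4 dvd k then e j (k div 4) else 0)"
    "\<And>i j. cauchy_profile \<delta>W \<kappa> \<bar>t i - t j\<bar> = (\<Sum>m\<le>max i j. e i m * e j m)"
    by (rule cauchy_pair_factorization[where t=t, OF \<delta>(1) \<delta>'(2) \<kappa>(1) \<delta>'(1) \<delta>(3) t(1)]) (rule that; assumption)
  have e_diag: "e j j \<noteq> 0" for j using uv(6)[of j] by simp
  define \<Phi> where "\<Phi> = gauss_pair (\<lambda>s. u (\<tau> s)) (\<lambda>s. v (\<tau> s))"
  have \<Phi> [measurable]: "\<Phi> \<in> measurable gauss_seq (PiM UNIV (\<lambda>_. borel))" unfolding \<Phi>_def by (rule gauss_pair_measurable)
  let ?P = "distr gauss_seq (PiM UNIV (\<lambda>_. borel)) \<Phi>"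
  have gc: "generalized_cauchy 1 1 \<delta> \<kappa> (s - s') = cauchy_profile \<delta> \<kappa> \<bar>\<tau> s - \<tau> s'\<bar>" for \<delta> \<kappa> s s'
    by (simp add: generalized_cauchy_def cauchy_profile_def \<tau>)
  have re: "(\<Sum>s\<in>S. \<Sum>s'\<in>S. a s * a s' * k (\<tau> s) (\<tau> s')) = (\<Sum>x\<in>\<tau> ` S. \<Sum>y\<in>\<tau> ` S. a (inv \<tau> x) * a (inv \<tau> y) * k x y)"
    for S :: "'a set" and a :: "'a \<Rightarrow> real" and k
    by (simp add: sum.reindex[OF inj_on_subset[OF \<tau>_inj subset_UNIV]] \<tau>_inj)
  have "?P \<in> model_laws \<delta>X \<delta>W"
    unfolding \<Phi>_def
  proof (rule gauss_pair_law[OF dim \<delta>'(1) \<delta>(3,1)])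
    show "\<delta>W < 2" "(0::real) < 1" "1 < \<delta>X * 1" "0 < \<kappa>" "1 < \<delta>W * \<kappa>" using \<delta> \<kappa> by auto
    fix S :: "'a set" and a :: "'a \<Rightarrow> real" assume S: "finite S" "\<exists>s\<in>S. a s \<noteq> 0"
    then have "finite (\<tau> ` S)" "\<exists>x\<in>\<tau> ` S. a (inv \<tau> x) \<noteq> 0" using \<tau>_inj by auto
    then show "0 < (\<Sum>s\<in>S. \<Sum>s'\<in>S. a s * a s' * generalized_cauchy 1 1 \<delta>X 1 (s - s'))"
      "0 < (\<Sum>s\<in>S. \<Sum>s'\<in>S. a s * a s' * generalized_cauchy 1 1 \<delta>W \<kappa> (s - s'))"
      unfolding gc re[where k="\<lambda>x y. cauchy_profile _ _ \<bar>x - y\<bar>"]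
      by (rule cauchy_kernel_strict[OF \<delta>'(1) \<delta>(3)], rule cauchy_profile_strict[OF \<delta>(1) \<delta>'(2) \<kappa>(1)])
  qed (simp_all only: gc uv)
  note cons = E(2)[OF this]
  define m where "m = nat \<lceil>B\<rceil>"
  define \<beta> where "\<beta> = 1 / (real m + 1)"
  have \<beta>0: "0 < \<beta>" by (simp add: \<beta>_def)
  have "B \<le> real m" using B(1) by (simp add: m_def)
  then have \<beta>B: "\<beta>\<^sup>2 * B \<le> 4"
  proof -
    assume Bm: "B \<le> real m"
    have "\<beta> * B \<le> 1" using Bm by (simp add: \<beta>_def field_simps)
    moreover have "\<beta> \<le> 1" by (simp add: \<beta>_def)
    ultimately have "\<beta> * (\<beta> * B) \<le> 1 * 1" using \<beta>0 B(1) by (intro mult_mono) auto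
    then show ?thesis by (simp add: power2_eq_square mult.assoc)
  qed
  define obs where "obs \<gamma> \<xi> = observed_data D \<gamma> (\<Phi> \<xi>)" for \<gamma> \<xi>
  have obs_m [measurable]: "obs \<gamma> \<in> measurable gauss_seq ?\<Omega>" for \<gamma>
    unfolding obs_def[abs_def] by (rule measurable_compose[OF \<Phi> observed_data_measurable])
  have lim: "(\<lambda>n. gauss_seq.prob {\<xi>. \<epsilon> < \<bar>E n (obs \<gamma> \<xi>) - \<gamma>\<bar>}) \<longlonglongrightarrow> 0" if "0 < \<epsilon>" for \<epsilon> \<gamma>
  proof -
    have "measure ?P {\<omega> \<in> space ?P. \<bar>E n (observed_data D \<gamma> \<omega>) - \<gamma>\<bar> > \<epsilon>} = gauss_seq.prob {\<xi>. \<epsilon> < \<bar>E n (obs \<gamma> \<xi>) - \<gamma>\<bar>}" for n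
    proof -
      note [measurable] = measurable_compose[OF observed_data_measurable E(1)]
      have s: "{\<omega> \<in> space (PiM UNIV (\<lambda>_. borel)). \<epsilon> < \<bar>E n (observed_data D \<gamma> \<omega>) - \<gamma>\<bar>} \<in> sets (PiM UNIV (\<lambda>_. borel))"
        by measurable
      show ?thesis using measure_distr[OF \<Phi> s] by (simp add: obs_def space_PiM vimage_def)
    qed
    then show ?thesis using cons[OF that, of \<gamma>] by simp
  qed
  \<comment> \<open>The thresholds differ so that lying outside \<open>A n m\<close>, where the
    estimate is at most \<open>\<beta> / 2\<close>, implies an error strictly above
    \<open>\<beta> / 3\<close> when \<beta> is the true value.\<close>
  have "\<forall>\<^sub>F n in sequentially. gauss_seq.prob {\<xi>. \<beta> / 2 < \<bar>E n (obs 0 \<xi>) - 0\<bar>} < 1 / 100"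
    "\<forall>\<^sub>F n in sequentially. gauss_seq.prob {\<xi>. \<beta> / 3 < \<bar>E n (obs \<beta> \<xi>) - \<beta>\<bar>} < 1 / 100"
    by (rule order_tendstoD(2)[OF lim], use \<beta>0 in simp, simp)+
  then have "\<forall>\<^sub>F n in sequentially. gauss_seq.prob {\<xi>. \<beta> / 2 < \<bar>E n (obs 0 \<xi>) - 0\<bar>} < 1 / 100
      \<and> gauss_seq.prob {\<xi>. \<beta> / 3 < \<bar>E n (obs \<beta> \<xi>) - \<beta>\<bar>} < 1 / 100" by (rule eventually_conj)
  from eventually_happens'[OF sequentially_bot this] obtain n where n: "gauss_seq.prob {\<xi>. \<beta> / 2 < \<bar>E n (obs 0 \<xi>)\<bar>} < 1 / 100"
    "gauss_seq.prob {\<xi>. \<beta> / 3 < \<bar>E n (obs \<beta> \<xi>) - \<beta>\<bar>} < 1 / 100"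
    by auto
  have obs_sp: "obs \<gamma> \<xi> \<in> D \<rightarrow>\<^sub>E UNIV" for \<gamma> \<xi> by (simp add: obs_def observed_data_def)
  have obs_A: "obs \<gamma> \<xi> \<in> A n m \<longleftrightarrow> \<beta> / 2 < \<bar>E n (obs \<gamma> \<xi>)\<bar>" for \<gamma> \<xi>
    using obs_sp[of \<gamma> \<xi>] by (simp add: A_def space_PiM \<beta>_def mult.commute)
  \<comment> \<open>\<open>True\<close> stands for the law of the data under 0 and
    \<open>False\<close> for the law under \<beta>.\<close>
  define M where "M c = distr gauss_seq ?\<Omega> (obs (if c then 0 else \<beta>))" for c
  have AT: "A n m \<in> sigma_sets (D \<rightarrow>\<^sub>E UNIV) (cylinders D T1)"
  proof (rule subsetD[OF sigma_sets_mono'])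
    show "cylinders D (T (n, m)) \<subseteq> cylinders D T1" by (rule cylinders_mono) (auto simp: T1_def)
    show "A n m \<in> sigma_sets (D \<rightarrow>\<^sub>E UNIV) (cylinders D (T (n, m)))" using T(3)[of "(n, m)"] by simp
  qed
  have M: "finite_measure (M c)" "sets (M c) = sets ?\<Omega>" for c
    unfolding M_def using gauss_seq.prob_space_distr[OF obs_m] by (auto simp: prob_space_def)
  have "(0::real) < 1 / 100" by simp
  from cylinder_approximation[where M=M and D=D and T=T1 and A="A n m", OF M T1(1) AT this]
  obtain F A' where F: "finite F" "F \<subseteq> T1" and A': "A' \<in> sets ?\<Omega>"
    "\<forall>z\<in>D \<rightarrow>\<^sub>E UNIV. \<forall>z'\<in>D \<rightarrow>\<^sub>E UNIV. (\<forall>s\<in>F. z s = z' s) \<longrightarrow> (z \<in> A' \<longleftrightarrow> z' \<in> A')"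
    "\<forall>c. measure (M c) (sym_diff (A n m) A') < 1 / 100"
    by (elim exE conjE) (rule that)
  have approx: "gauss_seq.prob {\<xi>. obs (if c then 0 else \<beta>) \<xi> \<in> sym_diff (A n m) A'} < 1 / 100" for c
    using A'(3)[rule_format, of c] A'(1) A[of n m] unfolding M_def by (subst (asm) measure_distr) (auto simp: vimage_def)
  have ev: "{\<xi>. obs \<gamma> \<xi> \<in> S} \<in> sets gauss_seq" if "S \<in> sets ?\<Omega>" for S \<gamma>
    using measurable_sets[OF obs_m that] by (simp add: vimage_def)
  have evE: "{\<xi>. \<beta> / 3 < \<bar>E n (obs \<beta> \<xi>) - \<beta>\<bar>} \<in> sets gauss_seq"
  proof -
    note [measurable] = measurable_compose[OF obs_m E(1)]
    have "{\<xi> \<in> space gauss_seq. \<beta> / 3 < \<bar>E n (obs \<beta> \<xi>) - \<beta>\<bar>} \<in> sets gauss_seq" by measurable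
    then show ?thesis by simp
  qed
  have SD: "sym_diff (A n m) A' \<in> sets ?\<Omega>" using A'(1) A[of n m] by auto
  have "gauss_seq.prob {\<xi>. obs 0 \<xi> \<in> A'} \<le> gauss_seq.prob ({\<xi>. \<beta> / 2 < \<bar>E n (obs 0 \<xi>)\<bar>} \<union> {\<xi>. obs 0 \<xi> \<in> sym_diff (A n m) A'})"
    using ev[OF A[of n m], of 0] ev[OF SD, of 0] unfolding obs_A by (intro gauss_seq.finite_measure_mono sets.Un) (auto simp: obs_A)
  also have "\<dots> \<le> gauss_seq.prob {\<xi>. \<beta> / 2 < \<bar>E n (obs 0 \<xi>)\<bar>} + gauss_seq.prob {\<xi>. obs 0 \<xi> \<in> sym_diff (A n m) A'}"
    using ev[OF A[of n m], of 0] ev[OF SD, of 0] unfolding obs_A by (rule measure_Un_le)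
  finally have p0: "gauss_seq.prob {\<xi>. obs 0 \<xi> \<in> A'} < 2 / 100" using n(1) approx[of True] by simp
  have "gauss_seq.prob {\<xi>. obs \<beta> \<xi> \<notin> A'} \<le> gauss_seq.prob ({\<xi>. \<beta> / 3 < \<bar>E n (obs \<beta> \<xi>) - \<beta>\<bar>} \<union> {\<xi>. obs \<beta> \<xi> \<in> sym_diff (A n m) A'})"
  proof (rule gauss_seq.finite_measure_mono)
    show "{\<xi>. \<beta> / 3 < \<bar>E n (obs \<beta> \<xi>) - \<beta>\<bar>} \<union> {\<xi>. obs \<beta> \<xi> \<in> sym_diff (A n m) A'} \<in> sets gauss_seq"
      using evE ev[OF SD, of \<beta>] by (rule sets.Un)
    show "{\<xi>. obs \<beta> \<xi> \<notin> A'} \<subseteq> {\<xi>. \<beta> / 3 < \<bar>E n (obs \<beta> \<xi>) - \<beta>\<bar>} \<union> {\<xi>. obs \<beta> \<xi> \<in> sym_diff (A n m) A'}"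
    proof
      fix \<xi> assume \<xi>: "\<xi> \<in> {\<xi>. obs \<beta> \<xi> \<notin> A'}"
      show "\<xi> \<in> {\<xi>. \<beta> / 3 < \<bar>E n (obs \<beta> \<xi>) - \<beta>\<bar>} \<union> {\<xi>. obs \<beta> \<xi> \<in> sym_diff (A n m) A'}"
      proof (cases "obs \<beta> \<xi> \<in> A n m")
        case False
        then have "\<bar>E n (obs \<beta> \<xi>)\<bar> \<le> \<beta> / 2" unfolding obs_A by simp
        then have "\<beta> / 3 < \<bar>E n (obs \<beta> \<xi>) - \<beta>\<bar>" using \<beta>0 by linarith
        then show ?thesis by simp
      qed (use \<xi> in simp)
    qed
  qed
  also have "\<dots> \<le> gauss_seq.prob {\<xi>. \<beta> / 3 < \<bar>E n (obs \<beta> \<xi>) - \<beta>\<bar>} + gauss_seq.prob {\<xi>. obs \<beta> \<xi> \<in> sym_diff (A n m) A'}"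
    using evE ev[OF SD, of \<beta>] by (rule measure_Un_le)
  finally have p1: "gauss_seq.prob {\<xi>. obs \<beta> \<xi> \<notin> A'} < 2 / 100" using n(2) approx[of False] by simp
  have "\<tau> ` F \<subseteq> range t" unfolding t(2) using F(2) by blast
  then obtain J where J: "finite J" "\<tau> ` F = t ` J" using F(1) by (metis finite_imageI finite_subset_image)
  obtain N where N: "\<And>j. j \<in> J \<Longrightarrow> j \<le> N" using J(1) by (metis finite_nat_set_iff_bounded_le)
  have tr: "(\<Sum>k\<le>N. \<Sum>i\<le>N. \<Sum>j\<le>N. dual_coeff e k i * dual_coeff e k j * cauchy_profile \<delta>X 1 \<bar>t i - t j\<bar>) \<le> B"
    using B(2)[rule_format, of e N] uv(5,8) e_diag by blast
  obtain \<Psi> where \<Psi>: "\<And>x \<xi>. gauss_series (u x) (\<Psi> \<xi>) = gauss_series (u x) \<xi>"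
    "\<And>j \<xi>. j \<le> N \<Longrightarrow> gauss_series (v (t j)) (\<Psi> \<xi>) = gauss_series (u (t j)) \<xi> * \<beta> + gauss_series (v (t j)) \<xi>"
    "\<And>A. A \<in> sets gauss_seq \<Longrightarrow> 3 / 32 \<le> gauss_seq.prob {\<xi>. \<Psi> \<xi> \<notin> A} + gauss_seq.prob A"
  proof (rule gauss_pair_shift_affinity[where u=u and v=v and e=e and t=t and N=N and B=B and \<beta>=\<beta>
        and K="\<lambda>x y. cauchy_profile \<delta>X 1 \<bar>x - y\<bar>", OF uv(1,4) _ e_diag uv(7) tr \<beta>B])
    show "e j k = 0" if "j < k" for j k by (rule uv(5)[OF that])
  qed (rule that)
  \<comment> \<open>On the finitely many points of \<open>F\<close> the data under 0 along the
    translated path are the data under \<beta> along the original path, so \<open>A'\<close> cannot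
    tell them apart.\<close>
  have "obs 0 (\<Psi> \<xi>) \<in> A' \<longleftrightarrow> obs \<beta> \<xi> \<in> A'" for \<xi>
  proof (rule A'(2)[rule_format, OF obs_sp obs_sp])
    fix s assume s: "s \<in> F"
    then obtain j where j: "j \<in> J" "\<tau> s = t j" using J(2) by blast
    have "s \<in> D" using s F(2) T1(1) by blast
    then show "obs 0 (\<Psi> \<xi>) s = obs \<beta> \<xi> s"
      by (simp add: obs_def observed_data_def \<Phi>_def gauss_pair_def j(2) \<Psi>(1) \<Psi>(2)[OF N[OF j(1)]])
  qed
  then have "{\<xi>. \<Psi> \<xi> \<notin> {\<xi>. obs 0 \<xi> \<in> A'}} = {\<xi>. obs \<beta> \<xi> \<notin> A'}" by simp
  \<comment> \<open>The two error probabilities add up to less than 4/100, which is below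
    3/32.\<close>
  then show False using \<Psi>(3)[OF ev[OF A'(1), of 0]] p0 p1 by simp
qed

theorem corollary4:
  fixes D :: "'a::euclidean_space set" and \<delta>X \<delta>W :: real
  assumes "bounded D" and "\<exists>x r. 0 < r \<and> ball x r \<subseteq> D"
    and "0 < \<delta>X" "\<delta>X < 2" and "0 < \<delta>W" "\<delta>W < 2"
  shows "(DIM('a) = 1 \<and> \<delta>X < \<delta>W + 1 \<longrightarrow>
            consistently_estimable D (model_laws \<delta>X \<delta>W) \<and>
            (\<forall>q l p h. \<forall>e\<in>Basis. 0 < l \<and> cube q l \<subseteq> D \<and> (\<forall>n. 0 < h n) \<and> h \<longlonglongrightarrow> 0 \<longrightarrow>
               consistent_estimator D (model_laws \<delta>X \<delta>W)
                 (\<lambda>n. ols_first_difference (cube q l \<inter> regular_lattice (p n) (h n)) (h n) e)))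
       \<and> (DIM('a) = 1 \<and> \<delta>X > \<delta>W + 1 \<longrightarrow>
            \<not> consistently_estimable D (model_laws \<delta>X \<delta>W))
       \<and> (DIM('a) \<ge> 2 \<longrightarrow>
            consistently_estimable D (model_laws \<delta>X \<delta>W) \<and>
            (\<forall>q l p h. 0 < l \<and> cube q l \<subseteq> D \<and> (\<forall>n. 0 < h n) \<and> h \<longlonglongrightarrow> 0 \<longrightarrow>
               consistent_estimator D (model_laws \<delta>X \<delta>W)
                 (\<lambda>n. ols_laplacian (cube q l \<inter> regular_lattice (p n) (h n)) (h n))))"
proof (intro conjI impI)
  show "consistently_estimable D (model_laws \<delta>X \<delta>W)"
    "\<forall>q l p h. \<forall>e\<in>Basis. 0 < l \<and> cube q l \<subseteq> D \<and> (\<forall>n. 0 < h n) \<and> h \<longlonglongrightarrow> 0 \<longrightarrow>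
       consistent_estimator D (model_laws \<delta>X \<delta>W)
         (\<lambda>n. ols_first_difference (cube q l \<inter> regular_lattice (p n) (h n)) (h n) e)"
    if "DIM('a) = 1 \<and> \<delta>X < \<delta>W + 1"
  proof -
    have gap: "\<delta>X < \<delta>W + real DIM('a)" using that by simp
    show "consistently_estimable D (model_laws \<delta>X \<delta>W)" by (rule consistency_of_differences(1)[OF assms(2) gap])
    show "\<forall>q l p h. \<forall>e\<in>Basis. 0 < l \<and> cube q l \<subseteq> D \<and> (\<forall>n. 0 < h n) \<and> h \<longlonglongrightarrow> 0 \<longrightarrow>
       consistent_estimator D (model_laws \<delta>X \<delta>W)
         (\<lambda>n. ols_first_difference (cube q l \<inter> regular_lattice (p n) (h n)) (h n) e)"
      by (rule consistency_of_differences(2)[OF assms(2) gap])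
  qed
  show "\<not> consistently_estimable D (model_laws \<delta>X \<delta>W)" if "DIM('a) = 1 \<and> \<delta>W + 1 < \<delta>X"
  proof -
    obtain x r where "0 < r" "ball x r \<subseteq> D" using assms(2) by blast
    then show ?thesis using not_consistently_estimable that assms(1,4,5) by blast
  qed
  show "consistently_estimable D (model_laws \<delta>X \<delta>W)"
    "\<forall>q l p h. 0 < l \<and> cube q l \<subseteq> D \<and> (\<forall>n. 0 < h n) \<and> h \<longlonglongrightarrow> 0 \<longrightarrow>
       consistent_estimator D (model_laws \<delta>X \<delta>W)
         (\<lambda>n. ols_laplacian (cube q l \<inter> regular_lattice (p n) (h n)) (h n))"
    if "2 \<le> DIM('a)"
  proof -
    \<comment> \<open>From dimension two on the gap condition is automatic, as
      \<open>\<delta>X < 2\<close> and \<open>0 < \<delta>W\<close>.\<close>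
    have gap: "\<delta>X < \<delta>W + real DIM('a)" using that assms(4,5) by simp
    show "consistently_estimable D (model_laws \<delta>X \<delta>W)" by (rule consistency_of_differences(1)[OF assms(2) gap])
    show "\<forall>q l p h. 0 < l \<and> cube q l \<subseteq> D \<and> (\<forall>n. 0 < h n) \<and> h \<longlonglongrightarrow> 0 \<longrightarrow>
       consistent_estimator D (model_laws \<delta>X \<delta>W)
         (\<lambda>n. ols_laplacian (cube q l \<inter> regular_lattice (p n) (h n)) (h n))"
      by (rule consistency_of_differences(3)[OF assms(2) gap])
  qed
qed

end
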